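(* Let $1<p<\infty$, let $X_0,X_1$ be Banach spaces with $X_1$ continuously and densely embedded in $X_0$, let $X_\gamma=(X_0,X_1)_{1-1/p,p}$, let $V\subset X_\gamma$ be open, and let $(A,F)\in C^1(V,\mathcal B(X_1,X_0)\times X_0)$. Consider the quasilinear problem $$\dot u(t)+A(u(t))u(t)=F(u(t)),\quad t>0,\qquad u(0)=u_0. \qquad (\ast)$$ Let $\mathcal E=\{u\in V\cap X_1: A(u)u=F(u)\}$ be its set of equilibria and let $u_*\in\mathcal E$. Suppose that $A(u_* )$ has the property of maximal $L_p$-regularity. Let $A_0$ be the linearization of $(\ast)$ at $u_*$, $$A_0v=A(u_* )v+(A'(u_* )v)u_*-F'(u_* )v,\qquad v\in X_1 .$$ Suppose that $u_*$ is normally stable, i.e. assume that (i) near $u_*$ the set of equilibria $\mathcal E$ is a $C^1$-manifold in $X_1$ of dimension $m\in\mathbb N$; (ii) the tangent space for $\mathcal E$ at $u_*$ is given by $N(A_0)$; (iii) $0$ is a semi-simple eigenvalue of $A_0$, i.e. $N(A_0)\oplus R(A_0)=X_0$; (iv) $\sigma(A_0)\setminus\{0\}\subset\mathbb C_+=\{z\in\mathbb C:\operatorname{Re}z>0\}$. Then $u_*$ is stable in $X_\gamma$, and there exists $\delta>0$ such that the unique solution $u(t)$ of $(\ast)$ with initial value $u_0\in X_\gamma$ satisfying $|u_0-u_*|_{X_\gamma}<\delta$ exists on $\mathbb R_+$ and converges at an exponential rate in $X_\gamma$ to some $u_\infty\in\mathcal E$ as $t\to\infty$.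
   Context: $\mathcal B(X_1,X_0)$ is the space of bounded linear operators from $X_1$ to $X_0$; $(\cdot,\cdot)_{1-1/p,p}$ is real interpolation; $N$, $R$, $\sigma$ denote kernel, range and spectrum. $A_0$ is regarded as an operator in $X_0$ with domain $X_1$. $B_X(u,r)$ is the open ball of radius $r$ around $u$ in $X$. Maximal $L_p$-regularity: an operator $A(u_* )\in\mathcal B(X_1,X_0)$ has this property if for finite $a>0$ and every $f\in L_p((0,a);X_0)$ the problem $\dot w+A(u_* )w=f$ on $(0,a)$, $w(0)=0$, has a unique solution $w\in H^1_p((0,a);X_0)\cap L_p((0,a);X_1)$. Condition (i) means: there are an open set $U\subset\mathbb R^m$ with $0\in U$ and a $C^1$-function $\Psi:U\to X_1$ such that $\Psi(U)\subset\mathcal E$, $\Psi(0)=u_*$, the rank of $\Psi'(0)$ equals $m$, $A(\Psi(\zeta))\Psi(\zeta)=F(\Psi(\zeta))$ for all $\zeta\in U$, and near $u_*$ there are no other equilibria than those given by $\Psi(U)$, i.e. $\mathcal E\cap B_{X_1}(u_*,r_1)=\Psi(U)$ for some $r_1>0$. The tangent space of $\mathcal E$ at $u_*$ is the range of $\Psi'(0)$. Solutions are strong $L_p$-solutions: on an interval $[0,a]$, $u\in H^1_p((0,a);X_0)\cap L_p((0,a);X_1)\cap C([0,a];X_\gamma)$ (with values in $V$) satisfying the equation for a.e. $t$; a solution on $\mathbb R_+$ is one with this property for every finite $a>0$. "Stable in $X_\gamma$" means: for every $r>0$ there is $\delta'>0$ such that every solution with $|u_0-u_*|_{X_\gamma}<\delta'$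 exists on $\mathbb R_+$ and satisfies $|u(t)-u_*|_{X_\gamma}<r$ for all $t\ge0$. Convergence at an exponential rate means $|u(t)-u_\infty|_{X_\gamma}\le Me^{-\omega t}$, $t\ge0$, for some $M,\omega>0$. *)

theory Defs
  imports "HOL-Analysis.Analysis"
begin

text \<open>
  The embedding of \<open>X\<^sub>1\<close> into \<open>X\<^sub>0\<close> is an explicit map \<open>J\<close> between two Banach space types, and
  \<open>X\<^sub>\<gamma>\<close> is a third type with an explicit inclusion \<open>i\<close> into \<open>X\<^sub>0\<close> whose range and norm are those
  of the real interpolation space. Scalars are real; the spectrum is that of the
  complexification. A complex Banach space may be regarded as a real one: for a complex-linear
  operator \<open>T\<close> this adds to the spectrum only the complex conjugates of its points, so that
  conditions on real parts are not affected, while kernel, range and maximal regularity are the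
  same in both readings.
\<close>

definition dense_embedding :: "('b::real_normed_vector \<Rightarrow> 'a::real_normed_vector) \<Rightarrow> bool" where
  "dense_embedding J \<longleftrightarrow> bounded_linear J \<and> inj J \<and> closure (range J) = UNIV"


subsection \<open>Real interpolation (K-method)\<close>

definition K_functional ::
  "('b::real_normed_vector \<Rightarrow> 'a::real_normed_vector) \<Rightarrow> real \<Rightarrow> 'a \<Rightarrow> real" where
  "K_functional J t x = Inf {norm x0 + t * norm x1 | x0 x1. x = x0 + J x1}"

definition interpolation_set ::
  "('b::real_normed_vector \<Rightarrow> 'a::real_normed_vector) \<Rightarrow> real \<Rightarrow> real \<Rightarrow> 'a set" where
  "interpolation_set J \<theta> q =
     {x. set_integrable lborel {0<..} (\<lambda>t. (t powr (-\<theta>) * K_functional J t x) powr q / t)}"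

definition interpolation_norm ::
  "('b::real_normed_vector \<Rightarrow> 'a::real_normed_vector) \<Rightarrow> real \<Rightarrow> real \<Rightarrow> 'a \<Rightarrow> real" where
  "interpolation_norm J \<theta> q x =
     (LINT t:{0<..}|lborel. (t powr (-\<theta>) * K_functional J t x) powr q / t) powr (1 / q)"

definition is_real_interpolation_space ::
  "('b::real_normed_vector \<Rightarrow> 'a::real_normed_vector) \<Rightarrow> real \<Rightarrow> real
    \<Rightarrow> ('c::real_normed_vector \<Rightarrow> 'a) \<Rightarrow> bool" where
  "is_real_interpolation_space J \<theta> q i \<longleftrightarrow>
     linear i \<and> inj i \<and> range i = interpolation_set J \<theta> q \<and>
     (\<forall>z. norm z = interpolation_norm J \<theta> q (i z))"

text \<open>The induced inclusion of \<open>X\<^sub>1\<close> into \<open>X\<^sub>\<gamma>\<close>; well behaved because \<open>range J \<subseteq> range i\<close>.\<close>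

definition incl ::
  "('b \<Rightarrow> 'a) \<Rightarrow> ('c \<Rightarrow> 'a) \<Rightarrow> 'b \<Rightarrow> 'c" where
  "incl J i x = inv i (J x)"


subsection \<open>Functions of class \<open>C\<^sup>1\<close> on open sets\<close>

definition C1_on ::
  "'x::real_normed_vector set \<Rightarrow> ('x \<Rightarrow> 'y::real_normed_vector) \<Rightarrow> bool" where
  "C1_on S f \<longleftrightarrow>
     (\<exists>f' :: 'x \<Rightarrow> 'x \<Rightarrow>\<^sub>L 'y.
        (\<forall>x\<in>S. (f has_derivative blinfun_apply (f' x)) (at x)) \<and> continuous_on S f')"


subsection \<open>Vector-valued Lebesgue and Sobolev spaces on \<open>(0,a)\<close>\<close>

text \<open>
  Bochner measurability; the spaces are not assumed to be separable, so Borel measurability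
  would not be enough.
\<close>

definition strongly_measurable ::
  "'s measure \<Rightarrow> ('s \<Rightarrow> 'x::real_normed_vector) \<Rightarrow> bool" where
  "strongly_measurable M f \<longleftrightarrow>
     (\<exists>s. (\<forall>n::nat. simple_function M (s n)) \<and> (AE x in M. (\<lambda>n. s n x) \<longlonglongrightarrow> f x))"

definition Lp :: "real \<Rightarrow> real \<Rightarrow> (real \<Rightarrow> 'x::real_normed_vector) \<Rightarrow> bool" where
  "Lp p a f \<longleftrightarrow> strongly_measurable (lebesgue_on {0<..<a}) f \<and>
     integrable (lebesgue_on {0<..<a}) (\<lambda>t. norm (f t) powr p)"

text \<open>
  Test functions are the compactly supported \<open>C\<^sup>1\<close>-functions on \<open>(0,a)\<close>. The library's Bochner
  integral is restricted to second countable spaces, hence the Henstock--Kurzweil integral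
  is used; both agree on Bochner integrable functions, and the weak derivative is only
  used for \<open>L\<^sub>p\<close>-functions.
\<close>

definition test_function :: "real \<Rightarrow> (real \<Rightarrow> real) \<Rightarrow> (real \<Rightarrow> real) \<Rightarrow> bool" where
  "test_function a \<phi> \<phi>' \<longleftrightarrow>
     (\<forall>t. (\<phi> has_real_derivative \<phi>' t) (at t)) \<and> continuous_on UNIV \<phi>' \<and>
     (\<exists>c d. 0 < c \<and> d < a \<and> (\<forall>t. t \<notin> {c..d} \<longrightarrow> \<phi> t = 0))"

definition weak_derivative ::
  "real \<Rightarrow> (real \<Rightarrow> 'x::real_normed_vector) \<Rightarrow> (real \<Rightarrow> 'x) \<Rightarrow> bool" where
  "weak_derivative a f g \<longleftrightarrow>
     (\<forall>\<phi> \<phi>'. test_function a \<phi> \<phi>' \<longrightarrow>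
        integral {0..a} (\<lambda>t. \<phi>' t *\<^sub>R f t) = - integral {0..a} (\<lambda>t. \<phi> t *\<^sub>R g t))"

text \<open>\<open>f \<in> H\<^sup>1\<^sub>p((0,a);X)\<close> with derivative \<open>g\<close>:\<close>

definition H1p_derivative ::
  "real \<Rightarrow> real \<Rightarrow> (real \<Rightarrow> 'x::real_normed_vector) \<Rightarrow> (real \<Rightarrow> 'x) \<Rightarrow> bool" where
  "H1p_derivative p a f g \<longleftrightarrow> Lp p a f \<and> Lp p a g \<and> weak_derivative a f g"


subsection \<open>Maximal regularity\<close>

text \<open>
  The initial condition refers to the continuous representative (with values in \<open>X\<^sub>0\<close>) of
  \<open>w\<close>, and uniqueness is uniqueness almost everywhere.
\<close>

definition linear_solution ::
  "real \<Rightarrow> ('b::real_normed_vector \<Rightarrow> 'a::real_normed_vector) \<Rightarrow> ('b \<Rightarrow>\<^sub>L 'a) \<Rightarrow> real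
    \<Rightarrow> (real \<Rightarrow> 'a) \<Rightarrow> (real \<Rightarrow> 'b) \<Rightarrow> bool" where
  "linear_solution p J B a f w \<longleftrightarrow>
     Lp p a w \<and>
     (\<exists>w'. H1p_derivative p a (\<lambda>t. J (w t)) w' \<and>
        (AE t in lebesgue_on {0<..<a}. w' t + blinfun_apply B (w t) = f t)) \<and>
     (\<exists>v. continuous_on {0..a} v \<and> (AE t in lebesgue_on {0<..<a}. v t = J (w t)) \<and> v 0 = 0)"

definition maximal_regularity ::
  "real \<Rightarrow> ('b::real_normed_vector \<Rightarrow> 'a::real_normed_vector) \<Rightarrow> ('b \<Rightarrow>\<^sub>L 'a) \<Rightarrow> bool" where
  "maximal_regularity p J B \<longleftrightarrow>
     (\<forall>a>0. \<forall>f. Lp p a f \<longrightarrow>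
        (\<exists>w. linear_solution p J B a f w) \<and>
        (\<forall>w1 w2. linear_solution p J B a f w1 \<and> linear_solution p J B a f w2 \<longrightarrow>
           (AE t in lebesgue_on {0<..<a}. w1 t = w2 t)))"


subsection \<open>Operators in \<open>X\<^sub>0\<close> with domain \<open>X\<^sub>1\<close>\<close>

definition null_space :: "('b::real_vector \<Rightarrow> 'a::real_vector) \<Rightarrow> 'b set" where
  "null_space T = {v. T v = 0}"

definition zero_semisimple_eigenvalue ::
  "('b::real_vector \<Rightarrow> 'a::real_vector) \<Rightarrow> ('b \<Rightarrow> 'a) \<Rightarrow> bool" where
  "zero_semisimple_eigenvalue J T \<longleftrightarrow>
     null_space T \<noteq> {0} \<and>
     J ` null_space T \<inter> range T = {0} \<and>
     {x + y | x y. x \<in> J ` null_space T \<and> y \<in> range T} = UNIV"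

text \<open>
  \<open>\<mu> - T\<close> on the complexification, a pair \<open>(x, y)\<close> standing for \<open>x + \<i> y\<close>.
\<close>

definition complexified_shift ::
  "('b::real_vector \<Rightarrow> 'a::real_vector) \<Rightarrow> ('b \<Rightarrow> 'a) \<Rightarrow> complex \<Rightarrow> 'b \<times> 'b \<Rightarrow> 'a \<times> 'a" where
  "complexified_shift J T \<mu> = (\<lambda>(x, y).
     (Re \<mu> *\<^sub>R J x - Im \<mu> *\<^sub>R J y - T x, Im \<mu> *\<^sub>R J x + Re \<mu> *\<^sub>R J y - T y))"

definition op_spectrum ::
  "('b::real_vector \<Rightarrow> 'a::real_normed_vector) \<Rightarrow> ('b \<Rightarrow> 'a) \<Rightarrow> complex set" where
  "op_spectrum J T = {\<mu>.
     \<not> (bij (complexified_shift J T \<mu>) \<and>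
        bounded_linear (\<lambda>z. map_prod J J (inv (complexified_shift J T \<mu>) z)))}"


subsection \<open>The quasilinear problem\<close>

definition equilibria ::
  "('b::real_normed_vector \<Rightarrow> 'a::real_normed_vector) \<Rightarrow> ('c::real_normed_vector \<Rightarrow> 'a)
    \<Rightarrow> 'c set \<Rightarrow> ('c \<Rightarrow> 'b \<Rightarrow>\<^sub>L 'a) \<Rightarrow> ('c \<Rightarrow> 'a) \<Rightarrow> 'b set" where
  "equilibria J i V A F =
     {u. incl J i u \<in> V \<and> blinfun_apply (A (incl J i u)) u = F (incl J i u)}"

definition linearization ::
  "('b::real_normed_vector \<Rightarrow> 'a::real_normed_vector) \<Rightarrow> ('c::real_normed_vector \<Rightarrow> 'a)
    \<Rightarrow> ('c \<Rightarrow> 'b \<Rightarrow>\<^sub>L 'a) \<Rightarrow> ('c \<Rightarrow> 'a) \<Rightarrow> 'b \<Rightarrow> 'b \<Rightarrow> 'a" where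
  "linearization J i A F u v =
     blinfun_apply (A (incl J i u)) v
     + blinfun_apply (frechet_derivative A (at (incl J i u)) (incl J i v)) u
     - frechet_derivative F (at (incl J i u)) (incl J i v)"

text \<open>
  Near \<open>u\<close>, the set \<open>E\<close> is a \<open>C\<^sup>1\<close>-manifold of dimension \<open>CARD('m)\<close>, parametrized by \<open>\<Psi>\<close> on \<open>U\<close>.
\<close>

definition C1_manifold_near ::
  "'b::real_normed_vector set \<Rightarrow> 'b \<Rightarrow> (real ^ 'm) set \<Rightarrow> (real ^ 'm \<Rightarrow> 'b) \<Rightarrow> bool" where
  "C1_manifold_near E u U \<Psi> \<longleftrightarrow>
     open U \<and> 0 \<in> U \<and> C1_on U \<Psi> \<and> \<Psi> ` U \<subseteq> E \<and> \<Psi> 0 = u \<and>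
     dim (range (frechet_derivative \<Psi> (at 0))) = CARD('m) \<and>
     (\<exists>r>0. E \<inter> ball u r = \<Psi> ` U)"

text \<open>
  The function \<open>w\<close> below is \<open>u\<close> regarded as an element of \<open>L\<^sub>p((0,a);X\<^sub>1)\<close>.
\<close>

definition solution_on ::
  "real \<Rightarrow> ('b::real_normed_vector \<Rightarrow> 'a::real_normed_vector) \<Rightarrow> ('c::real_normed_vector \<Rightarrow> 'a)
    \<Rightarrow> 'c set \<Rightarrow> ('c \<Rightarrow> 'b \<Rightarrow>\<^sub>L 'a) \<Rightarrow> ('c \<Rightarrow> 'a) \<Rightarrow> real \<Rightarrow> 'c \<Rightarrow> (real \<Rightarrow> 'c) \<Rightarrow> bool" where
  "solution_on p J i V A F a u0 u \<longleftrightarrow>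
     continuous_on {0..a} u \<and> u ` {0..a} \<subseteq> V \<and> u 0 = u0 \<and>
     (\<exists>w u'. Lp p a w \<and> (AE t in lebesgue_on {0<..<a}. i (u t) = J (w t)) \<and>
        H1p_derivative p a (\<lambda>t. i (u t)) u' \<and>
        (AE t in lebesgue_on {0<..<a}. u' t + blinfun_apply (A (u t)) (w t) = F (u t)))"

text \<open>
  \<open>u\<close> is a solution on \<open>[0,\<infinity>)\<close>, and every solution on a bounded interval with the same initial
  value is a restriction of \<open>u\<close>.
\<close>

definition unique_global_solution ::
  "real \<Rightarrow> ('b::real_normed_vector \<Rightarrow> 'a::real_normed_vector) \<Rightarrow> ('c::real_normed_vector \<Rightarrow> 'a)
    \<Rightarrow> 'c set \<Rightarrow> ('c \<Rightarrow> 'b \<Rightarrow>\<^sub>L 'a) \<Rightarrow> ('c \<Rightarrow> 'a) \<Rightarrow> 'c \<Rightarrow> (real \<Rightarrow> 'c) \<Rightarrow> bool" where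
  "unique_global_solution p J i V A F u0 u \<longleftrightarrow>
     (\<forall>a>0. solution_on p J i V A F a u0 u) \<and>
     (\<forall>a>0. \<forall>v. solution_on p J i V A F a u0 v \<longrightarrow> (\<forall>t\<in>{0..a}. v t = u t))"

definition stable_equilibrium ::
  "real \<Rightarrow> ('b::real_normed_vector \<Rightarrow> 'a::real_normed_vector) \<Rightarrow> ('c::real_normed_vector \<Rightarrow> 'a)
    \<Rightarrow> 'c set \<Rightarrow> ('c \<Rightarrow> 'b \<Rightarrow>\<^sub>L 'a) \<Rightarrow> ('c \<Rightarrow> 'a) \<Rightarrow> 'c \<Rightarrow> bool" where
  "stable_equilibrium p J i V A F z \<longleftrightarrow>
     (\<forall>r>0. \<exists>\<delta>>0. \<forall>u0. norm (u0 - z) < \<delta> \<longrightarrow>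
        (\<exists>u. unique_global_solution p J i V A F u0 u \<and> (\<forall>t\<ge>0. norm (u t - z) < r)))"

definition converges_exponentially ::
  "(real \<Rightarrow> 'c::real_normed_vector) \<Rightarrow> 'c \<Rightarrow> bool" where
  "converges_exponentially u z \<longleftrightarrow>
     (\<exists>M>0. \<exists>\<omega>>0. \<forall>t\<ge>0. norm (u t - z) \<le> M * exp (- \<omega> * t))"

end

theory Submission
  imports Defs "HOL-Library.Function_Algebras"
begin

text \<open>
 Maximal regularity makes the problem \<open>v' + A\<^sub>0 v = f\<close>, \<open>v(0) = z\<close> solvable on every bounded interval, with bounds in
 \<open>L\<^sub>p(X\<^sub>1)\<close> and \<open>C(X\<^sub>\<gamma>)\<close>: the bounds come from Zabreiko's lemma and from the trace theorem for the K-method. With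
 \<open>u = u\<^sub>* + v\<close> the quasilinear problem becomes \<open>v' + A\<^sub>0 v = G(v)\<close>, where \<open>G\<close> has a small Lipschitz constant near 0, so that it
 is solved by contraction on intervals of a fixed length \<open>T\<close>.

 By semi-simplicity \<open>X\<^sub>0 = N(A\<^sub>0) \<oplus> R(A\<^sub>0)\<close>. Let \<open>B = A\<^sub>0 + P\<close> with the projection \<open>P\<close> onto \<open>N(A\<^sub>0)\<close>. The closed right half plane
 is in the resolvent set of \<open>-B\<close>, and Cauchy's theorem, applied to the resolvent and to the finite Laplace transform of a solution of
 \<open>v' + B v = 0\<close>, gives \<open>|(1 + B)\<^sup>-\<^sup>2 v(T)| \<le> C |v(0)| / T\<close>. Parabolic smoothing removes the two resolvents at the cost of a
 shift in time, hence the linear flow on \<open>R(A\<^sub>0)\<close> is a contraction after a long time.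

 For \<open>c\<close> near 0 let \<open>u\<^sub>* + X c\<close> be the equilibrium on the manifold with \<open>P(X c) = P c\<close>. Over a time \<open>T\<close> the distance
 \<open>|c - X c|\<close> is halved, and the equilibrium moves by at most a multiple of it. Hence the equilibria converge geometrically, and their
 limit attracts the solution at an exponential rate.
\<close>

section \<open>Strongly measurable functions on the real line\<close>

text \<open>Neither the spectral condition nor maximal regularity, a statement on bounded intervals,
  contains a decay rate. The weak rate 1/T suffices because a factor below 1 after one fixed time
  becomes an exponential rate under iteration; thus no semigroup, sectoriality or spectral gap has
  to be constructed. The resolvent is only known to decay like 1/|l|, which is not integrable along
  the imaginary axis. The extra factor (1 - l)^-2 repairs this, and it removes in the limit
  everything that stems from v on (0,T), since exp((T - t) l) (1 - l)^-2 is bounded and holomorphic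
  to the left of the axis. Its double pole at 1 is what leaves two resolvents in front of v(T). The
  constants are chosen in the order T, M, smallness of the nonlinearity: M depends on T, but it may
  be kept on shorter intervals. A second obstacle is that L_p consists of functions here, not of
  classes in a normed space. Completeness therefore appears as convergence of norm-summable series,
  and the closed graph theorem and the contraction principle are proved in that form.\<close>

definition SM :: "(real => 'x::real_normed_vector) => bool" where
 "SM f \<longleftrightarrow> strongly_measurable lebesgue f"

lemma AE_measurable_lebesgue:
 fixes f g :: "real => real"
 assumes f: "f \<in> borel_measurable lebesgue" and fg: "AE t in lebesgue. f t = g t"
 shows "g \<in> borel_measurable lebesgue"
proof (rule measurableI)
 fix B :: "real set" assume B: "B \<in> sets borel"
 show "g -` B \<inter> space lebesgue \<in> sets lebesgue"
 proof (rule completion.in_sets_AE[where A = "f -` B \<inter> space lebesgue"])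
  show "AE t in lebesgue. (t \<in> f -` B \<inter> space lebesgue) = (t \<in> g -` B \<inter> space lebesgue)"
   using fg by eventually_elim auto
  show "f -` B \<inter> space lebesgue \<in> sets lebesgue" using f B by (rule measurable_sets)
 qed auto
qed auto

lemma SM_dist:
 assumes "SM f"
 shows "(%t. dist (f t) d) \<in> borel_measurable lebesgue"
proof -
 obtain s where s: "!!n::nat. simple_function lebesgue (s n)"
  and lim: "AE t in lebesgue. (%n. s n t) \<longlonglongrightarrow> f t"
  using assms unfolding SM_def strongly_measurable_def by auto
 have m: "(%t. dist (s n t) d) \<in> borel_measurable lebesgue" for n
  by (intro borel_measurable_simple_function simple_function_compose1[OF s])
 have "(%t. lim (%n. dist (s n t) d)) \<in> borel_measurable lebesgue"
  using m by measurable
 moreover have "AE t in lebesgue. lim (%n. dist (s n t) d) = dist (f t) d"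
  using lim by eventually_elim (intro limI tendsto_intros)
 ultimately show ?thesis by (rule AE_measurable_lebesgue)
qed

lemma SM_norm [measurable_dest]: "SM f ==> (%t. norm (f t)) \<in> borel_measurable lebesgue"
 using SM_dist[of f 0] by simp

text \<open>Pettis' criterion with distances in place of functionals. The right-hand side passes to
  almost everywhere limits directly, whereas limits of limits of simple functions would need a
  diagonal choice.\<close>

lemma SM_iff:
 "SM f \<longleftrightarrow> (EX D. countable D & (AE t in lebesgue. f t \<in> closure D) &
   (ALL d. (%t. dist (f t) d) \<in> borel_measurable lebesgue))" (is "_ \<longleftrightarrow> ?R")
proof
 assume f: "SM f"
 then obtain s where s: "!!n::nat. simple_function lebesgue (s n)"
  and lim: "AE t in lebesgue. (%n. s n t) \<longlonglongrightarrow> f t"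
  unfolding SM_def strongly_measurable_def by auto
 have "countable (\<Union>n. range (s n))"
  using s by (auto simp: simple_function_def intro: countable_finite)
 moreover have "AE t in lebesgue. f t \<in> closure (\<Union>n. range (s n))"
  using lim
 proof eventually_elim
  fix t assume t: "(%n. s n t) \<longlonglongrightarrow> f t"
  show "f t \<in> closure (\<Union>n. range (s n))"
   unfolding closure_sequential by (rule exI[of _ "%n. s n t"]) (use t in auto)
 qed
 ultimately show ?R using SM_dist[OF f] by blast
next
 assume ?R
 then obtain D where D: "countable D" and cl: "AE t in lebesgue. f t \<in> closure D"
  and m: "!!d. (%t. dist (f t) d) \<in> borel_measurable lebesgue" by blast
 \<comment> \<open>Inserting 0 makes the enumerated set nonempty even if \<open>D\<close> is
   empty.\<close>
 define e where "e = from_nat_into (insert 0 D)"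
 have re: "range e = insert 0 D" using D by (simp add: e_def range_from_nat_into)
 \<comment> \<open>\<open>s n t\<close> is a point among \<open>e 0\<close>, ..., \<open>e n\<close>
   nearest to \<open>f t\<close>, found by running through them once; the sets on which the choice
   changes are measurable because only distances are compared.\<close>
 define s where "s = rec_nat (%_::real. e 0)
   (%n u t. if dist (f t) (e (Suc n)) < dist (f t) (u t) then e (Suc n) else u t)"
 have s0: "s 0 = (%t. e 0)"
  and sS: "s (Suc n) = (%t. if dist (f t) (e (Suc n)) < dist (f t) (s n t) then e (Suc n) else s n t)" for n
  by (rule ext, simp add: s_def)+
 have dS: "(%t. dist (f t) (s (Suc n) t)) = (%t. min (dist (f t) (e (Suc n))) (dist (f t) (s n t)))" for n
  by (auto simp: sS)
 have dm: "(%t. dist (f t) (s n t)) \<in> borel_measurable lebesgue" for n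
 proof (induction n)
  case 0 show ?case by (simp add: s0 m)
 next
  case (Suc n)
  show ?case unfolding dS using m Suc by measurable
 qed
 have simp_s: "simple_function lebesgue (s n)" for n
 proof (induction n)
  case 0 show ?case by (simp add: s0)
 next
  case (Suc n)
  show ?case unfolding sS
  proof (rule simple_function_If)
   show "{x \<in> space lebesgue. dist (f x) (e (Suc n)) < dist (f x) (s n x)} \<in> sets lebesgue"
    using m dm by measurable
  qed (use Suc in auto)
 qed
 have le: "dist (f t) (s n t) <= dist (f t) (e i)" if "i <= n" for i n t
  using that
 proof (induction n)
  case 0 then show ?case by (simp add: s0)
 next
  case (Suc n) then show ?case by (cases "i = Suc n") (auto simp: sS)
 qed
 have "AE t in lebesgue. (%n. s n t) \<longlonglongrightarrow> f t"
  using cl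
 proof eventually_elim
  fix t assume t: "f t \<in> closure D"
  show "(%n. s n t) \<longlonglongrightarrow> f t"
  proof (rule metric_LIMSEQ_I)
   fix r :: real assume "r > 0"
   then obtain y where "y \<in> D" "dist y (f t) < r" using t by (auto simp: closure_approachable)
   then obtain i where "dist (e i) (f t) < r" using re by (metis insertCI rangeE)
   then show "EX no. \<forall>n\<ge>no. dist (s n t) (f t) < r"
    using le by (metis dist_commute order_le_less_trans)
  qed
 qed
 then show "SM f" using simp_s unfolding SM_def strongly_measurable_def by blast
qed

lemma SM_compose2:
 assumes "SM f" "SM g" and c: "continuous_on UNIV (%z. phi (fst z) (snd z))"
 shows "SM (%t. phi (f t) (g t))"
proof -
 obtain s where s: "!!n::nat. simple_function lebesgue (s n)" "AE t in lebesgue. (%n. s n t) \<longlonglongrightarrow> f t"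
  using assms unfolding SM_def strongly_measurable_def by auto
 obtain u where u: "!!n::nat. simple_function lebesgue (u n)" "AE t in lebesgue. (%n. u n t) \<longlonglongrightarrow> g t"
  using assms unfolding SM_def strongly_measurable_def by auto
 have "AE t in lebesgue. (%n. phi (s n t) (u n t)) \<longlonglongrightarrow> phi (f t) (g t)"
  using s(2) u(2)
 proof eventually_elim
  fix t assume "(%n. s n t) \<longlonglongrightarrow> f t" "(%n. u n t) \<longlonglongrightarrow> g t"
  then have "(%n. (s n t, u n t)) \<longlonglongrightarrow> (f t, g t)" by (rule tendsto_Pair)
  with c have "(%n. phi (fst (s n t, u n t)) (snd (s n t, u n t))) \<longlonglongrightarrow> phi (fst (f t, g t)) (snd (f t, g t))"
   by (intro continuous_on_tendsto_compose[OF c]) auto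
  then show "(%n. phi (s n t) (u n t)) \<longlonglongrightarrow> phi (f t) (g t)" by simp
 qed
 then show ?thesis unfolding SM_def strongly_measurable_def
  using simple_function_compose2[OF s(1) u(1), where h = phi] by (intro exI[of _ "%n t. phi (s n t) (u n t)"]) auto
qed

lemma SM_const [simp]: "SM (%_. c)"
 unfolding SM_def strongly_measurable_def by (intro exI[of _ "%_ _. c"]) auto

lemma SM_compose:
 assumes "SM f" and c: "continuous_on UNIV phi"
 shows "SM (%t. phi (f t))"
 by (rule SM_compose2[OF assms(1) SM_const, of "%x _. phi x"])
   (intro continuous_on_compose2[OF c] continuous_intros; simp)

lemma SM_add: "SM f ==> SM g ==> SM (%t. f t + g t)"
 and SM_diff: "SM f ==> SM g ==> SM (%t. f t - g t)"
 by (erule (1) SM_compose2; intro continuous_intros)+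

lemma SM_bilinear:
 assumes B: "bounded_bilinear B" and f: "SM f" "SM g"
 shows "SM (%t. B (f t) (g t))"
 using f bounded_bilinear.continuous_on[OF B continuous_on_fst[OF continuous_on_id] continuous_on_snd[OF continuous_on_id]]
 by (rule SM_compose2)

lemma SM_scaleR: "SM c ==> SM f ==> SM (%t. c t *\<^sub>R f t)"
 by (rule SM_bilinear[OF bounded_bilinear_scaleR])

lemma SM_linear: "bounded_linear L ==> SM f ==> SM (%t. L (f t))"
 by (erule SM_compose) (simp add: bounded_linear.linear linear_continuous_on)

lemma SM_real:
 fixes f :: "real => real"
 assumes [measurable]: "f \<in> borel_measurable lebesgue"
 shows "SM f"
 unfolding SM_iff
proof (intro exI conjI allI)
 show "countable (\<rat> :: real set)" by (rule countable_rat)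
 show "AE t in lebesgue. f t \<in> closure \<rat>" by (simp add: Rats_closure_real)
 show "(%t. dist (f t) d) \<in> borel_measurable lebesgue" for d
  unfolding dist_real_def by measurable
qed

lemma SM_AE_cong:
 assumes "SM f" "AE t in lebesgue. f t = g t"
 shows "SM g"
proof -
 obtain s where s: "!!n::nat. simple_function lebesgue (s n)" "AE t in lebesgue. (%n. s n t) \<longlonglongrightarrow> f t"
  using assms unfolding SM_def strongly_measurable_def by auto
 have "AE t in lebesgue. (%n. s n t) \<longlonglongrightarrow> g t" using s(2) assms(2) by eventually_elim auto
 with s(1) show ?thesis unfolding SM_def strongly_measurable_def by blast
qed

text \<open>By \<open>SM_iff\<close>: the union of the countable sets belonging to the
  \<open>f n\<close> serves for the limit, and the distance functions converge pointwise.\<close>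

lemma SM_lim:
 assumes f: "!!n::nat. SM (f n)" and lim: "AE t in lebesgue. (%n. f n t) \<longlonglongrightarrow> F t"
 shows "SM F"
proof -
 have "EX D. countable D & (AE t in lebesgue. f n t \<in> closure D)" for n
  using f[of n] unfolding SM_iff by blast
 then obtain D where D: "!!n. countable (D n)" "!!n. AE t in lebesgue. f n t \<in> closure (D n)" by metis
 have "AE t in lebesgue. ALL n. f n t \<in> closure (D n)" using D(2) by (simp add: AE_all_countable)
 with lim have "AE t in lebesgue. F t \<in> closure (\<Union>n. D n)"
 proof eventually_elim
  fix t assume t: "(%n. f n t) \<longlonglongrightarrow> F t" "ALL n. f n t \<in> closure (D n)"
  have "f n t \<in> closure (\<Union>n. D n)" for n
   using t(2) closure_mono[of "D n" "\<Union>n. D n"] by (meson UN_upper UNIV_I subsetD)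
  then show "F t \<in> closure (\<Union>n. D n)"
   using t(1) closed_sequentially[OF closed_closure] by metis
 qed
 moreover have "(%t. dist (F t) d) \<in> borel_measurable lebesgue" for d
 proof -
  have "(%t. dist (f n t) d) \<in> borel_measurable lebesgue" for n by (rule SM_dist[OF f])
  then have "(%t. lim (%n. dist (f n t) d)) \<in> borel_measurable lebesgue" by measurable
  moreover have "AE t in lebesgue. lim (%n. dist (f n t) d) = dist (F t) d"
   using lim by eventually_elim (intro limI tendsto_intros)
  ultimately show ?thesis by (rule AE_measurable_lebesgue)
 qed
 ultimately show ?thesis unfolding SM_iff using D(1) by (intro exI[of _ "\<Union>n. D n"]) auto
qed

text \<open>Extension by zero turns functions on an interval into functions on the line, so that one
  notion of measurability and one seminorm serve all intervals. The interval is open to agree with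
  \<open>lebesgue_on {0<..<a}\<close>.\<close>

definition cut :: "real => real => (real => 'x::real_normed_vector) => real => 'x" where
 "cut s t f = (%r. if s < r & r < t then f r else 0)"

lemma SM_cut:
 assumes "SM f" shows "SM (cut s t f)"
proof -
 have "cut s t f = (%r. indicator {s<..<t} r *\<^sub>R f r)" by (auto simp: cut_def indicator_def)
 then show ?thesis using assms by (auto intro!: SM_scaleR SM_real borel_measurable_indicator)
qed

text \<open>The images of the rational points form the countable set required by
  \<open>SM_iff\<close>; 0 is added for the values outside the interval.\<close>

lemma SM_continuous:
 assumes c: "continuous_on {s<..<t} f"
 shows "SM (cut s t f)"
 unfolding SM_iff
proof (intro exI conjI allI)
 show "countable (insert 0 (f ` (\<rat> \<inter> {s<..<t})))" by (simp add: countable_rat)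
 show "AE r in lebesgue. cut s t f r \<in> closure (insert 0 (f ` (\<rat> \<inter> {s<..<t})))"
 proof (intro always_eventually allI)
  fix r
  show "cut s t f r \<in> closure (insert 0 (f ` (\<rat> \<inter> {s<..<t})))"
  proof (cases "s < r & r < t")
   case True
   have "r \<in> closure (\<rat> \<inter> {s<..<t})"
   proof -
    have "{s<..<t} \<subseteq> closure ({s<..<t} \<inter> \<rat>)"
     using open_Int_closure_subset[of "{s<..<t}" "\<rat>"] by (simp add: Rats_closure_real)
    then show ?thesis using True by (auto simp: Int_commute)
   qed
   then obtain x where x: "!!n. x n \<in> \<rat> \<inter> {s<..<t}" "x \<longlonglongrightarrow> r" by (auto simp: closure_sequential)
   have "(%n. f (x n)) \<longlonglongrightarrow> f r"
    using True x by (intro continuous_on_tendsto_compose[OF c x(2)]) auto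
   then have "f r \<in> closure (f ` (\<rat> \<inter> {s<..<t}))"
    unfolding closure_sequential using x(1) by (intro exI[of _ "%n. f (x n)"]) blast
   then show ?thesis using True closure_mono[of "f ` (\<rat> \<inter> {s<..<t})" "insert 0 (f ` (\<rat> \<inter> {s<..<t}))"]
    by (auto simp: cut_def)
  qed (auto simp: cut_def intro: closure_subset[THEN subsetD])
 qed
 fix d
 have "(%r. if r \<in> {s<..<t} then dist (f r) d else dist 0 d) \<in> borel_measurable borel"
  by (intro borel_measurable_continuous_on_if continuous_intros c) auto
 moreover have "(%r. if r \<in> {s<..<t} then dist (f r) d else dist 0 d) = (%r. dist (cut s t f r) d)"
  by (auto simp: cut_def)
 ultimately have "(%r. dist (cut s t f r) d) \<in> borel_measurable lborel" by simp
 then show "(%r. dist (cut s t f r) d) \<in> borel_measurable lebesgue" by (rule measurable_completion)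
qed

text \<open>Affine maps of nonzero slope pull null sets back to null sets, which the almost
  everywhere part of strong measurability needs.\<close>

lemma SM_affine:
 assumes "SM f" and c: "c ~= 0"
 shows "SM (%t. f (s + c * t))"
proof -
 obtain u where u: "!!n::nat. simple_function lebesgue (u n)" "AE t in lebesgue. (%n. u n t) \<longlonglongrightarrow> f t"
  using assms unfolding SM_def strongly_measurable_def by auto
 have T: "(%t. s + c * t) \<in> lebesgue \<rightarrow>\<^sub>M lebesgue"
  using lebesgue_affine_measurable[of "%_. c" s] c by simp
 have sf: "simple_function lebesgue (%t. u n (s + c * t))" for n
  unfolding simple_function_def
 proof (intro conjI ballI)
  show "finite ((%t. u n (s + c * t)) ` space lebesgue)"
   using u(1)[of n] unfolding simple_function_def by (rule finite_subset[rotated, OF conjunct1]) auto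
  fix x
  have "u n -` {x} \<inter> space lebesgue \<in> sets lebesgue" using u(1) by (rule simple_functionD)
  from measurable_sets[OF T this]
  show "(%t. u n (s + c * t)) -` {x} \<inter> space lebesgue \<in> sets lebesgue" by (simp add: vimage_def)
 qed
 have "AE t in density (distr lebesgue lebesgue (%t. s + c * t)) (%_. ennreal \<bar>c\<bar>). (%n. u n t) \<longlonglongrightarrow> f t"
  using u(2) lebesgue_real_affine[OF c, of s] by metis
 then have "AE t in distr lebesgue lebesgue (%t. s + c * t). (%n. u n t) \<longlonglongrightarrow> f t"
  using c by (subst (asm) AE_density) auto
 then have "AE t in lebesgue. (%n. u n (s + c * t)) \<longlonglongrightarrow> f (s + c * t)"
  by (rule AE_distrD[OF T])
 with sf show ?thesis unfolding SM_def strongly_measurable_def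
  by (intro exI[of _ "%n t. u n (s + c * t)"] conjI allI)
qed

lemma AE_affine:
 fixes c :: real
 assumes "AE t in lebesgue. P t" and c: "c ~= 0"
 shows "AE t in lebesgue. P (s + c * t)"
proof -
 have T: "(%t. s + c * t) \<in> lebesgue \<rightarrow>\<^sub>M lebesgue"
  using lebesgue_affine_measurable[of "%_. c" s] c by simp
 have "AE t in density (distr lebesgue lebesgue (%t. s + c * t)) (%_. ennreal \<bar>c\<bar>). P t"
  using assms(1) lebesgue_real_affine[OF c, of s] by metis
 then have "AE t in distr lebesgue lebesgue (%t. s + c * t). P t"
  using c by (subst (asm) AE_density) auto
 then show ?thesis by (rule AE_distrD[OF T])
qed

section \<open>The spaces \<open>L\<^sub>p\<close>\<close>

definition PL :: "real => (real => 'x::real_normed_vector) => bool" where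
 "PL p f \<longleftrightarrow> SM f & integrable lebesgue (%t. norm (f t) powr p)"

text \<open>Only a seminorm, since functions equal almost everywhere are not identified. Without
  \<open>PL p f\<close> the value carries no information: the integral of a nonintegrable function
  is 0 by convention.\<close>

definition LN :: "real => (real => 'x::real_normed_vector) => real" where
 "LN p f = (\<integral>t. norm (f t) powr p \<partial>lebesgue) powr (1 / p)"

lemma LN_nonneg [simp]: "0 <= LN p f"
 by (simp add: LN_def)

lemma LN_powr: "0 < p ==> LN p f powr p = (\<integral>t. norm (f t) powr p \<partial>lebesgue)"
 by (simp add: LN_def powr_powr)

lemma SM_powr: "SM f ==> (%t. ennreal (norm (f t) powr p)) \<in> borel_measurable lebesgue"
 using SM_norm[of f] by measurable

text \<open>A bound on the nonnegative integral contains integrability and the norm bound at once,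
  so estimates can be made in \<open>ennreal\<close> before integrability is known.\<close>

lemma PL_iff:
 assumes p: "0 < p" and c: "0 <= c"
 shows "PL p f & LN p f <= c \<longleftrightarrow>
  SM f & (\<integral>\<^sup>+t. ennreal (norm (f t) powr p) \<partial>lebesgue) <= ennreal (c powr p)" (is "?L \<longleftrightarrow> ?R")
proof
 assume L: ?L
 then have "(\<integral>\<^sup>+t. ennreal (norm (f t) powr p) \<partial>lebesgue) = ennreal (LN p f powr p)"
  using p by (subst nn_integral_eq_integral) (auto simp: PL_def LN_powr)
 also have "... <= ennreal (c powr p)" using L p by (intro ennreal_leI powr_mono2) auto
 finally show ?R using L by (simp add: PL_def)
next
 assume R: ?R
 have i: "integrable lebesgue (%t. norm (f t) powr p)"
 proof (rule integrableI_bounded)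
  show "(%t. norm (f t) powr p) \<in> borel_measurable lebesgue"
  proof -
   have [measurable]: "(%t. norm (f t)) \<in> borel_measurable lebesgue" using R SM_norm by blast
   show ?thesis by measurable
  qed
  show "(\<integral>\<^sup>+ t. ennreal (norm (norm (f t) powr p)) \<partial>lebesgue) < \<infinity>"
   using R by (auto intro: le_less_trans)
 qed
 have "ennreal (LN p f powr p) <= ennreal (c powr p)"
  using R i p by (subst (asm) nn_integral_eq_integral) (auto simp: LN_powr)
 then have "LN p f powr p <= c powr p" by (simp add: ennreal_le_iff)
 then have "LN p f <= c" using p c by (meson LN_nonneg not_le powr_less_mono2)
 then show ?L using R i by (simp add: PL_def)
qed

lemma PL_nn: "0 < p ==> PL p f ==> (\<integral>\<^sup>+t. ennreal (norm (f t) powr p) \<partial>lebesgue) <= ennreal (LN p f powr p)"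
 using PL_iff[of p "LN p f" f] by simp

lemma PL_SM: "PL p f ==> SM f" by (simp add: PL_def)

lemma PL_bound:
 assumes p: "0 < p" and f: "SM f" and g: "PL p g" and c: "0 <= c"
  and le: "AE t in lebesgue. norm (f t) <= c * norm (g t)"
 shows "PL p f & LN p f <= c * LN p g"
proof -
 have "(\<integral>\<^sup>+t. ennreal (norm (f t) powr p) \<partial>lebesgue) <= (\<integral>\<^sup>+t. ennreal (c powr p) * ennreal (norm (g t) powr p) \<partial>lebesgue)"
 proof (rule nn_integral_mono_AE)
  show "AE t in lebesgue. ennreal (norm (f t) powr p) <= ennreal (c powr p) * ennreal (norm (g t) powr p)"
   using le
  proof eventually_elim
   fix t assume "norm (f t) <= c * norm (g t)"
   then have "norm (f t) powr p <= (c * norm (g t)) powr p" using p by (intro powr_mono2) auto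
   then show "ennreal (norm (f t) powr p) <= ennreal (c powr p) * ennreal (norm (g t) powr p)"
    using c by (simp add: powr_mult ennreal_mult[symmetric] ennreal_leI)
  qed
 qed
 also have "... = ennreal (c powr p) * (\<integral>\<^sup>+t. ennreal (norm (g t) powr p) \<partial>lebesgue)"
  using g by (intro nn_integral_cmult SM_powr PL_SM)
 also have "... <= ennreal (c powr p) * ennreal (LN p g powr p)"
  by (intro mult_left_mono PL_nn p g) auto
 also have "... = ennreal ((c * LN p g) powr p)"
  using c by (simp add: powr_mult ennreal_mult[symmetric])
 finally show ?thesis using f c PL_iff[OF p, of "c * LN p g" f] by auto
qed

lemma PL_mono:
 assumes "0 < p" "SM f" "PL p g" "AE t in lebesgue. norm (f t) <= norm (g t)"
 shows "PL p f" "LN p f <= LN p g"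
 using PL_bound[OF assms(1-3), of 1] assms(4) by auto

lemma PL_AE_cong:
 assumes "0 < p" "PL p f" "AE t in lebesgue. f t = g t"
 shows "PL p g" "LN p g = LN p f"
proof -
 have "SM g" using SM_AE_cong[OF PL_SM assms(3)] assms(2) by auto
 moreover have "AE t in lebesgue. norm (g t) <= norm (f t)" "AE t in lebesgue. norm (f t) <= norm (g t)"
  using assms(3) by (eventually_elim, simp)+
 ultimately show "PL p g" "LN p g = LN p f"
  using PL_mono[of p g f] PL_mono[of p f g] assms PL_SM[of p f] by (auto intro: antisym)
qed

lemma powr_convex_nonneg:
 fixes a b l p :: real
 assumes p: "1 <= p" and a: "0 <= a" and b: "0 <= b" and l: "0 <= l" "l <= 1"
 shows "(l * a + (1 - l) * b) powr p <= l * a powr p + (1 - l) * b powr p"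
proof -
 have less1: "x powr p <= x" if "0 <= x" "x <= 1" for x :: real
  using that p powr_mono'[of 1 p x] by (cases "x = 0") auto
 consider "a = 0" | "b = 0" | "a > 0" "b > 0" using a b by linarith
 then show ?thesis
 proof cases
  case 1 then show ?thesis
   using mult_right_mono[OF less1[of "1 - l"], of "b powr p"] l b by (simp add: powr_mult)
 next
  case 2 then show ?thesis
   using mult_right_mono[OF less1[of l], of "a powr p"] l a by (simp add: powr_mult)
 next
  case 3 then show ?thesis
   using convex_onD[OF powr_convex[OF p], of "1 - l" a b] l by simp
 qed
qed

text \<open>Minkowski's inequality from convexity of the p-th power: the sum is at most
  \<open>a + b\<close> times a convex combination of the two normalized norms, with weight
  \<open>l = a / (a + b)\<close>.\<close>

lemma PL_add:
 assumes p: "1 <= p" and f: "PL p f" and g: "PL p g"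
 shows "PL p (%t. f t + g t)" "LN p (%t. f t + g t) <= LN p f + LN p g"
proof -
 have p0: "0 < p" using p by simp
 have sm: "SM (%t. f t + g t)" using f g by (intro SM_add PL_SM)
 \<comment> \<open>Strictly positive majorants \<open>a\<close>, \<open>b\<close> of the norms keep
   the normalization meaningful when a norm vanishes; they are removed by
   \<open>field_le_epsilon\<close>.\<close>
 have *: "PL p (%t. f t + g t) & LN p (%t. f t + g t) <= a + b"
  if a: "LN p f <= a" "0 < a" and b: "LN p g <= b" "0 < b" for a b
 proof -
  define l where "l = a / (a + b)"
  have l: "0 <= l" "l <= 1" "1 - l = b / (a + b)" using a b by (auto simp: l_def field_simps)
  have pt: "norm (f t + g t) powr p <= (a + b) powr p * (l * (norm (f t) / a) powr p + (1 - l) * (norm (g t) / b) powr p)" for t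
  proof -
   have "norm (f t + g t) powr p <= (norm (f t) + norm (g t)) powr p"
    using p0 by (intro powr_mono2 norm_triangle_ineq) auto
   also have "norm (f t) + norm (g t) = (a + b) * (l * (norm (f t) / a) + (1 - l) * (norm (g t) / b))"
   proof -
    have "l * (norm (f t) / a) = norm (f t) / (a + b)" "(1 - l) * (norm (g t) / b) = norm (g t) / (a + b)"
     unfolding l(3) unfolding l_def using a b by auto
    then show ?thesis using a b by (simp add: add_divide_distrib[symmetric])
   qed
   also have "... powr p = (a + b) powr p * (l * (norm (f t) / a) + (1 - l) * (norm (g t) / b)) powr p"
    using a b l by (intro powr_mult)
   also have "... <= (a + b) powr p * (l * (norm (f t) / a) powr p + (1 - l) * (norm (g t) / b) powr p)"
    using a b l p by (intro mult_left_mono powr_convex_nonneg) auto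
   finally show ?thesis .
  qed
  define A B where "A = (a + b) powr p * l / a powr p" and "B = (a + b) powr p * (1 - l) / b powr p"
  have AB: "0 <= A" "0 <= B" using l(1,2) by (auto simp: A_def B_def)
  have pt': "norm (f t + g t) powr p <= A * norm (f t) powr p + B * norm (g t) powr p" for t
   using pt[of t] a b by (simp add: A_def B_def powr_divide algebra_simps)
  have "(\<integral>\<^sup>+t. ennreal (norm (f t + g t) powr p) \<partial>lebesgue)
    <= (\<integral>\<^sup>+t. ennreal A * ennreal (norm (f t) powr p) + ennreal B * ennreal (norm (g t) powr p) \<partial>lebesgue)"
   using pt' AB by (intro nn_integral_mono)
    (simp add: ennreal_mult[symmetric] ennreal_plus[symmetric] ennreal_leI del: ennreal_plus)
  also have "... = ennreal A * (\<integral>\<^sup>+t. ennreal (norm (f t) powr p) \<partial>lebesgue) + ennreal B * (\<integral>\<^sup>+t. ennreal (norm (g t) powr p) \<partial>lebesgue)"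
   using SM_powr[OF PL_SM[OF f], of p] SM_powr[OF PL_SM[OF g], of p]
   by (subst nn_integral_add) (auto simp: nn_integral_cmult)
  also have "... <= ennreal A * ennreal (a powr p) + ennreal B * ennreal (b powr p)"
   using PL_iff[OF p0, of a f] PL_iff[OF p0, of b g] a b f g
   by (intro add_mono mult_left_mono) auto
  also have "... = ennreal (A * a powr p + B * b powr p)"
   using AB by (simp add: ennreal_mult[symmetric] ennreal_plus[symmetric] del: ennreal_plus)
  also have "A * a powr p + B * b powr p = (a + b) powr p"
  proof -
   have "A * a powr p = (a + b) powr p * l" "B * b powr p = (a + b) powr p * (1 - l)"
    using a b by (simp_all add: A_def B_def)
   then show ?thesis by (simp add: algebra_simps)
  qed
  finally show ?thesis using PL_iff[OF p0, of "a + b"] a b sm by auto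
 qed
 show "PL p (%t. f t + g t)"
  using *[of "LN p f + 1" "LN p g + 1"] by (simp add: add_nonneg_pos)
 show "LN p (%t. f t + g t) <= LN p f + LN p g"
 proof (rule field_le_epsilon)
  fix e :: real assume "0 < e"
  then show "LN p (%t. f t + g t) <= LN p f + LN p g + e"
   using *[of "LN p f + e / 2" "LN p g + e / 2"] by (simp add: add_nonneg_pos)
 qed
qed

lemma PL_scale:
 assumes p: "0 < p" and f: "PL p f"
 shows "PL p (%t. c *\<^sub>R f t)" "LN p (%t. c *\<^sub>R f t) = \<bar>c\<bar> * LN p f"
proof -
 show PL: "PL p (%t. c *\<^sub>R f t)"
  using PL_bound[of p "%t. c *\<^sub>R f t" f "\<bar>c\<bar>"] p f SM_scaleR[OF SM_const PL_SM[OF f], of c] by simp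
 have "(\<integral>t. norm (c *\<^sub>R f t) powr p \<partial>lebesgue) = \<bar>c\<bar> powr p * (\<integral>t. norm (f t) powr p \<partial>lebesgue)"
  by (simp add: powr_mult)
 then show "LN p (%t. c *\<^sub>R f t) = \<bar>c\<bar> * LN p f"
  using p by (simp add: LN_def powr_mult powr_powr)
qed

lemma LN_minus: "LN p (%t. - f t) = LN p f"
 by (simp add: LN_def)

lemma PL_minus: "PL p f ==> PL p (%t. - f t)"
 using SM_linear[OF bounded_linear_minus[OF bounded_linear_ident], of f] by (simp add: PL_def)

lemma PL_diff:
 assumes p: "1 <= p" and f: "PL p f" and g: "PL p g"
 shows "PL p (%t. f t - g t)" "LN p (%t. f t - g t) <= LN p f + LN p g"
 using PL_add[OF p f PL_minus[OF g]] by (simp_all add: LN_minus)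

lemma PL_linear:
 assumes p: "0 < p" and L: "bounded_linear L" and f: "PL p f"
 shows "PL p (%t. L (f t))" "LN p (%t. L (f t)) <= onorm L * LN p f"
 using PL_bound[of p "%t. L (f t)" f "onorm L"] p f SM_linear[OF L PL_SM[OF f]]
  onorm[OF L] onorm_pos_le[OF L] by auto

lemma PL_zero [simp]: "PL p (%_. 0)" "LN p (%_. 0) = 0"
 by (simp_all add: PL_def LN_def)

lemma LN_eq_0_AE:
 assumes p: "0 < p" and f: "PL p f" and 0: "LN p f = 0"
 shows "AE t in lebesgue. f t = 0"
proof -
 have "(\<integral>t. norm (f t) powr p \<partial>lebesgue) = 0" using LN_powr[OF p, of f] 0 by simp
 then have "AE t in lebesgue. norm (f t) powr p = 0"
  using f by (subst (asm) integral_nonneg_eq_0_iff_AE) (auto simp: PL_def)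
 then show ?thesis by eventually_elim simp
qed

text \<open>Fatou's lemma, in the form that yields the tail estimates of
  \<open>PL_series\<close>.\<close>

lemma PL_fatou:
 assumes p: "0 < p" and f: "!!n::nat. PL p (f n)" and c: "!!n. LN p (f n) <= c"
  and lim: "AE t in lebesgue. (%n. f n t) \<longlonglongrightarrow> F t"
 shows "PL p F" "LN p F <= c"
proof -
 have c0: "0 <= c" using c[of 0] LN_nonneg[of p "f 0"] by linarith
 have sm: "SM F" by (rule SM_lim[OF PL_SM[OF f] lim])
 have "(\<integral>\<^sup>+t. ennreal (norm (F t) powr p) \<partial>lebesgue) = (\<integral>\<^sup>+t. liminf (%n. ennreal (norm (f n t) powr p)) \<partial>lebesgue)"
 proof (rule nn_integral_cong_AE)
  show "AE t in lebesgue. ennreal (norm (F t) powr p) = liminf (%n. ennreal (norm (f n t) powr p))"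
   using lim
  proof eventually_elim
   fix t assume "(%n. f n t) \<longlonglongrightarrow> F t"
   then have "(%n. ennreal (norm (f n t) powr p)) \<longlonglongrightarrow> ennreal (norm (F t) powr p)"
    using p by (intro tendsto_intros tendsto_powr') auto
   then show "ennreal (norm (F t) powr p) = liminf (%n. ennreal (norm (f n t) powr p))"
    by (intro lim_imp_Liminf[symmetric]) auto
  qed
 qed
 also have "... <= liminf (%n. \<integral>\<^sup>+t. ennreal (norm (f n t) powr p) \<partial>lebesgue)"
  by (rule nn_integral_liminf) (intro SM_powr PL_SM[OF f])
 also have "... <= ennreal (c powr p)"
 proof (rule Liminf_le)
  show "\<forall>\<^sub>F n in sequentially. (\<integral>\<^sup>+t. ennreal (norm (f n t) powr p) \<partial>lebesgue) <= ennreal (c powr p)"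
   using PL_iff[OF p c0, of "f _"] f c by (intro always_eventually allI) blast
 qed simp
 finally show "PL p F" "LN p F <= c" using sm PL_iff[OF p c0, of F] by auto
qed

lemma PL_sum:
 assumes p: "1 <= p" and f: "!!k. PL p (f k)"
 shows "PL p (%t. \<Sum>k\<in>A. f k t)" "LN p (%t. \<Sum>k\<in>A. f k t) <= (\<Sum>k\<in>A. LN p (f k))"
proof -
 have "PL p (%t. \<Sum>k\<in>A. f k t) & LN p (%t. \<Sum>k\<in>A. f k t) <= (\<Sum>k\<in>A. LN p (f k))"
 proof (induction A rule: infinite_finite_induct)
  case (insert x F)
  then show ?case using PL_add[OF p f[of x], of "%t. \<Sum>k\<in>F. f k t"] by auto
 qed auto
 then show "PL p (%t. \<Sum>k\<in>A. f k t)" "LN p (%t. \<Sum>k\<in>A. f k t) <= (\<Sum>k\<in>A. LN p (f k))" by auto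
qed

lemma PL_norm: "PL p f ==> PL p (%t. norm (f t))" "LN p (%t. norm (f t)) = LN p f"
 using SM_compose[of f norm] by (auto simp: PL_def LN_def continuous_on_norm_id)

text \<open>Completeness of L_p as convergence of norm-summable series, the form used by Zabreiko's
  lemma and by the fixed point theorem. Monotone convergence for the partial sums of the norms gives
  pointwise summability, Fatou's lemma the tail estimates.\<close>

lemma PL_series:
 fixes f :: "nat => real => 'x::banach"
 assumes p: "1 <= p" and f: "!!n. PL p (f n)" and s: "summable (%n. LN p (f n))"
 shows "AE t in lebesgue. summable (%n. norm (f n t))"
  and "PL p (%t. \<Sum>n. f n t)"
  and "LN p (%t. (\<Sum>k. f k t) - (\<Sum>k<n. f k t)) <= (\<Sum>k. LN p (f (k + n)))"
  and "LN p (%t. \<Sum>k. f k t) <= (\<Sum>k. LN p (f k))"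
proof -
 have p0: "0 < p" using p by simp
 define sg where "sg = (\<Sum>n. LN p (f n))"
 have part: "(\<Sum>k<m. LN p (f k)) <= sg" for m unfolding sg_def using s by (intro sum_le_suminf) auto
 have sg0: "0 <= sg" using part[of 0] by simp
 define S where "S m t = (\<Sum>k<m. norm (f k t))" for m t
 have S0: "0 <= S m t" for m t by (simp add: S_def sum_nonneg)
 have Sm: "PL p (S m)" "LN p (S m) <= sg" for m
  using PL_sum[of p "%k t. norm (f k t)" "{..<m}"] part[of m] p f by (auto simp: S_def[abs_def] PL_norm)
 have incS: "incseq (%m t. ennreal (S m t powr p))"
  using p0 S0 by (intro incseq_SucI le_funI ennreal_leI powr_mono2) (auto simp: S_def)
 have "(\<integral>\<^sup>+t. (SUP m. ennreal (S m t powr p)) \<partial>lebesgue) = (SUP m. \<integral>\<^sup>+t. ennreal (S m t powr p) \<partial>lebesgue)"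
  using SM_powr[OF PL_SM[OF Sm(1)], where p = p] S0 by (intro nn_integral_monotone_convergence_SUP incS) auto
 also have "... <= ennreal (sg powr p)"
  using Sm PL_iff[OF p0 sg0, of "S _"] S0 by (intro SUP_least) auto
 finally have fin: "(\<integral>\<^sup>+t. (SUP m. ennreal (S m t powr p)) \<partial>lebesgue) ~= \<infinity>"
  by (auto simp: top_unique)
 have "AE t in lebesgue. (SUP m. ennreal (S m t powr p)) ~= \<infinity>"
  using SM_powr[OF PL_SM[OF Sm(1)], where p = p] S0 by (intro nn_integral_PInf_AE fin borel_measurable_SUP) auto
 then show ae: "AE t in lebesgue. summable (%n. norm (f n t))"
 proof eventually_elim
  fix t assume "(SUP m. ennreal (S m t powr p)) ~= \<infinity>"
  then obtain c where c: "(SUP m. ennreal (S m t powr p)) = ennreal c" "0 <= c"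
   by (cases "SUP m. ennreal (S m t powr p)") auto
  show "summable (%n. norm (f n t))"
  proof (rule bounded_imp_summable)
   fix n
   have "ennreal (S (Suc n) t powr p) <= ennreal c" unfolding c(1)[symmetric] by (rule SUP_upper) simp
   then have "S (Suc n) t powr p <= c" using c(2) by simp
   then have "(S (Suc n) t powr p) powr (1/p) <= c powr (1/p)" using p0 by (intro powr_mono2) auto
   then show "(\<Sum>k\<le>n. norm (f k t)) <= c powr (1/p)"
    using p0 S0[of "Suc n" t] by (simp add: powr_powr S_def lessThan_Suc_atMost)
  qed simp
 qed
 have conv: "AE t in lebesgue. (%m. \<Sum>k<m. f k t) \<longlonglongrightarrow> (\<Sum>k. f k t)"
  using ae by eventually_elim (rule summable_LIMSEQ[OF summable_norm_cancel])
 have fl: "PL p (%t. (\<Sum>k. f k t) - (\<Sum>k<n. f k t)) & LN p (%t. (\<Sum>k. f k t) - (\<Sum>k<n. f k t)) <= (\<Sum>k. LN p (f (k + n)))" for n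
 proof -
  have sn: "summable (%k. LN p (f (k + n)))" using s by (rule summable_ignore_initial_segment)
  have "AE t in lebesgue. (%m. \<Sum>k<m. f (k + n) t) \<longlonglongrightarrow> (\<Sum>k. f k t) - (\<Sum>k<n. f k t)"
   using ae
  proof eventually_elim
   fix t assume t: "summable (%n. norm (f n t))"
   then have t': "summable (%n. f n t)" by (rule summable_norm_cancel)
   then have "summable (%k. f (k + n) t)" by (rule summable_ignore_initial_segment)
   from summable_LIMSEQ[OF this]
   show "(%m. \<Sum>k<m. f (k + n) t) \<longlonglongrightarrow> (\<Sum>k. f k t) - (\<Sum>k<n. f k t)"
    by (simp add: suminf_minus_initial_segment[OF t'])
  qed
  from PL_fatou[OF p0 PL_sum(1) _ this, of "\<Sum>k. LN p (f (k + n))"]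
  show ?thesis
   using order_trans[OF PL_sum(2)[OF p, of "%k. f (k + n)"] sum_le_suminf[OF sn]] f p by auto
 qed
 show "LN p (%t. (\<Sum>k. f k t) - (\<Sum>k<n. f k t)) <= (\<Sum>k. LN p (f (k + n)))" using fl by blast
 show "PL p (%t. \<Sum>n. f n t)" "LN p (%t. \<Sum>k. f k t) <= (\<Sum>k. LN p (f k))" using fl[of 0] by simp_all
qed

lemma PL_affine:
 assumes p: "0 < p" and f: "PL p f" and c: "\<bar>c\<bar> = 1"
 shows "PL p (%t. f (s + c * t))" "LN p (%t. f (s + c * t)) = LN p f"
proof -
 have c0: "c ~= 0" using c by auto
 have le: "PL p (%t. f (s + c * t)) & LN p (%t. f (s + c * t)) <= LN p f" if f: "PL p f" and c: "\<bar>c\<bar> = 1" for f :: "real => 'a" and s c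
 proof -
  have c0: "c ~= 0" using c by auto
  have "(\<integral>\<^sup>+t. ennreal (norm (f (s + c * t)) powr p) \<partial>lebesgue) = (\<integral>\<^sup>+t. ennreal (norm (f t) powr p) \<partial>lebesgue)"
   using nn_integral_real_affine_lebesgue[OF SM_powr[OF PL_SM[OF f], of p] c0, of s] c by simp
  then show ?thesis
   using PL_iff[OF p LN_nonneg, of f] PL_iff[OF p LN_nonneg, of "%t. f (s + c * t)" p f] f SM_affine[OF PL_SM[OF f] c0, of s]
   by auto
 qed
 show PL: "PL p (%t. f (s + c * t))" using le[OF f c] by blast
 \<comment> \<open>The inverse of the substitution has the same form, which gives the reverse
   inequality.\<close>
 have cc: "c * c = 1" using c by (metis abs_mult_self_eq mult_1)
 have "(%t. f (s + c * (- c * s + c * t))) = f" using cc by (auto simp: algebra_simps mult.assoc[symmetric])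
 then show "LN p (%t. f (s + c * t)) = LN p f"
  using le[OF f c, of s] le[OF PL c, of "- c * s"] by simp
qed

abbreviation PL0 where "PL0 p a f == PL p (cut 0 a f)"
abbreviation LN0 where "LN0 p a f == LN p (cut 0 a f)"

lemma cut_cut: "a <= s ==> t <= b ==> cut s t (cut a b f) = cut s t f"
 by (auto simp: cut_def fun_eq_iff)

lemma PL_cut_sub:
 assumes "0 < p" "PL p (cut a b f)" "a <= s" "t <= b"
 shows "PL p (cut s t f)" "LN p (cut s t f) <= LN p (cut a b f)"
proof -
 have "SM (cut s t f)" using SM_cut[OF PL_SM[OF assms(2)], of s t] assms by (simp add: cut_cut)
 then show "PL p (cut s t f)" "LN p (cut s t f) <= LN p (cut a b f)"
  using PL_mono[OF assms(1) _ assms(2), of "cut s t f"] assms(3,4) by (auto simp: cut_def)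
qed

lemma PL_cut_const:
 assumes p: "0 < p" and ab: "a <= b"
 shows "PL p (cut a b (%_. c :: 'x::real_normed_vector))" "LN p (cut a b (%_. c)) = norm c * (b - a) powr (1 / p)"
proof -
 have eq: "(%t. norm (cut a b (%_. c) t) powr p) = (%t. indicator {a<..<b} t * norm c powr p)"
  using p by (auto simp: cut_def indicator_def)
 have "emeasure lebesgue {a<..<b} = ennreal (b - a)" using ab by simp
 then show "PL p (cut a b (%_. c))"
  unfolding PL_def eq by (auto intro!: SM_continuous integrable_mult_left simp: integrable_indicator_iff)
 have "(\<integral>t. norm (cut a b (%_. c) t) powr p \<partial>lebesgue) = (b - a) * norm c powr p"
  unfolding eq using ab by (simp add: measure_def)
 then show "LN p (cut a b (%_. c)) = norm c * (b - a) powr (1 / p)"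
  using p ab by (simp add: LN_def powr_mult powr_powr)
qed

lemma PL_cut_bounded:
 assumes p: "0 < p" and ab: "a <= b" and sm: "SM (cut a b f)" and K: "!!t. a < t ==> t < b ==> norm (f t) <= K" "0 <= K"
 shows "PL p (cut a b f)" "LN p (cut a b f) <= K * (b - a) powr (1 / p)"
 using PL_bound[OF p sm PL_cut_const(1)[OF p ab, of K], of 1] PL_cut_const(2)[OF p ab, of K] K
 by (auto simp: cut_def)

lemma PL_cut_continuous:
 assumes p: "0 < p" and ab: "a <= b" and c: "continuous_on {a..b} f"
 shows "PL p (cut a b f)"
proof -
 have "bounded (f ` {a..b})" using c by (intro compact_imp_bounded compact_continuous_image) auto
 then obtain K where "\<forall>x\<in>f ` {a..b}. norm x <= K" by (auto simp: bounded_iff)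
 then have K: "!!t. t \<in> {a..b} ==> norm (f t) <= K" by auto
 have "0 <= K" using K[of a] ab order_trans[OF norm_ge_zero[of "f a"]] by auto
 then show ?thesis
  using K by (intro PL_cut_bounded[of p a b f K] p ab SM_continuous continuous_on_subset[OF c]) auto
qed

text \<open>Instead of Hoelder's inequality the pointwise bound
  \<open>x <= alpha + alpha powr (1 - p) * x powr p\<close> is integrated, with \<open>alpha\<close>
  just above the norm. The factor \<open>b - a + 1\<close> is not sharp.\<close>

lemma PL_cut_one:
 assumes p: "1 <= p" and ab: "a <= b" and f: "PL p (cut a b f)"
 shows "PL 1 (cut a b f)" "LN 1 (cut a b f) <= (b - a + 1) * LN p (cut a b f)"
proof -
 have p0: "0 < p" using p by simp
 have *: "PL 1 (cut a b f) & LN 1 (cut a b f) <= (b - a + 1) * alpha" if alpha: "LN p (cut a b f) <= alpha" "0 < alpha" for alpha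
 proof -
  have le: "x <= alpha + alpha powr (1 - p) * x powr p" if "0 <= x" for x
  proof (cases "x <= alpha")
   case True then show ?thesis by (simp add: add_increasing2)
  next
   case False
   then have "alpha powr (p - 1) <= x powr (p - 1)" using alpha p by (intro powr_mono2) auto
   then have "1 <= alpha powr (1 - p) * x powr (p - 1)"
    using alpha mult_left_mono[of "alpha powr (p - 1)" "x powr (p - 1)" "alpha powr (1 - p)"]
    by (simp add: powr_add[symmetric])
   then have "x * 1 <= x * (alpha powr (1 - p) * x powr (p - 1))" using that by (intro mult_left_mono)
   also have "... = alpha powr (1 - p) * x powr p" using False alpha by (simp add: powr_diff)
   finally show ?thesis using alpha by simp
  qed
  have "(\<integral>\<^sup>+t. ennreal (norm (cut a b f t) powr 1) \<partial>lebesgue)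
   <= (\<integral>\<^sup>+t. ennreal alpha * indicator {a..b} t + ennreal (alpha powr (1 - p)) * ennreal (norm (cut a b f t) powr p) \<partial>lebesgue)"
  proof (rule nn_integral_mono)
   fix t
   show "ennreal (norm (cut a b f t) powr 1) <= ennreal alpha * indicator {a..b} t + ennreal (alpha powr (1 - p)) * ennreal (norm (cut a b f t) powr p)"
   proof (cases "a < t & t < b")
    case True
    then show ?thesis using le[of "norm (cut a b f t)"] alpha
     by (simp add: ennreal_mult[symmetric] ennreal_plus[symmetric] del: ennreal_plus)
   qed (auto simp: cut_def)
  qed
  also have "... = (\<integral>\<^sup>+t. ennreal alpha * indicator {a..b} t \<partial>lebesgue) + (\<integral>\<^sup>+t. ennreal (alpha powr (1 - p)) * ennreal (norm (cut a b f t) powr p) \<partial>lebesgue)"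
   by (intro nn_integral_add borel_measurable_times_ennreal borel_measurable_indicator SM_powr PL_SM[OF f] measurable_const) auto
  also have "... = ennreal alpha * (\<integral>\<^sup>+t. indicator {a..b} t \<partial>lebesgue) + ennreal (alpha powr (1 - p)) * (\<integral>\<^sup>+t. ennreal (norm (cut a b f t) powr p) \<partial>lebesgue)"
   by (intro arg_cong2[where f = "(+)"] nn_integral_cmult borel_measurable_indicator SM_powr PL_SM[OF f]) auto
  also have "... <= ennreal alpha * ennreal (b - a) + ennreal (alpha powr (1 - p)) * ennreal (alpha powr p)"
   using PL_iff[OF p0, of alpha "cut a b f"] alpha f ab
   by (intro add_mono mult_left_mono) auto
  also have "... = ennreal ((b - a + 1) * alpha)"
   using alpha ab by (simp add: ennreal_mult[symmetric] ennreal_plus[symmetric] powr_add[symmetric] algebra_simps del: ennreal_plus)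
  also have "(b - a + 1) * alpha = ((b - a + 1) * alpha) powr 1" using alpha ab by simp
  finally show ?thesis using PL_iff[of 1 "(b - a + 1) * alpha" "cut a b f"] alpha ab PL_SM[OF f] by auto
 qed
 show "PL 1 (cut a b f)" using *[of "LN p (cut a b f) + 1"] by (simp add: add_nonneg_pos)
 show "LN 1 (cut a b f) <= (b - a + 1) * LN p (cut a b f)"
 proof (rule field_le_epsilon)
  fix e :: real assume "0 < e"
  then have "LN 1 (cut a b f) <= (b - a + 1) * (LN p (cut a b f) + e / (b - a + 1))"
   using *[of "LN p (cut a b f) + e / (b - a + 1)"] ab by (simp add: add_nonneg_pos)
  also have "... = (b - a + 1) * LN p (cut a b f) + e" using ab by (simp add: distrib_left)
  finally show "LN 1 (cut a b f) <= (b - a + 1) * LN p (cut a b f) + e" .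
 qed
qed

section \<open>Integration of strongly measurable functions\<close>

text \<open>Riemann sums of \<open>f\<close> and \<open>g\<close> differ by at most the Riemann sum
  of \<open>k\<close>, which is close to its small integral; so the Cauchy criterion passes from
  \<open>g\<close> to \<open>f\<close>.\<close>

lemma integrable_by_approx:
 fixes f :: "real => 'x::banach"
 assumes appr: "!!e. e > 0 ==> EX g k. g integrable_on cbox a b & k integrable_on cbox a b &
   (ALL x. norm (f x - g x) <= k x) & integral (cbox a b) k < (e::real)"
 shows "f integrable_on cbox a b"
 unfolding integrable_Cauchy
proof (intro allI impI)
 fix e :: real assume e: "0 < e"
 then obtain g k where g: "g integrable_on cbox a b" and k: "k integrable_on cbox a b"
  and le: "!!x. norm (f x - g x) <= k x" and ik: "integral (cbox a b) k < e / 8"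
  using appr[of "e / 8"] by auto
 obtain gamma1 where gamma1: "gauge gamma1" "!!D1 D2. D1 tagged_division_of cbox a b ==> gamma1 fine D1 ==>
   D2 tagged_division_of cbox a b ==> gamma1 fine D2 ==>
   norm ((\<Sum>(x,K)\<in>D1. measure lborel K *\<^sub>R g x) - (\<Sum>(x,K)\<in>D2. measure lborel K *\<^sub>R g x)) < e / 4"
  using g e unfolding integrable_Cauchy by (meson divide_pos_pos zero_less_numeral)
 have "(k has_integral integral (cbox a b) k) (cbox a b)" using k by (rule integrable_integral)
 then obtain gamma2 where gamma2: "gauge gamma2" "!!D. D tagged_division_of cbox a b ==> gamma2 fine D ==>
   norm ((\<Sum>(x,K)\<in>D. measure lborel K *\<^sub>R k x) - integral (cbox a b) k) < e / 8"
  using e unfolding has_integral by (meson divide_pos_pos zero_less_numeral)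
 have close: "norm ((\<Sum>(x,K)\<in>D. measure lborel K *\<^sub>R f x) - (\<Sum>(x,K)\<in>D. measure lborel K *\<^sub>R g x)) < e / 4"
  if D: "D tagged_division_of cbox a b" "gamma2 fine D" for D
 proof -
  have "(\<Sum>(x,K)\<in>D. measure lborel K *\<^sub>R f x) - (\<Sum>(x,K)\<in>D. measure lborel K *\<^sub>R g x) = (\<Sum>(x,K)\<in>D. measure lborel K *\<^sub>R (f x - g x))"
   by (simp add: sum_subtractf[symmetric] case_prod_unfold scaleR_diff_right)
  also have "norm ... <= (\<Sum>(x,K)\<in>D. measure lborel K *\<^sub>R k x)"
   by (rule sum_norm_le) (auto intro!: mult_left_mono le simp: case_prod_unfold)
  also have "... < e / 4" using gamma2(2)[OF D] ik by (auto simp: abs_if split: if_splits)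
  finally show ?thesis .
 qed
 show "\<exists>gamma. gauge gamma & (ALL D1 D2. D1 tagged_division_of cbox a b & gamma fine D1 & D2 tagged_division_of cbox a b & gamma fine D2 -->
   norm ((\<Sum>(x,K)\<in>D1. measure lborel K *\<^sub>R f x) - (\<Sum>(x,K)\<in>D2. measure lborel K *\<^sub>R f x)) < e)"
 proof (intro exI conjI allI impI)
  show "gauge (%x. gamma1 x \<inter> gamma2 x)" using gamma1 gamma2 by (auto intro: gauge_Int)
  fix D1 D2
  assume "D1 tagged_division_of cbox a b & (%x. gamma1 x \<inter> gamma2 x) fine D1 & D2 tagged_division_of cbox a b & (%x. gamma1 x \<inter> gamma2 x) fine D2"
  then have D: "D1 tagged_division_of cbox a b" "gamma1 fine D1" "gamma2 fine D1"
   "D2 tagged_division_of cbox a b" "gamma1 fine D2" "gamma2 fine D2" by (auto simp: fine_Int)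
  have "norm (x - y) <= norm (x - x') + norm (x' - y') + norm (y - y')" for x y x' y' :: 'x
   using norm_triangle_ineq4[of "x - y'" "y - y'"] norm_triangle_ineq[of "x - x'" "x' - y'"] by simp
  from this[of "\<Sum>(x,K)\<in>D1. measure lborel K *\<^sub>R f x" "\<Sum>(x,K)\<in>D2. measure lborel K *\<^sub>R f x" "\<Sum>(x,K)\<in>D1. measure lborel K *\<^sub>R g x" "\<Sum>(x,K)\<in>D2. measure lborel K *\<^sub>R g x"]
  show "norm ((\<Sum>(x,K)\<in>D1. measure lborel K *\<^sub>R f x) - (\<Sum>(x,K)\<in>D2. measure lborel K *\<^sub>R f x)) < e"
   using close[OF D(1,3)] close[OF D(4,6)] gamma1(2)[OF D(1,2,4,5)] e by linarith
 qed
qed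

lemma simple_integrable:
 fixes s :: "real => 'x::banach"
 assumes s: "simple_function lebesgue s"
 shows "s integrable_on {a..b}"
proof -
 have eq: "s = (%x. \<Sum>y\<in>range s. indicator (s -` {y}) x *\<^sub>R y)"
 proof
  fix x
  have "(\<Sum>y\<in>range s. indicator (s -` {y}) x *\<^sub>R y) = (\<Sum>y\<in>{s x}. indicator (s -` {y}) x *\<^sub>R y)"
   using s by (intro sum.mono_neutral_right) (auto simp: simple_function_def indicator_def)
  then show "s x = (\<Sum>y\<in>range s. indicator (s -` {y}) x *\<^sub>R y)" by simp
 qed
 have "(%x. indicator (s -` {y}) x *\<^sub>R y) integrable_on {a..b}" if "y \<in> range s" for y
 proof -
  have "s -` {y} \<in> sets lebesgue" using simple_functionD(2)[OF s, of "{y}"] by simp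
  then have "s -` {y} \<inter> {a..b} \<in> lmeasurable"
   by (intro bounded_set_imp_lmeasurable) (auto intro: bounded_subset[of "{a..b}"])
  then have "(indicator (s -` {y}) :: real => real) integrable_on {a..b}"
   by (simp add: integrable_on_indicator)
  then show ?thesis by (auto simp: integrable_on_def intro: has_integral_scaleR_left)
 qed
 then have "(%x. \<Sum>y\<in>range s. indicator (s -` {y}) x *\<^sub>R y) integrable_on {a..b}"
  using s by (intro integrable_sum) (auto simp: simple_function_def)
 then show ?thesis using eq by simp
qed

lemma lebesgue_HK:
 fixes h :: "real => real"
 assumes h: "integrable lebesgue h" and 0: "!!t. 0 <= h t"
 shows "h integrable_on {a..b}" "integral {a..b} h <= (\<integral>t. h t \<partial>lebesgue)"
proof -
 have I: "(h has_integral (\<integral>t. h t \<partial>lebesgue)) UNIV" using h by (rule has_integral_integral_lebesgue)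
 then show i: "h integrable_on {a..b}"
  using integrable_on_subcbox[of h UNIV a b] by (auto simp: integrable_on_def)
 show "integral {a..b} h <= (\<integral>t. h t \<partial>lebesgue)"
  using integral_subset_le[of "{a..b}" UNIV h] i I 0 by (auto simp: integral_unique integrable_on_def)
qed

text \<open>Links the two integration theories: simple functions approximate a strongly measurable
  function with integrable norm in mean, and \<open>integrable_by_approx\<close> turns this into
  Henstock-Kurzweil integrability in an arbitrary Banach space.\<close>

lemma PL1_integrable:
 fixes f :: "real => 'x::banach"
 assumes f: "PL 1 (cut a b f)"
 shows "f integrable_on {a..b}"
proof -
 define F where "F = cut a b f"
 have sm: "SM F" and iF: "integrable lebesgue (%t. norm (F t))" using f by (auto simp: PL_def F_def)
 have [measurable]: "(%t. norm (F t)) \<in> borel_measurable lebesgue" using sm by (rule SM_norm)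
 obtain s where s: "!!n::nat. simple_function lebesgue (s n)" "AE t in lebesgue. (%n. s n t) \<longlonglongrightarrow> F t"
  using sm unfolding SM_def strongly_measurable_def by auto
 have [measurable]: "(%t. norm (s n t)) \<in> borel_measurable lebesgue" for n
  using simple_function_compose1[OF s(1)] by (rule borel_measurable_simple_function)
 \<comment> \<open>The cutoff at twice the norm of the limit is eventually inactive where the limit
   is nonzero, and it supplies the integrable majorant \<open>3 * norm (F t)\<close> of the
   differences.\<close>
 define r where "r n t = (if norm (s n t) <= 2 * norm (F t) then s n t else 0)" for n t
 have rs: "simple_function lebesgue (r n)" for n
  unfolding r_def[abs_def]
 proof (rule simple_function_If)
  show "{t \<in> space lebesgue. norm (s n t) <= 2 * norm (F t)} \<in> sets lebesgue" by measurable
 qed (use s(1) in auto)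
 have rlim: "AE t in lebesgue. (%n. r n t) \<longlonglongrightarrow> F t"
  using s(2)
 proof eventually_elim
  fix t assume t: "(%n. s n t) \<longlonglongrightarrow> F t"
  show "(%n. r n t) \<longlonglongrightarrow> F t"
  proof (cases "F t = 0")
   case True
   then have "r n t = 0" for n by (auto simp: r_def)
   with True show ?thesis by simp
  next
   case False
   have "(%n. norm (s n t)) \<longlonglongrightarrow> norm (F t)" using t by (rule tendsto_norm)
   then have "\<forall>\<^sub>F n in sequentially. norm (s n t) < 2 * norm (F t)"
    using False by (intro order_tendstoD) auto
   then have "\<forall>\<^sub>F n in sequentially. s n t = r n t" by eventually_elim (simp add: r_def)
   then show ?thesis using t by (rule Lim_transform_eventually[rotated])
  qed
 qed
 have smr: "SM (%t. F t - r n t)" for n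
 proof (rule SM_diff[OF sm])
  show "SM (r n)" unfolding SM_def strongly_measurable_def
   by (intro exI[of _ "%_. r n"]) (auto simp: rs)
 qed
 have bnd: "norm (F t - r n t) <= 3 * norm (F t)" for n t
  using norm_triangle_ineq4[of "F t" "r n t"] by (auto simp: r_def split: if_splits)
 have ir: "integrable lebesgue (%t. norm (F t - r n t))" for n
 proof (rule Bochner_Integration.integrable_bound)
  show "integrable lebesgue (%t. 3 * norm (F t))" using iF by (rule integrable_mult_right)
  show "(%t. norm (F t - r n t)) \<in> borel_measurable lebesgue" by (rule SM_norm[OF smr])
  show "AE t in lebesgue. norm (norm (F t - r n t)) <= norm (3 * norm (F t))"
   by (intro always_eventually allI) (simp add: bnd)
 qed
 have "(%n. \<integral>t. norm (F t - r n t) \<partial>lebesgue) \<longlonglongrightarrow> (\<integral>t. 0 \<partial>(lebesgue :: real measure))"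
 proof (rule Bochner_Integration.integral_dominated_convergence[where w = "%t. 3 * norm (F t)"])
  show "integrable lebesgue (%t. 3 * norm (F t))" using iF by simp
  show "AE t in lebesgue. (%n. norm (F t - r n t)) \<longlonglongrightarrow> 0"
   using rlim
  proof eventually_elim
   fix t assume "(%n. r n t) \<longlonglongrightarrow> F t"
   then have "(%n. norm (F t - r n t)) \<longlonglongrightarrow> norm (F t - F t)" by (intro tendsto_intros)
   then show "(%n. norm (F t - r n t)) \<longlonglongrightarrow> 0" by simp
  qed
  show "AE t in lebesgue. norm (norm (F t - r n t)) <= 3 * norm (F t)" for n
   by (intro always_eventually allI) (simp add: bnd)
  show "(%t. norm (F t - r n t)) \<in> borel_measurable lebesgue" for n by (rule SM_norm[OF smr])
 qed simp
 then have lim: "(%n. \<integral>t. norm (F t - r n t) \<partial>lebesgue) \<longlonglongrightarrow> 0" by simp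
 have "F integrable_on cbox a b"
 proof (rule integrable_by_approx)
  fix e :: real assume "e > 0"
  with lim have "\<forall>\<^sub>F n in sequentially. (\<integral>t. norm (F t - r n t) \<partial>lebesgue) < e" by (intro order_tendstoD)
  then obtain n where n: "(\<integral>t. norm (F t - r n t) \<partial>lebesgue) < e" by (auto simp: eventually_sequentially)
  show "EX g k. g integrable_on cbox a b & k integrable_on cbox a b & (ALL x. norm (F x - g x) <= k x) & integral (cbox a b) k < e"
   using simple_integrable[OF rs[of n], of a b] lebesgue_HK[OF ir[of n], of a b] n
   by (intro exI[of _ "r n"] exI[of _ "%t. norm (F t - r n t)"]) auto
 qed
 then have "F integrable_on {a..b}" by simp
 then show ?thesis
  using integrable_spike_finite[of "{a, b}" "{a..b}" f F] by (auto simp: F_def cut_def)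
qed

lemma LN_cut_integral:
 fixes f :: "real => 'x::real_normed_vector"
 assumes p: "0 < p" and f: "PL p (cut a b f)"
 shows "(%t. norm (f t) powr p) integrable_on {a..b}"
  "integral {a..b} (%t. norm (f t) powr p) = LN p (cut a b f) powr p"
proof -
 define h where "h = (%t. norm (cut a b f t) powr p)"
 have h: "integrable lebesgue h" using f by (simp add: PL_def h_def)
 have I: "(h has_integral (\<integral>t. h t \<partial>lebesgue)) UNIV" using h by (rule has_integral_integral_lebesgue)
 have "(%t. if t \<in> {a..b} then h t else 0) = h" by (auto simp: h_def cut_def)
 then have "(h has_integral (\<integral>t. h t \<partial>lebesgue)) {a..b}" using I has_integral_restrict_UNIV[of "{a..b}" h] by simp
 moreover have "(\<integral>t. h t \<partial>lebesgue) = LN p (cut a b f) powr p" using LN_powr[OF p, of "cut a b f"] by (simp add: h_def)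
 ultimately have "(h has_integral LN p (cut a b f) powr p) {a..b}" by simp
 then have "((%t. norm (f t) powr p) has_integral LN p (cut a b f) powr p) {a..b}"
  using has_integral_spike_finite[of "{a, b}" "{a..b}" "%t. norm (f t) powr p" h] by (auto simp: h_def cut_def)
 then show "(%t. norm (f t) powr p) integrable_on {a..b}"
  "integral {a..b} (%t. norm (f t) powr p) = LN p (cut a b f) powr p"
  by (auto simp: integrable_on_def integral_unique)
qed

lemma PL_integral_norm:
 fixes f :: "real => 'x::banach"
 assumes p: "1 <= p" and f: "PL p (cut a b f)" and ab: "a <= b"
 shows "f integrable_on {a..b}" "(%t. norm (f t)) integrable_on {a..b}"
  "norm (integral {a..b} f) <= integral {a..b} (%t. norm (f t))"
  "integral {a..b} (%t. norm (f t)) <= (b - a + 1) * LN p (cut a b f)"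
proof -
 note P1 = PL_cut_one[OF p ab f]
 show i: "f integrable_on {a..b}" by (rule PL1_integrable[OF P1(1)])
 have n: "(%t. norm (f t)) integrable_on {a..b}" "integral {a..b} (%t. norm (f t)) = LN 1 (cut a b f)"
  using LN_cut_integral[of 1 a b f] P1(1) by auto
 show "(%t. norm (f t)) integrable_on {a..b}" by (rule n)
 show "norm (integral {a..b} f) <= integral {a..b} (%t. norm (f t))"
  by (rule integral_norm_bound_integral[OF i n(1)]) simp
 show "integral {a..b} (%t. norm (f t)) <= (b - a + 1) * LN p (cut a b f)" using n(2) P1(2) by simp
qed

text \<open>Uniform continuity of the primitive of the p-th power of the norm. It drives the
  continuity of traces and the uniqueness of solutions.\<close>

lemma PL_uniform_small:
 fixes f :: "real => 'x::real_normed_vector"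
 assumes p: "0 < p" and f: "PL p (cut a b f)" and e: "0 < e"
 shows "\<exists>d>0. ALL s t. a <= s --> s <= t --> t <= b --> t - s < d --> LN p (cut s t f) < e"
proof -
 define H where "H t = integral {a..t} (%t. norm (f t) powr p)" for t
 note L = LN_cut_integral[OF p f]
 have "continuous_on {a..b} H" unfolding H_def[abs_def] by (rule indefinite_integral_continuous_1[OF L(1)])
 then have "uniformly_continuous_on {a..b} H" by (intro compact_uniformly_continuous) auto
 moreover have ep: "0 < e powr p" using e by simp
 ultimately obtain d where d: "d > 0" "!!s t. s \<in> {a..b} ==> t \<in> {a..b} ==> dist t s < d ==> dist (H t) (H s) < e powr p"
  unfolding uniformly_continuous_on_def by blast
 have "LN p (cut s t f) < e" if st: "a <= s" "s <= t" "t <= b" "t - s < d" for s t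
 proof -
  have "LN p (cut s t f) powr p = integral {s..t} (%t. norm (f t) powr p)"
   using LN_cut_integral(2)[OF p PL_cut_sub(1)[OF p f st(1,3)]] by simp
  also have "... = H t - H s"
   using Henstock_Kurzweil_Integration.integral_combine[of a s t "%t. norm (f t) powr p"] integrable_subinterval_real[OF L(1), of a t] st
   by (simp add: H_def)
  also have "... < e powr p" using d(2)[of s t] st by (auto simp: dist_real_def)
  finally show ?thesis using powr_mono2[of p e "LN p (cut s t f)"] e p by force
 qed
 with d(1) show ?thesis by blast
qed

lemma PL_cut_join:
 assumes p: "1 <= p" and abc: "a <= b" "b <= c" and f: "PL p (cut a b f)" "PL p (cut b c f)"
 shows "PL p (cut a c f)" "LN p (cut a c f) <= LN p (cut a b f) + LN p (cut b c f)"
proof -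
 have p0: "0 < p" using p by simp
 have "AE t in lebesgue. t ~= b" using AE_completion[OF AE_lborel_singleton[of b]] by simp
 then have "AE t in lebesgue. cut a b f t + cut b c f t = cut a c f t"
  by eventually_elim (use abc in \<open>auto simp: cut_def\<close>)
 from PL_AE_cong[OF p0 PL_add(1)[OF p f] this] PL_add(2)[OF p f]
 show "PL p (cut a c f)" "LN p (cut a c f) <= LN p (cut a b f) + LN p (cut b c f)" by auto
qed

lemma PL_cut_shift:
 assumes p: "0 < p"
 shows "PL p (cut s t (%r. f (c + r))) \<longleftrightarrow> PL p (cut (s + c) (t + c) f)"
  "PL p (cut (s + c) (t + c) f) ==> LN p (cut s t (%r. f (c + r))) = LN p (cut (s + c) (t + c) f)"
proof -
 have eq: "cut s t (%r. f (c + r)) = (%r. cut (s + c) (t + c) f (c + 1 * r))" by (auto simp: cut_def)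
 have eq': "cut (s + c) (t + c) f = (%r. cut s t (%r. f (c + r)) (- c + 1 * r))" by (auto simp: cut_def)
 show "PL p (cut s t (%r. f (c + r))) \<longleftrightarrow> PL p (cut (s + c) (t + c) f)"
  using PL_affine(1)[OF p, of "cut s t (%r. f (c + r))" 1 "- c"] PL_affine(1)[OF p, of "cut (s + c) (t + c) f" 1 c]
  unfolding eq[symmetric] eq'[symmetric] by auto
 show "PL p (cut (s + c) (t + c) f) ==> LN p (cut s t (%r. f (c + r))) = LN p (cut (s + c) (t + c) f)"
  unfolding eq by (intro PL_affine(2) p) auto
qed

lemma cut_cong_AE:
 "AE t in lebesgue. a < t & t < b --> f t = g t ==> AE t in lebesgue. cut a b f t = cut a b g t"
 by (erule eventually_mono) (auto simp: cut_def)

text \<open>Simple functions are extended by zero in one direction and restricted in the other;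
  afterwards only functions on the whole line occur.\<close>

lemma Lp_PL: "Lp p a f \<longleftrightarrow> PL0 p a f"
proof -
 have S: "{0<..<a} \<in> sets (lebesgue :: real measure)" by simp
 have sm: "strongly_measurable (lebesgue_on {0<..<a}) f \<longleftrightarrow> SM (cut 0 a f)"
 proof
  assume "strongly_measurable (lebesgue_on {0<..<a}) f"
  then obtain s where s: "!!n::nat. simple_function (lebesgue_on {0<..<a}) (s n)"
   and lim: "AE t in lebesgue_on {0<..<a}. (%n. s n t) \<longlonglongrightarrow> f t"
   unfolding strongly_measurable_def by auto
  have "simple_function lebesgue (cut 0 a (s n))" for n
   unfolding simple_function_def
  proof (intro conjI ballI)
   have "cut 0 a (s n) ` space lebesgue \<subseteq> insert 0 (s n ` {0<..<a})"
   proof (rule image_subsetI)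
    fix y show "cut 0 a (s n) y \<in> insert 0 (s n ` {0<..<a})" by (cases "0 < y & y < a") (auto simp: cut_def)
   qed
   then show "finite (cut 0 a (s n) ` space lebesgue)"
    using s[of n] by (auto simp: simple_function_def dest: finite_subset)
   fix x
   have "s n -` {x} \<inter> {0<..<a} \<in> sets (lebesgue_on {0<..<a})"
    using simple_functionD(2)[OF s[of n], of "{x}"] by simp
   then have 1: "s n -` {x} \<inter> {0<..<a} \<in> sets lebesgue" using S by (auto simp: sets_restrict_space_iff)
   have "cut 0 a (s n) -` {x} = s n -` {x} \<inter> {0<..<a} \<union> (if x = 0 then - {0<..<a} else {})"
   proof (rule set_eqI)
    fix y
    show "y \<in> cut 0 a (s n) -` {x} \<longleftrightarrow> y \<in> s n -` {x} \<inter> {0<..<a} \<union> (if x = 0 then - {0<..<a} else {})"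
     by (cases "0 < y & y < a") (auto simp: cut_def)
   qed
   also have "... \<in> sets lebesgue" using 1 S by (auto intro: sets.Un simp: sets.compl_sets[of _ lebesgue, simplified])
   finally show "cut 0 a (s n) -` {x} \<inter> space lebesgue \<in> sets lebesgue" by simp
  qed
  moreover have "AE t in lebesgue. (%n. cut 0 a (s n) t) \<longlonglongrightarrow> cut 0 a f t"
   using lim by (subst (asm) AE_restrict_space_iff) (auto simp: cut_def elim!: eventually_mono)
  ultimately show "SM (cut 0 a f)"
   unfolding SM_def strongly_measurable_def by (intro exI[of _ "%n. cut 0 a (s n)"] conjI allI)
 next
  assume "SM (cut 0 a f)"
  then obtain s where s: "!!n::nat. simple_function lebesgue (s n)"
   and lim: "AE t in lebesgue. (%n. s n t) \<longlonglongrightarrow> cut 0 a f t"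
   unfolding SM_def strongly_measurable_def by auto
  have "simple_function (lebesgue_on {0<..<a}) (s n)" for n
   unfolding simple_function_def
  proof (intro conjI ballI)
   show "finite (s n ` space (lebesgue_on {0<..<a}))"
    using s[of n] by (auto simp: simple_function_def intro: finite_subset[of _ "range (s n)"])
   fix x
   have "s n -` {x} \<in> sets lebesgue" using simple_functionD(2)[OF s[of n], of "{x}"] by simp
   then show "s n -` {x} \<inter> space (lebesgue_on {0<..<a}) \<in> sets (lebesgue_on {0<..<a})"
    using S by (auto simp: sets_restrict_space_iff)
  qed
  moreover have "AE t in lebesgue_on {0<..<a}. (%n. s n t) \<longlonglongrightarrow> f t"
   using lim by (subst AE_restrict_space_iff) (auto simp: cut_def elim!: eventually_mono)
  ultimately show "strongly_measurable (lebesgue_on {0<..<a}) f"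
   unfolding strongly_measurable_def by (intro exI[of _ s] conjI allI)
 qed
 show ?thesis
 proof (cases "SM (cut 0 a f)")
  case True
  have "integrable (lebesgue_on {0<..<a}) (%t. norm (f t) powr p) \<longleftrightarrow>
    integrable lebesgue (%t. indicator {0<..<a} t *\<^sub>R (norm (f t) powr p))"
   using S by (intro integrable_restrict_space) auto
  also have "(%t. indicator {0<..<a} t *\<^sub>R (norm (f t) powr p)) = (%t. norm (cut 0 a f t) powr p)"
   by (auto simp: cut_def indicator_def)
  finally show ?thesis using True sm by (simp add: Lp_def PL_def)
 qed (use sm in \<open>auto simp: Lp_def PL_def\<close>)
qed

lemma AE_lebesgue_on_iff: "(AE t in lebesgue_on {0<..<a}. P t) \<longleftrightarrow> (AE t in lebesgue. 0 < t & t < a --> P t)" for a :: real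
 by (subst AE_restrict_space_iff) auto

lemma cut_add: "cut a b (%t. f t + g t) = (%t. cut a b f t + cut a b g t)"
 and cut_diff: "cut a b (%t. f t - g t) = (%t. cut a b f t - cut a b g t)"
 and cut_linear: "L 0 = 0 ==> cut a b (%t. L (f t)) = (%t. L (cut a b f t))"
 by (auto simp: cut_def)

section \<open>Vector-valued functions with integrable derivative\<close>

lemma AE_negligible: "(AE t in lebesgue. P t) \<longleftrightarrow> negligible {t :: real. \<not> P t}"
 by (simp add: completion.AE_iff_null_sets negligible_iff_null_sets)

lemma integral_cong_AE_lebesgue:
 fixes f g :: "real => 'x::banach"
 assumes "AE t in lebesgue. a < t & t < b --> f t = g t"
 shows "integral {a..b} f = integral {a..b} g" "f integrable_on {a..b} \<longleftrightarrow> g integrable_on {a..b}"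
proof -
 define S where "S = {t. \<not> (a < t & t < b --> f t = g t)} \<union> {a, b}"
 have S: "negligible S" unfolding S_def using assms by (intro negligible_Un) (auto simp: AE_negligible)
 show "integral {a..b} f = integral {a..b} g"
  using integral_spike[OF S, of "{a..b}" g f] by (auto simp: S_def)
 show "f integrable_on {a..b} \<longleftrightarrow> g integrable_on {a..b}"
  using has_integral_spike_eq[OF S, of "{a..b}" g f] by (auto simp: S_def integrable_on_def)
qed

text \<open>Subdivision into m equal pieces bounds the total increment by
  \<open>K * (a / m) * (G a - G 0)\<close>: increments of second order add up to zero.\<close>

lemma increments_zero:
 fixes D :: "real => 'x::real_normed_vector"
 assumes a: "0 <= a"
  and D: "!!s t. 0 <= s ==> s <= t ==> t <= a ==> norm (D t - D s) <= K * (t - s) * (G t - G s)"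
 shows "D a = D 0"
proof -
 have bound: "norm (D a - D 0) <= K * a * (G a - G 0) / real (Suc n)" for n
 proof -
  define m where "m = Suc n"
  define x where "x k = a * real k / real m" for k
  have x: "x 0 = 0" "x m = a" by (simp_all add: x_def m_def)
  have xd: "x (Suc k) - x k = a / real m" for k
   by (simp add: x_def diff_divide_distrib[symmetric] right_diff_distrib[symmetric])
  have mon: "0 <= x k" "x k <= x (Suc k)" for k using a by (auto simp: x_def intro!: divide_right_mono mult_left_mono)
  have le: "x (Suc k) <= a" if "k < m" for k
  proof -
   have "a * real (Suc k) <= a * real m" using a that by (intro mult_left_mono) auto
   then show ?thesis using that by (simp add: x_def divide_le_eq)
  qed
  have "D a - D 0 = (\<Sum>k<m. D (x (Suc k)) - D (x k))" using x sum_lessThan_telescope[of "%k. D (x k)" m] by simp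
  also have "norm ... <= (\<Sum>k<m. K * (a / real m) * (G (x (Suc k)) - G (x k)))"
   using D[OF mon le] by (intro sum_norm_le) (auto simp: xd)
  also have "... = K * (a / real m) * (\<Sum>k<m. G (x (Suc k)) - G (x k))"
   by (rule sum_distrib_left[symmetric])
  also have "... = K * (a / real m) * (G a - G 0)"
   using x sum_lessThan_telescope[of "%k. G (x k)" m] by simp
  finally show ?thesis by (simp add: m_def)
 qed
 have "(%n. K * a * (G a - G 0) * inverse (real (Suc n))) \<longlonglongrightarrow> K * a * (G a - G 0) * 0"
  by (intro tendsto_intros LIMSEQ_inverse_real_of_nat)
 then have "norm (D a - D 0) <= 0"
  using bound by (intro LIMSEQ_le_const[of "%n. K * a * (G a - G 0) * inverse (real (Suc n))"]) (auto simp: divide_inverse)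
 then show ?thesis by simp
qed

text \<open>The path \<open>v\<close> is only known to be an integral of \<open>g\<close>, so no
  pointwise derivative is used. The difference \<open>D\<close> of both sides has increments of
  second order, with \<open>G\<close> the primitive of the norm of \<open>g\<close>, and
  \<open>increments_zero\<close> applies.\<close>

lemma product_rule:
 fixes v g :: "real => 'x::banach"
 assumes p: "1 <= p" and a: "0 <= a" and g: "PL0 p a g"
  and v: "!!t. t \<in> {0..a} ==> v t = v 0 + integral {0..t} g"
  and phi: "!!t. t \<in> {0..a} ==> (phi has_real_derivative phi' t) (at t within {0..a})"
  and phi': "continuous_on {0..a} phi'"
 shows "((%r. phi' r *\<^sub>R v r + phi r *\<^sub>R g r) has_integral phi a *\<^sub>R v a - phi 0 *\<^sub>R v 0) {0..a}"
  and "PL0 p a (%r. phi' r *\<^sub>R v r + phi r *\<^sub>R g r)"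
proof -
 have p0: "0 < p" using p by simp
 have gint: "g integrable_on {s..t}" "(%t. norm (g t)) integrable_on {s..t}" "norm (integral {s..t} g) <= integral {s..t} (%t. norm (g t))"
  if "0 <= s" "s <= t" "t <= a" for s t
  using PL_integral_norm[OF p PL_cut_sub(1)[OF p0 g that(1,3)] that(2)] by auto
 have vd: "v t - v s = integral {s..t} g" if "0 <= s" "s <= t" "t <= a" for s t
  using v[of s] v[of t] that Henstock_Kurzweil_Integration.integral_combine[of 0 s t g] gint(1)[of 0 t] by (simp add: algebra_simps)
 have vc: "continuous_on {0..a} v"
 proof (rule continuous_on_eq)
  show "continuous_on {0..a} (%t. v 0 + integral {0..t} g)"
   using a by (intro continuous_intros indefinite_integral_continuous_1 gint(1)) auto
 qed (rule v[symmetric])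
 have phic: "continuous_on {0..a} phi" using phi by (rule DERIV_continuous_on)
 obtain C where C: "!!t. t \<in> {0..a} ==> \<bar>phi' t\<bar> <= C" "0 <= C"
 proof -
  have "bounded (phi' ` {0..a})" using phi' by (intro compact_imp_bounded compact_continuous_image) auto
  then obtain C where "\<forall>x\<in>phi' ` {0..a}. norm x <= C" by (auto simp: bounded_iff)
  then show ?thesis by (intro that[of "max 0 C"]) (auto simp: le_max_iff_disj)
 qed
 have phiL: "\<bar>phi t - phi s\<bar> <= C * (t - s)" if "0 <= s" "s <= t" "t <= a" for s t
 proof -
  have "norm (phi t - phi s) <= C * norm (t - s)"
   using phi C that by (intro field_differentiable_bound[of "{0..a}" phi phi']) auto
  then show ?thesis using that by simp
 qed
 have m: "PL0 p a (%r. phi' r *\<^sub>R v r)" using a by (intro PL_cut_continuous p0 continuous_intros phi' vc)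
 obtain C1 where C1: "!!t. t \<in> {0..a} ==> \<bar>phi t\<bar> <= C1" "0 <= C1"
 proof -
  have "bounded (phi ` {0..a})" using phic by (intro compact_imp_bounded compact_continuous_image) auto
  then obtain C where "\<forall>x\<in>phi ` {0..a}. norm x <= C" by (auto simp: bounded_iff)
  then show ?thesis by (intro that[of "max 0 C"]) (auto simp: le_max_iff_disj)
 qed
 have "cut 0 a (%r. phi r *\<^sub>R g r) = (%r. cut 0 a phi r *\<^sub>R cut 0 a g r)" by (auto simp: cut_def)
 then have "SM (cut 0 a (%r. phi r *\<^sub>R g r))"
  using SM_scaleR[OF SM_continuous[OF continuous_on_subset[OF phic greaterThanLessThan_subseteq_atLeastAtMost_iff[THEN iffD2]]] PL_SM[OF g], of 0 a] by auto
 moreover have "AE t in lebesgue. norm (cut 0 a (%r. phi r *\<^sub>R g r) t) <= C1 * norm (cut 0 a g t)"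
  using C1 by (intro always_eventually allI) (auto simp: cut_def intro!: mult_right_mono)
 ultimately have m': "PL0 p a (%r. phi r *\<^sub>R g r)" using PL_bound[OF p0 _ g C1(2)] by blast
 have "cut 0 a (%r. phi' r *\<^sub>R v r + phi r *\<^sub>R g r) = (%r. cut 0 a (%r. phi' r *\<^sub>R v r) r + cut 0 a (%r. phi r *\<^sub>R g r) r)"
  by (auto simp: cut_def)
 with PL_add(1)[OF p m m'] show PLk: "PL0 p a (%r. phi' r *\<^sub>R v r + phi r *\<^sub>R g r)" by simp
 define k where "k = (%r. phi' r *\<^sub>R v r + phi r *\<^sub>R g r)"
 define D where "D t = phi t *\<^sub>R v t - integral {0..t} k" for t
 define G where "G t = integral {0..t} (%t. norm (g t))" for t
 have kint: "k integrable_on {s..t}" if "0 <= s" "s <= t" "t <= a" for s t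
  using PL_integral_norm(1)[OF p PL_cut_sub(1)[OF p0 PLk that(1,3)] that(2)] by (simp add: k_def)
 have "D a = D 0"
 proof (rule increments_zero[OF a])
  fix s t assume st: "0 <= s" "s <= t" "t <= a"
  have Gst: "G t - G s = integral {s..t} (%t. norm (g t))"
   using Henstock_Kurzweil_Integration.integral_combine[of 0 s t "%t. norm (g t)"] gint(2)[of 0 t] st by (simp add: G_def)
  have gv: "norm (v s - v r) <= G t - G s" if "r \<in> {s..t}" for r
  proof -
   have "norm (v s - v r) = norm (integral {s..r} g)" using vd[of s r] that st by (simp add: norm_minus_commute)
   also have "... <= integral {s..r} (%t. norm (g t))" using gint(3)[of s r] that st by simp
   also have "... <= integral {s..t} (%t. norm (g t))"
    using gint(2)[of s r] gint(2)[of s t] that st by (intro integral_subset_le) auto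
   finally show ?thesis using Gst by simp
  qed
  \<comment> \<open>Freezing \<open>phi\<close> at \<open>t\<close> and \<open>v\<close> at
    \<open>s\<close> makes the increment of the product exact: phi(t) (v(t) - v(s)) + (phi(t) -
    phi(s)) v(s).\<close>
  have I1: "((%r. phi t *\<^sub>R g r) has_integral phi t *\<^sub>R (v t - v s)) {s..t}"
   using integrable_integral[OF gint(1)[OF st]] vd[OF st] by (auto intro: has_integral_cmul)
  have "((%r. phi' r) has_integral phi t - phi s) {s..t}"
   using st by (intro fundamental_theorem_of_calculus) (auto simp: has_real_derivative_iff_has_vector_derivative[symmetric] intro!: DERIV_subset[OF phi])
  then have I2: "((%r. phi' r *\<^sub>R v s) has_integral (phi t - phi s) *\<^sub>R v s) {s..t}" by (rule has_integral_scaleR_left)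
  have "integral {0..t} k - integral {0..s} k = integral {s..t} k"
   using Henstock_Kurzweil_Integration.integral_combine[of 0 s t k] kint[of 0 t] st by (simp add: algebra_simps)
  then have "((k) has_integral (integral {0..t} k - integral {0..s} k)) {s..t}"
   using integrable_integral[OF kint[OF st]] by simp
  from has_integral_diff[OF has_integral_add[OF I1 I2] this]
  have I: "((%r. phi t *\<^sub>R g r + phi' r *\<^sub>R v s - k r) has_integral D t - D s) {s..t}"
   by (simp add: D_def algebra_simps)
  define h where "h = (%r. C * (t - s) * norm (g r) + C * (G t - G s))"
  have hI: "(h has_integral C * (t - s) * (G t - G s) + (t - s) * (C * (G t - G s))) {s..t}"
   unfolding h_def Gst using st integrable_integral[OF gint(2)[OF st]] has_integral_const_real[of "C * integral {s..t} (%t. norm (g t))" s t]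
   by (intro has_integral_add has_integral_mult_right) (auto simp: mult.commute)
  have "norm (phi t *\<^sub>R g r + phi' r *\<^sub>R v s - k r) <= h r" if r: "r \<in> {s..t}" for r
  proof -
   have "phi t *\<^sub>R g r + phi' r *\<^sub>R v s - k r = (phi t - phi r) *\<^sub>R g r + phi' r *\<^sub>R (v s - v r)"
    by (simp add: k_def algebra_simps)
   also have "norm ... <= \<bar>phi t - phi r\<bar> * norm (g r) + \<bar>phi' r\<bar> * norm (v s - v r)"
    using norm_triangle_ineq[of "(phi t - phi r) *\<^sub>R g r" "phi' r *\<^sub>R (v s - v r)"] by simp
   also have "... <= C * (t - s) * norm (g r) + C * (G t - G s)"
    using phiL[of r t] C gv[OF r] r st
    by (intro add_mono mult_mono order_trans[OF phiL[of r t]] mult_left_mono) auto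
   finally show ?thesis by (simp add: h_def)
  qed
  then have "norm (integral {s..t} (%r. phi t *\<^sub>R g r + phi' r *\<^sub>R v s - k r)) <= integral {s..t} h"
   using I hI by (intro integral_norm_bound_integral) (auto simp: integrable_on_def)
  then show "norm (D t - D s) <= (2 * C) * (t - s) * (G t - G s)"
   using integral_unique[OF I] integral_unique[OF hI] by (simp add: algebra_simps)
 qed
 then have "phi a *\<^sub>R v a - phi 0 *\<^sub>R v 0 = integral {0..a} k" by (simp add: D_def algebra_simps)
 then show "((%r. phi' r *\<^sub>R v r + phi r *\<^sub>R g r) has_integral phi a *\<^sub>R v a - phi 0 *\<^sub>R v 0) {0..a}"
  using integrable_integral[OF kint[of 0 a]] a by (simp add: k_def)
qed

lemma half_square_deriv: "((%x::real. (max 0 x)\<^sup>2 / 2) has_real_derivative max 0 x) (at x)"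
proof (cases x "0::real" rule: linorder_cases)
 case less
 have "((%x::real. 0) has_real_derivative max 0 x) (at x)" using less by simp
 then show ?thesis by (rule has_field_derivative_transform_within_open[of _ _ x "{..<0}"]) (use less in auto)
next
 case greater
 have "((%x::real. x\<^sup>2 / 2) has_real_derivative max 0 x) (at x)"
  using greater by (auto intro!: derivative_eq_intros)
 then show ?thesis by (rule has_field_derivative_transform_within_open[of _ _ x "{0<..}"]) (use greater in auto)
next
 case equal
 have "(%h. ((max 0 (0 + h))\<^sup>2 / 2 - (max 0 0)\<^sup>2 / 2) / h) \<midarrow>0\<rightarrow> (0::real)"
 proof (rule Lim_null_comparison)
  show "\<forall>\<^sub>F h in at 0. norm (((max 0 (0 + h))\<^sup>2 / 2 - (max 0 0)\<^sup>2 / 2) / h) <= \<bar>h::real\<bar>"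
  proof (intro always_eventually allI)
   fix h :: real
   show "norm (((max 0 (0 + h))\<^sup>2 / 2 - (max 0 0)\<^sup>2 / 2) / h) <= \<bar>h\<bar>"
    by (cases "0 < h") (auto simp: power2_eq_square max_def)
  qed
  show "(%h::real. \<bar>h\<bar>) \<midarrow>0\<rightarrow> 0" by (intro tendsto_eq_intros) auto
 qed
 then show ?thesis using equal by (simp add: DERIV_def)
qed

text \<open>The second difference of half the squared positive part is a step of class C^1 whose
  derivative is the hat function on [-1,1]. It supplies the test functions here and the cutoff in
  the lemma \<open>extension\<close>.\<close>

lemma smooth_step_exists:
 obtains Theta theta :: "real => real"
 where "!!x. (Theta has_real_derivative theta x) (at x)" "continuous_on UNIV theta" "!!x. 0 <= theta x"
  "!!x. x <= -1 ==> Theta x = 0" "!!x. 1 <= x ==> Theta x = 1" "!!x. 1 <= \<bar>x\<bar> ==> theta x = 0"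
proof -
 define q where "q x = (max 0 x)\<^sup>2 / 2" for x :: real
 define Theta where "Theta x = q (x + 1) - 2 * q x + q (x - 1)" for x :: real
 define theta where "theta x = max 0 (x + 1) - 2 * max 0 x + max 0 (x - 1)" for x :: real
 have q: "((%x. q (x + c)) has_real_derivative max 0 (x + c)) (at x)" for x c
  using DERIV_chain2[OF half_square_deriv DERIV_add[OF DERIV_ident DERIV_const[of c]], of x UNIV] by (simp add: q_def[abs_def])
 show ?thesis
 proof (rule that[of Theta theta])
  show "(Theta has_real_derivative theta x) (at x)" for x
   unfolding Theta_def[abs_def] theta_def using q[of 1 x] q[of 0 x] q[of "-1" x]
   by (auto intro!: derivative_eq_intros)
  show "continuous_on UNIV theta" unfolding theta_def[abs_def] by (intro continuous_intros)
  show "1 <= x ==> Theta x = 1" for x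
   by (simp add: Theta_def q_def max_def field_simps power2_eq_square)
 qed (auto simp: Theta_def theta_def q_def max_def)
qed

text \<open>The lemma of du Bois-Reymond. The difference of two rescaled hat functions, centred at
  \<open>s\<close> and \<open>t\<close>, is the derivative of a test function; so the averages of
  \<open>k\<close> around the two points agree, and shrinking the hats gives
  \<open>k s = k t\<close>.\<close>

lemma test_function_orthogonal_const:
 fixes k :: "real => 'x::banach"
 assumes a: "0 < a" and k: "continuous_on {0..a} k"
  and orth: "!!phi phi'. test_function a phi phi' ==> integral {0..a} (%t. phi' t *\<^sub>R k t) = 0"
  and t: "t \<in> {0..a}"
 shows "k t = k 0"
proof -
 obtain Theta theta :: "real => real" where T: "!!x. (Theta has_real_derivative theta x) (at x)" "continuous_on UNIV theta" "!!x. 0 <= theta x"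
  "!!x. x <= -1 ==> Theta x = 0" "!!x. 1 <= x ==> Theta x = 1" "!!x. 1 <= \<bar>x\<bar> ==> theta x = 0"
  by (rule smooth_step_exists) blast
 have TD: "((%r. Theta ((r - s) / e)) has_real_derivative theta ((r - s) / e) / e) (at r)" if "e ~= 0" for r s e
 proof -
  have "((%r. (r - s) / e) has_real_derivative 1 / e) (at r)" using that by (auto intro!: derivative_eq_intros)
  from DERIV_chain2[OF T(1) this] show ?thesis by simp
 qed
 have Tc: "continuous_on S (%r. theta ((r - s) / e) / e)" if "e ~= 0" for S s e
  using that by (intro continuous_intros continuous_on_compose2[OF T(2)]) auto
 \<comment> \<open>A rescaled hat with support in [0,a] has integral 1 and averages \<open>k\<close>
   over the points within distance \<open>e\<close> of \<open>s\<close>.\<close>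
 have avg: "norm (integral {0..a} (%r. (theta ((r - s) / e) / e) *\<^sub>R k r) - k s) <= eta"
  if e: "0 < e" "e <= s" "s + e <= a" and eta: "!!r. r \<in> {0..a} ==> \<bar>r - s\<bar> <= e ==> norm (k r - k s) <= eta" for s e eta
 proof -
  define tau where "tau r = theta ((r - s) / e) / e" for r
  have tau1: "(tau has_integral 1) {0..a}"
  proof -
   have "(tau has_integral (Theta ((a - s) / e) - Theta ((0 - s) / e))) {0..a}"
    unfolding tau_def using a e TD
    by (intro fundamental_theorem_of_calculus) (auto simp: has_real_derivative_iff_has_vector_derivative[symmetric] intro!: has_field_derivative_at_within TD)
   moreover have "Theta ((a - s) / e) = 1" "Theta ((0 - s) / e) = 0" using e by (auto intro!: T(4,5) simp: field_simps)
   ultimately show ?thesis by simp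
  qed
  have tauc: "continuous_on {0..a} tau" unfolding tau_def[abs_def] using e by (intro Tc) auto
  have i1: "(%r. tau r *\<^sub>R k r) integrable_on {0..a}" by (intro integrable_continuous_real continuous_intros tauc k)
  have i2: "((%r. tau r *\<^sub>R k s) has_integral 1 *\<^sub>R k s) {0..a}" by (rule has_integral_scaleR_left[OF tau1])
  have "integral {0..a} (%r. tau r *\<^sub>R k r) - k s = integral {0..a} (%r. tau r *\<^sub>R k r - tau r *\<^sub>R k s)"
   using i1 i2 by (subst integral_diff) (auto simp: integrable_on_def integral_unique)
  also have "norm ... <= integral {0..a} (%r. tau r * eta)"
  proof (rule integral_norm_bound_integral)
   show "(%r. tau r *\<^sub>R k r - tau r *\<^sub>R k s) integrable_on {0..a}"
    by (intro integrable_continuous_real continuous_intros tauc k)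
   show "(%r. tau r * eta) integrable_on {0..a}" by (intro integrable_continuous_real continuous_intros tauc)
   fix r assume r: "r \<in> {0..a}"
   have "norm (tau r *\<^sub>R k r - tau r *\<^sub>R k s) = tau r * norm (k r - k s)"
    using T(3)[of "(r - s) / e"] e by (simp add: tau_def scaleR_diff_right[symmetric])
   also have "... <= tau r * eta"
   proof (cases "\<bar>r - s\<bar> <= e")
    case True
    then show ?thesis using eta[OF r] T(3)[of "(r - s) / e"] e by (intro mult_left_mono) (auto simp: tau_def)
   next
    case False
    then have "1 <= \<bar>(r - s) / e\<bar>" using e by (simp add: abs_divide le_divide_eq)
    then have "theta ((r - s) / e) = 0" by (rule T(6))
    then show ?thesis by (simp add: tau_def)
   qed
   finally show "norm (tau r *\<^sub>R k r - tau r *\<^sub>R k s) <= tau r * eta" .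
  qed
  also have "... = eta" using integral_unique[OF has_integral_mult_left[OF tau1, of eta]] by simp
  finally show ?thesis by (simp add: tau_def)
 qed
 have eq: "k s = k t" if st: "0 < s" "s < t" "t < a" for s t
 proof -
  have "norm (k s - k t) <= 0 + eta" if eta: "0 < eta" for eta
  proof -
   have "\<exists>d>0. \<forall>r\<in>{0..a}. \<bar>r - x\<bar> <= d --> norm (k r - k x) <= eta / 2" if x: "x \<in> {0..a}" for x
   proof -
    obtain d where "d > 0" "\<forall>r\<in>{0..a}. dist r x < d --> dist (k r) (k x) < eta / 2"
     using k x eta unfolding continuous_on_iff by (metis half_gt_zero)
    then show ?thesis by (intro exI[of _ "d / 2"]) (auto simp: dist_real_def dist_norm less_imp_le)
   qed
   from this[of s] this[of t] st obtain d1 d2 where d: "d1 > 0" "d2 > 0"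
    "!!r. r \<in> {0..a} ==> \<bar>r - s\<bar> <= d1 ==> norm (k r - k s) <= eta / 2"
    "!!r. r \<in> {0..a} ==> \<bar>r - t\<bar> <= d2 ==> norm (k r - k t) <= eta / 2" by fastforce
   \<comment> \<open>The first two entries control the oscillation of \<open>k\<close>; the last
     three separate the flanks of the plateau from each other and from 0 and
     \<open>a\<close>.\<close>
   define E where "E = {d1, d2, s / 2, (t - s) / 2, (a - t) / 2}"
   define e where "e = Min E"
   have "0 < e" unfolding e_def using d(1,2) st by (subst Min_gr_iff) (auto simp: E_def)
   moreover have "e <= d1" "e <= d2" "e <= s / 2" "e <= (t - s) / 2" "e <= (a - t) / 2"
    unfolding e_def by (rule Min_le; simp add: E_def)+
   ultimately have e: "0 < e" "e <= d1" "e <= d2" "e <= s / 2" "e <= (t - s) / 2" "e <= (a - t) / 2" .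
   define phi where "phi r = Theta ((r - s) / e) - Theta ((r - t) / e)" for r
   define phi' where "phi' r = theta ((r - s) / e) / e - theta ((r - t) / e) / e" for r
   have "test_function a phi phi'"
    unfolding test_function_def
   proof (intro conjI allI)
    show "(phi has_real_derivative phi' r) (at r)" for r
     unfolding phi_def[abs_def] phi'_def using e by (intro DERIV_diff TD) auto
    show "continuous_on UNIV phi'" unfolding phi'_def[abs_def] using e by (intro continuous_on_diff Tc) auto
    have "phi r = 0" if r: "r < s - e \<or> t + e < r" for r
     using r
    proof
     assume r: "r < s - e"
     then have "Theta ((r - s) / e) = 0" "Theta ((r - t) / e) = 0" using e st by (auto intro!: T(4) simp: divide_le_eq)
     then show ?thesis by (simp add: phi_def)
    next
     assume r: "t + e < r"
     then have "Theta ((r - s) / e) = 1" "Theta ((r - t) / e) = 1" using e st by (auto intro!: T(5) simp: le_divide_eq)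
     then show ?thesis by (simp add: phi_def)
    qed
    then have "ALL r. r \<notin> {s - e..t + e} --> phi r = 0" by fastforce
    then show "EX c d. 0 < c & d < a & (ALL r. r \<notin> {c..d} --> phi r = 0)"
     using e st by (intro exI[of _ "s - e"] exI[of _ "t + e"]) auto
   qed
   then have o: "integral {0..a} (%r. phi' r *\<^sub>R k r) = 0" by (rule orth)
   have int: "(%r. (theta ((r - x) / e) / e) *\<^sub>R k r) integrable_on {0..a}" for x
    by (rule integrable_continuous_real, rule continuous_on_scaleR[OF Tc k]) (use e in simp)
   have "integral {0..a} (%r. (theta ((r - s) / e) / e) *\<^sub>R k r) - integral {0..a} (%r. (theta ((r - t) / e) / e) *\<^sub>R k r) = 0"
    using o integral_diff[OF int[of s] int[of t]] by (simp add: phi'_def scaleR_diff_left)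
   moreover have "norm (integral {0..a} (%r. (theta ((r - s) / e) / e) *\<^sub>R k r) - k s) <= eta / 2"
   proof (rule avg[OF e(1)])
    show "norm (k r - k s) <= eta / 2" if "r \<in> {0..a}" "\<bar>r - s\<bar> <= e" for r
     using that e(2) by (intro d(3)) auto
   qed (use e(1-6) st in \<open>auto simp: field_simps\<close>)
   moreover have "norm (integral {0..a} (%r. (theta ((r - t) / e) / e) *\<^sub>R k r) - k t) <= eta / 2"
   proof (rule avg[OF e(1)])
    show "norm (k r - k t) <= eta / 2" if "r \<in> {0..a}" "\<bar>r - t\<bar> <= e" for r
     using that e(3) by (intro d(4)) auto
   qed (use e(1-6) st in \<open>auto simp: field_simps\<close>)
   ultimately show ?thesis
    using norm_triangle_ineq4[of "integral {0..a} (%r. (theta ((r - s) / e) / e) *\<^sub>R k r) - k t" "integral {0..a} (%r. (theta ((r - s) / e) / e) *\<^sub>R k r) - k s"]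
    by simp
  qed
  then have "norm (k s - k t) <= 0" by (rule field_le_epsilon)
  then show ?thesis by simp
 qed
 have const: "k r = k (a / 2)" if "r \<in> {0<..<a}" for r
 proof (cases r "a / 2" rule: linorder_cases)
  case less
  then show ?thesis using eq[of r "a / 2"] that a by simp
 next
  case greater
  then have "k (a / 2) = k r" using eq[of "a / 2" r] that a by simp
  then show ?thesis by (rule sym)
 qed (rule arg_cong)
 have cl: "closure {0<..<a} = {0..a}" using a by simp
 have all: "k r = k (a / 2)" if "r \<in> {0..a}" for r
  using continuous_constant_on_closure[of "{0<..<a}" k "k (a / 2)" r] k const that unfolding cl by blast
 have "0 \<in> {0..a}" using a by simp
 from all[OF t] all[OF this] show ?thesis by (rule trans[OF _ sym])
qed

text \<open>The product rule gives one direction, du Bois-Reymond's lemma the other. From here on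
  weak derivatives are replaced by integral equations for the continuous representative.\<close>

lemma weak_derivative_iff:
 fixes f v g :: "real => 'x::banach"
 assumes p: "1 <= p" and a: "0 < a" and g: "PL0 p a g" and v: "continuous_on {0..a} v"
  and f: "AE t in lebesgue. 0 < t & t < a --> f t = v t"
 shows "weak_derivative a f g \<longleftrightarrow> (\<forall>t\<in>{0..a}. v t = v 0 + integral {0..t} g)"
proof -
 have fv: "integral {0..a} (%t. phi' t *\<^sub>R f t) = integral {0..a} (%t. phi' t *\<^sub>R v t)" for phi'
  using f by (intro integral_cong_AE_lebesgue) (auto elim!: eventually_mono)
 have key: "integral {0..a} (%t. phi' t *\<^sub>R u t) = - integral {0..a} (%t. phi t *\<^sub>R g t)"
  if phi: "test_function a phi phi'" and u: "!!t. t \<in> {0..a} ==> u t = u 0 + integral {0..t} g" and uc: "continuous_on {0..a} u" for phi phi' u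
 proof -
  obtain c d where "0 < c" "d < a" "ALL t. t \<notin> {c..d} --> phi t = 0"
   and D: "!!t. (phi has_real_derivative phi' t) (at t)" "continuous_on UNIV phi'"
   using phi unfolding test_function_def by blast
  then have z: "phi 0 = 0" "phi a = 0" by auto
  have "((%r. phi' r *\<^sub>R u r + phi r *\<^sub>R g r) has_integral phi a *\<^sub>R u a - phi 0 *\<^sub>R u 0) {0..a}"
   by (rule product_rule(1)[OF p _ g u])
    (use a D in \<open>auto intro: DERIV_subset continuous_on_subset\<close>)
  moreover have "(%r. phi' r *\<^sub>R u r) integrable_on {0..a}"
   by (intro integrable_continuous_real continuous_intros uc continuous_on_subset[OF D(2)]) auto
  ultimately have "((%r. phi r *\<^sub>R g r) has_integral 0 - integral {0..a} (%r. phi' r *\<^sub>R u r)) {0..a}"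
   using has_integral_diff[of "%r. phi' r *\<^sub>R u r + phi r *\<^sub>R g r" 0 "{0..a}" "%r. phi' r *\<^sub>R u r"] z
   by (auto simp: integrable_integral)
  then show ?thesis by (simp add: integral_unique)
 qed
 show ?thesis
 proof
  assume W: "weak_derivative a f g"
  define G where "G t = integral {0..t} g" for t
  have gi: "g integrable_on {0..a}" using PL_integral_norm(1)[OF p g] a by simp
  have Gc: "continuous_on {0..a} G" unfolding G_def[abs_def] by (rule indefinite_integral_continuous_1[OF gi])
  have "v t - G t = v 0 - G 0" if t: "t \<in> {0..a}" for t
  proof (rule test_function_orthogonal_const[OF a _ _ t, of "%t. v t - G t"])
   show "continuous_on {0..a} (%t. v t - G t)" by (intro continuous_intros v Gc)
   fix phi phi' assume phi: "test_function a phi phi'"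
   then have c: "continuous_on {0..a} phi'" unfolding test_function_def by (meson continuous_on_subset subset_UNIV)
   have "integral {0..a} (%t. phi' t *\<^sub>R v t) = integral {0..a} (%t. phi' t *\<^sub>R G t)"
    using W phi key[OF phi _ Gc] unfolding weak_derivative_def fv by (auto simp: G_def)
   then show "integral {0..a} (%t. phi' t *\<^sub>R (v t - G t)) = 0"
    unfolding scaleR_diff_right
    by (subst integral_diff) (auto intro!: integrable_continuous_real continuous_intros c v Gc)
  qed
  note vG = this
  have "v t = v 0 + integral {0..t} g" if "t \<in> {0..a}" for t
   using vG[OF that] by (simp add: G_def algebra_simps)
  then show "\<forall>t\<in>{0..a}. v t = v 0 + integral {0..t} g" by blast
 next
  assume "\<forall>t\<in>{0..a}. v t = v 0 + integral {0..t} g"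
  then show "weak_derivative a f g" unfolding weak_derivative_def fv using key v by blast
 qed
qed

section \<open>Calculus of paths in X_0 with integrable X_1-valued representatives\<close>

locale interpolation_setting =
 fixes p :: real and J :: "'b::banach => 'a::banach" and i :: "'c::banach => 'a"
 assumes p: "1 < p" and J: "bounded_linear J" and inj_J: "inj J"
  and interp: "is_real_interpolation_space J (1 - 1 / p) p i"
begin

lemma p0: "0 < p" and p1: "1 <= p" using p by auto

text \<open>A path \<open>v\<close> in \<open>X\<^sub>0\<close> with derivative \<open>g\<close> in \<open>L\<^sub>p\<close>, given in \<open>L\<^sub>p\<close> by the \<open>X\<^sub>1\<close>-valued function \<open>w\<close>.\<close>

definition evo :: "real => (real => 'a) => (real => 'b) => (real => 'a) => bool" where
 "evo a v w g \<longleftrightarrow> PL0 p a w & PL0 p a g &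
   (\<forall>t\<in>{0..a}. v t = v 0 + integral {0..t} g) &
   (AE t in lebesgue. 0 < t & t < a --> v t = J (w t))"

lemma evoD:
 assumes "evo a v w g"
 shows "PL0 p a w" "PL0 p a g" "!!t. t \<in> {0..a} ==> v t = v 0 + integral {0..t} g"
  "AE t in lebesgue. 0 < t & t < a --> v t = J (w t)"
 using assms unfolding evo_def by blast+

lemma evo_integrable:
 assumes "evo a v w g" "0 <= s" "s <= t" "t <= a"
 shows "g integrable_on {s..t}" "w integrable_on {s..t}" "(%r. norm (g r)) integrable_on {s..t}"
  "(%r. norm (w r)) integrable_on {s..t}"
  "norm (integral {s..t} g) <= integral {s..t} (%r. norm (g r))"
 using PL_integral_norm[OF p1 PL_cut_sub(1)[OF p0 evoD(1)[OF assms(1)] assms(2,4)] assms(3)]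
  PL_integral_norm[OF p1 PL_cut_sub(1)[OF p0 evoD(2)[OF assms(1)] assms(2,4)] assms(3)] by auto

lemma evo_diff_integral:
 assumes "evo a v w g" "0 <= s" "s <= t" "t <= a"
 shows "v t - v s = integral {s..t} g"
 using evoD(3)[OF assms(1), of s] evoD(3)[OF assms(1), of t] assms(2-4)
  Henstock_Kurzweil_Integration.integral_combine[of 0 s t g] evo_integrable(1)[OF assms(1), of 0 t]
 by (simp add: algebra_simps)

lemma evo_continuous:
 assumes "evo a v w g"
 shows "continuous_on {0..a} v"
proof (cases "0 <= a")
 case True
 show ?thesis
 proof (rule continuous_on_eq)
  show "continuous_on {0..a} (%t. v 0 + integral {0..t} g)"
   by (rule continuous_on_add[OF continuous_on_const indefinite_integral_continuous_1[OF evo_integrable(1)[OF assms order_refl True order_refl]]])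
 qed (rule evoD(3)[OF assms, symmetric])
qed simp

lemma evo_sub:
 assumes e: "evo a v w g" and b: "b <= a"
 shows "evo b v w g"
 unfolding evo_def
proof (intro conjI ballI)
 show "PL0 p b w" "PL0 p b g"
  using PL_cut_sub(1)[OF p0 evoD(1)[OF e] order_refl b] PL_cut_sub(1)[OF p0 evoD(2)[OF e] order_refl b] by blast+
 show "v t = v 0 + integral {0..t} g" if "t \<in> {0..b}" for t using evoD(3)[OF e, of t] that b by simp
 show "AE t in lebesgue. 0 < t & t < b --> v t = J (w t)"
  by (rule eventually_mono[OF evoD(4)[OF e]]) (use b in auto)
qed

lemma evo_shift:
 assumes e: "evo a v w g" and s: "0 <= s" "s <= a"
 shows "evo (a - s) (%t. v (s + t)) (%t. w (s + t)) (%t. g (s + t))"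
 unfolding evo_def
proof (intro conjI ballI)
 show "PL0 p (a - s) (%t. w (s + t))" "PL0 p (a - s) (%t. g (s + t))"
  using PL_cut_sub(1)[OF p0 evoD(1)[OF e] s(1)] PL_cut_sub(1)[OF p0 evoD(2)[OF e] s(1)] by (auto simp: PL_cut_shift(1)[OF p0])
 show "v (s + t) = v (s + 0) + integral {0..t} (%t. g (s + t))" if t: "t \<in> {0..a - s}" for t
  using evo_diff_integral[OF e s(1), of "s + t"] t integral_shift_Icc_real[of 0 t g s]
  by (simp add: o_def add.commute algebra_simps)
 have "AE t in lebesgue. 0 < s + 1 * t & s + 1 * t < a --> v (s + 1 * t) = J (w (s + 1 * t))"
  by (rule AE_affine[OF evoD(4)[OF e]]) simp
 then show "AE t in lebesgue. 0 < t & t < a - s --> v (s + t) = J (w (s + t))"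
  by eventually_elim (use s in auto)
qed

text \<open>Time reversal carries statements about the left end of an interval over to its right
  end, where no interval of further times is available.\<close>

lemma evo_reverse:
 assumes e: "evo a v w g" and a: "0 <= a"
 shows "evo a (%t. v (a - t)) (%t. w (a - t)) (%t. - g (a - t))"
  and "LN0 p a (%t. w (a - t)) = LN0 p a w"
  and "LN0 p a (%t. - g (a - t)) = LN0 p a g"
proof -
 have c: "cut 0 a (%t. w (a - t)) = (%t. cut 0 a w (a + -1 * t))" "cut 0 a (%t. - g (a - t)) = (%t. - cut 0 a g (a + -1 * t))"
  by (auto simp: cut_def)
 note A = PL_affine[OF p0 evoD(1)[OF e], of "-1" a] PL_affine[OF p0 evoD(2)[OF e], of "-1" a]
 show "LN0 p a (%t. w (a - t)) = LN0 p a w" "LN0 p a (%t. - g (a - t)) = LN0 p a g"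
  unfolding c LN_minus using A by auto
 show "evo a (%t. v (a - t)) (%t. w (a - t)) (%t. - g (a - t))"
  unfolding evo_def
 proof (intro conjI ballI)
  show "PL0 p a (%t. w (a - t))" "PL0 p a (%t. - g (a - t))"
   unfolding c using A by (auto intro: PL_minus)
  show "v (a - t) = v (a - 0) + integral {0..t} (%t. - g (a - t))" if t: "t \<in> {0..a}" for t
  proof -
   have "(g has_integral integral {a - t..a} g) (cbox (a - t) a)"
    using integrable_integral[OF evo_integrable(1)[OF e, of "a - t" a]] t by auto
   note I = this
   have f: "(%x. (1 / (-1)) *\<^sub>R x + - ((1 / (-1)) *\<^sub>R a)) = (-) a" by (rule ext) simp
   have im: "(%x. (1 / (-1)) *\<^sub>R x + - ((1 / (-1)) *\<^sub>R a)) ` cbox (a - t) a = {0..t}"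
    unfolding f using image_diff_atLeastAtMost[of a "a - t" a] by simp
   have "((%r. g (a - r)) has_integral integral {a - t..a} g) {0..t}"
    using has_integral_affinity[OF I, of "-1" a] unfolding im by simp
   then have "integral {0..t} (%r. g (a - r)) = integral {a - t..a} g" by (simp add: integral_unique)
   then show ?thesis using evo_diff_integral[OF e, of "a - t" a] t by (simp add: algebra_simps)
  qed
  have "AE t in lebesgue. 0 < a + -1 * t & a + -1 * t < a --> v (a + -1 * t) = J (w (a + -1 * t))"
   by (rule AE_affine[OF evoD(4)[OF e]]) simp
  then show "AE t in lebesgue. 0 < t & t < a --> v (a - t) = J (w (a - t))"
   by eventually_elim auto
 qed
qed

lemma evo_add:
 assumes "evo a v1 w1 g1" "evo a v2 w2 g2"
 shows "evo a (%t. v1 t + v2 t) (%t. w1 t + w2 t) (%t. g1 t + g2 t)"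
 unfolding evo_def cut_add
proof (intro conjI ballI PL_add(1)[OF p1] evoD[OF assms(1)] evoD[OF assms(2)])
 fix t assume t: "t \<in> {0..a}"
 then have "integral {0..t} (%t. g1 t + g2 t) = integral {0..t} g1 + integral {0..t} g2"
  using evo_integrable(1)[OF assms(1), of 0 t] evo_integrable(1)[OF assms(2), of 0 t] by (intro integral_add) auto
 then show "v1 t + v2 t = v1 0 + v2 0 + integral {0..t} (%t. g1 t + g2 t)"
  using evoD(3)[OF assms(1) t] evoD(3)[OF assms(2) t] by (simp add: algebra_simps)
next
 show "AE t in lebesgue. 0 < t & t < a --> v1 t + v2 t = J (w1 t + w2 t)"
  using evoD(4)[OF assms(1)] evoD(4)[OF assms(2)]
  by eventually_elim (simp add: linear_add[OF bounded_linear.linear[OF J]])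
qed

lemma evo_scale:
 assumes "evo a v w g"
 shows "evo a (%t. c *\<^sub>R v t) (%t. c *\<^sub>R w t) (%t. c *\<^sub>R g t)"
proof -
 have c: "cut 0 a (%t. c *\<^sub>R f t) = (%t. c *\<^sub>R cut 0 a f t)" for f :: "real => 'z::real_normed_vector" by (auto simp: cut_def)
 show ?thesis
  unfolding evo_def c
 proof (intro conjI ballI PL_scale(1)[OF p0] evoD[OF assms])
  show "c *\<^sub>R v t = c *\<^sub>R v 0 + integral {0..t} (%t. c *\<^sub>R g t)" if t: "t \<in> {0..a}" for t
   using arg_cong[OF evoD(3)[OF assms t], of "%x. c *\<^sub>R x"] by (simp add: scaleR_add_right)
  show "AE t in lebesgue. 0 < t & t < a --> c *\<^sub>R v t = J (c *\<^sub>R w t)"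
   using evoD(4)[OF assms] by eventually_elim (simp add: linear_scale[OF bounded_linear.linear[OF J]])
 qed
qed

lemma evo_diff:
 assumes "evo a v1 w1 g1" "evo a v2 w2 g2"
 shows "evo a (%t. v1 t - v2 t) (%t. w1 t - w2 t) (%t. g1 t - g2 t)"
 using evo_add[OF assms(1) evo_scale[OF assms(2), of "-1"]] by simp

lemma evo_cong:
 assumes e: "evo a v w g" and v: "!!t. t \<in> {0..a} ==> v' t = v t"
  and w: "AE t in lebesgue. 0 < t & t < a --> w' t = w t" and g: "AE t in lebesgue. 0 < t & t < a --> g' t = g t"
 shows "evo a v' w' g'"
 unfolding evo_def
proof (intro conjI ballI)
 have sym: "AE t in lebesgue. 0 < t & t < a --> w t = w' t" "AE t in lebesgue. 0 < t & t < a --> g t = g' t"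
  by (rule eventually_mono[OF w], simp) (rule eventually_mono[OF g], simp)
 show "PL0 p a w'" "PL0 p a g'"
  using PL_AE_cong(1)[OF p0 evoD(1)[OF e] cut_cong_AE[OF sym(1)]] PL_AE_cong(1)[OF p0 evoD(2)[OF e] cut_cong_AE[OF sym(2)]] by auto
 show "v' t = v' 0 + integral {0..t} g'" if t: "t \<in> {0..a}" for t
 proof -
  have "integral {0..t} g = integral {0..t} g'"
   using sym(2) t by (intro integral_cong_AE_lebesgue) (auto elim!: eventually_mono)
  then show ?thesis using v[OF t] v[of 0] evoD(3)[OF e t] t by simp
 qed
 show "AE t in lebesgue. 0 < t & t < a --> v' t = J (w' t)"
  using evoD(4)[OF e] w by eventually_elim (use v in auto)
qed

text \<open>The second function runs on its own clock, starting at 0 when the first one ends; the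
  value at the junction \<open>a\<close> is that of the first.\<close>

definition join :: "real => (real => 'z) => (real => 'z) => real => 'z" where
 "join a f1 f2 = (%t. if t <= a then f1 t else f2 (t - a))"

lemma PL_cut_joined:
 assumes a: "0 <= a" "0 <= b" and f: "PL0 p a f1" "PL0 p b f2"
 shows "PL0 p (a + b) (join a f1 f2)"
  "LN0 p (a + b) (join a f1 f2) <= LN0 p a f1 + LN0 p b f2"
proof -
 have c: "cut 0 a (join a f1 f2) = cut 0 a f1" by (auto simp: cut_def join_def)
 have c2: "cut 0 b (%t. join a f1 f2 (a + t)) = cut 0 b f2" by (auto simp: cut_def join_def)
 have 2: "PL p (cut a (a + b) (join a f1 f2))" "LN p (cut a (a + b) (join a f1 f2)) = LN0 p b f2"
  using PL_cut_shift[OF p0, where s = 0 and t = b and c = a and f = "join a f1 f2"] f(2) unfolding c2 by (auto simp: add.commute)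
 show "PL0 p (a + b) (join a f1 f2)"
  "LN0 p (a + b) (join a f1 f2) <= LN0 p a f1 + LN0 p b f2"
  using PL_cut_join[OF p1, of 0 a "a + b" "join a f1 f2"] a f(1) 2 by (auto simp: c)
qed

lemma AE_join:
 fixes a b :: real
 assumes "AE t in lebesgue. 0 < t & t < a --> P t" "AE t in lebesgue. 0 < t & t < b --> P (a + t)"
 shows "AE t in lebesgue. 0 < t & t < a + b --> P t"
proof -
 have "AE t in lebesgue. t ~= a" using AE_completion[OF AE_lborel_singleton[of a]] by simp
 moreover have "AE t in lebesgue. 0 < - a + 1 * t & - a + 1 * t < b --> P (a + (- a + 1 * t))"
  by (rule AE_affine[OF assms(2)]) simp
 ultimately show ?thesis using assms(1)
 proof eventually_elim
  case (elim t) then show ?case by (cases t a rule: linorder_cases) auto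
 qed
qed

lemma evo_join:
 assumes e1: "evo a v1 w1 g1" and e2: "evo b v2 w2 g2" and ab: "0 <= a" "0 <= b" and eq: "v2 0 = v1 a"
 shows "evo (a + b) (join a v1 v2) (join a w1 w2) (join a g1 g2)"
 unfolding evo_def
proof (intro conjI ballI PL_cut_joined(1) evoD[OF e1] evoD[OF e2] ab)
 show "AE t in lebesgue. 0 < t & t < a + b --> join a v1 v2 t = J (join a w1 w2 t)"
 proof (rule AE_join)
  show "AE t in lebesgue. 0 < t & t < a --> join a v1 v2 t = J (join a w1 w2 t)"
   using evoD(4)[OF e1] by eventually_elim (auto simp: join_def)
  show "AE t in lebesgue. 0 < t & t < b --> join a v1 v2 (a + t) = J (join a w1 w2 (a + t))"
   using evoD(4)[OF e2] by eventually_elim (auto simp: join_def)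
 qed
 fix t assume t: "t \<in> {0..a + b}"
 have G: "integral {0..s} (join a g1 g2) = integral {0..s} g1" if "s <= a" for s
  using that by (intro integral_cong) (auto simp: join_def)
 show "join a v1 v2 t = join a v1 v2 0 + integral {0..t} (join a g1 g2)"
 proof (cases "t <= a")
  case True then show ?thesis using t ab evoD(3)[OF e1, of t] G[of t] by (simp add: join_def)
 next
  case False
  have ji: "join a g1 g2 integrable_on {0..a + b}"
   using PL_integral_norm(1)[OF p1 PL_cut_joined(1)[OF ab evoD(2)[OF e1] evoD(2)[OF e2]]] ab by simp
  then have jt: "join a g1 g2 integrable_on {0..t}" using t by (auto intro: integrable_subinterval_real)
  have "integral {a..t} (join a g1 g2) = integral {0..t - a} (%r. join a g1 g2 (a + r))"
   using integral_shift_Icc_real[of 0 "t - a" "join a g1 g2" a] by (simp add: o_def add.commute)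
  also have "... = integral {0..t - a} g2"
   by (rule integral_spike[of "{0}"]) (auto simp: join_def)
  finally have "integral {0..t} (join a g1 g2) = integral {0..a} g1 + integral {0..t - a} g2"
   using Henstock_Kurzweil_Integration.integral_combine[of 0 a t "join a g1 g2"] False ab jt G[of a] by simp
  then show ?thesis using False t ab eq evoD(3)[OF e1, of a] evoD(3)[OF e2, of "t - a"]
   by (simp add: join_def)
 qed
qed

text \<open>Scalar weights are needed twice: trigonometric ones for the finite Laplace transform,
  and the weight t for parabolic smoothing.\<close>

lemma evo_mult:
 assumes e: "evo a v w g" and a: "0 <= a"
  and phi: "!!t. (phi has_real_derivative phi' t) (at t)" and phi': "continuous_on UNIV phi'"
 shows "evo a (%t. phi t *\<^sub>R v t) (%t. phi t *\<^sub>R w t) (%t. phi' t *\<^sub>R v t + phi t *\<^sub>R g t)"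
proof -
 have phic: "continuous_on S phi" for S
  by (rule DERIV_continuous_on[of _ _ phi']) (use phi has_field_derivative_at_within in blast)
 have R: "((%r. phi' r *\<^sub>R v r + phi r *\<^sub>R g r) has_integral phi t *\<^sub>R v t - phi 0 *\<^sub>R v 0) {0..t}"
   "PL0 p t (%r. phi' r *\<^sub>R v r + phi r *\<^sub>R g r)" if t: "0 <= t" "t <= a" for t
  using product_rule[OF p1 t(1) evoD(2)[OF evo_sub[OF e t(2)]] evoD(3)[OF evo_sub[OF e t(2)]], of phi phi']
   phi continuous_on_subset[OF phi'] by (auto intro: has_field_derivative_at_within)
 have "bounded (phi ` {0..a})" using phic by (intro compact_imp_bounded compact_continuous_image) auto
 then obtain C0 where "\<forall>x\<in>phi ` {0..a}. norm x <= C0" by (auto simp: bounded_iff)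
 then have C: "!!t. t \<in> {0..a} ==> \<bar>phi t\<bar> <= max 0 C0" by (auto simp: le_max_iff_disj)
 have eq: "cut 0 a (%t. phi t *\<^sub>R w t) = (%t. cut 0 a phi t *\<^sub>R cut 0 a w t)" by (auto simp: cut_def)
 have sm: "SM (cut 0 a (%t. phi t *\<^sub>R w t))"
  unfolding eq by (intro SM_scaleR SM_continuous phic PL_SM[OF evoD(1)[OF e]])
 have "AE t in lebesgue. norm (cut 0 a (%t. phi t *\<^sub>R w t) t) <= max 0 C0 * norm (cut 0 a w t)"
  by (intro always_eventually allI) (use C in \<open>auto simp: cut_def intro!: mult_right_mono\<close>)
 with PL_bound[OF p0 sm evoD(1)[OF e], of "max 0 C0"] have 1: "PL0 p a (%t. phi t *\<^sub>R w t)" by auto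
 show ?thesis
  unfolding evo_def
 proof (intro conjI ballI 1 R(2) a order_refl)
  show "phi t *\<^sub>R v t = phi 0 *\<^sub>R v 0 + integral {0..t} (%r. phi' r *\<^sub>R v r + phi r *\<^sub>R g r)" if "t \<in> {0..a}" for t
   using integral_unique[OF R(1)[of t]] that by (simp add: algebra_simps)
  show "AE t in lebesgue. 0 < t & t < a --> phi t *\<^sub>R v t = J (phi t *\<^sub>R w t)"
   using evoD(4)[OF e] by eventually_elim (simp add: linear_scale[OF bounded_linear.linear[OF J]])
 qed
qed

lemma evo_C1:
 assumes z: "!!t. (z has_vector_derivative z' t) (at t)" and z': "continuous_on UNIV z'" and a: "0 <= a"
 shows "evo a (%t. J (z t)) z (%t. J (z' t))"
proof -
 have zc: "continuous_on S z" for S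
  by (rule continuous_on_vector_derivative[of _ _ z']) (use z has_vector_derivative_at_within in blast)
 have Jd: "((%t. J (z t)) has_vector_derivative J (z' t)) (at t within S)" for t S
  using bounded_linear.has_vector_derivative[OF J has_vector_derivative_at_within[OF z]] .
 show ?thesis
  unfolding evo_def
 proof (intro conjI ballI PL_cut_continuous p0 a zc)
  show "continuous_on {0..a} (%t. J (z' t))"
   using bounded_linear.continuous_on[OF J continuous_on_subset[OF z']] by auto
  show "J (z t) = J (z 0) + integral {0..t} (%t. J (z' t))" if "t \<in> {0..a}" for t
   using integral_unique[OF fundamental_theorem_of_calculus[of 0 t "%t. J (z t)" "%t. J (z' t)"]] that Jd by auto
 qed auto
qed

end

section \<open>Traces and the real interpolation space\<close>

text \<open>Tonelli's theorem on the region 0 < s < r. The Lebesgue measurable \<open>k\<close> is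
  replaced by a Borel function equal to it almost everywhere, since the product measure is formed
  from \<open>lborel\<close>.\<close>

lemma tonelli_triangle:
 fixes k q :: "real => ennreal"
 assumes k: "k \<in> borel_measurable lebesgue" and q: "q \<in> borel_measurable borel"
 shows "(\<integral>\<^sup>+r. q r * (\<integral>\<^sup>+s. k s * indicator {0<..<r} s \<partial>lebesgue) \<partial>lborel) =
  (\<integral>\<^sup>+s. k s * ((\<integral>\<^sup>+r. q r * indicator {s<..} r \<partial>lborel) * indicator {0<..} s) \<partial>lebesgue)"
proof -
 obtain k' where k'[measurable]: "k' \<in> borel_measurable lborel" and eq: "AE s in lborel. k s = k' s"
  using completion_ex_borel_measurable[OF k] by auto
 note [measurable] = q
 have 1: "(\<integral>\<^sup>+s. k s * f s \<partial>lebesgue) = (\<integral>\<^sup>+s. k' s * f s \<partial>lborel)" for f :: "real => ennreal"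
  unfolding nn_integral_completion by (rule nn_integral_cong_AE) (use eq in \<open>eventually_elim, simp\<close>)
 define psi where "psi r s = q r * (k' s * (if 0 < s & s < r then 1 else 0))" for r s
 have [measurable]: "case_prod psi \<in> borel_measurable (lborel \<Otimes>\<^sub>M lborel)"
  unfolding psi_def by measurable
 have "(\<integral>\<^sup>+r. q r * (\<integral>\<^sup>+s. k s * indicator {0<..<r} s \<partial>lebesgue) \<partial>lborel) = (\<integral>\<^sup>+r. (\<integral>\<^sup>+s. psi r s \<partial>lborel) \<partial>lborel)"
  unfolding 1 psi_def
  by (rule nn_integral_cong, subst nn_integral_cmult) (auto simp: indicator_def of_bool_def)
 also have "... = (\<integral>\<^sup>+s. (\<integral>\<^sup>+r. psi r s \<partial>lborel) \<partial>lborel)"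
  by (rule lborel_pair.Fubini'[symmetric]) measurable
 also have "... = (\<integral>\<^sup>+s. k' s * ((\<integral>\<^sup>+r. q r * indicator {s<..} r \<partial>lborel) * indicator {0<..} s) \<partial>lborel)"
 proof (rule nn_integral_cong)
  fix s :: real
  have "psi r s = (k' s * indicator {0<..} s) * (q r * indicator {s<..} r)" for r
   by (auto simp: psi_def indicator_def mult_ac)
  then have "(\<integral>\<^sup>+r. psi r s \<partial>lborel) = (k' s * indicator {0<..} s) * (\<integral>\<^sup>+r. q r * indicator {s<..} r \<partial>lborel)"
   by (simp add: nn_integral_cmult)
  then show "(\<integral>\<^sup>+r. psi r s \<partial>lborel) = k' s * ((\<integral>\<^sup>+r. q r * indicator {s<..} r \<partial>lborel) * indicator {0<..} s)"
   by (simp add: mult_ac)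
 qed
 finally show ?thesis unfolding 1 .
qed

text \<open>Hardy's inequality: Jensen's inequality for the probability measure \<open>(4 r s)\<^sup>-\<^sup>1\<^sup>/\<^sup>2 ds\<close> on \<open>(0,r)\<close>,
 in the form of Young's inequality, and Tonelli's theorem.\<close>

lemma hardy:
 fixes h :: "real => real"
 assumes p: "1 < p" and rho: "0 < rho" and h: "PL0 p rho h" and h0: "!!s. 0 <= h s"
 shows "(\<integral>\<^sup>+r. ennreal ((integral {0..r} h / r) powr p) * indicator {0<..<rho} r \<partial>lborel)
  <= ennreal (2 powr p / (p - 1) * LN0 p rho h powr p)"
proof -
 have p0: "0 < p" "1 <= p" using p by auto
 \<comment> \<open>The exponent left on \<open>r\<close>: p/2 from the p-th power and 1/2 from the
   density. It exceeds 1 because 1 < p, so the integral over r > s converges.\<close>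
 define e where "e = (p + 1) / 2"
 define k where "k s = ennreal (2 powr (p - 1) * cut 0 rho h s powr p * s powr (e - 1))" for s
 have hm: "cut 0 rho h \<in> borel_measurable lebesgue"
  using SM_norm[OF PL_SM[OF h]] h0 by (simp add: cut_def cong: if_cong)
 then have km: "k \<in> borel_measurable lebesgue" unfolding k_def
  by (intro measurable_compose[OF _ measurable_ennreal] borel_measurable_times powr_real_measurable) (auto intro: measurable_completion)
 \<comment> \<open>The tangent inequality of the p-th power at \<open>m\<close>. With
   \<open>m\<close> the mean of \<open>X\<close>, integration against a probability density turns it
   into Jensen's inequality.\<close>
 have young: "p * m powr (p - 1) * X <= X powr p + (p - 1) * m powr p" if "0 <= m" "0 <= X" for m X :: real
 proof -
  have "1 / p + 1 / (p / (p - 1)) = 1" using p by (simp add: field_simps)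
  then have "X * m powr (p - 1) <= X powr p / p + (m powr (p - 1)) powr (p / (p - 1)) / (p / (p - 1))"
   using p that by (intro Youngs_inequality) auto
  also have "(m powr (p - 1)) powr (p / (p - 1)) = m powr p" using p by (simp add: powr_powr)
  finally have "p * (X * m powr (p - 1)) <= p * (X powr p / p + m powr p / (p / (p - 1)))"
   using p0 by (intro mult_left_mono) auto
  also have "... = X powr p + (p - 1) * m powr p" using p by (simp add: distrib_left)
  finally show ?thesis by (simp add: mult_ac)
 qed
 have half: "(\<integral>\<^sup>+s. ennreal (s powr (-1/2) * r powr (-1/2) / 2) * indicator {0<..<r} s \<partial>lebesgue) <= 1" if r: "0 < r" for r
 proof -
  have "((%s. s powr (-1/2) * (r powr (-1/2) / 2)) has_integral (r powr (-1/2 + 1) / (-1/2 + 1)) * (r powr (-1/2) / 2)) {0..r}"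
   using r by (intro has_integral_mult_left has_integral_powr_from_0) auto
  moreover have "(r powr (-1/2 + 1) / (-1/2 + 1)) * (r powr (-1/2) / 2) = 1"
   using r by (simp add: powr_add[symmetric])
  ultimately have I: "((%s. s powr (-1/2) * r powr (-1/2) / 2) has_integral 1) {0..r}" by simp
  have "(\<integral>\<^sup>+s. ennreal (s powr (-1/2) * r powr (-1/2) / 2) * indicator {0..r} s \<partial>lborel) = ennreal 1"
   by (rule nn_integral_has_integral_lebesgue'[OF _ I]) simp
  moreover have "(\<integral>\<^sup>+s. ennreal (s powr (-1/2) * r powr (-1/2) / 2) * indicator {0<..<r} s \<partial>lborel)
    <= (\<integral>\<^sup>+s. ennreal (s powr (-1/2) * r powr (-1/2) / 2) * indicator {0..r} s \<partial>lborel)"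
   by (rule nn_integral_mono) (auto simp: indicator_def)
  ultimately show ?thesis unfolding nn_integral_completion by simp
 qed
 have pt: "ennreal ((integral {0..r} h / r) powr p) <= ennreal (r powr - e) * (\<integral>\<^sup>+s. k s * indicator {0<..<r} s \<partial>lebesgue)"
  if r: "0 < r" "r < rho" for r
 proof -
  define m where "m = integral {0..r} h / r"
  note PI = PL_integral_norm[OF p0(2) PL_cut_sub(1)[OF p0(1) h, of 0 r]]
  have hi: "h integrable_on {0..r}" using PI r by auto
  have m0: "0 <= m" unfolding m_def using r h0 by (intro divide_nonneg_nonneg integral_nonneg hi) auto
  have "((%s. p * m powr (p - 1) / r * h s) has_integral p * m powr (p - 1) / r * integral {0..r} h) {0..r}"
   by (intro has_integral_mult_right integrable_integral hi)
  moreover have "p * m powr (p - 1) / r * integral {0..r} h = p * m powr p"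
  proof (cases "m = 0")
   case False
   then have "m powr (p - 1) * m = m powr p" using m0 by (simp add: powr_diff)
   moreover have "integral {0..r} h = m * r" using r by (simp add: m_def)
   ultimately show ?thesis using r by (simp add: mult.assoc)
  qed (use r in \<open>simp add: m_def\<close>)
  ultimately have I: "((%s. p * m powr (p - 1) / r * h s) has_integral p * m powr p) {0..r}" by simp
  have J: "(\<integral>\<^sup>+s. ennreal (p * m powr (p - 1) / r * h s) * indicator {0..r} s \<partial>lborel) = ennreal (p * m powr p)"
   by (rule nn_integral_has_integral_lebesgue'[OF _ I]) (use p0 r h0 in auto)
  have km1: "(%s. k s * indicator {0<..<r} s) \<in> borel_measurable lebesgue"
   by (rule borel_measurable_times_ennreal[OF km borel_measurable_indicator]) simp
  have "(%s. ennreal (s powr (-1/2) * r powr (-1/2) / 2) * indicator {0<..<r} s) \<in> borel_measurable lborel"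
   by measurable
  then have km2: "(%s. ennreal (s powr (-1/2) * r powr (-1/2) / 2) * indicator {0<..<r} s) \<in> borel_measurable lebesgue"
   by (rule measurable_completion)
  have "(\<integral>\<^sup>+s. ennreal (p * m powr (p - 1) / r * h s) * indicator {0..r} s \<partial>lborel)
   <= (\<integral>\<^sup>+s. ennreal (r powr - e) * (k s * indicator {0<..<r} s)
      + ennreal ((p - 1) * m powr p) * (ennreal (s powr (-1/2) * r powr (-1/2) / 2) * indicator {0<..<r} s) \<partial>lborel)"
  proof (rule nn_integral_mono_AE)
   have "AE s in lborel. s ~= 0 & s ~= r" by (intro AE_conjI AE_lborel_singleton)
   then show "AE s in lborel. ennreal (p * m powr (p - 1) / r * h s) * indicator {0..r} s <= ennreal (r powr - e) * (k s * indicator {0<..<r} s)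
      + ennreal ((p - 1) * m powr p) * (ennreal (s powr (-1/2) * r powr (-1/2) / 2) * indicator {0<..<r} s)"
   proof eventually_elim
    case (elim s)
    show ?case
    proof (cases "0 < s & s < r")
     case True
     \<comment> \<open>Chosen so that the mean of \<open>X\<close> with respect to the density
       \<open>c\<close> is the mean \<open>m\<close> of \<open>h\<close>.\<close>
     define X where "X = 2 * h s * s powr (1/2) * r powr (-1/2)"
     define c where "c = s powr (-1/2) * r powr (-1/2) / 2"
     have c0: "0 <= c" by (simp add: c_def)
     have "p * m powr (p - 1) / r * h s = p * m powr (p - 1) * X * c"
     proof -
      have "X * c = h s * (s powr (1/2) * s powr (-1/2)) * (r powr (-1/2) * r powr (-1/2))"
       by (simp add: X_def c_def)
      also have "... = h s / r" using True by (simp add: powr_add[symmetric] powr_minus_divide)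
      finally show ?thesis by (simp add: mult.assoc)
     qed
     also have "... <= (X powr p + (p - 1) * m powr p) * c"
      using young[OF m0, of X] h0[of s] c0 by (intro mult_right_mono) (auto simp: X_def)
     also have "... = X powr p * c + (p - 1) * m powr p * c" by (simp add: distrib_right)
     also have "X powr p * c = r powr - e * (2 powr (p - 1) * cut 0 rho h s powr p * s powr (e - 1))"
     proof -
      have X: "X powr p = 2 powr p * h s powr p * s powr (p/2) * r powr (-p/2)"
       using h0[of s] by (simp add: X_def powr_mult powr_powr)
      have 2: "2 powr (p - 1) = 2 powr p / 2" by (simp add: powr_diff)
      have "p/2 + -1/2 = e - 1" "-p/2 + -1/2 = - e" by (simp_all add: e_def field_simps)
      then have 3: "s powr (p/2) * s powr (-1/2) = s powr (e - 1)" "r powr (-p/2) * r powr (-1/2) = r powr - e"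
       by (simp_all only: powr_add[symmetric])
      have "X powr p * c = (2 powr p / 2) * h s powr p * (s powr (p/2) * s powr (-1/2)) * (r powr (-p/2) * r powr (-1/2))"
       unfolding X c_def by (simp only: times_divide_eq_right times_divide_eq_left mult_ac)
      also have "... = 2 powr (p - 1) * h s powr p * s powr (e - 1) * r powr - e" unfolding 2 3 ..
      finally have "X powr p * c = 2 powr (p - 1) * h s powr p * s powr (e - 1) * r powr - e" .
      then show ?thesis using True r by (simp add: cut_def mult_ac)
     qed
     finally show ?thesis unfolding c_def[symmetric] using True c0 p m0
      by (simp add: k_def ennreal_mult[symmetric] ennreal_plus[symmetric] ennreal_leI mult_ac del: ennreal_plus)
    qed (use elim in \<open>auto simp: indicator_def\<close>)
   qed
  qed
  also have "... = (\<integral>\<^sup>+s. ennreal (r powr - e) * (k s * indicator {0<..<r} s)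
      + ennreal ((p - 1) * m powr p) * (ennreal (s powr (-1/2) * r powr (-1/2) / 2) * indicator {0<..<r} s) \<partial>lebesgue)"
   by (simp add: nn_integral_completion)
  also have "... = (\<integral>\<^sup>+s. ennreal (r powr - e) * (k s * indicator {0<..<r} s) \<partial>lebesgue)
      + (\<integral>\<^sup>+s. ennreal ((p - 1) * m powr p) * (ennreal (s powr (-1/2) * r powr (-1/2) / 2) * indicator {0<..<r} s) \<partial>lebesgue)"
   by (rule nn_integral_add[OF borel_measurable_times_ennreal[OF borel_measurable_const km1] borel_measurable_times_ennreal[OF borel_measurable_const km2]])
  also have "... = ennreal (r powr - e) * (\<integral>\<^sup>+s. k s * indicator {0<..<r} s \<partial>lebesgue)
      + ennreal ((p - 1) * m powr p) * (\<integral>\<^sup>+s. ennreal (s powr (-1/2) * r powr (-1/2) / 2) * indicator {0<..<r} s \<partial>lebesgue)"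
   by (simp only: nn_integral_cmult[OF km1] nn_integral_cmult[OF km2])
  also have "... <= ennreal (r powr - e) * (\<integral>\<^sup>+s. k s * indicator {0<..<r} s \<partial>lebesgue) + ennreal ((p - 1) * m powr p) * 1"
   by (intro add_left_mono mult_left_mono half r) auto
  finally have "ennreal (p * m powr p) <= ennreal (r powr - e) * (\<integral>\<^sup>+s. k s * indicator {0<..<r} s \<partial>lebesgue) + ennreal ((p - 1) * m powr p)"
   unfolding J by simp
  moreover have "ennreal (p * m powr p) = ennreal (m powr p) + ennreal ((p - 1) * m powr p)"
  proof -
   have "p * m powr p = m powr p + (p - 1) * m powr p" by (simp add: algebra_simps)
   then show ?thesis using ennreal_plus[of "m powr p" "(p - 1) * m powr p"] p by simp
  qed
  ultimately have "ennreal (m powr p) <= ennreal (r powr - e) * (\<integral>\<^sup>+s. k s * indicator {0<..<r} s \<partial>lebesgue)"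
   using ennreal_add_left_cancel_le[of "ennreal ((p - 1) * m powr p)" "ennreal (m powr p)"
    "ennreal (r powr - e) * (\<integral>\<^sup>+s. k s * indicator {0<..<r} s \<partial>lebesgue)"] by (simp add: add.commute)
  then show ?thesis by (simp add: m_def)
 qed
 \<comment> \<open>One factor of the final constant: \<open>2 powr (p - 1)\<close> is part of
   \<open>k\<close>, and 1 / (e - 1) = 2 / (p - 1) arises here.\<close>
 have inner: "(\<integral>\<^sup>+r. ennreal (r powr - e) * indicator {s<..} r \<partial>lborel) <= ennreal (s powr (1 - e) / (e - 1))" if s: "0 < s" for s
 proof -
  have I: "((%r. r powr - e) has_integral -(s powr (- e + 1)) / (- e + 1)) {s..}"
   using s p by (intro has_integral_powr_to_inf) (auto simp: e_def)
  have "(\<integral>\<^sup>+r. ennreal (r powr - e) * indicator {s<..} r \<partial>lborel) <= (\<integral>\<^sup>+r. ennreal (r powr - e) * indicator {s..} r \<partial>lborel)"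
   by (rule nn_integral_mono) (auto simp: indicator_def)
  also have "... = ennreal (-(s powr (- e + 1)) / (- e + 1))"
   by (rule nn_integral_has_integral_lebesgue'[OF _ I]) simp
  also have "-(s powr (- e + 1)) / (- e + 1) = s powr (1 - e) / (e - 1)"
   using minus_divide_divide[of "s powr (1 - e)" "e - 1"] by simp
  finally show ?thesis .
 qed
 have "(\<integral>\<^sup>+r. ennreal ((integral {0..r} h / r) powr p) * indicator {0<..<rho} r \<partial>lborel)
   <= (\<integral>\<^sup>+r. ennreal (r powr - e) * (\<integral>\<^sup>+s. k s * indicator {0<..<r} s \<partial>lebesgue) \<partial>lborel)"
 proof (rule nn_integral_mono)
  fix r :: real
  show "ennreal ((integral {0..r} h / r) powr p) * indicator {0<..<rho} r <= ennreal (r powr - e) * (\<integral>\<^sup>+s. k s * indicator {0<..<r} s \<partial>lebesgue)"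
  proof (cases "0 < r & r < rho")
   case True then show ?thesis using pt[of r] by simp
  next
   case False
   then have "indicator {0<..<rho} r = (0 :: ennreal)" by simp
   then show ?thesis by simp
  qed
 qed
 also have "... = (\<integral>\<^sup>+s. k s * ((\<integral>\<^sup>+r. ennreal (r powr - e) * indicator {s<..} r \<partial>lborel) * indicator {0<..} s) \<partial>lebesgue)"
  by (rule tonelli_triangle[OF km]) measurable
 also have "... <= (\<integral>\<^sup>+s. ennreal (2 powr p / (p - 1)) * ennreal (norm (cut 0 rho h s) powr p) \<partial>lebesgue)"
 proof (rule nn_integral_mono)
  fix s
  show "k s * ((\<integral>\<^sup>+r. ennreal (r powr - e) * indicator {s<..} r \<partial>lborel) * indicator {0<..} s) <= ennreal (2 powr p / (p - 1)) * ennreal (norm (cut 0 rho h s) powr p)"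
  proof (cases "0 < s")
   case True
   have "k s * (\<integral>\<^sup>+r. ennreal (r powr - e) * indicator {s<..} r \<partial>lborel) <= k s * ennreal (s powr (1 - e) / (e - 1))"
    by (intro mult_left_mono inner True) auto
   also have "... = ennreal (2 powr (p - 1) * cut 0 rho h s powr p * s powr (e - 1) * (s powr (1 - e) / (e - 1)))"
    unfolding k_def using p by (subst ennreal_mult[symmetric]) (auto simp: e_def)
   also have "2 powr (p - 1) * cut 0 rho h s powr p * s powr (e - 1) * (s powr (1 - e) / (e - 1))
     = 2 powr (p - 1) / (e - 1) * cut 0 rho h s powr p * (s powr (e - 1) * s powr (1 - e))" by simp
   also have "s powr (e - 1) * s powr (1 - e) = 1" using True by (simp add: powr_add[symmetric])
   also have "2 powr (p - 1) / (e - 1) = 2 powr p / (p - 1)" using p by (simp add: e_def powr_diff field_simps)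
   finally show ?thesis using True p h0[of s] by (simp add: ennreal_mult[symmetric] cut_def)
  qed simp
 qed
 also have "... = ennreal (2 powr p / (p - 1)) * (\<integral>\<^sup>+s. ennreal (norm (cut 0 rho h s) powr p) \<partial>lebesgue)"
  by (intro nn_integral_cmult SM_powr PL_SM[OF h])
 also have "... <= ennreal (2 powr p / (p - 1)) * ennreal (LN0 p rho h powr p)"
  by (intro mult_left_mono PL_nn p0 h) auto
 also have "... = ennreal (2 powr p / (p - 1) * LN0 p rho h powr p)"
  using p by (intro ennreal_mult[symmetric]) auto
 finally show ?thesis .
qed

section \<open>The K-functional and membership in the interpolation space\<close>

context interpolation_setting
begin

lemma K_le: "0 <= t ==> x = x0 + J x1 ==> K_functional J t x <= norm x0 + t * norm x1"
 unfolding K_functional_def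
 by (rule cInf_lower) (auto intro!: bdd_belowI[of _ 0])

lemma K_ne: "{norm x0 + t * norm x1 |x0 x1. x = x0 + J x1} ~= {}"
proof -
 have "x = x + J 0" using linear_0[OF bounded_linear.linear[OF J]] by simp
 then show ?thesis by blast
qed

lemma K_nonneg: "0 <= t ==> 0 <= K_functional J t x"
 unfolding K_functional_def by (rule cInf_greatest[OF K_ne]) auto

lemma K_approx:
 assumes "0 < e"
 obtains x0 x1 where "x = x0 + J x1" "norm x0 + t * norm x1 < K_functional J t x + e"
proof -
 have "K_functional J t x < K_functional J t x + e" using assms by simp
 from cInf_lessD[OF K_ne this[unfolded K_functional_def]] show ?thesis
  using that unfolding K_functional_def by blast
qed

lemma K_mono:
 assumes "0 <= s" "s <= t"
 shows "K_functional J s x <= K_functional J t x"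
proof (rule field_le_epsilon)
 fix e :: real assume "0 < e"
 then obtain x0 x1 where x: "x = x0 + J x1" "norm x0 + t * norm x1 < K_functional J t x + e" by (rule K_approx)
 have "K_functional J s x <= norm x0 + s * norm x1" by (rule K_le[OF assms(1) x(1)])
 also have "... <= norm x0 + t * norm x1" using assms by (intro add_left_mono mult_right_mono) auto
 finally show "K_functional J s x <= K_functional J t x + e" using x(2) by simp
qed

lemma K_le_norm: "0 <= t ==> K_functional J t x <= norm x"
 using K_le[of t x x 0] linear_0[OF bounded_linear.linear[OF J]] by simp

text \<open>For theta = 1 - 1/p the weights of the interpolation norm combine to
  \<open>t powr (-p)\<close>. This is the p-th power of that norm, with value infinity outside the
  interpolation space.\<close>

definition Kint :: "'a => ennreal" where
 "Kint x = (\<integral>\<^sup>+t. ennreal ((K_functional J t x / t) powr p) * indicator {0<..} t \<partial>lborel)"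

lemma K_measurable: "(%t. indicator {0<..} t * (K_functional J t x / t) powr p) \<in> borel_measurable borel"
proof -
 have "mono (%t. K_functional J (max 0 t) x)" by (intro monoI K_mono) auto
 then have [measurable]: "(%t. K_functional J (max 0 t) x) \<in> borel_measurable borel" by (rule borel_measurable_mono)
 have eq: "(%t. indicator {0<..} t * (K_functional J t x / t) powr p) = (%t. indicator {0<..} t * (K_functional J (max 0 t) x / t) powr p)"
  by (auto simp: indicator_def)
 show ?thesis unfolding eq by measurable
qed

lemma K_integrand:
 "indicator {0<..} t *\<^sub>R ((t powr (- (1 - 1 / p)) * K_functional J t x) powr p / t) = indicator {0<..} t * (K_functional J t x / t) powr p"
proof (cases "0 < t")
 case True
 have e: "- (1 - 1 / p) * p = 1 - p" using p by (simp add: field_simps)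
 have "(t powr (- (1 - 1 / p)) * K_functional J t x) powr p = (t powr (- (1 - 1 / p))) powr p * K_functional J t x powr p"
  by (rule powr_mult)
 also have "... = t powr (1 - p) * K_functional J t x powr p" by (simp only: powr_powr e)
 finally have "(t powr (- (1 - 1 / p)) * K_functional J t x) powr p = t powr (1 - p) * K_functional J t x powr p" .
 then have "(t powr (- (1 - 1 / p)) * K_functional J t x) powr p / t = K_functional J t x powr p * (t powr (1 - p) / t)"
  by (simp only: times_divide_eq_right mult.commute)
 also have "t powr (1 - p) / t = 1 / t powr p" using True by (simp add: powr_diff)
 also have "K_functional J t x powr p * (1 / t powr p) = (K_functional J t x / t) powr p"
  using True K_nonneg[of t x] by (simp add: powr_divide)
 finally show ?thesis using True by simp
qed simp

lemma Kint_alt: "Kint x = (\<integral>\<^sup>+t. ennreal (indicator {0<..} t * (K_functional J t x / t) powr p) \<partial>lborel)"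
 unfolding Kint_def by (rule nn_integral_cong) (auto simp: indicator_def)

lemma Kint_finite: "Kint x < \<infinity> \<longleftrightarrow> (EX z. i z = x)"
proof -
 have "x \<in> range i \<longleftrightarrow> integrable lborel (%t. indicator {0<..} t * (K_functional J t x / t) powr p)"
  using interp unfolding is_real_interpolation_space_def interpolation_set_def set_integrable_def K_integrand by simp
 also have "... \<longleftrightarrow> Kint x < \<infinity>"
  using K_measurable[of x] unfolding integrable_iff_bounded Kint_alt by simp
 finally show ?thesis by auto
qed

lemma Kint_i: "Kint (i z) = ennreal (norm z powr p)"
proof -
 have int: "integrable lborel (%t. indicator {0<..} t * (K_functional J t (i z) / t) powr p)"
  using interp unfolding is_real_interpolation_space_def interpolation_set_def set_integrable_def K_integrand by auto
 have "norm z = (\<integral>t. indicator {0<..} t * (K_functional J t (i z) / t) powr p \<partial>lborel) powr (1 / p)"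
  using interp unfolding is_real_interpolation_space_def interpolation_norm_def set_lebesgue_integral_def K_integrand by blast
 moreover have "0 <= (\<integral>t. indicator {0<..} t * (K_functional J t (i z) / t) powr p \<partial>lborel)"
  by (intro Bochner_Integration.integral_nonneg) auto
 ultimately have "norm z powr p = (\<integral>t. indicator {0<..} t * (K_functional J t (i z) / t) powr p \<partial>lborel)"
  using p by (simp add: powr_powr)
 then show ?thesis unfolding Kint_alt using int by (subst nn_integral_eq_integral) auto
qed

lemma linear_i: "linear i" and inj_i: "inj i"
 using interp unfolding is_real_interpolation_space_def by auto

lemma Kint_bound:
 assumes "Kint x <= ennreal c" "0 <= c"
 obtains z where "i z = x" "norm z powr p <= c"
proof -
 obtain z where z: "i z = x" using Kint_finite[of x] assms(1) by (auto intro: le_less_trans)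
 then show ?thesis using that[OF z] assms Kint_i[of z] by (auto simp: ennreal_le_iff)
qed

text \<open>K(1,x) dominates the norm of \<open>x\<close> in X_0 up to a constant, and K(t,x)/t >=
  K(1,x) for 0 < t < 1 bounds it by the interpolation norm.\<close>

lemma i_bound: "\<exists>C>0. ALL z. norm (i z) <= C * norm z"
proof -
 obtain B where B: "0 < B" "!!x. norm (J x) <= norm x * B" using bounded_linear.pos_bounded[OF J] by blast
 have "norm (i z) <= max 1 B * norm z" for z
 proof -
  define kappa where "kappa = K_functional J 1 (i z)"
  have kappa0: "0 <= kappa" by (simp add: kappa_def K_nonneg)
  have "norm (i z) <= max 1 B * kappa"
  proof (rule field_le_epsilon)
   fix e :: real assume e: "0 < e"
   then have "0 < e / max 1 B" by auto
   then obtain x0 x1 where x: "i z = x0 + J x1" "norm x0 + 1 * norm x1 < kappa + e / max 1 B"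
    unfolding kappa_def by (rule K_approx[where x = "i z" and t = 1])
   have "norm (i z) <= norm x0 + norm x1 * B" unfolding x(1) by (rule norm_triangle_le) (use B(2) in auto)
   also have "... <= max 1 B * norm x0 + max 1 B * norm x1"
    using mult_right_mono[of 1 "max 1 B" "norm x0"] mult_right_mono[of B "max 1 B" "norm x1"] by (simp add: mult.commute)
   also have "... <= max 1 B * (kappa + e / max 1 B)"
    unfolding distrib_left[symmetric] using x(2) by (intro mult_left_mono) auto
   also have "... = max 1 B * kappa + e" by (simp add: distrib_left)
   finally show "norm (i z) <= max 1 B * kappa + e" .
  qed
  moreover have "kappa <= norm z"
  proof -
   have "ennreal (kappa powr p) = (\<integral>\<^sup>+t. ennreal (kappa powr p) * indicator {0<..<1::real} t \<partial>lborel)"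
    by (subst nn_integral_cmult_indicator) auto
   also have "... <= Kint (i z)"
    unfolding Kint_def
   proof (rule nn_integral_mono)
    fix t :: real
    show "ennreal (kappa powr p) * indicator {0<..<1} t <= ennreal ((K_functional J t (i z) / t) powr p) * indicator {0<..} t"
    proof (cases "0 < t & t < 1")
     case True
     have "kappa <= K_functional J t (i z) / t"
     proof (rule field_le_epsilon)
      fix e :: real assume "0 < e"
      then have "0 < t * e" using True by simp
      then obtain x0 x1 where x: "i z = x0 + J x1" "norm x0 + t * norm x1 < K_functional J t (i z) + t * e" by (rule K_approx)
      have "t * kappa <= t * (norm x0 + 1 * norm x1)" unfolding kappa_def using True by (intro mult_left_mono K_le x(1)) auto
      also have "... <= norm x0 + t * norm x1" using True mult_right_mono[of t 1 "norm x0"] by (simp add: distrib_left)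
      finally have "t * kappa <= K_functional J t (i z) + t * e" using x(2) by simp
      then show "kappa <= K_functional J t (i z) / t + e" using True by (simp add: field_simps)
     qed
     then have "kappa powr p <= (K_functional J t (i z) / t) powr p" using kappa0 p by (intro powr_mono2) auto
     then show ?thesis using True by (simp add: ennreal_leI)
    qed simp
   qed
   also have "... = ennreal (norm z powr p)" by (rule Kint_i)
   finally have "kappa powr p <= norm z powr p" by (simp add: ennreal_le_iff)
   then show ?thesis using p kappa0 by (meson norm_ge_zero not_le powr_less_mono2 p0)
  qed
  ultimately show ?thesis by (meson max.cobounded1 mult_left_mono order_trans zero_le_one)
 qed
 then show ?thesis by (intro exI[of _ "max 1 B"]) auto
qed

lemma bounded_linear_i: "bounded_linear i"
 using i_bound linear_i by (auto simp: bounded_linear_def bounded_linear_axioms_def mult.commute)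

text \<open>On (0,rho) Hardy's inequality applies to the means of \<open>h\<close>; beyond rho,
  K(t,x) is at most the norm of \<open>x\<close> and \<open>t powr (-p)\<close> is
  integrable.\<close>

lemma trace_estimate:
 assumes rho: "0 < rho" and h: "PL0 p rho h" and h0: "!!s. 0 <= h s"
  and K: "!!r. 0 < r ==> r < rho ==> K_functional J r x <= integral {0..r} h"
 obtains z where "i z = x"
  "norm z powr p <= 2 powr p / (p - 1) * LN0 p rho h powr p + norm x powr p * (rho powr (1 - p) / (p - 1))"
proof -
 have I: "((%r. norm x powr p * r powr - p) has_integral norm x powr p * (-(rho powr (- p + 1)) / (- p + 1))) {rho..}"
  using p rho by (intro has_integral_mult_right has_integral_powr_to_inf) auto
 have m: "(%t. ennreal ((integral {0..t} h / t) powr p) * indicator {0<..<rho} t) \<in> borel_measurable lborel"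
 proof -
  have "continuous_on {0<..<rho} (%t. integral {0..t} h)"
   using PL_integral_norm(1)[OF p1 h] rho by (intro continuous_on_subset[OF indefinite_integral_continuous_1]) auto
  then have "(%t. if t \<in> {0<..<rho} then (integral {0..t} h / t) powr p else 0) \<in> borel_measurable borel"
   using p by (intro borel_measurable_continuous_on_if continuous_on_powr' continuous_intros)
     (auto intro!: divide_nonneg_nonneg integral_nonneg h0 integrable_subinterval_real[OF PL_integral_norm(1)[OF p1 h]])
  then have "(%t. ennreal (if t \<in> {0<..<rho} then (integral {0..t} h / t) powr p else 0)) \<in> borel_measurable borel" by measurable
  moreover have eq: "(%t. ennreal ((integral {0..t} h / t) powr p) * indicator {0<..<rho} t) =
   (%t. ennreal (if t \<in> {0<..<rho} then (integral {0..t} h / t) powr p else 0))" by (auto simp: indicator_def)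
  ultimately show ?thesis unfolding eq by simp
 qed
 have "Kint x <= (\<integral>\<^sup>+t. ennreal ((integral {0..t} h / t) powr p) * indicator {0<..<rho} t
   + ennreal (norm x powr p * t powr - p) * indicator {rho..} t \<partial>lborel)"
  unfolding Kint_def
 proof (rule nn_integral_mono)
  fix t :: real
  show "ennreal ((K_functional J t x / t) powr p) * indicator {0<..} t <= ennreal ((integral {0..t} h / t) powr p) * indicator {0<..<rho} t
   + ennreal (norm x powr p * t powr - p) * indicator {rho..} t"
  proof (cases "0 < t")
   case t: True
   show ?thesis
   proof (cases "t < rho")
    case True
    have "(K_functional J t x / t) powr p <= (integral {0..t} h / t) powr p"
     using t p K[OF t True] K_nonneg[of t x] by (intro powr_mono2 divide_right_mono) auto
    then show ?thesis using t True by (simp add: ennreal_leI)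
   next
    case False
    have "(K_functional J t x / t) powr p <= (norm x / t) powr p"
     using t p K_le_norm[of t x] K_nonneg[of t x] by (intro powr_mono2 divide_right_mono) auto
    also have "... = norm x powr p * t powr - p" using t by (simp add: powr_divide powr_minus_divide)
    finally show ?thesis using t False by (simp add: ennreal_leI)
   qed
  qed simp
 qed
 also have "... = (\<integral>\<^sup>+t. ennreal ((integral {0..t} h / t) powr p) * indicator {0<..<rho} t \<partial>lborel)
   + (\<integral>\<^sup>+t. ennreal (norm x powr p * t powr - p) * indicator {rho..} t \<partial>lborel)"
  by (rule nn_integral_add[OF m]) measurable
 also have "... <= ennreal (2 powr p / (p - 1) * LN0 p rho h powr p) + ennreal (norm x powr p * (-(rho powr (- p + 1)) / (- p + 1)))"
 proof (rule add_mono[OF hardy[OF p rho h h0] eq_refl])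
  show "(\<integral>\<^sup>+t. ennreal (norm x powr p * t powr - p) * indicator {rho..} t \<partial>lborel) = ennreal (norm x powr p * (-(rho powr (- p + 1)) / (- p + 1)))"
   by (rule nn_integral_has_integral_lebesgue'[OF _ I]) simp
 qed
 also have "- (rho powr (- p + 1)) / (- p + 1) = rho powr (1 - p) / (p - 1)"
  using minus_divide_divide[of "rho powr (1 - p)" "p - 1"] by simp
 also have "ennreal (2 powr p / (p - 1) * LN0 p rho h powr p) + ennreal (norm x powr p * (rho powr (1 - p) / (p - 1)))
   = ennreal (2 powr p / (p - 1) * LN0 p rho h powr p + norm x powr p * (rho powr (1 - p) / (p - 1)))"
  using p by (intro ennreal_plus[symmetric]) auto
 finally show ?thesis using p by (elim Kint_bound) (auto intro: that)
qed

end

section \<open>Traces of paths in X_gamma\<close>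

context interpolation_setting
begin

lemma linear_J: "linear J" by (rule bounded_linear.linear[OF J])

lemma LN_norm_sum:
 assumes "PL0 p rho w" "PL0 p rho g"
 shows "PL0 p rho (%s. norm (g s) + norm (w s))"
  "LN0 p rho (%s. norm (g s) + norm (w s)) <= LN0 p rho w + LN0 p rho g"
proof -
 have eq: "cut 0 rho (%s. norm (g s) + norm (w s)) = (%s. norm (cut 0 rho g s) + norm (cut 0 rho w s))"
  by (auto simp: cut_def)
 show "PL0 p rho (%s. norm (g s) + norm (w s))"
  "LN0 p rho (%s. norm (g s) + norm (w s)) <= LN0 p rho w + LN0 p rho g"
  unfolding eq using PL_add[OF p1 PL_norm(1)[OF assms(2)] PL_norm(1)[OF assms(1)]] by (simp_all add: PL_norm(2) add.commute)
qed

text \<open>\<open>x1\<close> is the mean of \<open>w\<close> over (0,r), so \<open>J x1\<close> is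
  the mean of \<open>u\<close>; the remainder is the mean of u(0) - u(s), controlled by the integral
  of the norm of \<open>g\<close>. Varying \<open>r\<close> serves every argument of the
  K-functional.\<close>

lemma evo_decomposition:
 assumes e: "evo rho u w g" and r: "0 < r" "r <= rho"
 obtains x0 x1 where "u 0 = x0 + J x1" "norm x0 <= integral {0..r} (%s. norm (g s))"
  "r * norm x1 <= integral {0..r} (%s. norm (w s))"
proof -
 note I = evo_integrable[OF e order_refl less_imp_le[OF r(1)] r(2)]
 define x1 where "x1 = (1 / r) *\<^sub>R integral {0..r} w"
 define N where "N = integral {0..r} (%s. norm (g s))"
 have "integral {0..r} u = integral {0..r} (%s. J (w s))"
  using evoD(4)[OF e] r by (intro integral_cong_AE_lebesgue) (auto elim!: eventually_mono)
 also have "... = J (integral {0..r} w)" using integral_linear[OF I(2) J] by (simp add: o_def)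
 finally have Iu: "integral {0..r} u = J (integral {0..r} w)" .
 have uc: "continuous_on {0..r} u" using evo_continuous[OF e] r by (auto intro: continuous_on_subset)
 have "integral {0..r} (%s. u 0 - u s) = r *\<^sub>R u 0 - integral {0..r} u"
  using r by (subst integral_diff) (auto intro: integrable_continuous_real uc)
 also have "... = r *\<^sub>R (u 0 - J x1)"
  using r by (simp add: x1_def Iu linear_scale[OF linear_J] scaleR_diff_right)
 finally have "r * norm (u 0 - J x1) = norm (integral {0..r} (%s. u 0 - u s))" using r by simp
 also have "... <= integral {0..r} (%s. N)"
 proof (rule integral_norm_bound_integral)
  show "(%s. u 0 - u s) integrable_on {0..r}" by (intro integrable_continuous_real continuous_intros uc)
  fix s assume s: "s \<in> {0..r}"
  have "norm (u 0 - u s) = norm (integral {0..s} g)"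
   using evo_diff_integral[OF e, of 0 s] s r norm_minus_commute[of "u 0" "u s"] by simp
  also have "... <= integral {0..s} (%s. norm (g s))" using evo_integrable(5)[OF e, of 0 s] s r by simp
  also have "... <= N" unfolding N_def using s r by (intro integral_subset_le evo_integrable(3)[OF e]) auto
  finally show "norm (u 0 - u s) <= N" .
 qed (rule integrable_continuous_real[OF continuous_on_const])
 also have "... = r * N" using r by simp
 finally have 1: "norm (u 0 - J x1) <= N" using r by simp
 have "r * norm x1 = norm (integral {0..r} w)" using r by (simp add: x1_def)
 also have "... <= integral {0..r} (%s. norm (w s))" by (rule integral_norm_bound_integral[OF I(2,4)]) simp
 finally show ?thesis using that[of "u 0 - J x1" x1] 1 by (simp add: N_def)
qed

text \<open>The norm of \<open>u 0\<close> in X_0 stays a separate term. On a short interval the L_p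
  terms are small while the coefficient of this term is large; the continuity of traces balances the
  two.\<close>

lemma trace_zero:
 assumes e: "evo rho u w g" and rho: "0 < rho"
 obtains z where "i z = u 0"
  "norm z powr p <= 2 powr p / (p - 1) * (LN0 p rho w + LN0 p rho g) powr p + norm (u 0) powr p * (rho powr (1 - p) / (p - 1))"
proof -
 define h where "h s = norm (g s) + norm (w s)" for s
 note L = LN_norm_sum[OF evoD(1,2)[OF e], folded h_def[abs_def]]
 have "K_functional J r (u 0) <= integral {0..r} h" if r: "0 < r" "r < rho" for r
 proof -
  obtain x0 x1 where x: "u 0 = x0 + J x1" "norm x0 <= integral {0..r} (%s. norm (g s))" "r * norm x1 <= integral {0..r} (%s. norm (w s))"
   by (rule evo_decomposition[OF e r(1) less_imp_le[OF r(2)]])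
  have "K_functional J r (u 0) <= norm x0 + r * norm x1" using r by (intro K_le x(1)) auto
  also have "... <= integral {0..r} (%s. norm (g s)) + integral {0..r} (%s. norm (w s))" using x by simp
  also have "... = integral {0..r} h" unfolding h_def
   using r by (intro integral_add[symmetric] evo_integrable(3,4)[OF e]) auto
  finally show ?thesis .
 qed
 then obtain z where z: "i z = u 0" "norm z powr p <= 2 powr p / (p - 1) * LN0 p rho h powr p + norm (u 0) powr p * (rho powr (1 - p) / (p - 1))"
  by (rule trace_estimate[OF rho L(1), rotated]) (auto simp: h_def)
 have "LN0 p rho h powr p <= (LN0 p rho w + LN0 p rho g) powr p"
  using L(2) p0 by (intro powr_mono2) auto
 then have "2 powr p / (p - 1) * LN0 p rho h powr p <= 2 powr p / (p - 1) * (LN0 p rho w + LN0 p rho g) powr p"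
  using p by (intro mult_left_mono) auto
 with z that[of z] show ?thesis by linarith
qed

lemma evo_norm_zero:
 assumes rho: "0 < rho"
 shows "\<exists>C>0. ALL u w g. evo rho u w g --> norm (u 0) <= C * (LN0 p rho w + LN0 p rho g)"
proof -
 obtain B where B: "0 < B" "!!x. norm (J x) <= norm x * B" using bounded_linear.pos_bounded[OF J] by blast
 define beta where "beta = B / rho"
 have beta: "0 < beta" using B rho by (simp add: beta_def)
 define C where "C = (rho + 1) * (1 + beta)"
 have "norm (u 0) <= C * (LN0 p rho w + LN0 p rho g)" if e: "evo rho u w g" for u w g
 proof -
  obtain x0 x1 where x: "u 0 = x0 + J x1" "norm x0 <= integral {0..rho} (%s. norm (g s))" "rho * norm x1 <= integral {0..rho} (%s. norm (w s))"
   by (rule evo_decomposition[OF e rho order_refl])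
  have g: "norm x0 <= (rho + 1) * LN0 p rho g" and w: "rho * norm x1 <= (rho + 1) * LN0 p rho w"
   using x PL_integral_norm(4)[OF p1 evoD(1)[OF e]] PL_integral_norm(4)[OF p1 evoD(2)[OF e]] rho by auto
  have "norm (u 0) <= norm x0 + norm x1 * B" unfolding x(1) by (rule norm_triangle_le) (use B(2) in auto)
  also have "... = norm x0 + (rho * norm x1) * beta" using rho by (simp add: beta_def)
  also have "... <= (rho + 1) * LN0 p rho g + ((rho + 1) * LN0 p rho w) * beta"
   using g w beta rho by (intro add_mono mult_right_mono) auto
  also have "... <= ((rho + 1) * LN0 p rho g) * (1 + beta) + ((rho + 1) * LN0 p rho w) * (1 + beta)"
  proof (rule add_mono)
   show "(rho + 1) * LN0 p rho g <= ((rho + 1) * LN0 p rho g) * (1 + beta)"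
    using beta rho mult_left_mono[of 1 "1 + beta" "(rho + 1) * LN0 p rho g"] by simp
   show "((rho + 1) * LN0 p rho w) * beta <= ((rho + 1) * LN0 p rho w) * (1 + beta)"
    using rho by (intro mult_left_mono) auto
  qed
  also have "... = C * (LN0 p rho w + LN0 p rho g)" by (simp add: C_def algebra_simps)
  finally show ?thesis .
 qed
 moreover have "0 < C" using beta rho by (simp add: C_def add_pos_pos)
 ultimately show ?thesis by blast
qed

lemma trace_zero_linear:
 assumes rho: "0 < rho"
 shows "\<exists>C>0. ALL u w g. evo rho u w g --> (EX z. i z = u 0 & norm z <= C * (LN0 p rho w + LN0 p rho g))"
proof -
 obtain D where D: "0 < D" "!!u w g. evo rho u w g ==> norm (u 0) <= D * (LN0 p rho w + LN0 p rho g)"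
  using evo_norm_zero[OF rho] by blast
 define E where "E = 2 powr p / (p - 1) + D powr p * (rho powr (1 - p) / (p - 1))"
 have E: "0 < E" using p D rho unfolding E_def by (intro add_pos_nonneg) auto
 have "EX z. i z = u 0 & norm z <= E powr (1/p) * (LN0 p rho w + LN0 p rho g)" if e: "evo rho u w g" for u w g
 proof -
  define X where "X = LN0 p rho w + LN0 p rho g"
  have X0: "0 <= X" by (simp add: X_def)
  obtain z where z: "i z = u 0" "norm z powr p <= 2 powr p / (p - 1) * X powr p + norm (u 0) powr p * (rho powr (1 - p) / (p - 1))"
   unfolding X_def by (rule trace_zero[OF e rho])
  have "norm (u 0) powr p <= (D * X) powr p" using D(2)[OF e] p0 by (intro powr_mono2) (auto simp: X_def)
  then have "norm (u 0) powr p * (rho powr (1 - p) / (p - 1)) <= D powr p * X powr p * (rho powr (1 - p) / (p - 1))"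
   using p D X0 by (intro mult_right_mono) (auto simp: powr_mult)
  then have "norm z powr p <= E * X powr p" using z(2) by (simp add: E_def algebra_simps)
  then have "(norm z powr p) powr (1/p) <= (E * X powr p) powr (1/p)" using p0 by (intro powr_mono2) auto
  then have "norm z <= E powr (1/p) * X" using p0 E X0 by (simp add: powr_powr powr_mult)
  then show ?thesis using z(1) by (auto simp: X_def)
 qed
 moreover have "0 < E powr (1/p)" using E by simp
 ultimately show ?thesis by blast
qed

lemma evo_window:
 assumes e: "evo a v w g" and t: "0 <= t" "t + rho <= a" "0 <= rho"
 shows "evo rho (%r. v (t + r)) (%r. w (t + r)) (%r. g (t + r))"
  "LN0 p rho (%r. w (t + r)) = LN p (cut t (t + rho) w)"
  "LN0 p rho (%r. g (t + r)) = LN p (cut t (t + rho) g)"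
  "LN p (cut t (t + rho) w) <= LN0 p a w" "LN p (cut t (t + rho) g) <= LN0 p a g"
proof -
 show "evo rho (%r. v (t + r)) (%r. w (t + r)) (%r. g (t + r))"
  by (rule evo_sub[OF evo_shift[OF e t(1)]]) (use t in auto)
 note S = PL_cut_sub[OF p0 evoD(1)[OF e] t(1,2)] PL_cut_sub[OF p0 evoD(2)[OF e] t(1,2)]
 show "LN p (cut t (t + rho) w) <= LN0 p a w" "LN p (cut t (t + rho) g) <= LN0 p a g" by (fact S)+
 show "LN0 p rho (%r. w (t + r)) = LN p (cut t (t + rho) w)"
  "LN0 p rho (%r. g (t + r)) = LN p (cut t (t + rho) g)"
  using PL_cut_shift(2)[OF p0, where s = 0 and t = rho and c = t and f = w] PL_cut_shift(2)[OF p0, where s = 0 and t = rho and c = t and f = g] S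
  by (simp_all add: add.commute)
qed

text \<open>Every time in the first half of the interval has a window of length a/2 to its right;
  the second half is reached by time reversal.\<close>

lemma trace_bound:
 assumes a: "0 < a"
 shows "\<exists>C>0. ALL v w g. evo a v w g --> (\<forall>t\<in>{0..a}. EX z. i z = v t & norm z <= C * (LN0 p a w + LN0 p a g))"
proof -
 have h: "0 < a / 2" using a by simp
 obtain C where C: "0 < C" "!!u w g. evo (a / 2) u w g ==> EX z. i z = u 0 & norm z <= C * (LN0 p (a / 2) w + LN0 p (a / 2) g)"
  using trace_zero_linear[OF h] by blast
 have first: "EX z. i z = v t & norm z <= C * (LN0 p a w + LN0 p a g)"
  if e: "evo a v w g" and t: "0 <= t" "t <= a / 2" for v w g t
 proof -
  have t2: "t + a / 2 <= a" using t by simp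
  note W = evo_window[OF e t(1) t2 less_imp_le[OF h]]
  obtain z where z: "i z = v t" "norm z <= C * (LN0 p (a / 2) (%r. w (t + r)) + LN0 p (a / 2) (%r. g (t + r)))"
   using C(2)[OF W(1)] by auto
  note z(2)
  also have "C * (LN0 p (a / 2) (%r. w (t + r)) + LN0 p (a / 2) (%r. g (t + r))) <= C * (LN0 p a w + LN0 p a g)"
   using W(2-5) a C(1) by (intro mult_left_mono add_mono) auto
  finally show ?thesis using z(1) by blast
 qed
 have "EX z. i z = v t & norm z <= C * (LN0 p a w + LN0 p a g)" if e: "evo a v w g" and t: "t \<in> {0..a}" for v w g t
 proof (cases "t <= a / 2")
  case True
  then show ?thesis using first[OF e, of t] t by auto
 next
  case False
  note R = evo_reverse[OF e less_imp_le[OF a]]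
  have "EX z. i z = v (a - (a - t)) & norm z <= C * (LN0 p a (%t. w (a - t)) + LN0 p a (%t. - g (a - t)))"
   using False t by (intro first[OF R(1)]) auto
  then show ?thesis unfolding R(2,3) by simp
 qed
 then show ?thesis using C(1) by blast
qed

text \<open>The difference of two windows of length \<open>rho\<close> of the same path is again a
  path, with initial value v(s) - v(t). First \<open>rho\<close> is chosen to make its L_p terms
  small, then |s - t| to make its initial value small in X_0.\<close>

lemma trace_continuous_half:
 assumes a: "0 < a" and e: "evo a v w g" and c: "!!t. t \<in> {0..a} ==> i (c t) = v t"
 shows "continuous_on {0..a / 2} c"
 unfolding continuous_on_iff
proof (intro ballI allI impI)
 fix t eta :: real assume t: "t \<in> {0..a / 2}" and eta: "0 < eta"
 define A where "A = 2 powr p / (p - 1)"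
 have A: "0 < A" using p by (simp add: A_def)
 \<comment> \<open>\<open>X\<close>, and \<open>Y\<close> below, are the sizes at which each of the
   two terms of \<open>trace_zero\<close> contributes \<open>eta powr p / 2\<close>.\<close>
 define X where "X = (eta powr p / (2 * A)) powr (1 / p)"
 have X: "0 < X" "A * X powr p = eta powr p / 2" using A eta p0 by (simp_all add: X_def powr_powr)
 have X4: "0 < X / 4" using X by simp
 obtain d1 where d1: "0 < d1" "!!s t. 0 <= s ==> s <= t ==> t <= a ==> t - s < d1 ==> LN p (cut s t w) < X / 4"
  using PL_uniform_small[OF p0 evoD(1)[OF e] X4] by blast
 obtain d2 where d2: "0 < d2" "!!s t. 0 <= s ==> s <= t ==> t <= a ==> t - s < d2 ==> LN p (cut s t g) < X / 4"
  using PL_uniform_small[OF p0 evoD(2)[OF e] X4] by blast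
 define rho where "rho = min (min (d1 / 2) (d2 / 2)) (a / 2)"
 have "0 < rho" "rho <= d1 / 2" "rho <= d2 / 2" "rho <= a / 2" using d1(1) d2(1) a by (auto simp: rho_def)
 then have rho: "0 < rho" "rho < d1" "rho < d2" "rho <= a / 2" using d1(1) d2(1) by linarith+
 define B where "B = rho powr (1 - p) / (p - 1)"
 have B: "0 < B" using p rho by (simp add: B_def)
 define Y where "Y = (eta powr p / (2 * B)) powr (1 / p)"
 have Y: "0 < Y" "Y powr p * B = eta powr p / 2" using B eta p0 by (simp_all add: Y_def powr_powr)
 have "t \<in> {0..a}" using t a by auto
 with evo_continuous[OF e] Y(1) obtain d3 where d3: "0 < d3" "!!s. s \<in> {0..a} ==> dist s t < d3 ==> dist (v s) (v t) < Y"
  unfolding continuous_on_iff by meson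
 have "dist (c s) (c t) < eta" if s: "s \<in> {0..a / 2}" "dist s t < d3" for s
 proof -
  have st: "0 <= s" "s + rho <= a" "0 <= t" "t + rho <= a" "s \<in> {0..a}" "t \<in> {0..a}" using s t rho a by auto
  note S = evo_window[OF e st(1,2) less_imp_le[OF rho(1)]] and T = evo_window[OF e st(3,4) less_imp_le[OF rho(1)]]
  note D = evo_diff[OF S(1) T(1)]
  obtain z where z: "i z = v (s + 0) - v (t + 0)"
   "norm z powr p <= A * (LN0 p rho (%r. w (s + r) - w (t + r)) + LN0 p rho (%r. g (s + r) - g (t + r))) powr p
     + norm (v (s + 0) - v (t + 0)) powr p * B"
   unfolding A_def B_def by (rule trace_zero[OF D rho(1)])
  have "i z = i (c s - c t)" using z(1) c st by (simp add: linear_diff[OF linear_i])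
  then have zc: "z = c s - c t" using inj_i by (simp add: inj_eq)
  have "LN0 p rho (%r. w (s + r) - w (t + r)) <= LN p (cut s (s + rho) w) + LN p (cut t (t + rho) w)"
   unfolding cut_diff using PL_diff(2)[OF p1 evoD(1)[OF S(1)] evoD(1)[OF T(1)]] S(2) T(2) rho(1) by simp
  moreover have "LN0 p rho (%r. g (s + r) - g (t + r)) <= LN p (cut s (s + rho) g) + LN p (cut t (t + rho) g)"
   unfolding cut_diff using PL_diff(2)[OF p1 evoD(2)[OF S(1)] evoD(2)[OF T(1)]] S(3) T(3) rho(1) by simp
  moreover have "LN p (cut s (s + rho) w) < X / 4" "LN p (cut t (t + rho) w) < X / 4"
   "LN p (cut s (s + rho) g) < X / 4" "LN p (cut t (t + rho) g) < X / 4"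
   using d1(2)[of s "s + rho"] d1(2)[of t "t + rho"] d2(2)[of s "s + rho"] d2(2)[of t "t + rho"] st rho by auto
  ultimately have "LN0 p rho (%r. w (s + r) - w (t + r)) + LN0 p rho (%r. g (s + r) - g (t + r)) <= X" by linarith
  then have "A * (LN0 p rho (%r. w (s + r) - w (t + r)) + LN0 p rho (%r. g (s + r) - g (t + r))) powr p <= A * X powr p"
   using A p0 by (intro mult_left_mono powr_mono2) auto
  moreover have "norm (v s - v t) powr p * B < Y powr p * B"
   using d3(2)[OF st(5) s(2)] B p0 by (intro mult_strict_right_mono powr_less_mono2) (auto simp: dist_norm)
  ultimately have "norm z powr p < eta powr p" using z(2) X(2) Y(2) by simp
  then have "norm z < eta" using eta p0 by (meson norm_ge_zero not_le powr_mono2 less_imp_le)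
  then show ?thesis by (simp add: zc dist_norm)
 qed
 then show "\<exists>d>0. \<forall>x'\<in>{0..a / 2}. dist x' t < d --> dist (c x') (c t) < eta" using d3(1) by blast
qed

lemma trace_continuous:
 assumes a: "0 < a" and e: "evo a v w g" and c: "!!t. t \<in> {0..a} ==> i (c t) = v t"
 shows "continuous_on {0..a} c"
proof -
 have 1: "continuous_on {0..a / 2} c" by (rule trace_continuous_half[OF assms])
 have "continuous_on {0..a / 2} (%t. c (a - t))"
  by (rule trace_continuous_half[OF a evo_reverse(1)[OF e less_imp_le[OF a]]]) (auto intro!: c)
 then have "continuous_on {a / 2..a} (%t. c (a - (a - t)))"
  by (rule continuous_on_compose2[where f = "%t. a - t"]) (auto intro!: continuous_intros)
 then have 2: "continuous_on {a / 2..a} c" by simp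
 have "{0..a} = {0..a / 2} \<union> {a / 2..a}" using a by auto
 then show ?thesis using continuous_on_closed_Un[OF closed_atLeastAtMost closed_atLeastAtMost 1 2] by simp
qed

text \<open>A path constant in time with value \<open>x\<close> in X_1 has trace \<open>J x\<close>,
  and its L_p norm over the unit interval is the norm of \<open>x\<close>; so the trace theorem
  contains the embedding of X_1 into X_gamma.\<close>

lemma incl_J: "i (incl J i x) = J x"
 and incl_bounded: "bounded_linear (incl J i)"
proof -
 obtain C where C: "0 < C" "!!u w g. evo 1 u w g ==> EX z. i z = u 0 & norm z <= C * (LN0 p 1 w + LN0 p 1 g)"
  using trace_zero_linear[of 1] by auto
 have ex: "EX z. i z = J x & norm z <= C * norm x" for x
 proof -
  have "evo 1 (%t. J x) (%t. x) (%t. J 0)" using evo_C1[of "%t. x" "%t. 0" 1] by auto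
  from C(2)[OF this] show ?thesis
   using PL_cut_const(2)[OF p0, of 0 1 x] PL_cut_const(2)[OF p0, of 0 1 "J 0"] linear_0[OF linear_J] by simp
 qed
 then have ij: "i (incl J i x) = J x" for x unfolding incl_def by (metis f_inv_into_f rangeI)
 then show "i (incl J i x) = J x" .
 have inj: "i y = i z ==> y = z" for y z using inj_i by (simp add: inj_eq)
 show "bounded_linear (incl J i)"
 proof (rule bounded_linear_intro[where K = C])
  show "incl J i (x + y) = incl J i x + incl J i y" for x y
   by (rule inj) (simp add: ij linear_add[OF linear_i] linear_add[OF linear_J])
  show "incl J i (r *\<^sub>R x) = r *\<^sub>R incl J i x" for r x
   by (rule inj) (simp add: ij linear_scale[OF linear_i] linear_scale[OF linear_J])
  show "norm (incl J i x) <= norm x * C" for x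
   using ex[of x] inj ij by (metis mult.commute)
 qed
qed

end

section \<open>Extension of interpolation elements to paths\<close>

context interpolation_setting
begin

lemma K_quotient_mono:
 assumes "0 < s" "s <= t"
 shows "K_functional J t x / t <= K_functional J s x / s"
proof (rule field_le_epsilon)
 fix e :: real assume e: "0 < e"
 then have "0 < e * s" using assms by simp
 then obtain x0 x1 where x: "x = x0 + J x1" "norm x0 + s * norm x1 < K_functional J s x + e * s" by (rule K_approx)
 have "K_functional J t x / t <= (norm x0 + t * norm x1) / t"
  using assms by (intro divide_right_mono K_le x(1)) auto
 also have "... = norm x0 / t + norm x1" using assms by (simp add: add_divide_distrib)
 also have "... <= norm x0 / s + norm x1" using assms by (intro add_right_mono divide_left_mono) auto
 also have "... = (norm x0 + s * norm x1) / s" using assms by (simp add: add_divide_distrib)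
 also have "... <= (K_functional J s x + e * s) / s" using x(2) assms by (intro divide_right_mono) auto
 also have "... = K_functional J s x / s + e" using assms by (simp add: add_divide_distrib)
 finally show "K_functional J t x / t <= K_functional J s x / s + e" .
qed

lemma K_quotient_PL:
 "PL0 p 1 (%t. K_functional J t (i z) / t)" "LN0 p 1 (%t. K_functional J t (i z) / t) <= norm z"
proof -
 define kappa where "kappa t = K_functional J t (i z) / t" for t
 have eq: "cut 0 1 kappa = (%t. (indicator {0<..} t * kappa t powr p) powr (1 / p) * indicator {0<..<1} t)"
 proof
  fix t
  show "cut 0 1 kappa t = (indicator {0<..} t * kappa t powr p) powr (1 / p) * indicator {0<..<1} t"
  proof (cases "0 < t & t < 1")
   case True
   then have "0 <= kappa t" using K_nonneg[of t "i z"] by (simp add: kappa_def)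
   then show ?thesis using True p0 by (simp add: cut_def powr_powr)
  qed (auto simp: cut_def)
 qed
 have m: "(%t. indicator {0<..} t * kappa t powr p) \<in> borel_measurable borel" unfolding kappa_def by (rule K_measurable)
 have "(%t. (indicator {0<..} t * kappa t powr p) powr (1 / p) * indicator {0<..<1} t) \<in> borel_measurable borel"
  using m by measurable
 then have "cut 0 1 kappa \<in> borel_measurable lborel" unfolding eq by simp
 then have sm: "SM (cut 0 1 kappa)" by (intro SM_real measurable_completion)
 have "(\<integral>\<^sup>+t. ennreal (norm (cut 0 1 kappa t) powr p) \<partial>lebesgue) <= Kint (i z)"
  unfolding nn_integral_completion Kint_def
 proof (rule nn_integral_mono)
  fix t
  show "ennreal (norm (cut 0 1 kappa t) powr p) <= ennreal ((K_functional J t (i z) / t) powr p) * indicator {0<..} t"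
  proof (cases "0 < t & t < 1")
   case True
   then show ?thesis using K_nonneg[of t "i z"] by (simp add: cut_def kappa_def)
  qed (use p0 in \<open>auto simp: cut_def\<close>)
 qed
 also have "... = ennreal (norm z powr p)" by (rule Kint_i)
 finally have "PL0 p 1 kappa & LN0 p 1 kappa <= norm z" using PL_iff[OF p0 norm_ge_zero, of "cut 0 1 kappa" z] sm by blast
 then show "PL0 p 1 (%t. K_functional J t (i z) / t)" "LN0 p 1 (%t. K_functional J t (i z) / t) <= norm z"
  unfolding kappa_def by auto
qed

text \<open>As K(t)/t decreases, its L_p norm over (0,s) is at least its value at \<open>s\<close>
  times \<open>s powr (1 / p)\<close>. The rate makes the X_0-parts of near-optimal decompositions
  vanish as \<open>s\<close> tends to 0.\<close>

lemma K_le_powr: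
 assumes s: "0 < s" "s <= 1"
 shows "K_functional J s (i z) <= norm z * s powr (1 - 1 / p)"
proof -
 define kappa where "kappa t = K_functional J t (i z) / t" for t
 note Kp = K_quotient_PL[of z, folded kappa_def[abs_def]]
 have kappa0: "0 <= kappa t" if "0 < t" for t unfolding kappa_def using that K_nonneg[of t "i z"] by simp
 have "LN0 p s (%_. kappa s) <= LN0 p 1 kappa"
 proof (rule PL_mono(2)[OF p0 _ Kp(1)])
  show "SM (cut 0 s (%_. kappa s))" using PL_cut_const(1)[OF p0, of 0 s "kappa s"] s by (intro PL_SM) auto
  have "kappa s <= kappa t" if "0 < t" "t < s" for t unfolding kappa_def using that by (intro K_quotient_mono) auto
  then show "AE t in lebesgue. norm (cut 0 s (%_. kappa s) t) <= norm (cut 0 1 kappa t)"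
   using s kappa0[of s] by (intro always_eventually allI) (force simp: cut_def)
 qed
 then have "kappa s * s powr (1 / p) <= norm z" using PL_cut_const(2)[OF p0, of 0 s "kappa s"] s kappa0[of s] Kp(2) by simp
 then have "kappa s * s powr (1 / p) * s powr (1 - 1 / p) <= norm z * s powr (1 - 1 / p)" by (intro mult_right_mono) auto
 moreover have "kappa s * s powr (1 / p) * s powr (1 - 1 / p) = kappa s * (s powr (1 / p) * s powr (1 - 1 / p))" by simp
 moreover have "s powr (1 / p) * s powr (1 - 1 / p) = s" using s by (simp add: powr_add[symmetric])
 ultimately show ?thesis using s by (simp add: kappa_def)
qed

lemma dyadic_index:
 fixes t :: real
 assumes "0 < t" "t <= 1"
 obtains n where "(1/2) ^ Suc n < t" "t <= (1/2) ^ n"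
proof -
 define P where "P n \<longleftrightarrow> (1/2) ^ Suc n < t" for n
 obtain m where "(1/2) ^ m < t" using real_arch_pow_inv[OF assms(1), of "1/2"] by auto
 then have "P m" unfolding P_def by (simp add: power_Suc) (use assms in \<open>auto intro: order.strict_trans1[rotated]\<close>)
 then have "P (LEAST n. P n)" by (rule LeastI)
 moreover have "t <= (1/2) ^ (LEAST n. P n)"
 proof (cases "LEAST n. P n")
  case (Suc k)
  then have "\<not> P k" using not_less_Least[of k P] by simp
  then have "t <= (1/2) ^ Suc k" unfolding P_def by (simp only: not_less)
  then show ?thesis unfolding Suc .
 qed (use assms in simp)
 ultimately show ?thesis using that unfolding P_def by blast
qed

text \<open>The extension interpolates near-optimal decompositions \<open>x = a\<^sub>n + J b\<^sub>n\<close> at the times \<open>2\<^sup>-\<^sup>n\<close>.\<close>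

lemma extension:
 "\<exists>C>0. ALL z. EX v w g. evo 1 v w g & v 0 = i z & LN0 p 1 w <= C * norm z & LN0 p 1 g <= C * norm z"
proof -
 obtain Theta theta :: "real => real" where T: "!!x. (Theta has_real_derivative theta x) (at x)" "continuous_on UNIV theta" "!!x. 0 <= theta x"
  "!!x. x <= -1 ==> Theta x = 0" "!!x. 1 <= x ==> Theta x = 1" "!!x. 1 <= \<bar>x\<bar> ==> theta x = 0"
  by (rule smooth_step_exists) blast
 have mono: "Theta x <= Theta y" if "x <= y" for x y
  using DERIV_nonneg_imp_nondecreasing[OF that, of Theta] T(1,3) by blast
 have Theta01: "0 <= Theta x" "Theta x <= 1" for x
  using mono[of "min x (-1)" x] T(4)[of "min x (-1)"] mono[of x "max x 1"] T(5)[of "max x 1"] by auto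
 have "bounded (theta ` {-1..1})" using T(2) by (intro compact_imp_bounded compact_continuous_image continuous_on_subset[OF T(2)]) auto
 then obtain T0 where T0: "\<forall>x\<in>theta ` {-1..1}. norm x <= T0" by (auto simp: bounded_iff)
 define T1 where "T1 = max 1 (4 * T0)"
 \<comment> \<open>A cutoff equal to 1 up to 1/2 and to 0 from 1 on: the affine map sends [1/2,1]
   onto the transition interval [-1,1] of \<open>Theta\<close>.\<close>
 define tau tau' where "tau s = 1 - Theta (4 * s - 3)" and "tau' s = - 4 * theta (4 * s - 3)" for s
 have taud: "(tau has_real_derivative tau' s) (at s)" for s
 proof -
  have "((%s. 4 * s - 3) has_real_derivative 4) (at s)" by (auto intro!: derivative_eq_intros)
  from DERIV_chain2[OF T(1) this] show ?thesis
   unfolding tau_def[abs_def] tau'_def by (auto intro!: derivative_eq_intros)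
 qed
 have tau'c: "continuous_on UNIV tau'"
  unfolding tau'_def[abs_def] by (intro continuous_intros continuous_on_compose2[OF T(2)]) auto
 have tau1: "tau s = 1" "tau' s = 0" if "s <= 1/2" for s using that T(4)[of "4 * s - 3"] T(6)[of "4 * s - 3"] by (auto simp: tau_def tau'_def)
 have tau0: "tau s = 0" "tau' s = 0" if "1 <= s" for s using that T(5)[of "4 * s - 3"] T(6)[of "4 * s - 3"] by (auto simp: tau_def tau'_def)
 have taub: "0 <= tau s" "tau s <= 1" for s using Theta01[of "4 * s - 3"] by (auto simp: tau_def)
 have tau'b: "\<bar>tau' s\<bar> <= T1" for s
 proof (cases "1 <= \<bar>4 * s - 3\<bar>")
  case True then show ?thesis using T(6)[OF True] by (simp add: tau'_def T1_def)
 next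
  case False
  then have "-1 <= 4 * s - 3" "4 * s - 3 <= 1" by linarith+
  then have "norm (theta (4 * s - 3)) <= T0" using T0 by simp
  then show ?thesis by (simp add: tau'_def T1_def)
 qed
 \<comment> \<open>Both \<open>w\<close> and the derivative will be bounded pointwise by
   \<open>T1\<close> times \<open>3 * kappa t + 2 * norm z\<close>, and the L_p norm of
   \<open>kappa\<close> on (0,1) is at most \<open>norm z\<close>.\<close>
 define C where "C = 5 * T1"
 have T1: "1 <= T1" by (simp add: T1_def)
 have "EX v w g. evo 1 v w g & v 0 = i z & LN0 p 1 w <= C * norm z & LN0 p 1 g <= C * norm z" for z
 proof (cases "z = 0")
  case True
  have "evo 1 (%t. J 0) (%t. 0) (%t. J 0)" using evo_C1[of "%t. 0" "%t. 0" 1] by auto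
  moreover have "J 0 = i z" using True linear_0[OF linear_J] linear_0[OF linear_i] by simp
  moreover have "cut 0 1 (%t. J 0) = (%t. 0)" "cut 0 1 (%t::real. 0::'b) = (%t. 0)"
   using linear_0[OF linear_J] by (auto simp: cut_def)
  ultimately show ?thesis using True by (intro exI[of _ "%t. J 0"] exI[of _ "%t. 0"]) simp
 next
  case False
  then have z: "0 < norm z" by simp
  define x where "x = i z"
  define s where "s n = (1/2::real) ^ n" for n
  have s: "0 < s n" "s (Suc n) = s n / 2" "s n <= 1" "s 0 = 1" for n by (auto simp: s_def power_le_one)
  have s_mono: "s m <= s n" if "n <= m" for m n using that by (simp add: s_def power_decreasing)
  define kappa where "kappa t = K_functional J t x / t" for t
  have "EX ab. x = fst ab + J (snd ab) & norm (fst ab) + s n * norm (snd ab) < K_functional J (s n) x + s n * norm z" for n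
  proof -
   have "0 < s n * norm z" using s(1) z by simp
   then obtain x0 x1 where "x = x0 + J x1" "norm x0 + s n * norm x1 < K_functional J (s n) x + s n * norm z" by (rule K_approx)
   then show ?thesis by (intro exI[of _ "(x0, x1)"]) simp
  qed
  then obtain ab where ab: "!!n. x = fst (ab n) + J (snd (ab n))"
   "!!n. norm (fst (ab n)) + s n * norm (snd (ab n)) < K_functional J (s n) x + s n * norm z" by metis
  define a where "a n = fst (ab n)" for n
  define b where "b n = snd (ab n)" for n
  have xab: "x = a n + J (b n)" and nab: "norm (a n) + s n * norm (b n) <= K_functional J (s n) x + s n * norm z" for n
   using ab[of n] by (auto simp: a_def b_def)
  have an: "norm (a n) <= s n * (kappa (s n) + norm z)" and bn: "norm (b n) <= kappa (s n) + norm z" for n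
  proof -
   have e: "K_functional J (s n) x + s n * norm z = s n * (kappa (s n) + norm z)" using s(1)[of n] by (simp add: kappa_def distrib_left)
   have "0 <= s n * norm (b n)" using s(1)[of n] by simp
   then show "norm (a n) <= s n * (kappa (s n) + norm z)" using nab[of n] unfolding e by linarith
   have "s n * norm (b n) <= s n * (kappa (s n) + norm z)" using nab[of n] norm_ge_zero[of "a n"] unfolding e by linarith
   then show "norm (b n) <= kappa (s n) + norm z" using s(1)[of n] by simp
  qed
  \<comment> \<open>Telescoping form of the interpolation: for \<open>t\<close> between
    \<open>s (Suc n)\<close> and \<open>s n\<close> the terms before \<open>n\<close> are fully
    switched on and those after \<open>n\<close> switched off. The cut at \<open>N\<close> keeps the
    function of class C^1 down to 0, where its value is \<open>b N\<close>.\<close>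
  define wN where "wN N t = b 0 + (\<Sum>k<N. tau (t / s k) *\<^sub>R (b (Suc k) - b k))" for N t
  define hN where "hN N t = (\<Sum>k<N. (tau' (t / s k) / s k) *\<^sub>R (b (Suc k) - b k))" for N t
  have wN_d: "(wN N has_vector_derivative hN N t) (at t)" for N t
  proof -
   have "((%t. tau (t / s k) *\<^sub>R (b (Suc k) - b k)) has_vector_derivative (tau' (t / s k) / s k) *\<^sub>R (b (Suc k) - b k)) (at t)" for k
   proof -
    have "((%t. t / s k) has_real_derivative 1 / s k) (at t)" by (rule DERIV_cdivide[OF DERIV_ident])
    from DERIV_chain2[OF taud this] have "((%t. tau (t / s k)) has_real_derivative tau' (t / s k) / s k) (at t)" by simp
    then show ?thesis using has_vector_derivative_scaleR[OF _ has_vector_derivative_const] by fastforce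
   qed
   then have "((%t. b 0 + (\<Sum>k<N. tau (t / s k) *\<^sub>R (b (Suc k) - b k))) has_vector_derivative 0 + (\<Sum>k<N. (tau' (t / s k) / s k) *\<^sub>R (b (Suc k) - b k))) (at t)"
    by (intro has_vector_derivative_add has_vector_derivative_const has_vector_derivative_sum) auto
   then show ?thesis by (simp add: wN_def[abs_def] hN_def)
  qed
  have hN_c: "continuous_on UNIV (hN N)" for N
   unfolding hN_def[abs_def] using s(1) by (intro continuous_intros continuous_on_compose2[OF tau'c]) (auto simp: less_imp_neq[symmetric])
  have evN: "evo 1 (%t. J (wN N t)) (wN N) (%t. J (hN N t))" for N
   by (rule evo_C1[OF wN_d hN_c]) simp
  have stab: "wN N t = b n + tau (t / s n) *\<^sub>R (b (Suc n) - b n)" "hN N t = (tau' (t / s n) / s n) *\<^sub>R (b (Suc n) - b n)"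
   if t: "s (Suc n) < t" "t <= s n" and N: "Suc n <= N" for N n t
  proof -
   have lo: "t / s k <= 1/2" if "k < n" for k
   proof -
    have "t <= s (Suc k)" using t(2) s_mono[of "Suc k" n] that by simp
    then show ?thesis using s(1)[of k] s(2)[of k] by (simp add: divide_le_eq)
   qed
   have hi: "1 <= t / s k" if "n < k" for k
   proof -
    have "s k <= t" using t(1) s_mono[of "Suc n" k] that by simp
    then show ?thesis using s(1)[of k] by (simp add: le_divide_eq)
   qed
   have r: "(\<Sum>k<N. f k) = (\<Sum>k<Suc n. f k)" if "!!k. n < k ==> f k = 0" for f :: "nat => 'b"
    using that N by (intro sum.mono_neutral_right) auto
   have "(\<Sum>k<N. tau (t / s k) *\<^sub>R (b (Suc k) - b k)) = (\<Sum>k<Suc n. tau (t / s k) *\<^sub>R (b (Suc k) - b k))"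
    by (rule r) (simp add: tau0[OF hi])
   also have "... = (\<Sum>k<n. b (Suc k) - b k) + tau (t / s n) *\<^sub>R (b (Suc n) - b n)"
    by (simp add: tau1[OF lo])
   also have "(\<Sum>k<n. b (Suc k) - b k) = b n - b 0" by (rule sum_lessThan_telescope)
   finally show "wN N t = b n + tau (t / s n) *\<^sub>R (b (Suc n) - b n)" by (simp add: wN_def)
   have "hN N t = (\<Sum>k<Suc n. (tau' (t / s k) / s k) *\<^sub>R (b (Suc k) - b k))"
    unfolding hN_def by (rule r) (simp add: tau0[OF hi])
   then show "hN N t = (tau' (t / s n) / s n) *\<^sub>R (b (Suc n) - b n)" by (simp add: tau1[OF lo])
  qed
  have h0: "hN N t = 0" if "t <= s N" for N t
   unfolding hN_def
  proof (rule sum.neutral, rule ballI)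
   fix k assume "k \<in> {..<N}"
   then have "t <= s (Suc k)" using that s_mono[of "Suc k" N] by simp
   then have "t / s k <= 1/2" using s(1)[of k] s(2)[of k] by (simp add: divide_le_eq)
   then show "(tau' (t / s k) / s k) *\<^sub>R (b (Suc k) - b k) = 0" by (simp add: tau1)
  qed
  define w where "w t = lim (%N. wN N t)" for t
  define h where "h t = lim (%N. hN N t)" for t
  have idx: "EX n. s (Suc n) < t & t <= s n" if "0 < t" "t <= 1" for t
   using dyadic_index[OF that] unfolding s_def by metis
  have ev: "w t = wN N t" "h t = hN N t" if t: "t <= 1" "s N < t" for t N
  proof -
   obtain n where n: "s (Suc n) < t" "t <= s n" using idx[of t] s(1)[of N] t by force
   have "n < N" using n t s_mono[of N n] by (meson leD le_less_linear less_le_trans)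
   then have N: "Suc n <= N" by simp
   have st: "wN M t = wN N t" "hN M t = hN N t" if M: "N <= M" for M
    using stab[OF n N] stab[OF n le_trans[OF N M]] by simp_all
   have "(%M. wN M t) \<longlonglongrightarrow> wN N t"
    by (rule tendsto_eventually, rule eventually_sequentiallyI[of N], rule st(1))
   then show "w t = wN N t" unfolding w_def by (rule limI)
   have "(%M. hN M t) \<longlonglongrightarrow> hN N t"
    by (rule tendsto_eventually, rule eventually_sequentiallyI[of N], rule st(2))
   then show "h t = hN N t" unfolding h_def by (rule limI)
  qed
  have s0: "s \<longlonglongrightarrow> 0" unfolding s_def[abs_def] by (rule LIMSEQ_realpow_zero) auto
  have big: "EX N. s N < t" if "0 < t" for t
   using order_tendstoD(2)[OF s0 that] by (auto simp: eventually_sequentially)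
  have bounds: "norm (w t) <= 3 * kappa t + 2 * norm z" "norm (J (h t)) <= T1 * (2 * kappa t + 2 * norm z)" if t: "0 < t" "t <= 1" for t
  proof -
   obtain n where n: "s (Suc n) < t" "t <= s n" using idx[OF t] by blast
   have kappa1: "kappa (s n) <= kappa t" unfolding kappa_def using t n by (intro K_quotient_mono) auto
   have kappa0: "0 <= kappa t" unfolding kappa_def using t K_nonneg[of t x] by simp
   have kappa2: "kappa (s (Suc n)) <= 2 * kappa t"
   proof -
    have "kappa (s (Suc n)) <= K_functional J t x / s (Suc n)"
     unfolding kappa_def using n s(1)[of "Suc n"] by (intro divide_right_mono K_mono) auto
    also have "... <= K_functional J t x / (t / 2)"
     using n s(2)[of n] t K_nonneg[of t x] s(1)[of n] by (intro divide_left_mono) auto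
    finally show ?thesis by (simp add: kappa_def mult.commute)
   qed
   have w: "w t = b n + tau (t / s n) *\<^sub>R (b (Suc n) - b n)" "h t = (tau' (t / s n) / s n) *\<^sub>R (b (Suc n) - b n)"
    using ev[OF t(2) n(1)] stab[OF n order_refl] by auto
   have "w t = (1 - tau (t / s n)) *\<^sub>R b n + tau (t / s n) *\<^sub>R b (Suc n)" unfolding w by (simp add: algebra_simps)
   also have "norm ... <= (1 - tau (t / s n)) * norm (b n) + tau (t / s n) * norm (b (Suc n))"
    using norm_triangle_ineq[of "(1 - tau (t / s n)) *\<^sub>R b n" "tau (t / s n) *\<^sub>R b (Suc n)"] taub[of "t / s n"] by simp
   also have "... <= 1 * norm (b n) + 1 * norm (b (Suc n))"
    using taub[of "t / s n"] by (intro add_mono mult_right_mono) auto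
   also have "... <= 3 * kappa t + 2 * norm z" using bn[of n] bn[of "Suc n"] kappa1 kappa2 by simp
   finally show "norm (w t) <= 3 * kappa t + 2 * norm z" .
   have "J (b (Suc n) - b n) = a n - a (Suc n)"
    using xab[of n] xab[of "Suc n"] by (simp add: linear_diff[OF linear_J] algebra_simps)
   then have Jh: "J (h t) = (tau' (t / s n) / s n) *\<^sub>R (a n - a (Suc n))" unfolding w by (simp add: linear_scale[OF linear_J])
   have "norm (a n - a (Suc n)) <= norm (a n) + norm (a (Suc n))" by (rule norm_triangle_ineq4)
   also have "... <= s n * (kappa t + norm z) + s (Suc n) * (2 * kappa t + norm z)"
    using an[of n] an[of "Suc n"] kappa1 kappa2 s(1)[of n] s(1)[of "Suc n"]
    by (intro add_mono order_trans[OF an] mult_left_mono) auto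
   also have "... <= s n * (2 * kappa t + 2 * norm z)" using s(1)[of n] kappa0 z by (simp add: s(2) algebra_simps)
   finally have a: "norm (a n - a (Suc n)) <= s n * (2 * kappa t + 2 * norm z)" .
   have "norm (J (h t)) = \<bar>tau' (t / s n)\<bar> * (norm (a n - a (Suc n)) / s n)" unfolding Jh using s(1)[of n] by simp
   also have "... <= T1 * (2 * kappa t + 2 * norm z)"
    using tau'b[of "t / s n"] a s(1)[of n] T1 by (intro mult_mono) (auto simp: divide_le_eq mult.commute)
   finally show "norm (J (h t)) <= T1 * (2 * kappa t + 2 * norm z)" .
  qed
  have Kp: "PL0 p 1 kappa" "LN0 p 1 kappa <= norm z" using K_quotient_PL[of z] unfolding kappa_def x_def by auto
  have maj: "PL0 p 1 (%t. 3 * kappa t + 2 * norm z)" "LN0 p 1 (%t. 3 * kappa t + 2 * norm z) <= 5 * norm z"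
  proof -
   have eq: "cut 0 1 (%t. 3 * kappa t + 2 * norm z) = (%t. 3 *\<^sub>R cut 0 1 kappa t + cut 0 1 (%t. 2 * norm z) t)" by (auto simp: cut_def)
   note A = PL_scale[OF p0 Kp(1), of 3] and B = PL_cut_const[OF p0, of 0 1 "2 * norm z"]
   show "PL0 p 1 (%t. 3 * kappa t + 2 * norm z)" unfolding eq using PL_add(1)[OF p1 A(1) B(1)] by simp
   show "LN0 p 1 (%t. 3 * kappa t + 2 * norm z) <= 5 * norm z"
    unfolding eq using PL_add(2)[OF p1 A(1) B(1)] A(2) B(2) Kp(2) by simp
  qed
  have ptw: "AE t in lebesgue. (%N. cut 0 1 (wN N) t) \<longlonglongrightarrow> cut 0 1 w t" "AE t in lebesgue. (%N. cut 0 1 (%t. J (hN N t)) t) \<longlonglongrightarrow> cut 0 1 (%t. J (h t)) t"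
  proof -
   have "(%N. cut 0 1 (wN N) t) \<longlonglongrightarrow> cut 0 1 w t & (%N. cut 0 1 (%t. J (hN N t)) t) \<longlonglongrightarrow> cut 0 1 (%t. J (h t)) t" for t
   proof (cases "0 < t & t < 1")
    case True
    then obtain N where N: "s N < t" using big by blast
    then have "wN M t = w t" "hN M t = h t" if "M \<ge> N" for M
     using ev[of t M] True s_mono[OF that] by auto
    then show ?thesis using True
     by (intro conjI tendsto_eventually eventually_sequentiallyI[of N]) (simp_all add: cut_def)
   qed (auto simp: cut_def)
   then show "AE t in lebesgue. (%N. cut 0 1 (wN N) t) \<longlonglongrightarrow> cut 0 1 w t" "AE t in lebesgue. (%N. cut 0 1 (%t. J (hN N t)) t) \<longlonglongrightarrow> cut 0 1 (%t. J (h t)) t"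
    by auto
  qed
  have smw: "SM (cut 0 1 w)" by (rule SM_lim[OF PL_SM[OF evoD(1)[OF evN]] ptw(1)])
  have smh: "SM (cut 0 1 (%t. J (h t)))" by (rule SM_lim[OF PL_SM[OF evoD(2)[OF evN]] ptw(2)])
  have wb: "PL0 p 1 w & LN0 p 1 w <= 1 * LN0 p 1 (%t. 3 * kappa t + 2 * norm z)"
  proof (rule PL_bound[OF p0 smw maj(1)])
   show "AE t in lebesgue. norm (cut 0 1 w t) <= 1 * norm (cut 0 1 (%t. 3 * kappa t + 2 * norm z) t)"
    by (intro always_eventually allI) (use bounds(1) in \<open>force simp: cut_def\<close>)
  qed simp
  have hb: "PL0 p 1 (%t. J (h t)) & LN0 p 1 (%t. J (h t)) <= T1 * LN0 p 1 (%t. 3 * kappa t + 2 * norm z)"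
  proof (rule PL_bound[OF p0 smh maj(1)])
   have "norm (J (h t)) <= T1 * norm (3 * kappa t + 2 * norm z)" if t: "0 < t" "t < 1" for t
   proof -
    have "0 <= kappa t" unfolding kappa_def using t K_nonneg[of t x] by simp
    then have "T1 * (2 * kappa t + 2 * norm z) <= T1 * norm (3 * kappa t + 2 * norm z)" using T1 by (intro mult_left_mono) auto
    then show ?thesis using bounds(2)[of t] t by simp
   qed
   then show "AE t in lebesgue. norm (cut 0 1 (%t. J (h t)) t) <= T1 * norm (cut 0 1 (%t. 3 * kappa t + 2 * norm z) t)"
    by (intro always_eventually allI) (simp add: cut_def)
  qed (use T1 in simp)
  \<comment> \<open>The value at 0 is prescribed, because \<open>w\<close> need not converge in X_1
    as t tends to 0.\<close>
  define v where "v t = (if t <= 0 then x else J (w t))" for t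
  have hint: "(%t. J (h t)) integrable_on {0..1}" using PL_integral_norm(1)[OF p1 conjunct1[OF hb]] by simp
  define H where "H t = integral {0..t} (%t. J (h t))" for t
  have Hc: "continuous_on {0..1} H" unfolding H_def[abs_def] by (rule indefinite_integral_continuous_1[OF hint])
  \<comment> \<open>The X_0-parts \<open>a N\<close> tend to 0, which identifies the initial value
    of the limit.\<close>
  have Js: "(%N. J (b N)) \<longlonglongrightarrow> x"
  proof -
   have "(%N. a N) \<longlonglongrightarrow> 0"
   proof (rule Lim_null_comparison)
    show "\<forall>\<^sub>F N in sequentially. norm (a N) <= K_functional J (s N) x + s N * norm z"
    proof (intro always_eventually allI)
     fix N
     have "0 <= s N * norm (b N)" using s(1)[of N] by simp
     then show "norm (a N) <= K_functional J (s N) x + s N * norm z" using nab[of N] by linarith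
    qed
    have "(%N. K_functional J (s N) x) \<longlonglongrightarrow> 0"
    proof (rule Lim_null_comparison)
     show "\<forall>\<^sub>F N in sequentially. norm (K_functional J (s N) x) <= norm z * s N powr (1 - 1 / p)"
      using K_le_powr s(1,3) K_nonneg by (intro always_eventually allI) (simp add: x_def less_imp_le)
     have "(%N. s N powr (1 - 1 / p)) \<longlonglongrightarrow> 0 powr (1 - 1 / p)"
      using p s(1) by (intro tendsto_powr' s0 tendsto_const) (auto simp: less_imp_le)
     then show "(%N. norm z * s N powr (1 - 1 / p)) \<longlonglongrightarrow> 0" using tendsto_mult_left[of _ 0 sequentially "norm z"] by simp
    qed
    then show "(%N. K_functional J (s N) x + s N * norm z) \<longlonglongrightarrow> 0"
     using tendsto_add[OF _ tendsto_mult_left[OF s0, of "norm z"], of _ 0] by (simp add: mult.commute)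
   qed
   then have "(%N. x - a N) \<longlonglongrightarrow> x - 0" by (intro tendsto_intros)
   moreover have "x - a N = J (b N)" for N using xab[of N] by (metis add_diff_cancel_left')
   ultimately show ?thesis by simp
  qed
  have main: "v t = x + H t" if t: "0 < t" "t <= 1" for t
  proof -
   have eq: "J (w t) = J (b N) + H t - H (s N)" if N: "s N < t" for N
   proof -
    have b0: "wN N 0 = b N"
    proof -
     have "wN N 0 = b 0 + (\<Sum>k<N. b (Suc k) - b k)" by (simp add: wN_def tau1)
     then show ?thesis using sum_lessThan_telescope[of b N] by simp
    qed
    have sN: "0 <= s N" "s N <= t" using s(1)[of N] N by auto
    have "J (wN N t) = J (wN N 0) + integral {0..t} (%t. J (hN N t))" using evoD(3)[OF evN, of t] t by simp
    also have "integral {0..t} (%t. J (hN N t)) = integral {0..s N} (%t. J (hN N t)) + integral {s N..t} (%t. J (hN N t))"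
     using evo_integrable(1)[OF evN, of 0 t] t by (intro Henstock_Kurzweil_Integration.integral_combine[symmetric] sN) auto
    also have "integral {0..s N} (%t. J (hN N t)) = integral {0..s N} (%t. 0)"
     using h0 linear_0[OF linear_J] by (intro integral_cong) simp
    also have "integral {s N..t} (%t. J (hN N t)) = integral {s N..t} (%t. J (h t))"
    proof (rule integral_spike[of "{s N}"])
     fix r assume "r \<in> {s N..t} - {s N}"
     then have "r <= 1" "s N < r" using t by auto
     then show "J (h r) = J (hN N r)" by (simp add: ev(2))
    qed simp
    also have "... = H t - H (s N)"
     using Henstock_Kurzweil_Integration.integral_combine[OF sN, of "%t. J (h t)"] integrable_subinterval_real[OF hint, of 0 t] t
     by (simp add: H_def algebra_simps)
    finally show ?thesis using ev(1)[OF t(2) N] b0 by simp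
   qed
   have "(%N. H (s N)) \<longlonglongrightarrow> H 0"
    by (rule continuous_on_tendsto_compose[OF Hc s0]) (simp_all add: s(3) less_imp_le[OF s(1)])
   then have "(%N. J (b N) + H t - H (s N)) \<longlonglongrightarrow> x + H t - H 0" by (intro tendsto_intros Js)
   moreover have "\<forall>\<^sub>F N in sequentially. J (b N) + H t - H (s N) = J (w t)"
    using order_tendstoD(2)[OF s0 t(1)] by eventually_elim (rule eq[symmetric])
   ultimately have "J (w t) = x + H t - H 0"
    using tendsto_unique[OF _ tendsto_eventually] by (metis sequentially_bot)
   then show ?thesis using t by (simp add: v_def H_def)
  qed
  have "evo 1 v w (%t. J (h t))"
   unfolding evo_def
  proof (intro conjI ballI)
   show "PL0 p 1 w" "PL0 p 1 (%t. J (h t))" using wb hb by auto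
   have v0: "v 0 = x" by (simp add: v_def)
   show "v t = v 0 + integral {0..t} (%t. J (h t))" if "t \<in> {0..1}" for t
   proof (cases "t = 0")
    case False
    then show ?thesis using main[of t] that v0 by (simp add: H_def)
   qed simp
  qed (simp add: v_def)
  moreover have "v 0 = i z" by (simp add: v_def x_def)
  moreover have "LN0 p 1 w <= C * norm z"
  proof -
   have "LN0 p 1 w <= 1 * (5 * norm z)" using wb maj(2) by simp
   also have "... <= T1 * (5 * norm z)" using T1 by (intro mult_right_mono) auto
   finally show ?thesis by (simp add: C_def)
  qed
  moreover have "LN0 p 1 (%t. J (h t)) <= C * norm z"
  proof -
   have "LN0 p 1 (%t. J (h t)) <= T1 * (5 * norm z)"
    using hb mult_left_mono[OF maj(2), of T1] T1 by linarith
   then show ?thesis by (simp add: C_def mult.left_commute)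
  qed
  ultimately show ?thesis by blast
 qed
 then show ?thesis using T1 by (intro exI[of _ C]) (auto simp: C_def)
qed

end

text \<open>Function spaces carry no norm type class; this makes their seminormed subspaces accessible to the closed graph theorem.\<close>

instantiation "fun" :: (type, real_vector) real_vector
begin

definition scaleR_fun_def: "scaleR c f = (%x. c *\<^sub>R f x)"

instance by intro_classes (auto simp: scaleR_fun_def fun_eq_iff algebra_simps)

end

section \<open>Closed graph theorem for seminormed spaces\<close>

text \<open>Zabreiko's lemma. Baire's theorem enters through the nested balls in the first step.\<close>

lemma zabreiko:
 fixes S :: "'x::real_vector set" and N q :: "'x => real"
 assumes S: "subspace S"
  and N_add: "!!x y. x \<in> S ==> y \<in> S ==> N (x + y) <= N x + N y" and N_scale: "!!x c. x \<in> S ==> N (c *\<^sub>R x) = \<bar>c\<bar> * N x"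
  and q_add: "!!x y. x \<in> S ==> y \<in> S ==> q (x + y) <= q x + q y" and q_scale: "!!x c. x \<in> S ==> q (c *\<^sub>R x) = \<bar>c\<bar> * q x"
  and N0: "!!x. x \<in> S ==> 0 <= N x" and q0: "!!x. x \<in> S ==> 0 <= q x"
  and compl: "!!x. (!!n::nat. x n \<in> S) ==> summable (%n. N (x n)) ==> \<exists>y\<in>S. (%n. N (y - (\<Sum>k<n. x k))) \<longlonglongrightarrow> 0"
  and csub: "!!x y. (!!n::nat. x n \<in> S) ==> y \<in> S ==> (%n. N (y - (\<Sum>k<n. x k))) \<longlonglongrightarrow> 0 ==> summable (%n. q (x n)) ==> q y <= (\<Sum>n. q (x n))"
 shows "\<exists>C>0. \<forall>x\<in>S. q x <= C * N x"
proof -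
 have Sd: "x \<in> S ==> y \<in> S ==> x - y \<in> S" and Sa: "x \<in> S ==> y \<in> S ==> x + y \<in> S" and Sc: "x \<in> S ==> c *\<^sub>R x \<in> S" for x y c
  using S by (auto intro: subspace_diff subspace_add subspace_scale)
 have N_minus: "N (x - y) = N (y - x)" if "x \<in> S" "y \<in> S" for x y
  using N_scale[of "y - x" "-1"] Sd[OF that(2,1)] by simp
 have N_tri: "N (x - z) <= N (x - y) + N (y - z)" if "x \<in> S" "y \<in> S" "z \<in> S" for x y z
  using N_add[OF Sd[OF that(1,2)] Sd[OF that(2,3)]] by simp
 have N_diff: "N (x - y) <= N x + N y" if "x \<in> S" "y \<in> S" for x y
  using N_tri[OF that(1) subspace_0[OF S] that(2)] N_minus[OF subspace_0[OF S] that(2)] by simp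
 have N_00: "N 0 = 0" using N_scale[of 0 0] subspace_0[OF S] by simp
 have q_00: "q 0 = 0" using q_scale[of 0 0] subspace_0[OF S] by simp
 \<comment> \<open>Some sublevel set of \<open>q\<close> is dense in some ball. Otherwise nested
   balls, the n-th of them avoiding the sublevel set of height n, would have a common point at which
   \<open>q\<close> exceeds every number.\<close>
 have "EX n. \<exists>x\<in>S. \<exists>r>0. \<forall>y\<in>S. N (y - x) < r --> (\<forall>rho>0. \<exists>a\<in>S. N (a - y) < rho & q a <= real n)"
 proof (rule ccontr)
  assume nt: "\<not> ?thesis"
  have step: "\<exists>y\<in>S. \<exists>rho>0. N (y - x) < r & (\<forall>a\<in>S. N (a - y) < rho --> real n < q a)" if x: "x \<in> S" "0 < r" for n x r
  proof (rule ccontr)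
   assume no: "\<not> ?thesis"
   have "\<exists>a\<in>S. N (a - y) < rho & q a <= real n" if "y \<in> S" "N (y - x) < r" "0 < rho" for y rho
   proof (rule ccontr)
    assume "\<not> ?thesis"
    then have "\<forall>a\<in>S. N (a - y) < rho --> real n < q a" by (auto simp: not_le)
    with no that show False by blast
   qed
   with nt x show False by blast
  qed
  have "EX f. ALL n. (fst (f n) \<in> S & 0 < snd (f n)) &
    (N (fst (f (Suc n)) - fst (f n)) < snd (f n) / 4 & snd (f (Suc n)) <= snd (f n) / 2 &
     (\<forall>a\<in>S. N (a - fst (f (Suc n))) < snd (f (Suc n)) --> real n < q a))"
  proof (rule dependent_nat_choice)
   show "EX x. fst x \<in> S & 0 < (snd x :: real)" using subspace_0[OF S] by (intro exI[of _ "(0, 1)"]) simp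
   fix x :: "'x \<times> real" and n assume x: "fst x \<in> S & 0 < snd x"
   then obtain y rho where y: "y \<in> S" "0 < rho" "N (y - fst x) < snd x / 4" "\<forall>a\<in>S. N (a - y) < rho --> real n < q a"
    using step[of "fst x" "snd x / 4" n] by auto
   show "EX y. (fst y \<in> S & 0 < snd y) & (N (fst y - fst x) < snd x / 4 & snd y <= snd x / 2 & (\<forall>a\<in>S. N (a - fst y) < snd y --> real n < q a))"
    using x y by (intro exI[of _ "(y, min rho (snd x / 2))"]) auto
  qed
  then obtain f where f: "!!n. fst (f n) \<in> S & 0 < snd (f n)"
    "!!n. N (fst (f (Suc n)) - fst (f n)) < snd (f n) / 4" "!!n. snd (f (Suc n)) <= snd (f n) / 2"
    "!!n a. a \<in> S ==> N (a - fst (f (Suc n))) < snd (f (Suc n)) ==> real n < q a" by blast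
  define X where "X n = fst (f n)" for n
  define R where "R n = snd (f n)" for n
  have X: "X n \<in> S" and R: "0 < R n" and XX: "N (X (Suc n) - X n) < R n / 4" and RR: "R (Suc n) <= R n / 2" for n
   using f(1-3)[of n] by (auto simp: X_def R_def)
  have far: "real n < q a" if "a \<in> S" "N (a - X (Suc n)) < R (Suc n)" for n a using f(4) that by (auto simp: X_def R_def)
  have Rn: "R n <= R 0 * (1/2) ^ n" for n
  proof (induction n)
   case (Suc n) then show ?case using RR[of n] by simp
  qed simp
  have near: "N (X (n + k) - X n) <= R n / 2 - R (n + k) / 2" for n k
  proof (induction k)
   case 0 then show ?case using N_00 by simp
  next
   case (Suc k)
   have "N (X (n + Suc k) - X n) <= N (X (Suc (n + k)) - X (n + k)) + N (X (n + k) - X n)" using N_tri[OF X X X] by simp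
   then show ?case using Suc XX[of "n + k"] RR[of "n + k"] by simp
  qed
  define d where "d n = X (Suc n) - X n" for n
  have "summable (%n. N (d n))"
  proof (rule summable_comparison_test')
   show "summable (%n. R 0 * (1/2) ^ n / 4)" by (intro summable_divide summable_mult summable_geometric) simp
   fix n
   show "norm (N (d n)) <= R 0 * (1/2) ^ n / 4"
    using XX[of n] Rn[of n] N0[OF Sd[OF X X], of "Suc n" n] by (simp add: d_def)
  qed
  then obtain y0 where y0: "y0 \<in> S" "(%n. N (y0 - (\<Sum>k<n. d k))) \<longlonglongrightarrow> 0" using compl[of d] Sd[OF X X] unfolding d_def by blast
  define y where "y = y0 + X 0"
  have y: "y \<in> S" using y0 X Sa by (simp add: y_def)
  have tele: "(\<Sum>k<n. d k) = X n - X 0" for n unfolding d_def by (rule sum_lessThan_telescope)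
  have lim: "(%n. N (y - X n)) \<longlonglongrightarrow> 0" using y0(2) unfolding tele y_def by (simp add: algebra_simps)
  have "N (y - X n) < R n" for n
  proof -
   have "N (y - X n) <= 0 + R n / 2"
   proof (rule LIMSEQ_le_const[of "%k. N (y - X (n + k)) + R n / 2"])
    show "(%k. N (y - X (n + k)) + R n / 2) \<longlonglongrightarrow> 0 + R n / 2"
     using LIMSEQ_ignore_initial_segment[OF lim, of n] by (intro tendsto_intros) (simp add: add.commute)
    show "EX M. \<forall>k\<ge>M. N (y - X n) <= N (y - X (n + k)) + R n / 2"
    proof (intro exI allI impI)
     fix k
     show "N (y - X n) <= N (y - X (n + k)) + R n / 2"
      using N_tri[OF y X X, of n "n + k"] near[of n k] R[of "n + k"] by simp
    qed
   qed
   then show ?thesis using R[of n] by simp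
  qed
  then have "real n < q y" for n using far[OF y] by blast
  then show False using reals_Archimedean2[of "q y"] by (metis less_asym)
 qed
 then obtain n x0 r where x0: "x0 \<in> S" "0 < r"
  and dense: "!!y rho. y \<in> S ==> N (y - x0) < r ==> 0 < rho ==> \<exists>a\<in>S. N (a - y) < rho & q a <= real n" by blast
 \<comment> \<open>By symmetry and convexity of sublevel sets the centre of the ball moves to 0:
   half the difference of approximants of \<open>x0 + z\<close> and \<open>x0 - z\<close>
   approximates \<open>z\<close>.\<close>
 have dense0: "\<exists>a\<in>S. N (z - a) < rho & q a <= real n" if z: "z \<in> S" "N z < r" and rho: "0 < rho" for z rho
 proof -
  have 1: "x0 + z \<in> S" "N (x0 + z - x0) < r" "x0 - z \<in> S" "N (x0 - z - x0) < r"
   using x0 z Sa Sd N_scale[of z "-1"] by auto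
  obtain a where a: "a \<in> S" "N (a - (x0 + z)) < rho" "q a <= real n" using dense[OF 1(1,2) rho] by blast
  obtain b where b: "b \<in> S" "N (b - (x0 - z)) < rho" "q b <= real n" using dense[OF 1(3,4) rho] by blast
  define c where "c = (1/2) *\<^sub>R (a - b)"
  have c: "c \<in> S" using a b Sc Sd by (simp add: c_def)
  have "q (a - b) <= q a + q b" using q_add[of a "- b"] q_scale[of b "-1"] a b Sc[of b "-1"] by simp
  then have qc: "q c <= real n" using q_scale[OF Sd[OF a(1) b(1)], of "1/2"] a b by (simp add: c_def)
  have "z = (1/2) *\<^sub>R z + (1/2) *\<^sub>R z" by (simp add: scaleR_add_left[symmetric])
  then have "c - z = (1/2) *\<^sub>R ((a - (x0 + z)) - (b - (x0 - z)))"
   unfolding c_def by (simp add: algebra_simps)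
  then have "N (c - z) = 1/2 * N ((a - (x0 + z)) - (b - (x0 - z)))"
   using N_scale[OF Sd[OF Sd[OF a(1) 1(1)] Sd[OF b(1) 1(3)]], of "1/2"] by simp
  also have "N ((a - (x0 + z)) - (b - (x0 - z))) <= N (a - (x0 + z)) + N (b - (x0 - z))"
   by (rule N_diff[OF Sd[OF a(1) 1(1)] Sd[OF b(1) 1(3)]])
  finally have "N (c - z) < rho" using a(2) b(2) by simp
  then show ?thesis using c qc N_minus[OF z(1) c] by (intro bexI[of _ c]) auto
 qed
 \<comment> \<open>Successive approximation: each remainder is doubled and approximated anew, so
   \<open>z\<close> is a sum of terms 2^-k a_k with q(a_k) <= n, and countable subadditivity gives 2
   n.\<close>
 have bnd: "q z <= 2 * real n" if z: "z \<in> S" "N z < r" for z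
 proof -
  have "EX f. ALL k. (fst (f k) \<in> S & N (fst (f k)) < r & snd (f k) \<in> S & q (snd (f k)) <= real n & N (fst (f k) - snd (f k)) < r / 2 & (k = 0 --> fst (f k) = z)) &
    fst (f (Suc k)) = 2 *\<^sub>R (fst (f k) - snd (f k))"
  proof (rule dependent_nat_choice)
   show "EX x. fst x \<in> S & N (fst x) < r & snd x \<in> S & q (snd x) <= real n & N (fst x - snd x) < r / 2 & (0 = (0::nat) --> fst x = z)"
    using dense0[OF z, of "r / 2"] x0(2) z by auto
   fix x :: "'x \<times> 'x" and k :: nat
   assume x: "fst x \<in> S & N (fst x) < r & snd x \<in> S & q (snd x) <= real n & N (fst x - snd x) < r / 2 & (k = 0 --> fst x = z)"
   define z' where "z' = 2 *\<^sub>R (fst x - snd x)"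
   have "z' \<in> S" "N z' < r" using x Sc Sd N_scale[of "fst x - snd x" 2] by (auto simp: z'_def)
   then show "EX y. (fst y \<in> S & N (fst y) < r & snd y \<in> S & q (snd y) <= real n & N (fst y - snd y) < r / 2 & (Suc k = 0 --> fst y = z)) &
      fst y = 2 *\<^sub>R (fst x - snd x)"
    using dense0[of z' "r / 2"] x0(2) unfolding z'_def by auto
  qed
  then obtain f where f: "!!k. fst (f k) \<in> S" "!!k. N (fst (f k)) < r" "!!k. snd (f k) \<in> S" "!!k. q (snd (f k)) <= real n"
   "fst (f 0) = z" "!!k. fst (f (Suc k)) = 2 *\<^sub>R (fst (f k) - snd (f k))" by blast
  define a where "a k = (1/2) ^ k *\<^sub>R snd (f k)" for k
  have aS: "a k \<in> S" for k using f(3) Sc by (simp add: a_def)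
  have rem: "z - (\<Sum>k<m. a k) = (1/2) ^ m *\<^sub>R fst (f m)" for m
  proof (induction m)
   case (Suc m)
   have "z - (\<Sum>k<Suc m. a k) = (1/2) ^ m *\<^sub>R fst (f m) - a m" using Suc by (simp add: algebra_simps)
   also have "... = (1/2) ^ m *\<^sub>R (fst (f m) - snd (f m))" by (simp add: a_def scaleR_diff_right)
   also have "... = (1/2) ^ Suc m *\<^sub>R fst (f (Suc m))" unfolding f(6) by simp
   finally show ?case .
  qed (simp add: f(5))
  have "(%m. N (z - (\<Sum>k<m. a k))) \<longlonglongrightarrow> 0"
  proof (rule Lim_null_comparison)
   show "\<forall>\<^sub>F m in sequentially. norm (N (z - (\<Sum>k<m. a k))) <= (1/2) ^ m * r"
    using N_scale[OF f(1)] N0[OF f(1)] f(2) by (intro always_eventually allI) (simp add: rem less_imp_le)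
   show "(%m. (1/2) ^ m * r) \<longlonglongrightarrow> 0" by (rule tendsto_mult_left_zero[OF LIMSEQ_realpow_zero]) auto
  qed
  moreover have qa: "q (a k) <= (1/2) ^ k * real n" for k using q_scale[OF f(3)] f(4)[of k] by (simp add: a_def mult_left_mono)
  moreover have sg: "summable (%k. (1/2) ^ k * real n)" by (intro summable_mult2 summable_geometric) simp
  moreover have "summable (%k. q (a k))"
   by (rule summable_comparison_test'[OF sg]) (use qa q0[OF aS] in auto)
  ultimately have "q z <= (\<Sum>k. q (a k))" "(\<Sum>k. q (a k)) <= (\<Sum>k. (1/2) ^ k * real n)"
   using csub[of a z] aS z(1) by (auto intro: suminf_le)
  moreover have "(\<Sum>k. (1/2) ^ k * real n) = 2 * real n"
   using suminf_mult2[OF summable_geometric, of "1/2" "real n"] suminf_geometric[of "1/2::real"] by simp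
  ultimately show ?thesis by simp
 qed
 have "q x <= (4 * real n / r + 1) * N x" if x: "x \<in> S" for x
 proof (cases "N x = 0")
  case True
  have "q x = 0"
  proof (rule ccontr)
   assume "q x ~= 0"
   then have qx: "0 < q x" using q0[OF x] by simp
   define c where "c = (2 * real n + 1) / q x"
   have "N (c *\<^sub>R x) < r" using N_scale[OF x, of c] True x0(2) by simp
   from bnd[OF Sc[OF x] this] have "\<bar>c\<bar> * q x <= 2 * real n" using q_scale[OF x, of c] by simp
   moreover have "\<bar>c\<bar> * q x = 2 * real n + 1" using qx by (simp add: c_def)
   ultimately show False by simp
  qed
  then show ?thesis using True by simp
 next
  case False
  then have Nx: "0 < N x" using N0[OF x] by simp
  define c where "c = r / (2 * N x)"
  have c: "0 < c" using Nx x0 by (simp add: c_def)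
  have "N (c *\<^sub>R x) < r" using N_scale[OF x, of c] Nx x0(2) by (simp add: c_def)
  from bnd[OF Sc[OF x] this] have "c * q x <= 2 * real n" using q_scale[OF x, of c] c by simp
  then have "q x <= 4 * real n / r * N x" using c Nx x0(2) by (simp add: c_def field_simps)
  then show ?thesis using Nx by (simp add: distrib_right)
 qed
 moreover have "0 < 4 * real n / r + 1" using x0(2) by (simp add: add_nonneg_pos)
 ultimately show ?thesis by blast
qed

section \<open>Linear problems and maximal regularity\<close>

context interpolation_setting
begin

definition sol :: "('b => 'a) => real => (real => 'a) => (real => 'b) => (real => 'a) => bool" where
 "sol B a v w f \<longleftrightarrow> evo a v w (%t. f t - B (w t)) & PL0 p a f"

lemma PL_cut_linear:
 assumes "bounded_linear L" "PL p (cut a b f)"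
 shows "PL p (cut a b (%t. L (f t)))" "LN p (cut a b (%t. L (f t))) <= onorm L * LN p (cut a b f)"
proof -
 have eq: "cut a b (%t. L (f t)) = (%t. L (cut a b f t))"
  by (rule cut_linear) (rule linear_0[OF bounded_linear.linear[OF assms(1)]])
 show "PL p (cut a b (%t. L (f t)))" "LN p (cut a b (%t. L (f t))) <= onorm L * LN p (cut a b f)"
  unfolding eq using PL_linear[OF p0 assms] by auto
qed

lemma sol_evo: "sol B a v w f ==> evo a v w (%t. f t - B (w t))" and sol_PL: "sol B a v w f ==> PL0 p a f"
 by (auto simp: sol_def)

lemma sol_deriv_bound:
 assumes "bounded_linear B" "sol B a v w f"
 shows "LN0 p a (%t. f t - B (w t)) <= LN0 p a f + onorm B * LN0 p a w"
 unfolding cut_diff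
 using PL_diff(2)[OF p1 sol_PL[OF assms(2)] PL_cut_linear(1)[OF assms(1) evoD(1)[OF sol_evo[OF assms(2)]]]]
  PL_cut_linear(2)[OF assms(1) evoD(1)[OF sol_evo[OF assms(2)]]] by linarith

lemma sol_add:
 assumes B: "bounded_linear B" and s: "sol B a v1 w1 f1" "sol B a v2 w2 f2"
 shows "sol B a (%t. v1 t + v2 t) (%t. w1 t + w2 t) (%t. f1 t + f2 t)"
proof -
 have "evo a (%t. v1 t + v2 t) (%t. w1 t + w2 t) (%t. f1 t - B (w1 t) + (f2 t - B (w2 t)))"
  by (rule evo_add[OF sol_evo[OF s(1)] sol_evo[OF s(2)]])
 then have "evo a (%t. v1 t + v2 t) (%t. w1 t + w2 t) (%t. (f1 t + f2 t) - B (w1 t + w2 t))"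
  by (simp add: linear_add[OF bounded_linear.linear[OF B]] algebra_simps)
 then show ?thesis unfolding sol_def cut_add using PL_add(1)[OF p1 sol_PL[OF s(1)] sol_PL[OF s(2)]] by simp
qed

lemma sol_scale:
 assumes B: "bounded_linear B" and s: "sol B a v w f"
 shows "sol B a (%t. c *\<^sub>R v t) (%t. c *\<^sub>R w t) (%t. c *\<^sub>R f t)"
proof -
 have "evo a (%t. c *\<^sub>R v t) (%t. c *\<^sub>R w t) (%t. c *\<^sub>R (f t - B (w t)))" by (rule evo_scale[OF sol_evo[OF s]])
 then have "evo a (%t. c *\<^sub>R v t) (%t. c *\<^sub>R w t) (%t. c *\<^sub>R f t - B (c *\<^sub>R w t))"
  by (simp add: linear_scale[OF bounded_linear.linear[OF B]] scaleR_diff_right)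
 then show ?thesis unfolding sol_def using PL_cut_linear(1)[OF bounded_linear_scaleR_right sol_PL[OF s], of c] by simp
qed

lemma sol_diff:
 assumes B: "bounded_linear B" and s: "sol B a v1 w1 f1" "sol B a v2 w2 f2"
 shows "sol B a (%t. v1 t - v2 t) (%t. w1 t - w2 t) (%t. f1 t - f2 t)"
 using sol_add[OF B s(1) sol_scale[OF B s(2), of "-1"]] by simp

lemma sol_of_evo:
 assumes B: "bounded_linear B" and e: "evo a v w g"
 shows "sol B a v w (%t. g t + B (w t))"
 unfolding sol_def cut_add
 using PL_add(1)[OF p1 evoD(2)[OF e] PL_cut_linear(1)[OF B evoD(1)[OF e]]] e by simp

lemma sol_cong:
 assumes s: "sol B a v w f" and v: "!!t. t \<in> {0..a} ==> v' t = v t"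
  and w: "AE t in lebesgue. 0 < t & t < a --> w' t = w t" and f: "AE t in lebesgue. 0 < t & t < a --> f' t = f t"
 shows "sol B a v' w' f'"
 unfolding sol_def
proof
 show "evo a v' w' (%t. f' t - B (w' t))"
 proof (rule evo_cong[OF sol_evo[OF s] v w])
  show "AE t in lebesgue. 0 < t & t < a --> f' t - B (w' t) = f t - B (w t)" using w f by eventually_elim simp
 qed
 have "AE t in lebesgue. 0 < t & t < a --> f t = f' t" using f by eventually_elim simp
 then show "PL0 p a f'" using PL_AE_cong(1)[OF p0 sol_PL[OF s] cut_cong_AE] by blast
qed

lemma sol_sub: "sol B a v w f ==> b <= a ==> sol B b v w f"
 unfolding sol_def using evo_sub PL_cut_sub(1)[OF p0, of 0 a f 0 b] by auto

lemma sol_shift: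
 assumes s: "sol B a v w f" and r: "0 <= r" "r <= a"
 shows "sol B (a - r) (%t. v (r + t)) (%t. w (r + t)) (%t. f (r + t))"
 unfolding sol_def
proof
 show "evo (a - r) (%t. v (r + t)) (%t. w (r + t)) (%t. f (r + t) - B (w (r + t)))"
  by (rule evo_shift[OF sol_evo[OF s] r])
 show "PL0 p (a - r) (%t. f (r + t))"
  using PL_cut_sub(1)[OF p0 sol_PL[OF s] r(1) order_refl] by (simp add: PL_cut_shift(1)[OF p0])
qed

lemma sol_join:
 assumes s: "sol B a v1 w1 f1" "sol B b v2 w2 f2" and ab: "0 <= a" "0 <= b" and eq: "v2 0 = v1 a"
 shows "sol B (a + b) (join a v1 v2) (join a w1 w2) (join a f1 f2)"
 unfolding sol_def
proof
 have "join a (%t. f1 t - B (w1 t)) (%t. f2 t - B (w2 t)) = (%t. join a f1 f2 t - B (join a w1 w2 t))"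
  by (auto simp: join_def)
 then show "evo (a + b) (join a v1 v2) (join a w1 w2) (%t. join a f1 f2 t - B (join a w1 w2 t))"
  using evo_join[OF sol_evo[OF s(1)] sol_evo[OF s(2)] ab eq] by simp
 show "PL0 p (a + b) (join a f1 f2)" by (rule PL_cut_joined(1)[OF ab sol_PL[OF s(1)] sol_PL[OF s(2)]])
qed

text \<open>The closed graph of the solution map with zero initial value. Convergence of the data
  and of the \<open>W n\<close> in L_p makes the derivatives converge in L_p, hence the paths
  converge pointwise in X_0 to the integral of the limit.\<close>

lemma sol_limit:
 assumes B: "bounded_linear B" and a: "0 <= a" and s: "!!n::nat. sol B a (V n) (W n) (F n)" and V0: "!!n. V n 0 = 0"
  and F: "PL0 p a f" "(%n. LN0 p a (%t. f t - F n t)) \<longlonglongrightarrow> 0"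
  and W: "PL0 p a w" "(%n. LN0 p a (%t. w t - W n t)) \<longlonglongrightarrow> 0"
  and ae: "AE t in lebesgue. 0 < t & t < a --> (%n. W n t) \<longlonglongrightarrow> w t"
 shows "sol B a (%t. integral {0..t} (%t. f t - B (w t))) w f"
 unfolding sol_def
proof
 define g where "g t = f t - B (w t)" for t
 define G where "G n t = F n t - B (W n t)" for n t
 have g: "PL0 p a g" unfolding g_def[abs_def] cut_diff by (rule PL_diff(1)[OF p1 F(1) PL_cut_linear(1)[OF B W(1)]])
 note e = sol_evo[OF s, folded G_def]
 have gG: "PL0 p a (%t. g t - G n t)" for n
  unfolding cut_diff by (rule PL_diff(1)[OF p1 g evoD(2)[OF e]])
 have bound: "LN0 p a (%t. g t - G n t) <= LN0 p a (%t. f t - F n t) + onorm B * LN0 p a (%t. w t - W n t)" for n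
 proof -
  have eq: "(%t. g t - G n t) = (%t. (f t - F n t) - B (w t - W n t))"
   by (auto simp: g_def G_def linear_diff[OF bounded_linear.linear[OF B]])
  have 1: "PL0 p a (%t. f t - F n t)" "PL0 p a (%t. w t - W n t)"
   unfolding cut_diff by (rule PL_diff(1)[OF p1 F(1) sol_PL[OF s]], rule PL_diff(1)[OF p1 W(1) evoD(1)[OF e]])
  show ?thesis unfolding eq cut_diff[of _ _ "%t. f t - F n t"]
   using PL_diff(2)[OF p1 1(1) PL_cut_linear(1)[OF B 1(2)]] PL_cut_linear(2)[OF B 1(2)] by linarith
 qed
 have conv: "(%n. V n t) \<longlonglongrightarrow> integral {0..t} g" if t: "t \<in> {0..a}" for t
 proof -
  have t': "0 <= t" "t <= a" using t by auto
  have "(%n. V n t - integral {0..t} g) \<longlonglongrightarrow> 0"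
  proof (rule Lim_null_comparison)
   show "(%n. (t - 0 + 1) * (LN0 p a (%t. f t - F n t) + onorm B * LN0 p a (%t. w t - W n t))) \<longlonglongrightarrow> 0"
    using tendsto_mult_left[OF tendsto_add[OF F(2) tendsto_mult_left[OF W(2), of "onorm B"]], of "t - 0 + 1"] by simp
   show "\<forall>\<^sub>F n in sequentially. norm (V n t - integral {0..t} g) <= (t - 0 + 1) * (LN0 p a (%t. f t - F n t) + onorm B * LN0 p a (%t. w t - W n t))"
   proof (intro always_eventually allI)
    fix n
    have S: "PL0 p t (%t. g t - G n t)" "LN0 p t (%t. g t - G n t) <= LN0 p a (%t. g t - G n t)"
     using PL_cut_sub[OF p0 gG order_refl t'(2)] by auto
    have gi: "g integrable_on {0..t}" using PL_integral_norm(1)[OF p1 PL_cut_sub(1)[OF p0 g order_refl t'(2)] t'(1)] .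
    have "V n t = integral {0..t} (G n)" using evoD(3)[OF e t, of n] V0[of n] by simp
    then have "V n t - integral {0..t} g = - integral {0..t} (%t. g t - G n t)"
     using integral_diff[OF gi evo_integrable(1)[OF e order_refl t'], of n] by simp
    then have "norm (V n t - integral {0..t} g) = norm (integral {0..t} (%t. g t - G n t))" by simp
    also have "... <= (t - 0 + 1) * LN0 p t (%t. g t - G n t)"
     using PL_integral_norm(3,4)[OF p1 S(1) t'(1)] by linarith
    also have "... <= (t - 0 + 1) * (LN0 p a (%t. f t - F n t) + onorm B * LN0 p a (%t. w t - W n t))"
     using t' S(2) bound[of n] by (intro mult_left_mono) auto
    finally show "norm (V n t - integral {0..t} g) <= (t - 0 + 1) * (LN0 p a (%t. f t - F n t) + onorm B * LN0 p a (%t. w t - W n t))" .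
   qed
  qed
  then show ?thesis by (simp add: LIM_zero_iff)
 qed
 have aen: "AE t in lebesgue. 0 < t & t < a --> V n t = J (W n t)" for n by (rule evoD(4)[OF e])
 have alln: "AE t in lebesgue. ALL n. 0 < t & t < a --> V n t = J (W n t)" unfolding AE_all_countable by (rule allI) (rule aen)
 have ae2: "AE t in lebesgue. 0 < t & t < a --> integral {0..t} g = J (w t)"
  using alln ae
 proof (eventually_elim, intro impI)
  fix t assume el: "ALL n. 0 < t & t < a --> V n t = J (W n t)" "0 < t & t < a --> (%n. W n t) \<longlonglongrightarrow> w t" and t: "0 < t & t < a"
  have l1: "(%n. J (W n t)) \<longlonglongrightarrow> J (w t)" by (rule bounded_linear.tendsto[OF J mp[OF el(2) t]])
  have eqn: "(%n. V n t) = (%n. J (W n t))" by (rule ext) (rule mp[OF spec[OF el(1)] t])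
  have "t \<in> {0..a}" using t by auto
  from conv[OF this] have l2: "(%n. J (W n t)) \<longlonglongrightarrow> integral {0..t} g" unfolding eqn .
  show "integral {0..t} g = J (w t)" by (rule LIMSEQ_unique[OF l2 l1])
 qed
 have z: "integral {0..0} g = 0" by (rule integral_unique) (rule has_integral_refl(1)[of g 0, unfolded cbox_interval])
 have int: "\<forall>t\<in>{0..a}. integral {0..t} g = integral {0..0} g + integral {0..t} g"
  by (intro ballI) (simp only: z add_0_left)
 have "evo a (%t. integral {0..t} g) w g"
  unfolding evo_def by (rule conjI[OF W(1) conjI[OF g conjI[OF int ae2]]])
 moreover have "(%t. f t - B (w t)) = g" by (rule ext) (simp only: g_def)
 ultimately show "evo a (%t. integral {0..t} (%t. f t - B (w t))) w (%t. f t - B (w t))" by simp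
qed (rule F(1))

definition LS :: "('b => 'a) => real => real => bool" where
 "LS B a M \<longleftrightarrow> bounded_linear B & 0 < a & 0 < M &
   (ALL z f. PL0 p a f --> (EX v w. sol B a v w f & v 0 = i z)) &
   (ALL v w f z. sol B a v w f --> v 0 = i z -->
    LN0 p a w <= M * (norm z + LN0 p a f) &
    (\<forall>t\<in>{0..a}. EX c. i c = v t & norm c <= M * (norm z + LN0 p a f)))"

text \<open>By \<open>weak_derivative_iff\<close>, applied to the continuous representative that
  carries the initial condition.\<close>

lemma linear_solution_iff:
 assumes a: "0 < a"
 shows "linear_solution p J B a f w & PL0 p a f \<longleftrightarrow> (EX v. sol (blinfun_apply B) a v w f & v 0 = 0)"
proof
 assume L: "linear_solution p J B a f w & PL0 p a f"
 then obtain w' v where w: "Lp p a w" and w': "H1p_derivative p a (%t. J (w t)) w'"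
  and eq: "AE t in lebesgue_on {0<..<a}. w' t + blinfun_apply B (w t) = f t"
  and v: "continuous_on {0..a} v" "AE t in lebesgue_on {0<..<a}. v t = J (w t)" "v 0 = 0"
  unfolding linear_solution_def by blast
 have P: "PL0 p a w" "PL0 p a w'" using w w' by (auto simp: H1p_derivative_def Lp_PL)
 have ae: "AE t in lebesgue. 0 < t & t < a --> J (w t) = v t" "AE t in lebesgue. 0 < t & t < a --> v t = J (w t)"
  using v(2) by (auto simp: AE_lebesgue_on_iff elim!: eventually_mono)
 have wd: "weak_derivative a (%t. J (w t)) w'" using w' by (simp add: H1p_derivative_def)
 have vi: "\<forall>t\<in>{0..a}. v t = v 0 + integral {0..t} w'" by (rule weak_derivative_iff[OF p1 a P(2) v(1) ae(1), THEN iffD1, OF wd])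
 have "evo a v w w'" unfolding evo_def by (intro conjI P vi ae(2))
 then have "evo a v w (%t. f t - blinfun_apply B (w t))"
 proof (rule evo_cong)
  show "AE t in lebesgue. 0 < t & t < a --> f t - blinfun_apply B (w t) = w' t"
   using eq unfolding AE_lebesgue_on_iff by eventually_elim (auto simp: algebra_simps)
 qed auto
 then show "EX v. sol (blinfun_apply B) a v w f & v 0 = 0" using L v(3) by (auto simp: sol_def)
next
 assume "EX v. sol (blinfun_apply B) a v w f & v 0 = 0"
 then obtain v where s: "sol (blinfun_apply B) a v w f" and v0: "v 0 = 0" by blast
 note e = sol_evo[OF s]
 have ae: "AE t in lebesgue. 0 < t & t < a --> J (w t) = v t" using evoD(4)[OF e] by eventually_elim auto
 have vi: "\<forall>t\<in>{0..a}. v t = v 0 + integral {0..t} (%t. f t - blinfun_apply B (w t))" using evoD(3)[OF e] by blast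
 have wd: "weak_derivative a (%t. J (w t)) (%t. f t - blinfun_apply B (w t))"
  by (rule weak_derivative_iff[OF p1 a evoD(2)[OF e] evo_continuous[OF e] ae, THEN iffD2, OF vi])
 have "H1p_derivative p a (%t. J (w t)) (%t. f t - blinfun_apply B (w t))"
  unfolding H1p_derivative_def Lp_PL using PL_cut_linear(1)[OF J evoD(1)[OF e]] evoD(2)[OF e] wd by blast
 moreover have "AE t in lebesgue_on {0<..<a}. v t = J (w t)" using evoD(4)[OF e] by (simp add: AE_lebesgue_on_iff)
 moreover have "AE t in lebesgue_on {0<..<a}. f t - blinfun_apply B (w t) + blinfun_apply B (w t) = f t" by simp
 moreover have "Lp p a w" "PL0 p a f" using evoD(1)[OF e] sol_PL[OF s] by (simp_all add: Lp_PL)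
 ultimately show "linear_solution p J B a f w & PL0 p a f"
  unfolding linear_solution_def using evo_continuous[OF e] v0 by blast
qed

text \<open>Maximal regularity asserts existence and uniqueness but no estimate. Uniqueness makes
  the norm of the solution a well-defined function \<open>q\<close> of the data,
  \<open>sol_limit\<close> makes it countably subadditive, and Zabreiko's lemma bounds it.\<close>

lemma maximal_regularity_bound:
 assumes mr: "maximal_regularity p J B"
 shows "\<exists>M>0. ALL f. PL0 p 1 f --> (EX v w. sol (blinfun_apply B) 1 v w f & v 0 = 0) &
  (ALL v w. sol (blinfun_apply B) 1 v w f --> v 0 = 0 --> LN0 p 1 w <= M * LN0 p 1 f)"
proof -
 let ?B = "blinfun_apply B"
 have B: "bounded_linear ?B" by (rule blinfun.bounded_linear_right)
 have ex: "EX w v. sol ?B 1 v w f & v 0 = 0" if "PL0 p 1 f" for f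
  using mr that linear_solution_iff[of 1 B f] unfolding maximal_regularity_def Lp_PL by (metis zero_less_one)
 have uniq: "AE t in lebesgue. 0 < t & t < 1 --> w1 t = w2 t"
  if "sol ?B 1 v1 w1 f" "v1 0 = 0" "sol ?B 1 v2 w2 f" "v2 0 = 0" for v1 v2 w1 w2 f
 proof -
  have "linear_solution p J B 1 f w1" "linear_solution p J B 1 f w2" "Lp p 1 f"
   using linear_solution_iff[of 1 B f] that sol_PL[OF that(1)] unfolding Lp_PL by auto
  then show ?thesis using mr unfolding maximal_regularity_def AE_lebesgue_on_iff[symmetric] by (meson zero_less_one)
 qed
 define W where "W f = (SOME w. EX v. sol ?B 1 v w f & v 0 = 0)" for f
 have W: "EX v. sol ?B 1 v (W f) f & v 0 = 0" if "PL0 p 1 f" for f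
  unfolding W_def by (rule someI_ex[OF ex[OF that]])
 define S where "S = {f :: real => 'a. PL0 p 1 f}"
 define N where "N f = LN0 p 1 f" for f :: "real => 'a"
 define q where "q f = LN0 p 1 (W f)" for f
 have sc: "cut 0 1 (c *\<^sub>R f) = (%t. c *\<^sub>R cut 0 1 f t)" for c and f :: "real => 'z::real_normed_vector"
  by (auto simp: cut_def scaleR_fun_def)
 have ad: "cut 0 1 (f + g) = (%t. cut 0 1 f t + cut 0 1 g t)" for f g :: "real => 'z::real_normed_vector"
  by (auto simp: cut_def)
 have qw: "q f = LN0 p 1 w" if s: "sol ?B 1 v w f" "v 0 = 0" for v w f
 proof -
  obtain v' where v': "sol ?B 1 v' (W f) f" "v' 0 = 0" using W[OF sol_PL[OF s(1)]] by blast
  have "AE t in lebesgue. cut 0 1 w t = cut 0 1 (W f) t" by (rule cut_cong_AE[OF uniq[OF s v']])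
  then show ?thesis unfolding q_def by (rule PL_AE_cong(2)[OF p0 evoD(1)[OF sol_evo[OF s(1)]]])
 qed
 have "\<exists>C>0. \<forall>x\<in>S. q x <= C * N x"
 proof (rule zabreiko)
  show "subspace S"
   unfolding subspace_def S_def using PL_add(1)[OF p1] PL_scale(1)[OF p0]
   by (auto simp: ad sc) (simp add: zero_fun_def cut_def)
  show "N (f + g) <= N f + N g" if "f \<in> S" "g \<in> S" for f g
   using that PL_add(2)[OF p1] by (simp add: N_def S_def ad)
  show "N (c *\<^sub>R f) = \<bar>c\<bar> * N f" if "f \<in> S" for f c
   using that PL_scale(2)[OF p0] by (simp add: N_def S_def sc)
  show "q (f + g) <= q f + q g" if fg: "f \<in> S" "g \<in> S" for f g
  proof -
   obtain v1 v2 where v: "sol ?B 1 v1 (W f) f" "v1 0 = 0" "sol ?B 1 v2 (W g) g" "v2 0 = 0"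
    using W fg by (auto simp: S_def) blast
   have "sol ?B 1 (%t. v1 t + v2 t) (%t. W f t + W g t) (f + g)" using sol_add[OF B v(1,3)] by (simp add: plus_fun_def)
   from qw[OF this] v show ?thesis
    using PL_add(2)[OF p1 evoD(1)[OF sol_evo[OF v(1)]] evoD(1)[OF sol_evo[OF v(3)]]] by (simp add: q_def cut_add)
  qed
  show "q (c *\<^sub>R f) = \<bar>c\<bar> * q f" if f: "f \<in> S" for f c
  proof -
   obtain v where v: "sol ?B 1 v (W f) f" "v 0 = 0" using W f by (auto simp: S_def)
   have "sol ?B 1 (%t. c *\<^sub>R v t) (%t. c *\<^sub>R W f t) (c *\<^sub>R f)" using sol_scale[OF B v(1)] by (simp add: scaleR_fun_def)
   from qw[OF this] v show ?thesis
    using PL_scale(2)[OF p0 evoD(1)[OF sol_evo[OF v(1)]], of c] sc[of c "W f"] by (simp add: q_def scaleR_fun_def)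
  qed
  show "0 <= N f" "0 <= q f" for f by (simp_all add: N_def q_def)
  fix x :: "nat => real => 'a" assume xS: "!!n. x n \<in> S"
  have P: "PL0 p 1 (x n)" for n using xS by (simp add: S_def)
  have sf: "(\<Sum>k<n. f k) t = (\<Sum>k<n. f k t)" for f :: "nat => real => 'a" and n t by (induction n) simp_all
  have cs: "cut 0 1 (\<Sum>k<n. x k) = (%t. \<Sum>k<n. cut 0 1 (x k) t)" for n
   by (auto simp: cut_def fun_eq_iff sf)
  show "\<exists>y\<in>S. (%n. N (y - (\<Sum>k<n. x k))) \<longlonglongrightarrow> 0" if sm: "summable (%n. N (x n))"
  proof -
   define y where "y t = (\<Sum>n. cut 0 1 (x n) t)" for t
   note R = PL_series[OF p1 P sm[unfolded N_def], folded y_def]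
   have yc: "cut 0 1 y = y"
    by (rule ext) (auto simp: cut_def y_def)
   have "(%n. LN p (%t. y t - (\<Sum>k<n. cut 0 1 (x k) t))) \<longlonglongrightarrow> 0"
   proof (rule Lim_null_comparison)
    show "\<forall>\<^sub>F n in sequentially. norm (LN p (%t. y t - (\<Sum>k<n. cut 0 1 (x k) t))) <= (\<Sum>k. LN0 p 1 (x (k + n)))"
     using R(3) by simp
    show "(%n. \<Sum>k. LN0 p 1 (x (k + n))) \<longlonglongrightarrow> 0"
     by (rule suminf_exist_split2[OF sm[unfolded N_def]])
   qed
   moreover have "cut 0 1 (y - (\<Sum>k<n. x k)) = (%t. y t - (\<Sum>k<n. cut 0 1 (x k) t))" for n
    using cs[of n] yc cut_diff[of 0 1 y "\<Sum>k<n. x k"] by (simp add: fun_diff_def)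
   ultimately show ?thesis using R(2) yc by (intro bexI[of _ y]) (auto simp: S_def N_def y_def[abs_def])
  qed
  fix y assume y: "y \<in> S" and lim: "(%n. N (y - (\<Sum>k<n. x k))) \<longlonglongrightarrow> 0" and sq: "summable (%n. q (x n))"
  obtain v where v: "!!n. sol ?B 1 (v n) (W (x n)) (x n)" "!!n. v n 0 = 0" using W[OF P] by metis
  have PW: "PL0 p 1 (W (x n))" for n by (rule evoD(1)[OF sol_evo[OF v(1)]])
  note R = PL_series[OF p1 PW sq[unfolded q_def]]
  define w where "w t = (\<Sum>n. cut 0 1 (W (x n)) t)" for t
  have wc: "cut 0 1 w = w" by (rule ext) (auto simp: cut_def w_def)
  define V where "V n t = (\<Sum>k<n. v k t)" for n t
  define Wn where "Wn n t = (\<Sum>k<n. W (x k) t)" for n t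
  define Fn where "Fn n t = (\<Sum>k<n. x k t)" for n t
  have part: "sol ?B 1 (V n) (Wn n) (Fn n) & V n 0 = 0" for n
  proof (induction n)
   case 0
   have "evo 1 (%t. J 0) (%t. 0) (%t. J 0)" using evo_C1[of "%t. 0" "%t. 0" 1] by auto
   then show ?case using linear_0[OF linear_J]
    by (auto simp: sol_def V_def[abs_def] Wn_def[abs_def] Fn_def[abs_def] cut_def blinfun.zero_right cong: if_cong)
  next
   case (Suc n)
   then show ?case using sol_add[OF B conjunct1[OF Suc] v(1)[of n]] v(2)[of n]
    by (simp add: V_def[abs_def] Wn_def[abs_def] Fn_def[abs_def])
  qed
  have cW: "cut 0 1 (%t. w t - Wn n t) = (%t. w t - (\<Sum>k<n. cut 0 1 (W (x k)) t))" for n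
   by (rule ext) (auto simp: cut_def w_def Wn_def)
  have "sol ?B 1 (%t. integral {0..t} (%t. y t - ?B (w t))) w y"
  proof (rule sol_limit[OF B _ conjunct1[OF part] conjunct2[OF part]])
   show "PL0 p 1 y" using y by (simp add: S_def)
   have "(%t. y t - Fn n t) = y - (\<Sum>k<n. x k)" for n by (auto simp: Fn_def fun_eq_iff sf)
   then show "(%n. LN0 p 1 (%t. y t - Fn n t)) \<longlonglongrightarrow> 0" using lim by (simp add: N_def)
   show "PL0 p 1 w" unfolding wc using R(2) by (simp add: w_def[abs_def])
   show "(%n. LN0 p 1 (%t. w t - Wn n t)) \<longlonglongrightarrow> 0"
    unfolding cW
   proof (rule Lim_null_comparison)
    show "\<forall>\<^sub>F n in sequentially. norm (LN p (%t. w t - (\<Sum>k<n. cut 0 1 (W (x k)) t))) <= (\<Sum>k. LN0 p 1 (W (x (k + n))))"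
     using R(3) by (simp add: w_def)
    show "(%n. \<Sum>k. LN0 p 1 (W (x (k + n)))) \<longlonglongrightarrow> 0"
     by (rule suminf_exist_split2[OF sq[unfolded q_def]])
   qed
   show "AE t in lebesgue. 0 < t & t < 1 --> (%n. Wn n t) \<longlonglongrightarrow> w t"
    using R(1)
   proof eventually_elim
    case (elim t)
    show ?case
    proof
     assume t: "0 < t & t < 1"
     have "(%n. \<Sum>k<n. cut 0 1 (W (x k)) t) \<longlonglongrightarrow> w t"
      unfolding w_def by (rule summable_LIMSEQ[OF summable_norm_cancel[OF elim]])
     then show "(%n. Wn n t) \<longlonglongrightarrow> w t" using t by (simp add: cut_def Wn_def)
    qed
   qed
  qed simp
  from qw[OF this] have "q y = LN p w" by (simp add: wc)
  then show "q y <= (\<Sum>n. q (x n))" using R(4) by (simp add: w_def[abs_def] q_def)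
 qed
 then obtain C where C: "0 < C" "!!f. PL0 p 1 f ==> q f <= C * LN0 p 1 f" by (auto simp: S_def N_def)
 show ?thesis
  using C ex qw by (intro exI[of _ C]) (metis sol_PL)
qed

text \<open>An initial value is reduced to 0 by subtracting a path from \<open>extension\<close>
  with that trace; the trace theorem then adds the bound in X_gamma.\<close>

lemma maximal_regularity_LS:
 assumes mr: "maximal_regularity p J B"
 shows "EX M. LS (blinfun_apply B) 1 M"
proof -
 let ?B = "blinfun_apply B"
 have B: "bounded_linear ?B" by (rule blinfun.bounded_linear_right)
 obtain M where M: "0 < M" "!!f. PL0 p 1 f ==> EX v w. sol ?B 1 v w f & v 0 = 0"
  "!!f v w. sol ?B 1 v w f ==> v 0 = 0 ==> LN0 p 1 w <= M * LN0 p 1 f"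
  using maximal_regularity_bound[OF mr] sol_PL by metis
 obtain C where C: "0 < C" "!!z. EX v w g. evo 1 v w g & v 0 = i z & LN0 p 1 w <= C * norm z & LN0 p 1 g <= C * norm z"
  using extension by blast
 obtain T where T: "0 < T" "!!v w g t. evo 1 v w g ==> t \<in> {0..1} ==> EX z. i z = v t & norm z <= T * (LN0 p 1 w + LN0 p 1 g)"
  using trace_bound[of 1] by auto
 define b where "b = onorm ?B"
 have b: "0 <= b" unfolding b_def by (rule onorm_pos_le[OF B])
 \<comment> \<open>\<open>M1\<close> bounds \<open>w\<close> as the extension plus a solution with
   zero initial value; \<open>M2\<close> bounds the trace, the derivative being estimated through
   the equation.\<close>
 define M1 where "M1 = C + M * (1 + C + b * C)"
 define M2 where "M2 = T * (M1 + 1 + b * M1)"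
 have M1: "0 < M1" using C M b by (simp add: M1_def add_pos_nonneg)
 have M2: "0 < M2" using T M1 b by (simp add: M2_def add_pos_nonneg)
 have ex: "EX v w. sol ?B 1 v w f & v 0 = i z" if f: "PL0 p 1 f" for f z
 proof -
  obtain v w g where e: "evo 1 v w g" "v 0 = i z" using C(2)[of z] by blast
  note s = sol_of_evo[OF B e(1)]
  have "PL0 p 1 (%t. f t - (g t + ?B (w t)))" unfolding cut_diff by (rule PL_diff(1)[OF p1 f sol_PL[OF s]])
  then obtain v' w' where s': "sol ?B 1 v' w' (%t. f t - (g t + ?B (w t)))" "v' 0 = 0" using M(2) by blast
  show ?thesis using sol_add[OF B s s'(1)] e(2) s'(2) by (intro exI[of _ "%t. v t + v' t"] exI[of _ "%t. w t + w' t"]) simp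
 qed
 have bd: "LN0 p 1 w <= M1 * (norm z + LN0 p 1 f)" if s: "sol ?B 1 v w f" "v 0 = i z" for v w f z
 proof -
  obtain v1 w1 g1 where e: "evo 1 v1 w1 g1" "v1 0 = i z" "LN0 p 1 w1 <= C * norm z" "LN0 p 1 g1 <= C * norm z"
   using C(2)[of z] by blast
  note s1 = sol_of_evo[OF B e(1)]
  have "LN0 p 1 (%t. g1 t + ?B (w1 t)) <= LN0 p 1 g1 + b * LN0 p 1 w1"
   unfolding cut_add b_def using PL_add(2)[OF p1 evoD(2)[OF e(1)] PL_cut_linear(1)[OF B evoD(1)[OF e(1)]]]
    PL_cut_linear(2)[OF B evoD(1)[OF e(1)]] by linarith
  also have "... <= C * norm z + b * (C * norm z)" using e(3,4) b by (intro add_mono mult_left_mono)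
  finally have F1: "LN0 p 1 (%t. g1 t + ?B (w1 t)) <= C * norm z + b * (C * norm z)" .
  note d = sol_diff[OF B s(1) s1]
  have "LN0 p 1 (%t. w t - w1 t) <= M * LN0 p 1 (%t. f t - (g1 t + ?B (w1 t)))"
   by (rule M(3)[OF d]) (simp add: s(2) e(2))
  also have "... <= M * (LN0 p 1 f + (C * norm z + b * (C * norm z)))"
   unfolding cut_diff using M(1) PL_diff(2)[OF p1 sol_PL[OF s(1)] sol_PL[OF s1]] F1 by (intro mult_left_mono) auto
  finally have D: "LN0 p 1 (%t. w t - w1 t) <= M * (LN0 p 1 f + (C * norm z + b * (C * norm z)))" .
  have "LN0 p 1 w = LN p (%t. cut 0 1 (%t. w t - w1 t) t + cut 0 1 w1 t)" unfolding cut_diff by simp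
  also have "... <= LN0 p 1 (%t. w t - w1 t) + LN0 p 1 w1"
   by (rule PL_add(2)[OF p1 evoD(1)[OF sol_evo[OF d]] evoD(1)[OF e(1)]])
  also have "... <= M * (LN0 p 1 f + (C * norm z + b * (C * norm z))) + C * norm z" using D e(3) by simp
  also have "... <= M * ((1 + C + b * C) * (norm z + LN0 p 1 f)) + C * (norm z + LN0 p 1 f)"
  proof (intro add_mono mult_left_mono)
   have "(1 + C + b * C) * (norm z + LN0 p 1 f) - (LN0 p 1 f + (C * norm z + b * (C * norm z)))
    = norm z + (C + b * C) * LN0 p 1 f" by (simp add: algebra_simps)
   moreover have "0 <= (C + b * C) * LN0 p 1 f" using C b by (intro mult_nonneg_nonneg) auto
   ultimately show "LN0 p 1 f + (C * norm z + b * (C * norm z)) <= (1 + C + b * C) * (norm z + LN0 p 1 f)"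
    using norm_ge_zero[of z] by linarith
  qed (use M C in auto)
  also have "... = M1 * (norm z + LN0 p 1 f)" by (simp add: M1_def algebra_simps)
  finally show ?thesis .
 qed
 have sup: "EX c. i c = v t & norm c <= M2 * (norm z + LN0 p 1 f)" if s: "sol ?B 1 v w f" "v 0 = i z" and t: "t \<in> {0..1}" for v w f z t
 proof -
  define D where "D = norm z + LN0 p 1 f"
  obtain c where c: "i c = v t" "norm c <= T * (LN0 p 1 w + LN0 p 1 (%t. f t - ?B (w t)))"
   using T(2)[OF sol_evo[OF s(1)] t] by blast
  have w: "LN0 p 1 w <= M1 * D" using bd[OF s] by (simp add: D_def)
  have "LN0 p 1 (%t. f t - ?B (w t)) <= LN0 p 1 f + b * LN0 p 1 w"
   unfolding b_def by (rule sol_deriv_bound[OF B s(1)])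
  also have "... <= D + b * (M1 * D)" using w b by (intro add_mono mult_left_mono) (auto simp: D_def)
  finally have "T * (LN0 p 1 w + LN0 p 1 (%t. f t - ?B (w t))) <= T * (M1 * D + (D + b * (M1 * D)))"
   using w T(1) by (intro mult_left_mono) auto
  also have "... = M2 * D" by (simp add: M2_def algebra_simps)
  finally show ?thesis using c by (auto simp: D_def)
 qed
 have "LS ?B 1 (M1 + M2)"
  unfolding LS_def
 proof (intro conjI allI impI ballI B zero_less_one add_pos_pos M1 M2 ex)
  fix v w f z assume s: "sol ?B 1 v w f" "v 0 = i z"
  have D: "0 <= norm z + LN0 p 1 f" by simp
  have "M1 * (norm z + LN0 p 1 f) <= (M1 + M2) * (norm z + LN0 p 1 f)"
   using M2 D by (intro mult_right_mono) auto
  then show "LN0 p 1 w <= (M1 + M2) * (norm z + LN0 p 1 f)" using bd[OF s] by linarith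
  fix t :: real assume t: "t \<in> {0..1}"
  have "M2 * (norm z + LN0 p 1 f) <= (M1 + M2) * (norm z + LN0 p 1 f)"
   using M1 D by (intro mult_right_mono) auto
  then show "EX c. i c = v t & norm c <= (M1 + M2) * (norm z + LN0 p 1 f)" using sup[OF s t] by force
 qed
 then show ?thesis by blast
qed

end

section \<open>Contraction principle, change of intervals and perturbed problems\<close>

lemma PL_cut_zero [simp]: "PL p (cut a b (%_. 0))" "LN p (cut a b (%_. 0)) = 0"
 by (simp_all add: cut_def)

text \<open>Banach's theorem in a ball of L_p on (0,a). The iterates start at 0 and the limit is the
  series of their differences, so completeness enters through \<open>PL_series\<close>; the fixed
  point equation holds almost everywhere.\<close>

lemma PL_fixpoint:
 fixes Phi :: "(real => 'x::banach) => real => 'x"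
 assumes p: "1 <= p" and Phi: "!!f. PL0 p a f ==> LN0 p a f <= R ==> PL0 p a (Phi f)"
  and 0: "LN0 p a (Phi (%_. 0)) <= R / 2"
  and lip: "!!f g. PL0 p a f ==> PL0 p a g ==> LN0 p a f <= R ==> LN0 p a g <= R ==>
   LN0 p a (%t. Phi f t - Phi g t) <= LN0 p a (%t. f t - g t) / 2"
 obtains f where "PL0 p a f" "LN0 p a f <= R" "AE t in lebesgue. 0 < t & t < a --> Phi f t = f t"
proof -
 have p0: "0 < p" using p by simp
 define F where "F = rec_nat (%_. 0) (%_. Phi)"
 have F: "F 0 = (%_. 0)" "F (Suc n) = Phi (F n)" for n by (simp_all add: F_def)
 define d where "d n = cut 0 a (%t. F (Suc n) t - F n t)" for n
 have z: "PL0 p a (%_. 0 :: 'x)" "LN0 p a (%_. 0 :: 'x) = 0" by (simp_all add: cut_def)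
 have R: "0 <= R" using 0 LN_nonneg[of p "cut 0 a (Phi (%_. 0))"] by linarith
 have inv: "PL0 p a (F n) & LN0 p a (F n) <= R" for n
 proof (induction n)
  case 0 show ?case using z R by (simp add: F)
 next
  case (Suc n)
  have P: "PL0 p a (F (Suc n))" using Phi Suc by (simp add: F)
  have P0: "PL0 p a (Phi (%_. 0))" by (rule Phi[OF z(1)]) (use z R in simp)
  have PD: "PL0 p a (%t. Phi (F n) t - Phi (%_. 0) t)" using PL_diff(1)[OF p P P0] by (simp only: cut_diff F)
  have "LN0 p a (%t. Phi (F n) t - Phi (%_. 0) t) <= LN0 p a (F n) / 2"
   using lip[of "F n" "%_. 0"] Suc z R by simp
  moreover have "cut 0 a (F (Suc n)) = (%t. cut 0 a (%t. Phi (F n) t - Phi (%_. 0) t) t + cut 0 a (Phi (%_. 0)) t)"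
   by (auto simp: cut_def F)
  ultimately show ?case using P PL_add(2)[OF p PD P0] 0 Suc by simp
 qed
 have inv1: "PL0 p a (F n)" and inv2: "LN0 p a (F n) <= R" for n using inv by blast+
 have dPL: "PL p (d n)" for n
 proof -
  have "d n = (%t. cut 0 a (F (Suc n)) t - cut 0 a (F n) t)" by (auto simp: d_def cut_def)
  then show ?thesis using PL_diff(1)[OF p, of "cut 0 a (F (Suc n))" "cut 0 a (F n)"] inv by metis
 qed
 \<comment> \<open>The first difference is at most R/2, so the geometric series sums to
   \<open>R\<close> and the limit stays in the ball.\<close>
 have dLN: "LN p (d n) <= R / 2 * (1/2) ^ n" for n
 proof (induction n)
  case 0 show ?case using assms(3) by (simp add: d_def F)
 next
  case (Suc n)
  have "LN p (d (Suc n)) <= LN p (d n) / 2" unfolding d_def F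
   using lip[OF inv1 inv1 inv2 inv2, of "Suc n" n] unfolding F .
  then show ?case using Suc by simp
 qed
 have gs: "(%n. R / 2 * (1/2) ^ n) sums (R / 2 * 2)" using sums_mult[OF geometric_sums[of "1/2::real"], of "R/2"] by simp
 have sm: "summable (%n. LN p (d n))"
  by (rule summable_comparison_test[OF _ sums_summable[OF gs]]) (use dLN in auto)
 define f where "f t = (\<Sum>n. d n t)" for t
 have tel: "(\<Sum>k<n. d k t) = cut 0 a (F n) t" for n t
  by (induction n) (auto simp: d_def cut_def F)
 have f0: "\<not> (0 < t & t < a) ==> f t = 0" for t by (auto simp: f_def d_def cut_def)
 have cf: "cut 0 a f = f" by (auto simp: cut_def f_def d_def fun_eq_iff)
 have fPL: "PL0 p a f" unfolding cf f_def by (rule PL_series(2)[OF p dPL sm])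
 have "LN p f <= (\<Sum>k. LN p (d k))" unfolding f_def by (rule PL_series(4)[OF p dPL sm])
 also have "... <= R" using suminf_le[OF dLN sm sums_summable[OF gs]] sums_unique[OF gs] by simp
 finally have fR: "LN0 p a f <= R" unfolding cf .
 have diffPL: "PL0 p a (%t. f t - F n t)" for n
  using PL_diff(1)[OF p fPL, of "cut 0 a (F n)"] inv unfolding cut_diff cf by blast
 have diff: "LN0 p a (%t. f t - F n t) <= (\<Sum>k. LN p (d (k + n)))" for n
 proof -
  have "cut 0 a (%t. f t - F n t) = (%t. (\<Sum>k. d k t) - (\<Sum>k<n. d k t))"
   unfolding tel f_def[symmetric] using f0 by (intro ext) (simp add: cut_def)
  then show ?thesis using PL_series(3)[OF p dPL sm, of n] by simp
 qed
 have tail: "(%n. \<Sum>k. LN p (d (k + n))) \<longlonglongrightarrow> 0" by (rule suminf_exist_split2[OF sm])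
 have "LN0 p a (%t. Phi f t - f t) <= (\<Sum>k. LN p (d (k + n))) / 2 + (\<Sum>k. LN p (d (k + Suc n)))" for n
 proof -
  have P1: "PL0 p a (%t. Phi f t - Phi (F n) t)"
   using PL_diff(1)[OF p Phi[OF fPL fR] Phi[of "F n"]] inv unfolding cut_diff by blast
  have "cut 0 a (%t. Phi f t - f t) = (%t. cut 0 a (%t. Phi f t - Phi (F n) t) t - cut 0 a (%t. f t - F (Suc n) t) t)"
   by (auto simp: cut_def F)
  then have "LN0 p a (%t. Phi f t - f t) <= LN0 p a (%t. Phi f t - Phi (F n) t) + LN0 p a (%t. f t - F (Suc n) t)"
   using PL_diff(2)[OF p P1 diffPL[of "Suc n"]] by simp
  then show ?thesis using lip[OF fPL _ fR, of "F n"] inv[of n] diff[of n] diff[of "Suc n"] by linarith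
 qed
 moreover have "(%n. (\<Sum>k. LN p (d (k + n))) / 2 + (\<Sum>k. LN p (d (k + Suc n)))) \<longlonglongrightarrow> 0"
  using tendsto_add[OF tendsto_divide[OF tail tendsto_const[of 2]] LIMSEQ_Suc[OF tail]] by simp
 ultimately have "LN0 p a (%t. Phi f t - f t) <= 0"
  by (intro LIMSEQ_le_const[of _ 0]) auto
 then have L0: "LN0 p a (%t. Phi f t - f t) = 0" using LN_nonneg order_antisym by blast
 have Pd: "PL0 p a (%t. Phi f t - f t)"
  using PL_diff(1)[OF p Phi[OF fPL fR] fPL] by (simp only: cut_diff)
 have "AE t in lebesgue. cut 0 a (%t. Phi f t - f t) t = 0" by (rule LN_eq_0_AE[OF p0 Pd L0])
 then have "AE t in lebesgue. 0 < t & t < a --> Phi f t = f t"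
  by eventually_elim (auto simp: cut_def)
 then show ?thesis by (rule that[OF fPL fR])
qed

context interpolation_setting
begin

text \<open>The X_gamma-valued version of a path. Off the range of \<open>i\<close> its value is
  unspecified; \<open>evo_tr\<close> shows that paths in the sense of \<open>evo\<close> stay in
  this range.\<close>

definition tr :: "(real => 'a) => real => 'c" where "tr v t = inv i (v t)"

lemma tr_eqI: "i c = v t ==> tr v t = c"
 unfolding tr_def using inv_f_f[OF inj_i, of c] by simp

lemma evo_tr:
 assumes a: "0 < a" and e: "evo a v w g"
 shows "!!t. t \<in> {0..a} ==> i (tr v t) = v t" "continuous_on {0..a} (tr v)"
  "AE t in lebesgue. 0 < t & t < a --> tr v t = incl J i (w t)"
proof -
 show *: "i (tr v t) = v t" if "t \<in> {0..a}" for t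
  using trace_bound[OF a] e that tr_eqI by metis
 show "continuous_on {0..a} (tr v)" by (rule trace_continuous[OF a e *])
 show "AE t in lebesgue. 0 < t & t < a --> tr v t = incl J i (w t)"
  using evoD(4)[OF e] by eventually_elim (auto intro: tr_eqI simp: incl_J)
qed

lemma tr_diff:
 assumes "i (tr v t) = v t" "i (tr u t) = u t"
 shows "tr (%t. v t - u t) t = tr v t - tr u t"
 by (rule tr_eqI) (simp add: linear_diff[OF linear_i] assms)

lemma LS_D:
 assumes L: "LS B a M" and s: "sol B a v w f" "v 0 = i z"
 shows "LN0 p a w <= M * (norm z + LN0 p a f)"
  "!!t. t \<in> {0..a} ==> norm (tr v t) <= M * (norm z + LN0 p a f)"
  "!!t. t \<in> {0..a} ==> i (tr v t) = v t" "continuous_on {0..a} (tr v)" "tr v 0 = z"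
  "AE t in lebesgue. 0 < t & t < a --> tr v t = incl J i (w t)"
proof -
 have a: "0 < a" using L by (simp add: LS_def)
 have b: "LN0 p a w <= M * (norm z + LN0 p a f) &
    (\<forall>t\<in>{0..a}. EX c. i c = v t & norm c <= M * (norm z + LN0 p a f))"
  using L s unfolding LS_def by blast
 show "LN0 p a w <= M * (norm z + LN0 p a f)" using b by blast
 show "norm (tr v t) <= M * (norm z + LN0 p a f)" if "t \<in> {0..a}" for t
  using b that tr_eqI by metis
 show "!!t. t \<in> {0..a} ==> i (tr v t) = v t" "continuous_on {0..a} (tr v)"
  "AE t in lebesgue. 0 < t & t < a --> tr v t = incl J i (w t)" by (rule evo_tr[OF a sol_evo[OF s(1)]], assumption?)+
 show "tr v 0 = z" by (rule tr_eqI) (simp add: s(2))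
qed

lemma LS_ex:
 assumes L: "LS B a M" and f: "PL0 p a f"
 obtains v w where "sol B a v w f" "v 0 = i z"
 using L f unfolding LS_def by blast

lemma LS_pos: "LS B a M ==> 0 < a" "LS B a M ==> 0 < M" "LS B a M ==> bounded_linear B"
 by (simp_all add: LS_def)

lemma LS_I:
 assumes B: "bounded_linear B" and a: "0 < a" and M: "0 < M"
  and ex: "!!z f. PL0 p a f ==> EX v w. sol B a v w f & v 0 = i z"
  and bd: "!!v w f z. sol B a v w f ==> v 0 = i z ==> LN0 p a w <= M * (norm z + LN0 p a f) &
   (\<forall>t\<in>{0..a}. norm (tr v t) <= M * (norm z + LN0 p a f))"
 shows "LS B a M"
 unfolding LS_def
proof (intro conjI allI impI ballI)
 fix v w f z t assume s: "sol B a v w f" "v 0 = i z"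
 show "LN0 p a w <= M * (norm z + LN0 p a f)" using bd[OF s] by blast
 assume t: "t \<in> {0..a}"
 show "EX c. i c = v t & norm c <= M * (norm z + LN0 p a f)"
  using evo_tr(1)[OF a sol_evo[OF s(1)] t] bd[OF s] t by blast
qed (use assms in auto)

lemma cut_eq_join: "0 <= b ==> cut 0 b (join b f g) = cut 0 b f"
 by (auto simp: cut_def join_def)

text \<open>The constant does not deteriorate on shorter intervals: a solution on [0,b] is continued
  to [0,a] by the homogeneous problem, and the estimate on the long interval applies with data of no
  larger norm. Lengths can thus be shrunk to make their powers small.\<close>

lemma LS_short:
 assumes L: "LS B a M" and b: "0 < b" "b <= a"
 shows "LS B b M"
proof (rule LS_I)
 fix z and f :: "real => 'a" assume f: "PL0 p b f"
 have "cut 0 a (cut 0 b f) = cut 0 b f" using b by (auto simp: cut_def fun_eq_iff)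
 then have "PL0 p a (cut 0 b f)" using f by (simp only:)
 then obtain v w where "sol B a v w (cut 0 b f)" "v 0 = i z" using LS_ex[OF L] by metis
 then have "sol B b v w f & v 0 = i z"
  using sol_cong[OF sol_sub[of B a v w "cut 0 b f" b] refl, of w f] b by (simp add: cut_def)
 then show "EX v w. sol B b v w f & v 0 = i z" by blast
next
 fix v w f z assume s: "sol B b v w f" "v 0 = i z"
 have a: "0 < a" using b by linarith
 obtain c where c: "i c = v b" using evo_tr(1)[OF b(1) sol_evo[OF s(1)], of b] b by auto
 have "PL0 p a (%_. 0 :: 'a)" by (simp add: cut_def)
 from LS_ex[OF L this] obtain v2 w2 where s2: "sol B a v2 w2 (%_. 0)" "v2 0 = i c" by metis
 have s2': "sol B (a - b) v2 w2 (%_. 0)" by (rule sol_sub[OF s2(1)]) (use b in simp)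
 have j: "sol B (b + (a - b)) (join b v v2) (join b w w2) (join b f (%_. 0))"
  by (rule sol_join[OF s(1) s2']) (use b s2 c in auto)
 then have j: "sol B a (join b v v2) (join b w w2) (join b f (%_. 0))" by simp
 have j0: "join b v v2 0 = i z" using b s by (simp add: join_def)
 have jf: "LN0 p a (join b f (%_. 0)) <= LN0 p b f"
  using PL_cut_joined(2)[of b "a - b" f "%_. 0"] sol_PL[OF s(1)] b by (simp add: cut_def)
 have mm: "M * (norm z + LN0 p a (join b f (%_. 0))) <= M * (norm z + LN0 p b f)"
  using jf LS_pos(2)[OF L] by simp
 have "LN0 p b w <= LN0 p a (join b w w2)"
  using PL_cut_sub(2)[OF p0 evoD(1)[OF sol_evo[OF j]], of 0 b] b cut_eq_join[of b w w2] by simp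
 moreover have "norm (tr v t) <= M * (norm z + LN0 p b f)" if "t \<in> {0..b}" for t
  using LS_D(2)[OF L j j0, of t] that b mm by (simp add: tr_def join_def)
 ultimately show "LN0 p b w <= M * (norm z + LN0 p b f) & (\<forall>t\<in>{0..b}. norm (tr v t) <= M * (norm z + LN0 p b f))"
  using LS_D(1)[OF L j j0] mm by auto
qed (use LS_pos[OF L] b in auto)

text \<open>The second half starts from a value of norm at most \<open>M\<close> times the size of
  the data, which accounts for the product in the new constant.\<close>

lemma LS_double:
 assumes L: "LS B a M"
 shows "LS B (a + a) (M + M * (M + 1))"
proof (rule LS_I)
 note a = LS_pos(1)[OF L] and M = LS_pos(2)[OF L] and B = LS_pos(3)[OF L]
 show "0 < a + a" "0 < M + M * (M + 1)" "bounded_linear B" using a M B by (auto intro: add_pos_pos)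
 fix z and f :: "real => 'a" assume f: "PL0 p (a + a) f"
 have f1: "PL0 p a f" using PL_cut_sub(1)[OF p0 f] a by simp
 have f2: "PL0 p a (%t. f (a + t))" using PL_cut_shift(1)[OF p0, of 0 a f a] PL_cut_sub(1)[OF p0 f, of a "a + a"] a by simp
 obtain v w where s: "sol B a v w f" "v 0 = i z" using LS_ex[OF L f1] .
 have c: "i (tr v a) = v a" by (rule LS_D(3)[OF L s]) (use a in simp)
 obtain v2 w2 where s2: "sol B a v2 w2 (%t. f (a + t))" "v2 0 = i (tr v a)" using LS_ex[OF L f2] .
 have "sol B (a + a) (join a v v2) (join a w w2) (join a f (%t. f (a + t)))"
  by (rule sol_join[OF s(1) s2(1)]) (use a s2 c in auto)
 moreover have "join a f (%t. f (a + t)) = f" by (auto simp: join_def)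
 ultimately show "EX v w. sol B (a + a) v w f & v 0 = i z" using s a by (auto simp: join_def intro!: exI[of _ "join a v v2"])
next
 note a = LS_pos(1)[OF L] and M = LS_pos(2)[OF L]
 fix v w f z assume s: "sol B (a + a) v w f" "v 0 = i z"
 have s1: "sol B a v w f" by (rule sol_sub[OF s(1)]) (use a in simp)
 have s2: "sol B a (%t. v (a + t)) (%t. w (a + t)) (%t. f (a + t))" using sol_shift[OF s(1), of a] a by simp
 note f = sol_PL[OF s(1)]
 define D where "D = norm z + LN0 p (a + a) f"
 have l1: "LN0 p a f <= LN0 p (a + a) f" using PL_cut_sub(2)[OF p0 f, of 0 a] a by simp
 have l2: "LN0 p a (%t. f (a + t)) <= LN0 p (a + a) f"
  using PL_cut_sub[OF p0 f, of a "a + a"] PL_cut_shift(2)[OF p0, of 0 a a f] a by simp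
 have D1: "M * (norm z + LN0 p a f) <= M * D" using l1 M by (simp add: D_def)
 have tra: "norm (tr v a) <= M * D" using LS_D(2)[OF L s1 s(2), of a] a D1 by simp
 have "i (tr v a) = v a" by (rule LS_D(3)[OF L s1 s(2)]) (use a in simp)
 then have i2: "v (a + 0) = i (tr v a)" by simp
 have D2: "M * (norm (tr v a) + LN0 p a (%t. f (a + t))) <= M * (M * D + D)"
  using tra l2 M by (intro mult_left_mono) (auto simp: D_def add_increasing intro: add_mono)
 have Dp: "0 <= D" by (simp add: D_def)
 have MD: "M * (M * D + D) <= (M + M * (M + 1)) * D" "M * D <= (M + M * (M + 1)) * D" using M Dp by (auto simp: algebra_simps)
 have w: "PL0 p (a + a) w" by (rule evoD(1)[OF sol_evo[OF s(1)]])
 have w2: "PL p (cut a (a + a) w)" by (rule PL_cut_sub(1)[OF p0 w]) (use a in auto)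
 have "LN0 p (a + a) w <= LN0 p a w + LN p (cut a (a + a) w)"
  by (rule PL_cut_join(2)[OF p1 _ _ evoD(1)[OF sol_evo[OF s1]] w2]) (use a in auto)
 also have "LN p (cut a (a + a) w) = LN0 p a (%t. w (a + t))" using PL_cut_shift(2)[OF p0, of 0 a a w] w2 by simp
 finally have "LN0 p (a + a) w <= M * D + M * (M * D + D)" using LS_D(1)[OF L s1 s(2)] LS_D(1)[OF L s2 i2] D1 D2 by linarith
 moreover have "norm (tr v t) <= (M + M * (M + 1)) * D" if t: "t \<in> {0..a + a}" for t
 proof (cases "t <= a")
  case True
  then show ?thesis using LS_D(2)[OF L s1 s(2), of t] t D1 MD by simp
 next
  case False
  have "tr (%t. v (a + t)) (t - a) = tr v t" by (simp add: tr_def)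
  then show ?thesis using LS_D(2)[OF L s2 i2, of "t - a"] t False D2 MD by simp
 qed
 ultimately show "LN0 p (a + a) w <= (M + M * (M + 1)) * (norm z + LN0 p (a + a) f) &
   (\<forall>t\<in>{0..a + a}. norm (tr v t) <= (M + M * (M + 1)) * (norm z + LN0 p (a + a) f))"
  unfolding D_def[symmetric] by (auto simp: algebra_simps)
qed

lemma LS_long:
 assumes L: "LS B a M" and b: "0 < b"
 shows "EX M. LS B b M"
proof -
 have a: "0 < a" by (rule LS_pos(1)[OF L])
 have "EX M. LS B (2 ^ n * a) M" for n
 proof (induction n)
  case 0 show ?case using L by auto
 next
  case (Suc n)
  then obtain M where "LS B (2 ^ n * a) M" by blast
  moreover have "2 ^ Suc n * a = 2 ^ n * a + 2 ^ n * a" by simp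
  ultimately show ?case using LS_double[of B "2 ^ n * a" M] by metis
 qed
 moreover obtain n where "b / a < 2 ^ n" using real_arch_pow[of 2 "b / a"] by auto
 then have "b <= 2 ^ n * a" using a by (simp add: field_simps)
 ultimately show ?thesis using LS_short b by blast
qed

text \<open>Both the lower order perturbations of the linear problem and the quasilinear problem are of the form
 \<open>v' + B v = f + N v\<close> with \<open>N\<close> subject to the following estimate.\<close>

definition nonlinearity :: "('c => 'b => 'a) => real => real => real => real => bool" where
 "nonlinearity N rho eps L eta \<longleftrightarrow> 0 <= rho & 0 <= eps & 0 <= L & 0 <= eta & N 0 0 = 0 &
  (ALL c1 c2 w1 w2. norm c1 <= rho --> norm c2 <= rho -->
    norm (N c1 w1 - N c2 w2) <= eps * norm (w1 - w2) + norm (c1 - c2) * (L * norm w2 + eta)) &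
  (ALL a c w. continuous_on {0..a} c --> (\<forall>t\<in>{0..a}. norm (c t) <= rho) --> SM (cut 0 a w) --> SM (cut 0 a (%t. N (c t) (w t))))"

text \<open>The pointwise estimate under the L_p norm, with the difference of the X_gamma-components
  taken out in the supremum norm; integrating the constant \<open>eta\<close> produces
  \<open>a powr (1 / p)\<close>.\<close>

lemma nonlinearity_estimate:
 assumes N: "nonlinearity N rho eps L eta" and a: "0 <= a"
  and c: "continuous_on {0..a} c1" "continuous_on {0..a} c2" "!!t. t \<in> {0..a} ==> norm (c1 t) <= rho"
   "!!t. t \<in> {0..a} ==> norm (c2 t) <= rho" "!!t. t \<in> {0..a} ==> norm (c1 t - c2 t) <= sg"
  and w: "PL0 p a w1" "PL0 p a w2"
 shows "PL0 p a (%t. N (c1 t) (w1 t) - N (c2 t) (w2 t))" (is "PL p ?d")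
  "LN0 p a (%t. N (c1 t) (w1 t) - N (c2 t) (w2 t))
   <= eps * LN0 p a (%t. w1 t - w2 t) + sg * (L * LN0 p a w2 + eta * a powr (1 / p))" (is "_ <= ?r")
proof -
 note n = N[unfolded nonlinearity_def]
 have sg: "0 <= sg" using c(5)[of 0] a norm_ge_zero[of "c1 0 - c2 0"] by (simp del: norm_ge_zero)
 have sm: "SM ?d" unfolding cut_diff using n c PL_SM[OF w(1)] PL_SM[OF w(2)] by (intro SM_diff) blast+
 have dw: "PL0 p a (%t. w1 t - w2 t)" unfolding cut_diff by (rule PL_diff(1)[OF p1 w])
 define m1 where "m1 = (%t. eps *\<^sub>R norm (cut 0 a (%t. w1 t - w2 t) t))"
 define m2 where "m2 = (%t. (sg * L) *\<^sub>R norm (cut 0 a w2 t))"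
 define m3 where "m3 = cut 0 a (%_. sg * eta)"
 have m: "PL p m1" "LN p m1 = eps * LN0 p a (%t. w1 t - w2 t)" "PL p m2" "LN p m2 = sg * L * LN0 p a w2"
  unfolding m1_def m2_def using PL_scale[OF p0 PL_norm(1)[OF dw], of eps] PL_scale[OF p0 PL_norm(1)[OF w(2)], of "sg * L"] n sg
  by (auto simp: PL_norm(2))
 have m3: "PL p m3" "LN p m3 = sg * eta * a powr (1 / p)" unfolding m3_def using PL_cut_const[OF p0 a, of "sg * eta"] n sg by auto
 have m23: "PL p (%t. m2 t + m3 t)" "LN p (%t. m2 t + m3 t) <= LN p m2 + LN p m3" using PL_add[OF p1 m(3) m3(1)] .
 have ms: "PL p (%t. m1 t + (m2 t + m3 t))" "LN p (%t. m1 t + (m2 t + m3 t)) <= LN p m1 + LN p (%t. m2 t + m3 t)"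
  using PL_add[OF p1 m(1) m23(1)] .
 have pos: "0 <= m1 t" "0 <= m2 t" "0 <= m3 t" for t using n sg by (auto simp: m1_def m2_def m3_def cut_def)
 have "norm (?d t) <= 1 * norm (m1 t + (m2 t + m3 t))" for t
 proof (cases "0 < t & t < a")
  case True
  then have t: "t \<in> {0..a}" by auto
  have "norm (N (c1 t) (w1 t) - N (c2 t) (w2 t)) <= eps * norm (w1 t - w2 t) + norm (c1 t - c2 t) * (L * norm (w2 t) + eta)"
   using n c(3,4)[OF t] by blast
  also have "... <= eps * norm (w1 t - w2 t) + sg * (L * norm (w2 t) + eta)"
   using c(5)[OF t] n by (intro add_left_mono mult_right_mono) auto
  also have "... = m1 t + (m2 t + m3 t)" using True by (simp add: m1_def m2_def m3_def cut_def algebra_simps)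
  finally show ?thesis using True by (simp add: cut_def)
 next
  case False then have "?d t = 0" by (auto simp: cut_def)
  then show ?thesis by simp
 qed
 then have "PL p ?d & LN p ?d <= 1 * LN p (%t. m1 t + (m2 t + m3 t))"
  by (intro PL_bound[OF p0 sm ms(1)] AE_I2) auto
 then show "PL p ?d" "LN p ?d <= ?r" using ms(2) m23(2) m m3 by (auto simp: algebra_simps)
qed

lemma nonlinearity_PL:
 assumes N: "nonlinearity N rho eps L eta" and a: "0 <= a" and c: "continuous_on {0..a} c" "!!t. t \<in> {0..a} ==> norm (c t) <= rho"
  and w: "PL0 p a w"
 shows "PL0 p a (%t. N (c t) (w t))"
proof -
 have "\<exists>sg. \<forall>t\<in>{0..a}. norm (c t - 0) <= sg" using c(2) by (intro exI[of _ rho]) simp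
 then obtain sg where sg: "!!t. t \<in> {0..a} ==> norm (c t - 0) <= sg" by blast
 have "PL0 p a (%t. N (c t) (w t) - N 0 0)"
  by (rule nonlinearity_estimate(1)[OF N a c(1) continuous_on_const c(2) _ sg w]) (use N in \<open>auto simp: nonlinearity_def cut_def\<close>)
 then show ?thesis using N by (simp add: nonlinearity_def)
qed

text \<open>The nonlinear part of the difference is absorbed because its factor \<open>kappa\<close>
  is at most 1/2. Only the second solution has to be small in L_p(X_1); this asymmetry gives
  uniqueness against competitors of unknown size in that norm.\<close>

lemma nonlinear_diff:
 assumes L: "LS B a M" and N: "nonlinearity N rho eps L eta" and kappa: "kappa = M * (eps + L * rho + eta * a powr (1 / p))" "kappa <= 1 / 2"
  and s1: "sol B a v1 w1 g1" and s2: "sol B a v2 w2 g2"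
  and r: "!!t. t \<in> {0..a} ==> norm (tr v1 t) <= rho" "!!t. t \<in> {0..a} ==> norm (tr v2 t) <= rho" "LN0 p a w2 <= rho"
  and f: "PL0 p a f"
  and g: "AE t in lebesgue. 0 < t & t < a --> g1 t - g2 t = f t + (N (tr v1 t) (w1 t) - N (tr v2 t) (w2 t))"
  and z: "v1 0 - v2 0 = i z"
 shows "LN0 p a (%t. g1 t - g2 t) <= 2 * LN0 p a f + 2 * kappa * norm z"
  "LN0 p a (%t. w1 t - w2 t) <= M * (norm z + LN0 p a (%t. g1 t - g2 t))"
  "!!t. t \<in> {0..a} ==> norm (tr v1 t - tr v2 t) <= M * (norm z + LN0 p a (%t. g1 t - g2 t))"
proof -
 note a = LS_pos(1)[OF L] and M = LS_pos(2)[OF L] and B = LS_pos(3)[OF L]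
 note n = N[unfolded nonlinearity_def]
 note t1 = evo_tr[OF a sol_evo[OF s1]] and t2 = evo_tr[OF a sol_evo[OF s2]]
 have d: "sol B a (%t. v1 t - v2 t) (%t. w1 t - w2 t) (%t. g1 t - g2 t)" by (rule sol_diff[OF B s1 s2])
 define D where "D = norm z + LN0 p a (%t. g1 t - g2 t)"
 note dd = LS_D[OF L d z]
 show lw: "LN0 p a (%t. w1 t - w2 t) <= M * (norm z + LN0 p a (%t. g1 t - g2 t))" by (rule dd(1))
 show lc: "norm (tr v1 t - tr v2 t) <= M * (norm z + LN0 p a (%t. g1 t - g2 t))" if "t \<in> {0..a}" for t
  using dd(2)[OF that] tr_diff[of v1 t v2, OF t1(1)[OF that] t2(1)[OF that]] by simp
 have a0: "0 <= a" using a by simp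
 note NE = nonlinearity_estimate[OF N a0 t1(2) t2(2) r(1,2) lc evoD(1)[OF sol_evo[OF s1]] evoD(1)[OF sol_evo[OF s2]], folded D_def]
 have "LN0 p a (%t. g1 t - g2 t) = LN0 p a (%t. f t + (N (tr v1 t) (w1 t) - N (tr v2 t) (w2 t)))"
  using PL_AE_cong(2)[OF p0 sol_PL[OF d] cut_cong_AE[OF g]] by simp
 also have "... <= LN0 p a f + LN0 p a (%t. N (tr v1 t) (w1 t) - N (tr v2 t) (w2 t))"
  unfolding cut_add using PL_add(2)[OF p1 f NE(1)] by simp
 also have "... <= LN0 p a f + (eps * LN0 p a (%t. w1 t - w2 t) + M * D * (L * LN0 p a w2 + eta * a powr (1 / p)))"
  using NE(2) by simp
 also have "... <= LN0 p a f + (eps * (M * D) + M * D * (L * rho + eta * a powr (1 / p)))"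
  using lw r(3) n M by (intro add_left_mono add_mono mult_left_mono) (auto simp: D_def)
 also have "... = LN0 p a f + kappa * D" by (simp add: kappa(1) algebra_simps)
 finally have 1: "LN0 p a (%t. g1 t - g2 t) <= LN0 p a f + kappa * D" .
 have "kappa * D <= kappa * norm z + 1 / 2 * LN0 p a (%t. g1 t - g2 t)"
  unfolding D_def distrib_left using kappa(2) by (intro add_left_mono mult_right_mono) auto
 then show "LN0 p a (%t. g1 t - g2 t) <= 2 * LN0 p a f + 2 * kappa * norm z" using 1 by linarith
qed

text \<open>The unknown of the fixed point problem is the right-hand side g = f + N(v,w) and not the
  solution: the linear problem turns \<open>g\<close> into a solution, and the contraction takes
  place in L_p(0,a;X_0).\<close>

lemma nonlinear_solution:
 assumes L: "LS B a M" and N: "nonlinearity N rho eps L eta" and kappa: "M * (eps + L * rho + eta * a powr (1 / p)) <= 1 / 2"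
  and f: "PL0 p a f" and rho: "M * (2 * norm z + 2 * LN0 p a f) <= rho"
 obtains v w where "sol B a v w (%t. f t + N (tr v t) (w t))" "v 0 = i z"
  "LN0 p a w <= M * (2 * norm z + 2 * LN0 p a f)"
  "!!t. t \<in> {0..a} ==> norm (tr v t) <= M * (2 * norm z + 2 * LN0 p a f)"
proof -
 note a = LS_pos(1)[OF L] and M = LS_pos(2)[OF L] and B = LS_pos(3)[OF L]
 have a0: "0 <= a" using a by simp
 \<comment> \<open>The radius for which \<open>Phi\<close> maps 0 into the ball of radius R/2: the
   nonlinearity at the homogeneous solution has norm at most \<open>norm z / 2\<close>.\<close>
 define R where "R = norm z + 2 * LN0 p a f"
 define m where "m = M * (2 * norm z + 2 * LN0 p a f)"
 note n = N[unfolded nonlinearity_def]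
 have "EX v w. sol B a v w g & v 0 = i z" if "PL0 p a g" for g using LS_ex[OF L that, of z] by blast
 then obtain v w where s: "!!g. PL0 p a g ==> sol B a (v g) (w g) g & v g 0 = i z" by metis
 have s1: "sol B a (v g) (w g) g" and s2: "v g 0 = i z" if "PL0 p a g" for g using s[OF that] by blast+
 note D = LS_D[OF L s1 s2]
 define Phi where "Phi g t = f t + N (tr (v g) t) (w g t)" for g t
 have bd: "LN0 p a (w g) <= m" "!!t. t \<in> {0..a} ==> norm (tr (v g) t) <= m" if g: "PL0 p a g" "LN0 p a g <= R" for g
 proof -
  have "M * (norm z + LN0 p a g) <= m" unfolding m_def using g(2) M by (intro mult_left_mono) (auto simp: R_def)
  then show "LN0 p a (w g) <= m" "!!t. t \<in> {0..a} ==> norm (tr (v g) t) <= m"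
   using D(1)[OF g(1) g(1)] D(2)[OF g(1) g(1)] by (auto intro: order_trans)
 qed
 have mrho: "m <= rho" using rho by (simp add: m_def)
 have brho: "LN0 p a (w g) <= rho" "!!t. t \<in> {0..a} ==> norm (tr (v g) t) <= rho" if g: "PL0 p a g" "LN0 p a g <= R" for g
  using bd[OF g] mrho by (auto intro: order_trans)
 note cont = D(4)
 have wPL: "PL0 p a (w g)" if "PL0 p a g" for g by (rule evoD(1)[OF sol_evo[OF s1[OF that]]])
 have R0: "0 <= R" by (simp add: R_def)
 have NPL: "PL0 p a (%t. N (tr (v g) t) (w g t))" if g: "PL0 p a g" "LN0 p a g <= R" for g
  by (rule nonlinearity_PL[OF N a0 cont[OF g(1) g(1)] brho(2)[OF g] wPL[OF g(1)]])
 have sm: "LN0 p a (Phi g) <= LN0 p a f + LN0 p a (%t. N (tr (v g) t) (w g t))" "PL0 p a (Phi g)"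
  if g: "PL0 p a g" "LN0 p a g <= R" for g
  unfolding Phi_def[abs_def] cut_add using PL_add[OF p1 f NPL[OF g]] by auto
 obtain g where g: "PL0 p a g" "LN0 p a g <= R" "AE t in lebesgue. 0 < t & t < a --> Phi g t = g t"
 proof (rule PL_fixpoint[OF p1, where Phi = Phi and a = a and R = R])
  show "PL0 p a (Phi g)" if "PL0 p a g" "LN0 p a g <= R" for g using sm(2)[OF that] .
  let ?o = "%_::real. 0 :: 'a"
  have o: "PL0 p a ?o" "LN0 p a ?o <= R" using R0 by auto
  have c0: "norm (tr (v ?o) t - 0) <= M * norm z" if "t \<in> {0..a}" for t
   using D(2)[OF o(1) o(1) that] by simp
  have "LN0 p a (%t. N (tr (v ?o) t) (w ?o t) - N 0 0)
   <= eps * LN0 p a (%t. w ?o t - 0) + M * norm z * (L * LN0 p a (%_. 0 :: 'b) + eta * a powr (1 / p))"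
   by (rule nonlinearity_estimate(2)[OF N a0 cont[OF o(1) o(1)] continuous_on_const brho(2)[OF o] _ c0 wPL[OF o(1)] PL_cut_zero(1)])
    (use n in auto)
  also have "... <= eps * (M * norm z) + M * norm z * (L * rho + eta * a powr (1 / p))"
   using D(1)[OF o(1) o(1)] n M by (intro add_mono mult_left_mono) auto
  also have "... = M * (eps + L * rho + eta * a powr (1 / p)) * norm z" by (simp add: algebra_simps)
  also have "... <= 1 / 2 * norm z" using kappa by (intro mult_right_mono) auto
  finally have "LN0 p a (%t. N (tr (v ?o) t) (w ?o t)) <= norm z / 2" using n by simp
  then show "LN0 p a (Phi ?o) <= R / 2" using sm(1)[OF o] by (simp add: R_def)
 next
  fix g h :: "real => 'a" assume gh: "PL0 p a g" "PL0 p a h" "LN0 p a g <= R" "LN0 p a h <= R"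
  define E where "E = LN0 p a (%t. g t - h t)"
  have dd: "sol B a (%t. v g t - v h t) (%t. w g t - w h t) (%t. g t - h t)" by (rule sol_diff[OF B s1[OF gh(1)] s1[OF gh(2)]])
  have d0: "v g 0 - v h 0 = i 0" using s2 gh by (simp add: linear_0[OF linear_i])
  have dc: "norm (tr (v g) t - tr (v h) t) <= M * E" if "t \<in> {0..a}" for t
   using LS_D(2)[OF L dd d0 that] tr_diff[of "v g" t "v h", OF D(3)[OF gh(1) gh(1) that] D(3)[OF gh(2) gh(2) that]] by (simp add: E_def)
  have dw: "LN0 p a (%t. w g t - w h t) <= M * E" using LS_D(1)[OF L dd d0] by (simp add: E_def)
  have "LN0 p a (%t. Phi g t - Phi h t) = LN0 p a (%t. N (tr (v g) t) (w g t) - N (tr (v h) t) (w h t))"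
   by (simp add: Phi_def)
  also have "... <= eps * LN0 p a (%t. w g t - w h t) + M * E * (L * LN0 p a (w h) + eta * a powr (1 / p))"
   by (rule nonlinearity_estimate(2)[OF N a0 cont[OF gh(1) gh(1)] cont[OF gh(2) gh(2)] brho(2)[OF gh(1,3)] brho(2)[OF gh(2,4)] dc wPL[OF gh(1)] wPL[OF gh(2)]])
  also have "... <= eps * (M * E) + M * E * (L * rho + eta * a powr (1 / p))"
   using dw brho(1)[OF gh(2,4)] n M by (intro add_mono mult_left_mono) (auto simp: E_def)
  also have "... = M * (eps + L * rho + eta * a powr (1 / p)) * E" by (simp add: algebra_simps)
  also have "... <= 1 / 2 * E" using kappa by (intro mult_right_mono) (auto simp: E_def)
  finally show "LN0 p a (%t. Phi g t - Phi h t) <= LN0 p a (%t. g t - h t) / 2" by (simp add: E_def)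
 qed
 have "sol B a (v g) (w g) (%t. f t + N (tr (v g) t) (w g t))"
  by (rule sol_cong[OF s1[OF g(1)] refl]) (use g(3) in \<open>auto simp: Phi_def\<close>)
 from that[OF this s2[OF g(1)]] show ?thesis using bd[OF g(1,2)] unfolding m_def by blast
qed

text \<open>The perturbation factors through X_gamma, so on an interval of length \<open>h\<close>
  it costs only \<open>eta * h powr (1 / p)\<close>. As a nonlinearity it has vanishing
  \<open>eps\<close> and \<open>L\<close>, which leaves \<open>rho\<close> unrestricted;
  \<open>LS_long\<close> recovers arbitrary lengths.\<close>

lemma LS_perturb:
 assumes L: "LS B a M" and C: "bounded_linear C" and b: "0 < b"
 shows "EX M. LS (%x. B x + C (incl J i x)) b M"
proof -
 note a = LS_pos(1)[OF L] and M = LS_pos(2)[OF L] and B = LS_pos(3)[OF L]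
 let ?B = "%x. B x + C (incl J i x)"
 have B': "bounded_linear ?B" by (rule bounded_linear_add[OF B bounded_linear_compose[OF C incl_bounded]])
 obtain eta where eta: "0 < eta" "!!c. norm (C c) <= norm c * eta" using bounded_linear.pos_bounded[OF C] by blast
 define N where "N c (w :: 'b) = - C c" for c w
 have N: "nonlinearity N rho 0 0 eta" if "0 <= rho" for rho
  unfolding nonlinearity_def
 proof (intro conjI allI impI)
  fix c1 c2 w1 w2 show "norm (N c1 w1 - N c2 w2) <= 0 * norm (w1 - w2) + norm (c1 - c2) * (0 * norm w2 + eta)"
   using eta(2)[of "c2 - c1"] by (simp add: N_def linear_diff[OF bounded_linear.linear[OF C]] norm_minus_commute)
 next
  fix t and c :: "real => 'c" and w :: "real => 'b" assume c: "continuous_on {0..t} c"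
  have "continuous_on {0<..<t} (%t. - C (c t))"
   by (rule continuous_on_subset[OF continuous_on_minus[OF bounded_linear.continuous_on[OF C c]]]) auto
  then show "SM (cut 0 t (%s. N (c s) (w s)))" unfolding N_def by (rule SM_continuous)
 qed (use that eta in \<open>auto simp: N_def linear_0[OF bounded_linear.linear[OF C]]\<close>)
 define h where "h = min a ((1 / (2 * M * eta)) powr p)"
 have h: "0 < h" "h <= a" using a M eta p by (auto simp: h_def)
 have "h powr (1 / p) <= ((1 / (2 * M * eta)) powr p) powr (1 / p)" using h p0 by (intro powr_mono2) (auto simp: h_def)
 also have "... = 1 / (2 * M * eta)" using p0 M eta by (simp add: powr_powr)
 finally have "M * (eta * h powr (1 / p)) <= M * (eta * (1 / (2 * M * eta)))" using M eta by (intro mult_left_mono) auto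
 also have "... = 1 / 2" using M eta by simp
 finally have kappa: "M * (0 + 0 * rho + eta * h powr (1 / p)) <= 1 / 2" for rho by simp
 have Lh: "LS B h M" by (rule LS_short[OF L h])
 have ae: "AE t in lebesgue. 0 < t & t < h --> C (tr v t) = C (incl J i (w t))" if "evo h v w g" for v w g
  using evo_tr(3)[OF h(1) that] by eventually_elim auto
 have "LS ?B h (2 * M)"
 proof (rule LS_I[OF B' h(1)])
  show "0 < 2 * M" using M by simp
  fix z and f :: "real => 'a" assume f: "PL0 p h f"
  obtain v w where s: "sol B h v w (%t. f t + N (tr v t) (w t))" "v 0 = i z"
   by (rule nonlinear_solution[OF Lh N kappa f order_refl]) (use M in auto)
  have "evo h v w (%t. f t - ?B (w t))"
   by (rule evo_cong[OF sol_evo[OF s(1)]]) (use ae[OF sol_evo[OF s(1)]] in \<open>auto simp: N_def algebra_simps elim!: eventually_mono\<close>)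
  then show "EX v w. sol ?B h v w f & v 0 = i z" using s f by (auto simp: sol_def)
 next
  fix v w f z assume s: "sol ?B h v w f" "v 0 = i z"
  note e = sol_evo[OF s(1)]
  define g where "g t = (f t - ?B (w t)) + B (w t)" for t
  have s1: "sol B h v w g" unfolding g_def by (rule sol_of_evo[OF B e])
  have s2: "sol B h (%_. 0) (%_. 0) (%_. 0)" unfolding sol_def evo_def by (simp add: cut_def linear_0[OF bounded_linear.linear[OF B]] linear_0[OF linear_J])
  have tr0: "tr (%_. 0) t = 0" for t by (rule tr_eqI) (simp add: linear_0[OF linear_i])
  have "bounded (tr v ` {0..h})" by (rule compact_imp_bounded[OF compact_continuous_image[OF evo_tr(2)[OF h(1) e] compact_Icc]])
  then obtain rho where rho: "0 <= rho" "!!t. t \<in> {0..h} ==> norm (tr v t) <= rho" unfolding bounded_iff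
   by (metis imageI norm_ge_zero order_trans atLeastAtMost_iff h(1) order_refl less_imp_le)
  have gg: "AE t in lebesgue. 0 < t & t < h --> g t - 0 = f t + (N (tr v t) (w t) - N (tr (%_. 0) t) 0)"
   using ae[OF e] by eventually_elim (auto simp: g_def N_def tr0 linear_0[OF bounded_linear.linear[OF C]])
  have 3: "LN0 p h (%_. 0 :: 'b) <= rho" using rho by (simp add: cut_def)
  have 4: "norm (tr (%_. 0) t) <= rho" for t using rho by (simp add: tr0)
  have vz: "v 0 - 0 = i z" using s by simp
  note nd = nonlinear_diff[OF Lh N[OF rho(1)] refl kappa s1 s2 rho(2) 4 3 sol_PL[OF s(1)] gg vz, unfolded diff_zero tr0]
  have "2 * (M * (0 + 0 * rho + eta * h powr (1 / p))) * norm z <= 1 * norm z" using kappa[of rho] by (intro mult_right_mono) auto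
  then have "LN0 p h g <= 2 * LN0 p h f + norm z" using nd(1) by linarith
  then have "M * (norm z + LN0 p h g) <= M * (2 * (norm z + LN0 p h f))" using M by (intro mult_left_mono) auto
  then have le: "M * (norm z + LN0 p h g) <= 2 * M * (norm z + LN0 p h f)" by (simp add: mult.left_commute mult.assoc)
  have "norm (tr v t) <= 2 * M * (norm z + LN0 p h f)" if "t \<in> {0..h}" for t
   using LS_D(2)[OF Lh s1 s(2) that] le by linarith
  then show "LN0 p h w <= 2 * M * (norm z + LN0 p h f) & (\<forall>t\<in>{0..h}. norm (tr v t) <= 2 * M * (norm z + LN0 p h f))"
   using LS_D(1)[OF Lh s1 s(2)] le by auto
 qed
 then show ?thesis by (rule LS_long[OF _ b])
qed

end

lemma has_integral_norm_le:
 fixes f :: "real => 'x::real_normed_vector"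
 assumes "0 <= B" "(f has_integral y) {a..b}" "a <= b" "!!x. x \<in> {a..b} ==> norm (f x) <= B"
 shows "norm y <= B * (b - a)"
 using has_integral_bound_real[OF assms(1) finite.emptyI assms(2)] assms(3,4) by simp

text \<open>Zabreiko's lemma for the quotient norm, the infimum of the norms of preimages. A series
  of near-optimal preimages, with errors summing to \<open>e\<close>, gives its countable
  subadditivity.\<close>

lemma open_mapping_bound:
 fixes T :: "'x::banach => 'y::banach"
 assumes T: "bounded_linear T" and surj: "surj T"
 shows "\<exists>K>0. ALL y. EX x. T x = y & norm x <= K * norm y"
proof -
 note lin = bounded_linear.linear[OF T]
 define q where "q y = Inf (norm ` (T -` {y}))" for y
 have ne: "norm ` (T -` {y}) ~= {}" for y using surjD[OF surj, of y] by blast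
 have bb: "bdd_below (norm ` (T -` {y}))" for y by (rule bdd_belowI[of _ 0]) auto
 have ql: "T x = y ==> q y <= norm x" for x y unfolding q_def by (rule cInf_lower[OF _ bb]) auto
 have qa: "EX x. T x = y & norm x < q y + e" if "0 < e" for y e
 proof -
  have "\<exists>r\<in>norm ` (T -` {y}). r < q y + e" unfolding q_def by (rule cInf_lessD[OF ne]) (use that in simp)
  then show ?thesis by auto
 qed
 have q0: "0 <= q y" for y unfolding q_def by (rule cInf_greatest[OF ne]) auto
 have q_add: "q (x + y) <= q x + q y" for x y
 proof (rule field_le_epsilon)
  fix e :: real assume "0 < e"
  then obtain u v where "T u = x" "norm u < q x + e / 2" "T v = y" "norm v < q y + e / 2" using qa[of "e / 2"] by (metis half_gt_zero)
  then show "q (x + y) <= q x + q y + e" using ql[of "u + v" "x + y"] norm_triangle_ineq[of u v] by (simp add: linear_add[OF lin])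
 qed
 have q_sc1: "q (c *\<^sub>R x) <= \<bar>c\<bar> * q x" for c x
 proof (rule field_le_epsilon)
  fix e :: real assume "0 < e"
  then have e: "0 < e / (\<bar>c\<bar> + 1)" by simp
  obtain u where u: "T u = x" "norm u < q x + e / (\<bar>c\<bar> + 1)" using qa[OF e] by blast
  have "q (c *\<^sub>R x) <= \<bar>c\<bar> * norm u" using ql[of "c *\<^sub>R u"] u by (simp add: linear_scale[OF lin])
  also have "... <= \<bar>c\<bar> * (q x + e / (\<bar>c\<bar> + 1))" using u by (intro mult_left_mono) auto
  also have "... <= \<bar>c\<bar> * q x + e" using \<open>0 < e\<close> by (simp add: field_simps)
  finally show "q (c *\<^sub>R x) <= \<bar>c\<bar> * q x + e" .
 qed
 have q_scale: "q (c *\<^sub>R x) = \<bar>c\<bar> * q x" for c x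
 proof (cases "c = 0")
  case True then show ?thesis using q_sc1[of c x] q0[of "c *\<^sub>R x"] by simp
 next
  case False
  have "q x <= \<bar>inverse c\<bar> * q (c *\<^sub>R x)" using q_sc1[of "inverse c" "c *\<^sub>R x"] False by simp
  then have "\<bar>c\<bar> * q x <= q (c *\<^sub>R x)" using False by (simp add: field_simps abs_inverse)
  then show ?thesis using q_sc1[of c x] by simp
 qed
 have "\<exists>C>0. \<forall>y\<in>UNIV. q y <= C * norm y"
 proof (rule zabreiko)
  fix x :: "nat => 'y" assume s: "summable (%n. norm (x n))"
  have "(%n. (\<Sum>k. x k) - (\<Sum>k<n. x k)) \<longlonglongrightarrow> (\<Sum>k. x k) - (\<Sum>k. x k)"
   by (rule tendsto_diff[OF tendsto_const summable_LIMSEQ[OF summable_norm_cancel[OF s]]])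
  then have "(%n. norm ((\<Sum>k. x k) - (\<Sum>k<n. x k))) \<longlonglongrightarrow> 0" by (intro tendsto_norm_zero) (simp only: diff_self)
  then show "\<exists>y\<in>UNIV. (%n. norm (y - (\<Sum>k<n. x k))) \<longlonglongrightarrow> 0" by blast
 next
  fix y :: "nat => 'y" and b assume b: "(%n. norm (b - (\<Sum>k<n. y k))) \<longlonglongrightarrow> 0" and s: "summable (%n. q (y n))"
  show "q b <= (\<Sum>n. q (y n))"
  proof (rule field_le_epsilon)
   fix e :: real assume e: "0 < e"
   have "EX x. T x = y n & norm x < q (y n) + e / 2 * (1/2)^n" for n by (rule qa) (use e in simp)
   then obtain x where x: "!!n. T (x n) = y n" "!!n. norm (x n) < q (y n) + e / 2 * (1/2)^n" by metis
   have g: "(%n. e / 2 * (1/2::real)^n) sums e" using sums_mult[OF geometric_sums[of "1/2::real"], of "e/2"] by simp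
   have sg: "summable (%n. q (y n) + e / 2 * (1/2)^n)" by (rule summable_add[OF s sums_summable[OF g]])
   have sn: "summable (%n. norm (x n))" by (rule summable_comparison_test[OF _ sg]) (use x(2) in \<open>auto intro: less_imp_le\<close>)
   have "(%n. T (x n)) sums T (\<Sum>n. x n)"
    by (rule bounded_linear.sums[OF T summable_sums[OF summable_norm_cancel[OF sn]]])
   then have "(%n. \<Sum>k<n. y k) \<longlonglongrightarrow> T (\<Sum>n. x n)" by (simp add: x(1) sums_def)
   moreover have "(%n. b - (\<Sum>k<n. y k)) \<longlonglongrightarrow> 0" using b by (rule tendsto_norm_zero_cancel)
   then have "(%n. b - (b - (\<Sum>k<n. y k))) \<longlonglongrightarrow> b - 0" by (intro tendsto_diff tendsto_const)
   then have "(%n. \<Sum>k<n. y k) \<longlonglongrightarrow> b" by simp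
   ultimately have "T (\<Sum>n. x n) = b" by (rule LIMSEQ_unique)
   then have "q b <= norm (\<Sum>n. x n)" by (rule ql)
   also have "... <= (\<Sum>n. norm (x n))" by (rule summable_norm[OF sn])
   also have "... <= (\<Sum>n. q (y n) + e / 2 * (1/2)^n)" by (rule suminf_le[OF _ sn sg]) (use x(2) in \<open>auto intro: less_imp_le\<close>)
   also have "... = (\<Sum>n. q (y n)) + e" using suminf_add[OF s sums_summable[OF g]] sums_unique[OF g] by simp
   finally show "q b <= (\<Sum>n. q (y n)) + e" .
  qed
 qed (auto simp: q_scale q0 intro: q_add norm_triangle_ineq)
 then obtain C where C: "0 < C" "!!y. q y <= C * norm y" by blast
 \<comment> \<open>The infimum need not be attained; the slack \<open>norm y\<close> turns
   \<open>C\<close> into \<open>C + 1\<close>.\<close>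
 have "EX x. T x = y & norm x <= (C + 1) * norm y" for y
 proof (cases "y = 0")
  case True then show ?thesis using linear_0[OF lin] by (intro exI[of _ 0]) simp
 next
  case False
  then obtain x where "T x = y" "norm x < q y + norm y" using qa[of "norm y" y] by auto
  then show ?thesis using C(2)[of y] by (intro exI[of _ x]) (simp add: algebra_simps)
 qed
 then show ?thesis using C(1) by (intro exI[of _ "C + 1"]) auto
qed

section \<open>Complexification and contour integrals\<close>

text \<open>Multiplication by complex scalars on the complexification, whose elements are the pairs \<open>(x, y)\<close> standing for \<open>x + i y\<close>.\<close>

definition cs :: "complex => 'z::real_normed_vector \<times> 'z => 'z \<times> 'z" where
 "cs c z = (Re c *\<^sub>R fst z - Im c *\<^sub>R snd z, Im c *\<^sub>R fst z + Re c *\<^sub>R snd z)"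

lemma norm_cs: "norm (cs c z) <= 4 * norm c * norm z"
proof -
 have 1: "norm (Re c *\<^sub>R x) <= norm c * norm z" "norm (Im c *\<^sub>R x) <= norm c * norm z" if "norm x <= norm z" for x
  using that abs_Re_le_cmod[of c] abs_Im_le_cmod[of c] by (auto intro!: mult_mono)
 have 2: "norm (fst z) <= norm z" "norm (snd z) <= norm z" using norm_fst_le[of "fst z" "snd z"] norm_snd_le[of "snd z" "fst z"] by simp_all
 have "norm (cs c z) <= norm (Re c *\<^sub>R fst z - Im c *\<^sub>R snd z) + norm (Im c *\<^sub>R fst z + Re c *\<^sub>R snd z)"
  unfolding cs_def by (rule norm_Pair_le)
 also have "... <= (norm (Re c *\<^sub>R fst z) + norm (Im c *\<^sub>R snd z)) + (norm (Im c *\<^sub>R fst z) + norm (Re c *\<^sub>R snd z))"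
  by (intro add_mono norm_triangle_ineq norm_triangle_ineq4)
 also have "... <= 4 * norm c * norm z" using 1[OF 2(1)] 1[OF 2(2)] by linarith
 finally show ?thesis .
qed

lemma bounded_bilinear_cs: "bounded_bilinear cs"
proof
 show "EX K. ALL a b. norm (cs a b) <= norm a * norm b * K"
  by (rule exI[of _ 4]) (metis norm_cs mult.commute mult.assoc)
qed (auto simp: cs_def prod_eq_iff algebra_simps)

lemma cs_simps [simp]: "cs 1 z = z" "cs 0 z = 0" "cs c 0 = 0" "cs (of_real r) z = r *\<^sub>R z"
 and cs_cs: "cs a (cs b z) = cs (a * b) z"
 and cs_commute: "cs a (cs b z) = cs b (cs a z)"
 by (auto simp: cs_def prod_eq_iff algebra_simps)

lemmas cs_bl = bounded_bilinear.bounded_linear_right[OF bounded_bilinear_cs]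
 and cs_bl_left = bounded_bilinear.bounded_linear_left[OF bounded_bilinear_cs]
 and cs_add = bounded_bilinear.add_left[OF bounded_bilinear_cs] bounded_bilinear.add_right[OF bounded_bilinear_cs]
 and cs_diff = bounded_bilinear.diff_left[OF bounded_bilinear_cs] bounded_bilinear.diff_right[OF bounded_bilinear_cs]
 and cs_minus = bounded_bilinear.minus_left[OF bounded_bilinear_cs] bounded_bilinear.minus_right[OF bounded_bilinear_cs]
 and continuous_on_cs = bounded_bilinear.continuous_on[OF bounded_bilinear_cs]

text \<open>Differentiability is one-sided on the imaginary axis, so nothing is required to its
  left. Continuity of the derivative permits differentiation under the integral, which takes the
  place of Goursat's theorem.\<close>

definition holo :: "(complex => 'z::real_normed_vector \<times> 'z) => (complex => 'z \<times> 'z) => bool" where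
 "holo h h' \<longleftrightarrow> (ALL l. 0 <= Re l --> (h has_derivative (%d. cs d (h' l))) (at l within {l. 0 <= Re l})) & continuous_on {l. 0 <= Re l} h'"

lemma holo_D:
 assumes h: "holo h h'"
 shows "0 <= a ==> ((%a. h (Complex a x)) has_vector_derivative h' (Complex a x)) (at a within {0..})"
  "0 <= a ==> ((%x. h (Complex a x)) has_vector_derivative cs \<i> (h' (Complex a x))) (at x within S)"
  "continuous_on {l. 0 <= Re l} h'" "continuous_on {l. 0 <= Re l} h"
proof -
 let ?S = "{l. 0 <= Re l}"
 have d: "(h has_derivative (%d. cs d (h' l))) (at l within ?S)" if "l \<in> ?S" for l using h that by (auto simp: holo_def)
 show "continuous_on ?S h'" using h by (simp add: holo_def)
 show "continuous_on ?S h" by (rule has_derivative_continuous_on[OF d])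
 have e: "Complex a x = of_real a + \<i> * of_real x" for a x by (simp add: complex_eq_iff)
 show "((%a. h (Complex a x)) has_vector_derivative h' (Complex a x)) (at a within {0..})" if a: "0 <= a"
 proof -
  have f: "((%a. Complex a x) has_derivative (%d. of_real d)) (at a within {0..})"
   unfolding e by (auto intro!: derivative_eq_intros)
  have "((%a. h (Complex a x)) has_derivative (%d. cs (of_real d) (h' (Complex a x)))) (at a within {0..})"
   by (rule has_derivative_in_compose2[where t = ?S and g = h and f = "%a. Complex a x", OF d _ _ f]) (use a in auto)
  then show ?thesis unfolding has_vector_derivative_def cs_simps .
 qed
 show "((%x. h (Complex a x)) has_vector_derivative cs \<i> (h' (Complex a x))) (at x within S)" if a: "0 <= a"
 proof -
  have f: "((%x. Complex a x) has_derivative (%d. \<i> * of_real d)) (at x within UNIV)"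
   unfolding e by (auto intro!: derivative_eq_intros)
  have "((%x. h (Complex a x)) has_derivative (%d. cs (\<i> * of_real d) (h' (Complex a x)))) (at x within UNIV)"
   by (rule has_derivative_in_compose2[where t = ?S and g = h and f = "%x. Complex a x", OF d _ _ f]) (use a in auto)
  moreover have "cs (\<i> * of_real d) y = d *\<^sub>R cs \<i> y" for d :: real and y :: "'a \<times> 'a"
   using cs_cs[of "of_real d" "\<i>" y] by (simp add: mult.commute)
  ultimately show ?thesis unfolding has_vector_derivative_def by (auto intro: has_derivative_subset)
 qed
qed

text \<open>Cauchy's theorem for the integral over the imaginary axis: the integral over \<open>[a - i N, a + i N]\<close> changes with \<open>a\<close>
 only by the values of \<open>h\<close> at the end points.\<close>

lemma contour_bound:
 fixes h h' :: "complex => 'z::banach \<times> 'z"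
 assumes h: "holo h h'" and b: "!!l. 0 <= Re l ==> norm (h l) <= C / (1 + (norm l)\<^sup>2)" and N: "0 < N"
 shows "norm (integral {-N..N} (%x. h (Complex 0 x))) <= 10 * C / N"
proof -
 \<comment> \<open>The segment is moved to the right up to a = N, where the integrand itself is of
   order N^-2. The move costs at most 8 C/N and the final segment 2 C/N.\<close>
 define Phi where "Phi a = integral (cbox (-N) N) (%x. h (Complex a x))" for a
 have C: "0 <= C" using b[of 0] norm_ge_zero[of "h 0"] by (simp del: norm_ge_zero)
 have bN: "norm (h (Complex a x)) <= C / (1 + N\<^sup>2)" if "0 <= a" "N\<^sup>2 <= a\<^sup>2 + x\<^sup>2" for a x
 proof -
  have "norm (h (Complex a x)) <= C / (1 + (a\<^sup>2 + x\<^sup>2))" using b[of "Complex a x"] that by (simp add: cmod_power2)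
  also have "... <= C / (1 + N\<^sup>2)" using that C by (intro divide_left_mono mult_pos_pos) (auto intro: add_pos_nonneg)
  finally show ?thesis .
 qed
 have ci: "continuous_on S (%x. h (Complex a x))" if "0 <= a" for a S
  by (rule continuous_on_compose2[OF holo_D(4)[OF h]]) (use that in \<open>auto simp: Complex_eq intro!: continuous_intros\<close>)
 have ci': "continuous_on S (%x. h' (Complex a x))" if "0 <= a" for a S
  by (rule continuous_on_compose2[OF holo_D(3)[OF h]]) (use that in \<open>auto simp: Complex_eq intro!: continuous_intros\<close>)
 have der: "(Phi has_vector_derivative integral (cbox (-N) N) (%x. h' (Complex a x))) (at a within {0..N})" if a: "a \<in> {0..N}" for a
  unfolding Phi_def
 proof (rule leibniz_rule_vector_derivative)
  show "((%a. h (Complex a x)) has_vector_derivative h' (Complex a x)) (at a within {0..N})" if "a \<in> {0..N}" for a x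
   using has_vector_derivative_within_subset[OF holo_D(1)[OF h]] that by auto
  show "(%x. h (Complex a x)) integrable_on cbox (- N) N" if "a \<in> {0..N}" for a
   by (rule integrable_continuous) (use ci that in auto)
  show "continuous_on ({0..N} \<times> cbox (- N) N) (%(a, x). h' (Complex a x))"
   unfolding case_prod_unfold by (rule continuous_on_compose2[OF holo_D(3)[OF h]])
    (auto simp: Complex_eq intro!: continuous_intros)
 qed (use a in auto)
 \<comment> \<open>Along a vertical segment \<open>h'\<close> is the derivative of \<open>h\<close>
   up to a factor i, so its integral is a multiple of a difference of end values.\<close>
 have small: "norm (integral (cbox (-N) N) (%x. h' (Complex a x))) <= 8 * C / (1 + N\<^sup>2)" if a: "a \<in> {0..N}" for a
 proof -
  have a0: "0 <= a" using a by simp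
  have "((%x. cs \<i> (h' (Complex a x))) has_integral (h (Complex a N) - h (Complex a (-N)))) {-N..N}"
   by (rule fundamental_theorem_of_calculus) (use holo_D(2)[OF h a0] N in auto)
  moreover have I: "((%x. h' (Complex a x)) has_integral integral {-N..N} (%x. h' (Complex a x))) {-N..N}"
   by (rule integrable_integral[OF integrable_continuous_interval[OF ci'[OF a0]]])
  have "((%x. cs \<i> (h' (Complex a x))) has_integral cs \<i> (integral {-N..N} (%x. h' (Complex a x)))) {-N..N}"
   using has_integral_linear[OF I cs_bl] by (simp add: o_def)
  ultimately have eq: "cs \<i> (integral {-N..N} (%x. h' (Complex a x))) = h (Complex a N) - h (Complex a (-N))"
   by (rule has_integral_unique[rotated])
  have "integral {-N..N} (%x. h' (Complex a x)) = cs (-\<i>) (h (Complex a N) - h (Complex a (-N)))"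
   unfolding eq[symmetric] cs_cs by simp
  then have "norm (integral {-N..N} (%x. h' (Complex a x))) <= 4 * norm (h (Complex a N) - h (Complex a (-N)))"
   using norm_cs[of "-\<i>" "h (Complex a N) - h (Complex a (-N))"] by simp
  also have "... <= 4 * (C / (1 + N\<^sup>2) + C / (1 + N\<^sup>2))"
   using norm_triangle_ineq4[of "h (Complex a N)" "h (Complex a (-N))"] bN[OF a0, of N] bN[OF a0, of "-N"] by simp
  finally show ?thesis by simp
 qed
 have "((%a. integral (cbox (-N) N) (%x. h' (Complex a x))) has_integral (Phi N - Phi 0)) {0..N}"
  by (rule fundamental_theorem_of_calculus[OF _ der]) (use N in auto)
 then have 1: "norm (Phi N - Phi 0) <= 8 * C / (1 + N\<^sup>2) * (N - 0)"
  by (rule has_integral_norm_le[rotated 1]) (use small C N in auto)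
 have "((%x. h (Complex N x)) has_integral Phi N) {-N..N}"
  unfolding Phi_def cbox_interval by (rule integrable_integral[OF integrable_continuous_interval[OF ci]]) (use N in auto)
 then have 2: "norm (Phi N) <= C / (1 + N\<^sup>2) * (N - - N)"
  by (rule has_integral_norm_le[rotated 1]) (use bN C N in auto)
 have "norm (Phi 0) <= norm (Phi N) + norm (Phi N - Phi 0)" using norm_triangle_ineq4[of "Phi N" "Phi N - Phi 0"] by simp
 also have "... <= 10 * (C * (N / (1 + N\<^sup>2)))"
 proof -
  have "8 * C / (1 + N\<^sup>2) * (N - 0) = 8 * (C * (N / (1 + N\<^sup>2)))" "C / (1 + N\<^sup>2) * (N - - N) = 2 * (C * (N / (1 + N\<^sup>2)))" by simp_all
  then show ?thesis using 1 2 by linarith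
 qed
 also have "... = 10 * C * (N / (1 + N\<^sup>2))" by simp
 also have "... <= 10 * C * (N / (N * N))" using C N by (intro mult_left_mono divide_left_mono mult_pos_pos) (auto simp: power2_eq_square intro: add_pos_pos)
 finally show ?thesis using N by (simp add: Phi_def)
qed

lemma norm_one_plus: "0 <= Re l ==> 1 + (norm l)\<^sup>2 <= (norm (1 + l))\<^sup>2"
 unfolding cmod_power2 by (simp add: power2_eq_square algebra_simps)

lemma holo_cs:
 assumes c: "!!l. 0 <= Re l ==> (c has_field_derivative c' l) (at l)" "continuous_on {l. 0 <= Re l} c'" and h: "holo h h'"
 shows "holo (%l. cs (c l) (h l)) (%l. cs (c' l) (h l) + cs (c l) (h' l))"
 unfolding holo_def
proof (intro conjI allI impI)
 fix l :: complex assume l: "0 <= Re l"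
 have dc: "(c has_derivative (%d. c' l * d)) (at l within {l. 0 <= Re l})"
  using c(1)[OF l] has_derivative_at_withinI unfolding has_field_derivative_def by blast
 have dh: "(h has_derivative (%d. cs d (h' l))) (at l within {l. 0 <= Re l})" using h l by (simp add: holo_def)
 have "((%l. cs (c l) (h l)) has_derivative (%d. cs (c l) (cs d (h' l)) + cs (c' l * d) (h l))) (at l within {l. 0 <= Re l})"
  by (rule bounded_bilinear.FDERIV[OF bounded_bilinear_cs dc dh])
 moreover have "(%d. cs (c l) (cs d (h' l)) + cs (c' l * d) (h l)) = (%d. cs d (cs (c' l) (h l) + cs (c l) (h' l)))"
  by (auto simp: cs_add cs_cs algebra_simps)
 ultimately show "((%l. cs (c l) (h l)) has_derivative (%d. cs d (cs (c' l) (h l) + cs (c l) (h' l)))) (at l within {l. 0 <= Re l})" by simp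
next
 have "continuous_on {l. 0 <= Re l} c" by (rule continuous_at_imp_continuous_on) (use c(1) DERIV_isCont in blast)
 then show "continuous_on {l. 0 <= Re l} (%l. cs (c' l) (h l) + cs (c l) (h' l))"
  by (intro continuous_on_add continuous_on_cs c(2) holo_D(3,4)[OF h])
qed

lemma holo_const: "holo (%_. z) (%_. 0)"
 by (simp add: holo_def)

text \<open>Reflection at the origin turns the kernel into exp(-s l) / (1 + l)^2, which is
  holomorphic and at most 1 / (1 + |l|^2) in the closed right half plane because s >= 0. The
  constant is 4 from \<open>norm_cs\<close> times 10 from \<open>contour_bound\<close>.\<close>

lemma kernel_bound:
 fixes z :: "'z::banach \<times> 'z"
 assumes s: "0 <= s" and N: "0 < N"
 shows "norm (integral {-N..N} (%x. cs (exp (Complex 0 (s * x)) / (1 - Complex 0 x)\<^sup>2) z)) <= 40 * norm z / N"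
proof -
 define c where "c l = exp (- (of_real s * l)) / (1 + l)\<^sup>2" for l :: complex
 define c' where "c' l = - of_real s * exp (- (of_real s * l)) / (1 + l)\<^sup>2 - 2 * exp (- (of_real s * l)) / (1 + l)^3" for l :: complex
 have nz: "1 + l ~= 0" if "0 <= Re l" for l using that by (auto simp: complex_eq_iff)
 have d: "(c has_field_derivative c' l) (at l)" if "0 <= Re l" for l
  unfolding c_def c'_def using nz[OF that]
  by (auto intro!: derivative_eq_intros simp: divide_simps power2_eq_square power3_eq_cube) (simp add: algebra_simps)?
 have cc: "continuous_on {l. 0 <= Re l} c'" unfolding c'_def using nz by (intro continuous_intros) auto
 have H: "holo (%l. cs (c l) z) (%l. cs (c' l) z)" using holo_cs[OF d cc holo_const[of z]] by simp
 have bd: "norm (cs (c l) z) <= 4 * norm z / (1 + (norm l)\<^sup>2)" if l: "0 <= Re l" for l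
 proof -
  have "norm (exp (- (of_real s * l))) <= 1" using s l by (simp add: norm_exp_eq_Re)
  then have "norm (c l) <= 1 / (norm (1 + l))\<^sup>2" unfolding c_def by (simp add: norm_divide norm_power divide_right_mono)
  also have "... <= 1 / (1 + (norm l)\<^sup>2)" using norm_one_plus[OF l] by (intro divide_left_mono) (auto intro!: add_pos_nonneg mult_pos_pos simp: nz[OF l])
  finally have "4 * norm (c l) * norm z <= 4 * (1 / (1 + (norm l)\<^sup>2)) * norm z" by (intro mult_right_mono mult_left_mono) auto
  then show ?thesis using norm_cs[of "c l" z] by simp
 qed
 have e: "exp (Complex 0 (s * x)) / (1 - Complex 0 x)\<^sup>2 = c (Complex 0 (- x))" for x
 proof -
  have "Complex 0 (s * x) = - (of_real s * Complex 0 (- x))" "1 - Complex 0 x = 1 + Complex 0 (- x)" by (simp_all add: complex_eq_iff)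
  then show ?thesis unfolding c_def by presburger
 qed
 have "integral {-N..N} (%x. cs (exp (Complex 0 (s * x)) / (1 - Complex 0 x)\<^sup>2) z) = integral {-N..N} (%x. cs (c (Complex 0 x)) z)"
  unfolding e using Henstock_Kurzweil_Integration.integral_reflect_real[of N "-N" "%x. cs (c (Complex 0 x)) z"] by simp
 then show ?thesis using contour_bound[OF H bd N] by simp
qed

lemma integral_arctan: "((%x::real. 1 / (1 + x\<^sup>2)) has_integral 2 * arctan N) {-N..N}" if "0 <= N"
proof -
 have "((%x. 1 / (1 + x\<^sup>2)) has_integral arctan N - arctan (-N)) {-N..N}"
  by (rule fundamental_theorem_of_calculus) (use that in \<open>auto intro!: derivative_eq_intros simp: has_real_derivative_iff_has_vector_derivative[symmetric] inverse_eq_divide\<close>)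
 then show ?thesis by (simp add: arctan_minus)
qed

section \<open>The resolvent and the decay of solutions\<close>

lemma bounded_linear_map_prod:
 assumes "bounded_linear f" "bounded_linear g"
 shows "bounded_linear (map_prod f g)"
proof -
 have "map_prod f g = (%z. (f (fst z), g (snd z)))" by (simp add: map_prod_def case_prod_unfold)
 then show ?thesis using bounded_linear_Pair[OF bounded_linear_compose[OF assms(1) bounded_linear_fst] bounded_linear_compose[OF assms(2) bounded_linear_snd]] by simp
qed

lemma map_prod_cs: "linear f ==> map_prod f f (cs c z) = cs c (map_prod f f z)"
 by (simp add: cs_def prod_eq_iff linear_diff linear_add linear_scale map_prod_def case_prod_unfold)

lemma norm_cs_ge: "norm c * norm z <= 4 * norm (cs c z)"
proof (cases "c = 0")
 case False
 have "norm z = norm (cs (1 / c) (cs c z))" using False by (simp add: cs_cs)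
 also have "... <= 4 * norm (1 / c) * norm (cs c z)" by (rule norm_cs)
 finally show ?thesis using False by (simp add: norm_divide field_simps)
qed simp

lemma exp_imag: "exp (Complex 0 y) = cis y"
 by (simp add: cis_conv_exp Complex_eq)

text \<open>On the closed right half plane only bijectivity is assumed; boundedness of the inverses
  comes from the open mapping theorem, and their decay in \<open>l\<close> from
  \<open>LS\<close>.\<close>

locale resolvent_setting = interpolation_setting p J i for p and J :: "'b::banach => 'a::banach" and i :: "'c::banach => 'a" +
 fixes B :: "'b => 'a" and M :: real
 assumes LS: "LS B 1 M"
  and bij: "!!l. 0 <= Re l ==> bij (%z. cs l (map_prod J J z) + map_prod B B z)"
begin

abbreviation JJ where "JJ \<equiv> map_prod J J"
abbreviation BB where "BB \<equiv> map_prod B B"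

definition Lop :: "complex => 'b \<times> 'b => 'a \<times> 'a" where "Lop l z = cs l (JJ z) + BB z"
definition Rop :: "complex => 'a \<times> 'a => 'b \<times> 'b" where "Rop l = inv (Lop l)"
definition res :: "complex => 'a \<times> 'a => 'a \<times> 'a" where "res l f = JJ (Rop l f)"

lemmas B = LS_pos(3)[OF LS] and M = LS_pos(2)[OF LS]
lemmas JJ = bounded_linear_map_prod[OF J J] and BB = bounded_linear_map_prod[OF B B]
lemmas lin_B = bounded_linear.linear[OF B] and lin_JJ = bounded_linear.linear[OF JJ] and lin_BB = bounded_linear.linear[OF BB]

lemma Lop_bl: "bounded_linear (Lop l)"
 unfolding Lop_def[abs_def] by (intro bounded_linear_add bounded_linear_compose[OF cs_bl JJ] BB)

lemmas lin_L = bounded_linear.linear[OF Lop_bl]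

lemma Lop_cs: "Lop l (cs c z) = cs c (Lop l z)"
 unfolding Lop_def by (simp add: map_prod_cs[OF linear_J] map_prod_cs[OF lin_B] cs_commute[of l c] cs_add)

lemma Lop_bij: "0 <= Re l ==> bij (Lop l)"
 unfolding Lop_def[abs_def] by (rule bij)

lemma Lop_Rop: "0 <= Re l ==> Lop l (Rop l f) = f" and Rop_Lop: "0 <= Re l ==> Rop l (Lop l z) = z"
 unfolding Rop_def using Lop_bij[of l] by (simp_all add: bij_is_surj surj_f_inv_f bij_is_inj)

lemma Rop_eqI: "0 <= Re l ==> Lop l z = f ==> Rop l f = z"
 using Rop_Lop by blast

lemma linear_Rop: "0 <= Re l ==> linear (Rop l)"
 by (rule linearI) (auto intro!: Rop_eqI simp: linear_add[OF lin_L] linear_scale[OF lin_L] Lop_Rop)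

lemma Rop_cs: "0 <= Re l ==> Rop l (cs c f) = cs c (Rop l f)"
 by (rule Rop_eqI) (simp_all add: Lop_cs Lop_Rop)

lemma Rop_bound:
 assumes l: "0 <= Re l"
 shows "\<exists>K>0. ALL f. norm (Rop l f) <= K * norm f"
 using open_mapping_bound[OF Lop_bl bij_is_surj[OF Lop_bij[OF l]]] Rop_eqI[OF l] by metis

lemma res_cs: "0 <= Re l ==> res l (cs c f) = cs c (res l f)"
 unfolding res_def by (simp add: Rop_cs map_prod_cs[OF linear_J])

lemma linear_res: "0 <= Re l ==> linear (res l)"
 unfolding res_def[abs_def] using linear_compose[OF linear_Rop lin_JJ] by (simp add: o_def)

lemma res_identity:
 assumes "0 <= Re l" "0 <= Re m"
 shows "res l f - res m f = cs (m - l) (res l (res m f))"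
proof -
 have "Lop l (Rop m f) = f - cs (m - l) (res m f)"
  using Lop_Rop[OF assms(2), of f] by (simp add: Lop_def res_def cs_diff algebra_simps)
 then have "Lop l (Rop l f - Rop m f) = cs (m - l) (res m f)"
  by (simp add: linear_diff[OF lin_L] Lop_Rop[OF assms(1)])
 then have "Rop l f - Rop m f = cs (m - l) (Rop l (res m f))"
  using Rop_Lop[OF assms(1)] Rop_cs[OF assms(1)] by metis
 then show ?thesis unfolding res_def using linear_diff[OF lin_JJ] map_prod_cs[OF linear_J] by metis
qed

text \<open>The function \<open>t e\<^bsup>l(t-1)\<^esup> z\<close> has initial value 0, so that maximal regularity bounds its derivative by \<open>z\<close> and \<open>Lop l z\<close>.\<close>

lemma resolvent_large:
 "\<exists>C>0. ALL l z. 0 <= Re l --> norm l * norm (JJ z) <= C * (norm (JJ z) + norm (Lop l z))"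
proof -
 define C0 where "C0 = 8 + 4 * (onorm B * M)"
 have oB: "0 <= onorm B" by (rule onorm_pos_le[OF B])
 have C0: "0 < C0" unfolding C0_def using oB M by (intro add_pos_nonneg mult_nonneg_nonneg) auto
 have "norm l * norm (JJ z) <= 32 * C0 * (norm (JJ z) + norm (Lop l z))" if l: "0 <= Re l" for l z
 proof -
  define E where "E t = exp (l * (of_real t - 1))" for t
  define a where "a = norm (JJ z) + norm (Lop l z)"
  define e where "e t = exp (Re l * (t - 1))" for t
  have nE: "norm (E t) = e t" for t by (simp add: E_def e_def norm_exp_eq_Re)
  have a0: "0 <= a" by (simp add: a_def)
  define u where "u t = t *\<^sub>R cs (E t) z" for t
  define u' where "u' t = cs (E t) z + t *\<^sub>R cs (l * E t) z" for t
  have dE: "(E has_vector_derivative l * E t) (at t)" for t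
  proof -
   have "((%x. exp (l * (x - 1))) has_field_derivative l * E t) (at (of_real t))"
    unfolding E_def by (auto intro!: derivative_eq_intros)
   from has_vector_derivative_real_field[OF this, of UNIV] show ?thesis by (simp add: E_def[abs_def])
  qed
  have ds: "((%t. cs (E t) z) has_vector_derivative cs (l * E t) z) (at t)" for t
   by (rule bounded_linear.has_vector_derivative[OF cs_bl_left dE])
  have du: "(u has_vector_derivative u' t) (at t)" for t
   using has_vector_derivative_scaleR[OF DERIV_ident ds, of t] unfolding u_def[abs_def] u'_def by (simp add: add.commute)
  have cE: "continuous_on S E" for S unfolding E_def by (intro continuous_intros)
  have cu': "continuous_on UNIV u'" unfolding u'_def by (intro continuous_intros continuous_on_cs cE)
  have ec: "continuous_on S e" for S unfolding e_def by (intro continuous_intros)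
  have ePL: "PL p (cut s t e)" if "s <= t" for s t by (rule PL_cut_continuous[OF p0 that ec])
  define n where "n = LN0 p 1 e"
  have bnd: "PL0 p 1 h" "LN0 p 1 h <= c * n"
   if "continuous_on {0..1} h" "0 <= c" "!!t. 0 < t ==> t < 1 ==> norm (h t) <= c * e t" for h :: "real => 'a" and c
  proof -
   show P: "PL0 p 1 h" by (rule PL_cut_continuous[OF p0 _ that(1)]) simp
   have "PL0 p 1 h & LN0 p 1 h <= c * LN0 p 1 e"
    by (rule PL_bound[OF p0 PL_SM[OF P] ePL that(2)]) (use that(3) in \<open>auto simp: cut_def e_def\<close>)
   then show "LN0 p 1 h <= c * n" by (simp add: n_def)
  qed
  \<comment> \<open>\<open>LS\<close> is a real statement and is applied to the real and the
    imaginary component separately, with \<open>fst\<close> and \<open>snd\<close> for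
    \<open>pr\<close>.\<close>
  have comp: "PL0 p 1 (%t. t *\<^sub>R pr (cs (l * E t) (JJ z)))" "LN0 p 1 (%t. t *\<^sub>R pr (cs (l * E t) (JJ z))) <= C0 * a * n"
   if pr: "bounded_linear pr" "!!z. norm (pr z) <= norm z" and pr': "bounded_linear pr'" "!!z. pr (JJ z) = J (pr' z)" "!!z. pr (BB z) = B (pr' z)"
   for pr :: "'a \<times> 'a => 'a" and pr' :: "'b \<times> 'b => 'b"
  proof -
   have lpr: "linear pr" by (rule bounded_linear.linear[OF pr(1)])
   have e1: "evo 1 (%t. J (pr' (u t))) (%t. pr' (u t)) (%t. J (pr' (u' t)))"
    by (rule evo_C1) (use bounded_linear.has_vector_derivative[OF pr'(1) du] bounded_linear.continuous_on[OF pr'(1) cu'] in auto)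
   define f where "f t = J (pr' (u' t)) + B (pr' (u t))" for t
   have s: "sol B 1 (%t. J (pr' (u t))) (%t. pr' (u t)) f" unfolding f_def by (rule sol_of_evo[OF B e1])
   have ju: "J (pr' (u' t)) = pr (cs (E t) (JJ z)) + t *\<^sub>R pr (cs (l * E t) (JJ z))" for t
    unfolding pr'(2)[symmetric] u'_def by (simp add: linear_add[OF lin_JJ] linear_scale[OF lin_JJ] map_prod_cs[OF linear_J] linear_add[OF lpr] linear_scale[OF lpr])
   have bu: "B (pr' (u t)) = t *\<^sub>R pr (cs (E t) (BB z))" for t
    unfolding pr'(3)[symmetric] u_def by (simp add: linear_scale[OF lin_BB] map_prod_cs[OF lin_B] linear_scale[OF lpr])
   have feq: "f t = pr (cs (E t) (JJ z + t *\<^sub>R Lop l z))" for t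
    unfolding f_def ju bu Lop_def by (simp add: cs_add linear_add[OF lpr] linear_scale[OF lpr] cs_cs mult.commute scaleR_add_right bounded_bilinear.scaleR_right[OF bounded_bilinear_cs])
   have fn: "LN0 p 1 f <= 4 * a * n"
   proof (rule bnd(2))
    show "continuous_on {0..1} f" unfolding feq by (intro bounded_linear.continuous_on[OF pr(1)] continuous_on_cs cE continuous_intros)
    fix t :: real assume t: "0 < t" "t < 1"
    have "norm (f t) <= 4 * norm (E t) * norm (JJ z + t *\<^sub>R Lop l z)" unfolding feq using pr(2) norm_cs order_trans by blast
    also have "... <= 4 * norm (E t) * a"
    proof (rule mult_left_mono)
     have "norm (JJ z + t *\<^sub>R Lop l z) <= norm (JJ z) + \<bar>t\<bar> * norm (Lop l z)" using norm_triangle_ineq[of "JJ z" "t *\<^sub>R Lop l z"] by simp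
     also have "... <= a" unfolding a_def using t by (intro add_left_mono mult_left_le_one_le) auto
     finally show "norm (JJ z + t *\<^sub>R Lop l z) <= a" .
    qed simp
    finally show "norm (f t) <= 4 * a * e t" by (simp add: nE mult.commute mult.left_commute)
   qed (use a0 in simp)
   have u0: "J (pr' (u 0)) = i 0" by (simp add: u_def linear_0[OF bounded_linear.linear[OF pr'(1)]] linear_0[OF linear_J] linear_0[OF linear_i])
   have "LN0 p 1 (%t. pr' (u t)) <= M * LN0 p 1 f" using LS_D(1)[OF LS s u0] by simp
   then have "LN0 p 1 (%t. f t - B (pr' (u t))) <= LN0 p 1 f + onorm B * (M * LN0 p 1 f)"
    using sol_deriv_bound[OF B s] mult_left_mono[OF _ oB] by (meson add_left_mono order_trans)
   also have "... = (1 + onorm B * M) * LN0 p 1 f" by (simp add: algebra_simps)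
   also have "... <= (1 + onorm B * M) * (4 * a * n)" using fn oB M by (intro mult_left_mono) auto
   finally have jn: "LN0 p 1 (%t. J (pr' (u' t))) <= (1 + onorm B * M) * (4 * a * n)" by (simp add: f_def)
   have kc: "continuous_on {0..1} (%t. pr (cs (E t) (JJ z)))" by (intro bounded_linear.continuous_on[OF pr(1)] continuous_on_cs cE continuous_intros)
   have kb: "norm (pr (cs (E t) (JJ z))) <= (4 * a) * e t" for t
   proof -
    have "norm (pr (cs (E t) (JJ z))) <= 4 * norm (E t) * norm (JJ z)" using pr(2) norm_cs order_trans by blast
    also have "... <= 4 * norm (E t) * a" by (intro mult_left_mono) (auto simp: a_def)
    finally show ?thesis by (simp add: nE mult.commute mult.left_commute)
   qed
   note k = bnd[OF kc _ kb, simplified, OF a0]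
   have eq: "cut 0 1 (%t. t *\<^sub>R pr (cs (l * E t) (JJ z))) = (%t. cut 0 1 (%t. J (pr' (u' t))) t - cut 0 1 (%t. pr (cs (E t) (JJ z))) t)"
    by (auto simp: cut_def ju)
   show "PL0 p 1 (%t. t *\<^sub>R pr (cs (l * E t) (JJ z)))" "LN0 p 1 (%t. t *\<^sub>R pr (cs (l * E t) (JJ z))) <= C0 * a * n"
    unfolding eq using PL_diff[OF p1 evoD(2)[OF e1] k(1)] jn k(2) by (auto simp: C0_def algebra_simps)
  qed
  have bf: "map_prod J J z = (J (fst z), J (snd z))" "map_prod B B z = (B (fst z), B (snd z))" for z by (simp_all add: map_prod_def case_prod_unfold)
  note c1 = comp[where pr = fst and pr' = fst, OF bounded_linear_fst _ bounded_linear_fst, unfolded bf fst_conv, OF _ refl refl]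
   and c2 = comp[where pr = snd and pr' = snd, OF bounded_linear_snd _ bounded_linear_snd, unfolded bf snd_conv, OF _ refl refl]
  have nf: "norm (fst x) <= norm x" "norm (snd x) <= norm x" for x :: "'a \<times> 'a" using norm_fst_le[of "fst x" "snd x"] norm_snd_le[of "snd x" "fst x"] by simp_all
  note c1 = c1[OF nf(1)] and c2 = c2[OF nf(2)]
  define s1 where "s1 = cut 0 1 (%t. t *\<^sub>R fst (cs (l * E t) (J (fst z), J (snd z))))"
  define s2 where "s2 = cut 0 1 (%t. t *\<^sub>R snd (cs (l * E t) (J (fst z), J (snd z))))"
  have ss: "PL p (%t. norm (s1 t) + norm (s2 t))" "LN p (%t. norm (s1 t) + norm (s2 t)) <= 2 * (C0 * a * n)"
   using PL_add[OF p1 PL_norm(1)[OF c1(1)] PL_norm(1)[OF c2(1)]] c1(2) c2(2) by (auto simp: PL_norm(2) s1_def s2_def)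
  define te where "te t = (norm l * norm (JJ z)) *\<^sub>R (t * e t)" for t
  have tPL: "PL p (cut s t (%t. t * e t))" if "s <= t" for s t by (rule PL_cut_continuous[OF p0 that]) (intro continuous_intros ec)
  have tel: "norm (cut 0 1 te t) <= 4 * norm (norm (s1 t) + norm (s2 t))" for t
  proof (cases "0 < t & t < 1")
   case True
   have "norm (cut 0 1 te t) = t * (norm (l * E t) * norm (JJ z))" using True by (simp add: cut_def te_def norm_mult nE e_def)
   also have "... <= t * (4 * norm (cs (l * E t) (JJ z)))" using True by (intro mult_left_mono norm_cs_ge) auto
   also have "... <= t * (4 * (norm (fst (cs (l * E t) (JJ z))) + norm (snd (cs (l * E t) (JJ z)))))"
    using norm_Pair_le[of "fst (cs (l * E t) (JJ z))" "snd (cs (l * E t) (JJ z))"] True by (intro mult_left_mono) auto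
   also have "... = 4 * (norm (s1 t) + norm (s2 t))" using True by (simp add: s1_def s2_def cut_def bf distrib_left)
   finally show ?thesis by simp
  qed (auto simp: cut_def)
  have teP: "cut 0 1 te = (%t. (norm l * norm (JJ z)) *\<^sub>R cut 0 1 (%t. t * e t) t)" by (auto simp: cut_def te_def)
  have "LN0 p 1 te <= 4 * LN p (%t. norm (s1 t) + norm (s2 t))"
   using PL_bound[OF p0 _ ss(1), of "cut 0 1 te" 4] PL_SM[OF PL_scale(1)[OF p0 tPL, of 0 1 "norm l * norm (JJ z)"]] tel by (simp add: teP)
  then have 1: "(norm l * norm (JJ z)) * LN0 p 1 (%t. t * e t) <= 8 * (C0 * a * n)"
   unfolding teP using PL_scale(2)[OF p0 tPL, of 0 1 "norm l * norm (JJ z)"] ss(2) by simp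
  \<comment> \<open>As \<open>e\<close> does not decrease, its norm over (0,1/2) is at most that
    over (1/2,1), where the weight is at least 1/2. Hence \<open>t * e t\<close> carries a fixed
    share of the norm of \<open>e\<close>, uniformly in \<open>l\<close>.\<close>
  have half: "LN p (cut (1/2) 1 e) <= 2 * LN0 p 1 (%t. t * e t)"
  proof -
   have "LN p (cut (1/2) 1 e) <= 2 * LN p (cut (1/2) 1 (%t. t * e t))"
    using PL_bound[OF p0 PL_SM[OF ePL[of "1/2" 1]] tPL[of "1/2" 1], of 2] by (auto simp: cut_def e_def)
   then show ?thesis using PL_cut_sub(2)[OF p0 tPL[of 0 1], of "1/2" 1] by simp
  qed
  have "LN0 p (1/2) e <= LN0 p (1/2) (%t. e (1/2 + t))"
  proof (rule PL_mono(2)[OF p0 PL_SM[OF ePL]])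
   show "PL0 p (1/2) (%t. e (1/2 + t))" using PL_cut_shift(1)[OF p0, of 0 "1/2" e "1/2"] ePL[of "1/2" 1] by simp
   show "AE t in lebesgue. norm (cut 0 (1/2) e t) <= norm (cut 0 (1/2) (%t. e (1/2 + t)) t)"
    using l by (auto simp: cut_def e_def intro!: mult_left_mono)
  qed simp
  also have "... = LN p (cut (1/2) 1 e)" using PL_cut_shift(2)[OF p0, of 0 "1/2" "1/2" e] ePL[of "1/2" 1] by simp
  finally have "n <= 4 * LN0 p 1 (%t. t * e t)"
   using PL_cut_join(2)[OF p1 _ _ ePL[of 0 "1/2"] ePL[of "1/2" 1]] half by (simp add: n_def)
  then have "(norm l * norm (JJ z)) * n <= (norm l * norm (JJ z)) * (4 * LN0 p 1 (%t. t * e t))"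
   by (intro mult_left_mono) auto
  then have 2: "(norm l * norm (JJ z)) * n <= (32 * C0 * a) * n" using 1 by simp
  have "LN0 p 1 (%_. exp (- Re l)) <= n" unfolding n_def
   by (rule PL_mono(2)[OF p0 SM_cut[OF SM_const] ePL]) (use l in \<open>auto simp: cut_def e_def algebra_simps intro!: mult_nonneg_nonneg\<close>)
  then have "0 < n" using PL_cut_const(2)[OF p0, of 0 1 "exp (- Re l)"] by (smt (verit) exp_gt_zero mult_pos_pos powr_gt_zero real_norm_def)
  then show ?thesis using 2 by (simp add: a_def)
 qed
 then show ?thesis using C0 by (intro exI[of _ "32 * C0"]) auto
qed

text \<open>\<open>Lop l\<close> and \<open>Lop m\<close> differ by \<open>cs (l - m)\<close>
  applied to \<open>JJ\<close>, which is bounded on X_1, so near \<open>l\<close> the difference is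
  absorbed with a radius determined by the bound at \<open>l\<close>.\<close>

lemma resolvent_local:
 assumes l: "0 <= Re l"
 shows "\<exists>d>0. EX K. ALL m f. 0 <= Re m --> dist l m < d --> norm (res m f) <= K * norm f"
proof -
 obtain K where K: "0 < K" "!!f. norm (Rop l f) <= K * norm f" using Rop_bound[OF l] by blast
 obtain c where c: "0 < c" "!!z. norm (JJ z) <= norm z * c" using bounded_linear.pos_bounded[OF JJ] by blast
 have "norm (res m f) <= 2 * K * c * norm f" if m: "0 <= Re m" "dist l m < 1 / (8 * K * c)" for m f
 proof -
  define z where "z = Rop m f"
  have "Lop l z = f + cs (l - m) (JJ z)" using Lop_Rop[OF m(1), of f] by (simp add: z_def Lop_def cs_diff algebra_simps)
  then have "norm z <= K * norm (f + cs (l - m) (JJ z))" using K(2)[of "Lop l z"] Rop_Lop[OF l, of z] by simp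
  also have "... <= K * (norm f + 4 * norm (l - m) * (norm z * c))"
  proof (intro mult_left_mono order_trans[OF norm_triangle_ineq] add_left_mono)
   show "norm (cs (l - m) (JJ z)) <= 4 * norm (l - m) * (norm z * c)"
    by (rule order_trans[OF norm_cs]) (intro mult_left_mono c, simp)
  qed (use K in simp)
  also have "... = K * norm f + (4 * K * c * norm (l - m)) * norm z" by (simp add: algebra_simps)
  also have "... <= K * norm f + (1 / 2) * norm z"
  proof (intro add_left_mono mult_right_mono)
   have "norm (l - m) * (8 * K * c) <= 1" using m(2) K c by (simp add: dist_norm field_simps)
   then show "4 * K * c * norm (l - m) <= 1 / 2" by (simp add: algebra_simps)
  qed simp
  finally have "norm z <= 2 * K * norm f" by simp
  then have "norm z * c <= 2 * K * norm f * c" using c by (intro mult_right_mono) auto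
  then show ?thesis using c(2)[of z] by (simp add: res_def z_def mult.commute mult.left_commute)
 qed
 then show ?thesis using K c by (intro exI[of _ "1 / (8 * K * c)"]) auto
qed

text \<open>For |l| > 2 C + 1 the resolvent term on the right of \<open>resolvent_large\<close> is
  absorbed; the remaining half disc is compact and covered by finitely many neighbourhoods from
  \<open>resolvent_local\<close>.\<close>

lemma resolvent_bound:
 "\<exists>K>0. ALL l f. 0 <= Re l --> norm (res l f) <= K * norm f / (1 + norm l)"
proof -
 obtain C where C: "0 < C" "!!l z. 0 <= Re l ==> norm l * norm (JJ z) <= C * (norm (JJ z) + norm (Lop l z))" using resolvent_large by blast
 define R where "R = 2 * C + 1"
 define S where "S = {l. 0 <= Re l} \<inter> cball 0 R"
 have S: "compact S" unfolding S_def by (intro closed_Int_compact compact_cball closed_Collect_le continuous_intros)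
 have "\<forall>l\<in>S. \<exists>d>0. EX K. ALL m f. 0 <= Re m --> dist l m < d --> norm (res m f) <= K * norm f" using resolvent_local by (auto simp: S_def)
 then obtain d K where dK: "!!l. l \<in> S ==> 0 < d l" "!!l m f. l \<in> S ==> 0 <= Re m ==> dist l m < d l ==> norm (res m f) <= K l * norm f" by metis
 have cover: "S \<subseteq> (\<Union>l\<in>S. ball l (d l))" using dK(1) by (auto intro!: centre_in_ball[THEN iffD2])
 obtain D where D: "D \<subseteq> S" "finite D" "S \<subseteq> (\<Union>l\<in>D. ball l (d l))"
  by (rule compactE_image[OF S open_ball cover])
 define K1 where "K1 = (\<Sum>l\<in>D. \<bar>K l\<bar>)"
 have K1: "norm (res m f) <= K1 * norm f" if m: "m \<in> S" for m f
 proof -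
  obtain l where l: "l \<in> D" "dist l m < d l" using D(3) m by (auto simp: mem_ball)
  then have "norm (res m f) <= K l * norm f" using dK(2)[OF subsetD[OF D(1) l(1)] _ l(2), of f] m by (simp add: S_def)
  also have "K l <= K1" unfolding K1_def using member_le_sum[OF l(1), of "%l. \<bar>K l\<bar>"] D(2) by simp
  finally show ?thesis by (simp add: mult_right_mono)
 qed
 have K10: "0 <= K1" by (simp add: K1_def sum_nonneg)
 have "norm (res l f) <= (K1 * (1 + R) + 4 * C) * norm f / (1 + norm l)" if l: "0 <= Re l" for l f
 proof (cases "norm l <= R")
  case True
  then have "norm (res l f) * (1 + norm l) <= (K1 * norm f) * (1 + R)"
   using K1[of l f] l K10 by (intro mult_mono) (auto simp: S_def)
  also have "... <= (K1 * (1 + R) + 4 * C) * norm f" using C(1) by (simp add: algebra_simps)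
  finally show ?thesis by (simp add: pos_le_divide_eq add_pos_nonneg)
 next
  case False
  have "norm l * norm (res l f) <= C * (norm (res l f) + norm f)" using C(2)[OF l, of "Rop l f"] Lop_Rop[OF l] by (simp add: res_def)
  moreover have "(2 * C + 1) * norm (res l f) <= norm l * norm (res l f)" using False by (intro mult_right_mono) (auto simp: R_def)
  moreover have "0 <= C * norm f" using C(1) by simp
  ultimately have "norm (res l f) * (1 + norm l) <= 4 * C * norm f" by (simp add: algebra_simps)
  also have "... <= (K1 * (1 + R) + 4 * C) * norm f" using K10 C(1) by (intro mult_right_mono) (auto simp: R_def)
  finally show ?thesis by (simp add: pos_le_divide_eq add_pos_nonneg)
 qed
 moreover have "0 < K1 * (1 + R) + 4 * C" using K10 C(1) by (auto simp: R_def intro!: add_nonneg_pos)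
 ultimately show ?thesis by blast
qed

text \<open>The resolvent identity and the uniform bound give Lipschitz continuity first, and with
  it the limit of the difference quotients.\<close>

lemma res_holo: "holo (%l. res l f) (%l. - res l (res l f))"
proof -
 obtain K where K: "0 < K" "!!l f. 0 <= Re l ==> norm (res l f) <= K * norm f / (1 + norm l)" using resolvent_bound by blast
 have b: "norm (res l f) <= K * norm f" if "0 <= Re l" for l f
  
 proof -
  have "K * norm f / (1 + norm l) <= K * norm f / 1" using K(1) by (intro divide_left_mono) (auto simp: add_pos_nonneg)
  then show ?thesis using K(2)[OF that, of f] by simp
 qed
 have lip: "norm (res l g - res m g) <= 4 * K\<^sup>2 * norm g * norm (l - m)" if "0 <= Re l" "0 <= Re m" for l m g
 proof -
  have "norm (res l g - res m g) <= 4 * norm (m - l) * norm (res l (res m g))" unfolding res_identity[OF that] by (rule norm_cs)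
  also have "... <= 4 * norm (m - l) * (K * (K * norm g))"
   using b[OF that(1), of "res m g"] b[OF that(2), of g] K(1) by (intro mult_left_mono) (auto intro: order_trans mult_left_mono)
  finally show ?thesis by (simp add: power2_eq_square norm_minus_commute algebra_simps)
 qed
 show ?thesis unfolding holo_def
 proof (intro conjI allI impI)
  fix l :: complex assume l: "0 <= Re l"
  define c where "c = 16 * K\<^sup>2 * norm (res l f)"
  show "((%l. res l f) has_derivative (%d. cs d (- res l (res l f)))) (at l within {l. 0 <= Re l})"
  proof (rule has_derivativeI_sandwich[of 1])
   fix m assume m: "m \<in> {l. 0 <= Re l}" "m ~= l"
   have "res m f - res l f - cs (m - l) (- res l (res l f)) = cs (m - l) (res l (res l f) - res m (res l f))"
    using res_identity[of m l f] l m by (simp add: cs_minus cs_diff algebra_simps)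
   then have "norm (res m f - res l f - cs (m - l) (- res l (res l f))) <= 4 * norm (m - l) * norm (res l (res l f) - res m (res l f))"
    using norm_cs by metis
   also have "... <= 4 * norm (m - l) * (4 * K\<^sup>2 * norm (res l f) * norm (l - m))" using lip[OF l, of m "res l f"] m by (intro mult_left_mono) auto
   also have "... = (c * norm (m - l)) * norm (m - l)" by (simp add: c_def norm_minus_commute algebra_simps)
   finally show "norm (res m f - res l f - cs (m - l) (- res l (res l f))) / norm (m - l) <= c * norm (m - l)"
    using m(2) by (simp add: divide_le_eq)
  next
   show "((%m. c * norm (m - l)) \<longlongrightarrow> 0) (at l within {l. 0 <= Re l})" by (rule tendsto_eq_intros refl | simp)+
  qed (auto intro: cs_bl_left)
 next
  have "(8 * K^3 * norm f)-lipschitz_on {l. 0 <= Re l} (%l. - res l (res l f))"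
  proof (rule lipschitz_onI)
   fix l m :: complex assume lm: "l \<in> {l. 0 <= Re l}" "m \<in> {l. 0 <= Re l}"
   have "res l (res l f) - res m (res m f) = res l (res l f - res m f) + (res l (res m f) - res m (res m f))"
    using lm by (simp add: linear_diff[OF linear_res])
   then have "norm (res l (res l f) - res m (res m f)) <= norm (res l (res l f - res m f)) + norm (res l (res m f) - res m (res m f))"
    using norm_triangle_ineq by metis
   also have "... <= K * (4 * K\<^sup>2 * norm f * norm (l - m)) + 4 * K\<^sup>2 * (K * norm f) * norm (l - m)"
   proof (intro add_mono)
    show "norm (res l (res l f - res m f)) <= K * (4 * K\<^sup>2 * norm f * norm (l - m))"
     using b[of l "res l f - res m f"] lip[of l m f] lm K(1) by (auto intro: order_trans mult_left_mono)
    have "4 * K\<^sup>2 * norm (res m f) * norm (l - m) <= 4 * K\<^sup>2 * (K * norm f) * norm (l - m)"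
     using b[of m f] lm by (intro mult_right_mono mult_left_mono) auto
    then show "norm (res l (res m f) - res m (res m f)) <= 4 * K\<^sup>2 * (K * norm f) * norm (l - m)" using lip[of l m "res m f"] lm by simp
   qed
   finally show "dist (- res l (res l f)) (- res m (res m f)) <= 8 * K^3 * norm f * dist l m"
    by (simp add: dist_norm norm_minus_commute power2_eq_square power3_eq_cube algebra_simps)
  qed (use K in simp)
  then show "continuous_on {l. 0 <= Re l} (%l. - res l (res l f))" by (rule lipschitz_on_continuous_on)
 qed
qed

end

section \<open>Finite Laplace transforms and decay\<close>

context resolvent_setting
begin

text \<open>Integration against a weight turns the evolution equation into an equation for a single
  element of X_1, the weighted integral of \<open>w\<close>, to which \<open>B\<close> can be
  applied.\<close>

lemma weighted_solution_integral:
 assumes s: "sol B T v w (%_. 0)" and T: "0 <= T"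
  and phi: "!!t. (phi has_real_derivative phi' t) (at t)" "continuous_on UNIV phi'"
 shows "J (integral {0..T} (%t. phi t *\<^sub>R w t)) = integral {0..T} (%t. phi t *\<^sub>R v t)"
  "phi T *\<^sub>R v T = phi 0 *\<^sub>R v 0 + integral {0..T} (%t. phi' t *\<^sub>R v t) - B (integral {0..T} (%t. phi t *\<^sub>R w t))"
proof -
 note e0 = sol_evo[OF s]
 note e = evo_mult[OF e0 T phi]
 note I = evo_integrable[OF e order_refl T order_refl]
 have "J (integral {0..T} (%t. phi t *\<^sub>R w t)) = integral {0..T} (%t. J (phi t *\<^sub>R w t))"
  using integral_linear[OF I(2) J] by (simp add: o_def)
 also have "... = integral {0..T} (%t. phi t *\<^sub>R v t)"
  by (rule integral_cong_AE_lebesgue(1)) (use evoD(4)[OF e] in \<open>eventually_elim, auto\<close>)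
 finally show "J (integral {0..T} (%t. phi t *\<^sub>R w t)) = integral {0..T} (%t. phi t *\<^sub>R v t)" .
 have c: "continuous_on {0..T} (%t. phi' t *\<^sub>R v t)"
  by (intro continuous_on_scaleR evo_continuous[OF e0] continuous_on_subset[OF phi(2)]) auto
 have I2: "(%t. B (phi t *\<^sub>R w t)) integrable_on {0..T}" using integrable_linear[OF I(2) B] by (simp add: o_def)
 have eq: "(%t. phi' t *\<^sub>R v t + phi t *\<^sub>R (0 - B (w t))) = (%t. phi' t *\<^sub>R v t - B (phi t *\<^sub>R w t))"
  by (auto simp: linear_scale[OF lin_B])
 have "phi T *\<^sub>R v T = phi 0 *\<^sub>R v 0 + integral {0..T} (%t. phi' t *\<^sub>R v t - B (phi t *\<^sub>R w t))"
  using evoD(3)[OF e, of T] T unfolding eq by simp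
 also have "integral {0..T} (%t. phi' t *\<^sub>R v t - B (phi t *\<^sub>R w t)) = integral {0..T} (%t. phi' t *\<^sub>R v t) - integral {0..T} (%t. B (phi t *\<^sub>R w t))"
  by (rule Henstock_Kurzweil_Integration.integral_diff[OF integrable_continuous_interval[OF c] I2])
 also have "integral {0..T} (%t. B (phi t *\<^sub>R w t)) = B (integral {0..T} (%t. phi t *\<^sub>R w t))"
  using integral_linear[OF I(2) B] by (simp add: o_def)
 finally show "phi T *\<^sub>R v T = phi 0 *\<^sub>R v 0 + integral {0..T} (%t. phi' t *\<^sub>R v t) - B (integral {0..T} (%t. phi t *\<^sub>R w t))" by simp
qed

text \<open>The finite Laplace transform W of \<open>w\<close> at l = i x satisfies (l + B) W = v(0)
  - exp(-l T) v(T); the resolvent is applied and the equation solved for the last term.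
  \<open>a1\<close> and \<open>a2\<close> are the real and imaginary parts of W.\<close>

lemma resolvent_laplace:
 assumes s: "sol B T v w (%_. 0)" and T: "0 <= T"
 shows "res (Complex 0 x) (v T, 0) =
  cs (cis (x * T)) (res (Complex 0 x) (v 0, 0) - integral {0..T} (%t. cs (cis (- (x * t))) (v t, 0)))"
proof -
 define a1 where "a1 = integral {0..T} (%t. cos (x * t) *\<^sub>R w t)"
 define a2 where "a2 = integral {0..T} (%t. (- sin (x * t)) *\<^sub>R w t)"
 have d: "((%t. cos (x * t)) has_real_derivative - x * sin (x * t)) (at t)" "((%t. - sin (x * t)) has_real_derivative - x * cos (x * t)) (at t)" for t
  by (auto intro!: derivative_eq_intros)
 have c: "continuous_on UNIV (%t. - x * sin (x * t))" "continuous_on UNIV (%t. - x * cos (x * t))"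
  by (intro continuous_intros)+
 note 1 = weighted_solution_integral[OF s T d(1) c(1), folded a1_def] and 2 = weighted_solution_integral[OF s T d(2) c(2), folded a2_def]
 have cv: "continuous_on {0..T} v" by (rule evo_continuous[OF sol_evo[OF s]])
 have s1: "integral {0..T} (%t. (- x * sin (x * t)) *\<^sub>R v t) = x *\<^sub>R J a2"
  unfolding 2(1) using integral_cmul[of "{0..T}" x "%t. (- sin (x * t)) *\<^sub>R v t"] by simp
 have s2: "integral {0..T} (%t. (- x * cos (x * t)) *\<^sub>R v t) = - (x *\<^sub>R J a1)"
  unfolding 1(1) using integral_cmul[of "{0..T}" "-x" "%t. cos (x * t) *\<^sub>R v t"] by simp
 have L: "Lop (Complex 0 x) (a1, a2) = (v 0, 0) - cs (cis (- (x * T))) (v T, 0)"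
  using 1(2) 2(2) unfolding s1 s2 by (simp add: Lop_def cs_def algebra_simps)
 have R: "0 <= Re (Complex 0 x)" by simp
 have i1: "(%t. cos (x * t) *\<^sub>R v t) integrable_on {0..T}" "(%t. (- sin (x * t)) *\<^sub>R v t) integrable_on {0..T}"
  by (intro integrable_continuous_interval continuous_intros cv)+
 have "((%t. (cos (x * t) *\<^sub>R v t, (- sin (x * t)) *\<^sub>R v t)) has_integral (J a1, J a2)) {0..T}"
 proof -
  have l: "bounded_linear (%y::'a. (y, 0 :: 'a))" "bounded_linear (%y::'a. (0 :: 'a, y))"
   by (rule bounded_linear_Pair[OF bounded_linear_ident bounded_linear_zero], rule bounded_linear_Pair[OF bounded_linear_zero bounded_linear_ident])
  show ?thesis
   using has_integral_add[OF has_integral_linear[OF integrable_integral[OF i1(1)] l(1)] has_integral_linear[OF integrable_integral[OF i1(2)] l(2)]]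
   unfolding 1(1) 2(1) by (simp add: o_def)
 qed
 then have "((%t. cs (cis (- (x * t))) (v t, 0)) has_integral (J a1, J a2)) {0..T}" by (simp add: cs_def)
 then have I: "integral {0..T} (%t. cs (cis (- (x * t))) (v t, 0)) = (J a1, J a2)" by (rule integral_unique)
 have "res (Complex 0 x) ((v 0, 0) - cs (cis (- (x * T))) (v T, 0)) = (J a1, J a2)"
  unfolding res_def L[symmetric] Rop_Lop[OF R] by simp
 then have "cs (cis (- (x * T))) (res (Complex 0 x) (v T, 0)) = res (Complex 0 x) (v 0, 0) - (J a1, J a2)"
  unfolding linear_diff[OF linear_res[OF R]] res_cs[OF R] by (simp add: algebra_simps)
 from arg_cong[OF this, of "cs (cis (x * T))"] show ?thesis unfolding I cs_cs by (simp add: cis_mult)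
qed

text \<open>The integral of \<open>(1 - l)\<^sup>-\<^sup>2 res l x\<close> over the imaginary axis picks up the residue \<open>(res 1)\<^sup>2 x\<close> at \<open>l = 1\<close>.
 Splitting off the singular part explicitly avoids contours around the pole.\<close>

lemma residue_part:
 "EX D. \<forall>N\<ge>1. pi * norm (res 1 (res 1 x)) <= norm (integral {-N..N} (%t. cs (1 / (1 - Complex 0 t)\<^sup>2) (res (Complex 0 t) x))) + D / N"
proof -
 define q where "q = res 1 x"
 define r where "r = res 1 q"
 \<comment> \<open>This element gives (1 + l) res l r = r + res l s. The remainder
   \<open>res l r\<close> is thereby traded for one with an additional factor 1 / (1 + l), which
   decays fast enough for \<open>contour_bound\<close>.\<close>
 define s where "s = cs 2 r - q"
 obtain K where K: "0 < K" "!!l f. 0 <= Re l ==> norm (res l f) <= K * norm f / (1 + norm l)" using resolvent_bound by blast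
 have nz: "1 + l ~= 0" if "0 <= Re l" for l using that by (auto simp: complex_eq_iff)
 define g where "g l = cs (1 / (1 + l)) (res l s)" for l
 have id: "cs (1 / (1 - l)\<^sup>2) (res l x) = cs (1 / (1 - l)\<^sup>2) q + cs (1 / (1 - l) + 1 / (1 + l)) r + g l"
  if l: "0 <= Re l" "l ~= 1" for l
 proof -
  have a: "res l x = q + cs (1 - l) (res l q)" "res l q = r + cs (1 - l) (res l r)"
   using res_identity[OF l(1), of 1 x] res_identity[OF l(1), of 1 q] by (simp_all add: q_def r_def algebra_simps)
  have "cs (1 + l) (res l r) = cs 2 (res l r) - cs (1 - l) (res l r)" by (simp add: cs_diff(1)[symmetric])
  also have "... = r + res l s" unfolding s_def linear_diff[OF linear_res[OF l(1)]] res_cs[OF l(1)] a(2) by simp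
  finally have "cs (1 / (1 + l)) (cs (1 + l) (res l r)) = cs (1 / (1 + l)) r + g l" by (simp add: g_def cs_add)
  then have c: "res l r = cs (1 / (1 + l)) r + g l" using nz[OF l(1)] by (simp add: cs_cs)
  have k: "1 / (1 - l)\<^sup>2 * (1 - l) = 1 / (1 - l)" "1 / (1 - l)\<^sup>2 * (1 - l) * (1 - l) = 1" using l(2) by (simp_all add: power2_eq_square)
  have "cs (1 / (1 - l)\<^sup>2) (res l x) = cs (1 / (1 - l)\<^sup>2) q + cs (1 / (1 - l)) r + res l r"
  proof -
   have "cs (1 / (1 - l)\<^sup>2) (res l x) = cs (1 / (1 - l)\<^sup>2) q + (cs (1 / (1 - l)\<^sup>2 * (1 - l)) r + cs (1 / (1 - l)\<^sup>2 * (1 - l) * (1 - l)) (res l r))"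
    unfolding a(1) a(2) by (simp only: cs_add cs_cs mult.assoc)
   then show ?thesis unfolding k using l(2) by simp
  qed
  then show ?thesis unfolding c by (simp add: cs_add)
 qed
 have gh: "EX g'. holo g g'"
 proof -
  have "holo (%l. cs (1 / (1 + l)) (res l s)) (%l. cs (- 1 / (1 + l)\<^sup>2) (res l s) + cs (1 / (1 + l)) (- res l (res l s)))"
   by (rule holo_cs[OF _ _ res_holo]) (use nz in \<open>auto intro!: derivative_eq_intros continuous_intros simp: power2_eq_square\<close>)
  then show ?thesis unfolding g_def[abs_def] by blast
 qed
 then obtain g' where H: "holo g g'" by blast
 have gb: "norm (g l) <= 4 * K * norm s / (1 + (norm l)\<^sup>2)" if l: "0 <= Re l" for l
 proof -
  have "1 + (norm l)\<^sup>2 <= norm (1 + l) * (1 + norm l)"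
  proof (rule power2_le_imp_le)
   have "(1 + (norm l)\<^sup>2) * (1 + (norm l)\<^sup>2) <= (norm (1 + l))\<^sup>2 * (1 + norm l)\<^sup>2"
    using norm_one_plus[OF l] by (intro mult_mono) (auto simp: power2_eq_square algebra_simps)
   then show "(1 + (norm l)\<^sup>2)\<^sup>2 <= (norm (1 + l) * (1 + norm l))\<^sup>2" by (simp only: power_mult_distrib power2_eq_square[of "1 + (norm l)\<^sup>2"])
  qed (simp add: add_nonneg_nonneg)
  then have k: "1 / (norm (1 + l) * (1 + norm l)) <= 1 / (1 + (norm l)\<^sup>2)"
   by (intro divide_left_mono mult_pos_pos) (auto simp: nz[OF l] add_pos_nonneg intro: add_pos_nonneg)
  have "norm (g l) <= 4 * norm (1 / (1 + l)) * norm (res l s)" unfolding g_def by (rule norm_cs)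
  also have "... <= 4 * norm (1 / (1 + l)) * (K * norm s / (1 + norm l))" using K(2)[OF l] by (intro mult_left_mono) auto
  also have "... = 4 * K * norm s * (1 / (norm (1 + l) * (1 + norm l)))" by (simp add: norm_divide)
  also have "... <= 4 * K * norm s * (1 / (1 + (norm l)\<^sup>2))" using k K(1) by (intro mult_left_mono) auto
  finally show ?thesis by simp
 qed
 have "pi * norm r <= norm (integral {-N..N} (%t. cs (1 / (1 - Complex 0 t)\<^sup>2) (res (Complex 0 t) x))) + (40 * norm q + 40 * K * norm s) / N"
  if N: "1 <= N" for N
 proof -
  have N0: "0 < N" using N by simp
  have e: "cs (1 / (1 - Complex 0 t)\<^sup>2) (res (Complex 0 t) x) = cs (1 / (1 - Complex 0 t)\<^sup>2) q + (2 * (1 / (1 + t\<^sup>2))) *\<^sub>R r + g (Complex 0 t)" for t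
  proof -
   have n: "Complex 0 t ~= 1" "1 - Complex 0 t ~= 0" "1 + Complex 0 t ~= 0" by (auto simp: complex_eq_iff)
   have "1 / (1 - Complex 0 t) + 1 / (1 + Complex 0 t) = 2 / ((1 - Complex 0 t) * (1 + Complex 0 t))"
    using n by (simp add: field_simps)
   also have "(1 - Complex 0 t) * (1 + Complex 0 t) = of_real (1 + t\<^sup>2)" by (simp add: complex_eq_iff power2_eq_square)
   finally have "1 / (1 - Complex 0 t) + 1 / (1 + Complex 0 t) = of_real (2 * (1 / (1 + t\<^sup>2)))" by simp
   then show ?thesis using id[of "Complex 0 t"] n by (simp only: cs_simps(4)) simp
  qed
  have nn: "Complex 0 t ~= 1" for t by (auto simp: complex_eq_iff)
  have c1: "continuous_on {-N..N} (%t. cs (1 / (1 - Complex 0 t)\<^sup>2) q)"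
   by (intro continuous_on_cs continuous_intros) (auto simp: Complex_eq[symmetric] nn intro!: continuous_intros)
  have c3: "continuous_on {-N..N} (%t. g (Complex 0 t))"
   by (rule continuous_on_compose2[OF holo_D(4)[OF H]]) (auto simp: Complex_eq intro!: continuous_intros)
  have i2: "((%t. (2 * (1 / (1 + t\<^sup>2))) *\<^sub>R r) has_integral (2 * (2 * arctan N)) *\<^sub>R r) {-N..N}"
   by (intro has_integral_scaleR_left has_integral_mult_right integral_arctan) (use N in simp)
  define I1 where "I1 = integral {-N..N} (%t. cs (1 / (1 - Complex 0 t)\<^sup>2) q)"
  define I3 where "I3 = integral {-N..N} (%t. g (Complex 0 t))"
  have "((%t. cs (1 / (1 - Complex 0 t)\<^sup>2) (res (Complex 0 t) x)) has_integral I1 + (2 * (2 * arctan N)) *\<^sub>R r + I3) {-N..N}"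
   unfolding e I1_def I3_def
   by (intro has_integral_add i2 integrable_integral integrable_continuous_interval c1 c3)
  then have I: "integral {-N..N} (%t. cs (1 / (1 - Complex 0 t)\<^sup>2) (res (Complex 0 t) x)) = I1 + (2 * (2 * arctan N)) *\<^sub>R r + I3"
   by (rule integral_unique)
  have b1: "norm I1 <= 40 * norm q / N" using kernel_bound[of 0 N q] N unfolding I1_def Complex_eq_0 by (simp add: exp_imag)
  have b3: "norm I3 <= 40 * K * norm s / N" using contour_bound[OF H gb N0] unfolding I3_def by simp
  \<comment> \<open>On the axis the two simple fractions add up to 2 / (1 + t^2), whose integral is
    4 arctan N; this is at least pi because N >= 1.\<close>
  have "pi / 4 <= arctan N" using arctan_monotone'[OF N] by (simp add: arctan_one)
  then have "pi * norm r <= (2 * (2 * arctan N)) * norm r" by (intro mult_right_mono) auto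
  also have "... = norm ((2 * (2 * arctan N)) *\<^sub>R r)" using N by simp
  also have "(2 * (2 * arctan N)) *\<^sub>R r = (I1 + (2 * (2 * arctan N)) *\<^sub>R r + I3) - I1 - I3" by simp
  also have "norm ... <= norm (I1 + (2 * (2 * arctan N)) *\<^sub>R r + I3) + norm I1 + norm I3"
   by (intro order_trans[OF norm_triangle_ineq4] add_right_mono norm_triangle_ineq4)
  finally show ?thesis unfolding I using b1 b3 by (simp add: add_divide_distrib)
 qed
 then show ?thesis unfolding r_def q_def by blast
qed

text \<open>\<open>resolvent_laplace\<close> splits the integral into \<open>E\<close>, with an
  oscillating factor exp(i x T), and \<open>P\<close>, which collects \<open>v\<close> on (0,T). One
  integration by parts in x gains 1/T in \<open>E\<close>; \<open>P\<close> disappears as N tends to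
  infinity.\<close>

lemma smoothed_decay:
 "\<exists>C>0. ALL T v w. 0 < T --> sol B T v w (%_. 0) --> norm (res 1 (res 1 (v T, 0))) <= C / T * norm (v 0)"
proof -
 obtain K where K: "0 < K" "!!l f. 0 <= Re l ==> norm (res l f) <= K * norm f / (1 + norm l)" using resolvent_bound by blast
 have b: "norm (res l f) <= K * norm f" if "0 <= Re l" for l f
 proof -
  have "K * norm f / (1 + norm l) <= K * norm f / 1" using K(1) by (intro divide_left_mono) (auto simp: add_pos_nonneg)
  then show ?thesis using K(2)[OF that, of f] by simp
 qed
 \<comment> \<open>The boundary terms of the integration by parts give 8 K, the remaining integral 4
   (8 K + 4 K^2).\<close>
 define C where "C = 40 * K + 16 * K\<^sup>2"
 have "norm (res 1 (res 1 (v T, 0))) <= C / T * norm (v 0)" if T: "0 < T" and s: "sol B T v w (%_. 0)" for T v w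
 proof -
  define y where "y = (v 0, 0 :: 'a)"
  have ny: "norm y = norm (v 0)" by (simp add: y_def)
  have cv: "continuous_on {0..T} v" by (rule evo_continuous[OF sol_evo[OF s]])
  have "bounded (v ` {0..T})" by (rule compact_imp_bounded[OF compact_continuous_image[OF cv compact_Icc]])
  then obtain V where V: "!!t. t \<in> {0..T} ==> norm (v t) <= V" unfolding bounded_iff by blast
  have V0: "0 <= V" using V[of 0] T norm_ge_zero[of "v 0"] by (simp del: norm_ge_zero)
  define k where "k t = 1 / (1 - Complex 0 t)\<^sup>2" for t
  define phi where "phi x = integral {0..T} (%t. cs (cis (- (x * t))) (v t, 0))" for x
  have nn: "1 - Complex 0 t ~= 0" for t by (auto simp: complex_eq_iff)
  have nk: "norm (1 - Complex 0 t)^2 = 1 + t\<^sup>2" for t by (simp add: cmod_power2)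
  have CC: "continuous_on S (%x. Complex 0 (f x))" if "continuous_on S f" for S :: "'d::topological_space set" and f
   unfolding Complex_eq using that by (intro continuous_intros)
  have ck: "continuous_on S (%x. k (f x))" if "continuous_on S f" for S :: "'d::topological_space set" and f
   unfolding k_def using nn that by (intro continuous_intros CC) auto
  have ccis: "continuous_on S (%x. cis (f x))" if "continuous_on S f" for S :: "'d::topological_space set" and f
   unfolding cis_conv_exp using that by (intro continuous_intros)
  have cres: "continuous_on S (%x. res (Complex 0 x) z)" for S z
   by (rule continuous_on_compose2[OF holo_D(4)[OF res_holo]]) (auto intro: CC continuous_on_id)
  have main: "norm (integral {-N..N} (%x. cs (k x) (res (Complex 0 x) (v T, 0)))) <= C / T * norm y + 40 * V * T / N" if N: "1 <= N" for N
  proof -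
   have N0: "0 < N" using N by simp
   define E where "E = integral {-N..N} (%x. cs (k x * cis (x * T)) (res (Complex 0 x) y))"
   define P where "P = integral {-N..N} (%x. integral {0..T} (%t. cs (k x * cis (x * (T - t))) (v t, 0)))"
   have cP: "continuous_on ({-N..N} \<times> {0..T}) (%(x, t). cs (k x * cis (x * (T - t))) (v t, 0))"
    unfolding case_prod_unfold
    by (intro continuous_on_cs continuous_on_mult ck ccis continuous_intros continuous_on_compose2[OF cv continuous_on_snd]) auto
   have in1: "integral {0..T} (%t. cs (k x * cis (x * (T - t))) (v t, 0)) = cs (k x * cis (x * T)) (phi x)" for x
   proof -
    have c: "continuous_on {0..T} (%t. cs (cis (- (x * t))) (v t, 0))"
     by (intro continuous_on_cs ccis continuous_intros cv)
    have "cs (k x * cis (x * (T - t))) (v t, 0) = cs (k x * cis (x * T)) (cs (cis (- (x * t))) (v t, 0))" for t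
     unfolding cs_cs mult.assoc cis_mult by (simp add: algebra_simps)
    then show ?thesis unfolding phi_def using integral_linear[OF integrable_continuous_interval[OF c] cs_bl, of "k x * cis (x * T)"]
     by (simp add: o_def)
   qed
   have iP: "(%x. cs (k x * cis (x * T)) (phi x)) integrable_on {-N..N}"
    unfolding in1[symmetric] cbox_interval[symmetric]
    by (rule integrable_continuous[OF integral_continuous_on_param]) (use cP in \<open>simp add: cbox_interval\<close>)
   have iE: "(%x. cs (k x * cis (x * T)) (res (Complex 0 x) y)) integrable_on {-N..N}"
    by (intro integrable_continuous_interval continuous_on_cs continuous_on_mult ck ccis cres continuous_intros)
   have "integral {-N..N} (%x. cs (k x) (res (Complex 0 x) (v T, 0))) = integral {-N..N} (%x. cs (k x * cis (x * T)) (res (Complex 0 x) y) - cs (k x * cis (x * T)) (phi x))"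
    unfolding resolvent_laplace[OF s less_imp_le[OF T]] phi_def y_def by (simp add: cs_cs cs_diff)
   also have "... = E - P" unfolding E_def P_def in1 by (rule Henstock_Kurzweil_Integration.integral_diff[OF iE iP])
   finally have split: "integral {-N..N} (%x. cs (k x) (res (Complex 0 x) (v T, 0))) = E - P" .
   \<comment> \<open>Exchanging the integrations makes \<open>kernel_bound\<close> applicable for
     each fixed time, since T - t >= 0. The bound \<open>V\<close> of this particular solution is
     harmless because N tends to infinity with the solution fixed.\<close>
   have P: "norm P <= 40 * V / N * (T - 0)"
   proof (rule has_integral_norm_le)
    have "P = integral {0..T} (%t. integral {-N..N} (%x. cs (k x * cis (x * (T - t))) (v t, 0)))"
     unfolding P_def cbox_interval[symmetric] by (rule integral_swap_continuous) (use cP in \<open>simp add: cbox_Pair_eq\<close>)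
    moreover have "(%t. integral (cbox (-N) N) (%x. cs (k x * cis (x * (T - t))) (v t, 0))) integrable_on cbox 0 T"
    proof (rule integrable_continuous[OF integral_continuous_on_param])
     show "continuous_on (cbox 0 T \<times> cbox (-N) N) (%(t, x). cs (k x * cis (x * (T - t))) (v t, 0))"
      unfolding case_prod_unfold
      by (intro continuous_on_cs continuous_on_mult ck ccis continuous_intros continuous_on_compose2[OF cv continuous_on_fst]) auto
    qed
    ultimately show "((%t. integral {-N..N} (%x. cs (k x * cis (x * (T - t))) (v t, 0))) has_integral P) {0..T}"
     by (simp add: integrable_integral)
    fix t assume t: "t \<in> {0..T}"
    have "norm (integral {-N..N} (%x. cs (exp (Complex 0 ((T - t) * x)) / (1 - Complex 0 x)\<^sup>2) (v t, 0))) <= 40 * norm (v t, 0 :: 'a) / N"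
     by (rule kernel_bound) (use t N in auto)
    also have "... <= 40 * V / N" using V[OF t] N by (simp add: divide_right_mono)
    finally show "norm (integral {-N..N} (%x. cs (k x * cis (x * (T - t))) (v t, 0))) <= 40 * V / N"
     by (simp add: k_def exp_imag mult.commute)
   qed (use V0 N T in auto)
   have E: "norm E <= C / T * norm y"
   proof -
    \<comment> \<open>A primitive of \<open>k x * cis (x * T)\<close> up to the term
      \<open>d\<close>, which like \<open>c\<close> carries a factor 1/T.\<close>
    define c where "c x = cis (x * T) / (\<i> * of_real T * (1 - Complex 0 x)\<^sup>2)" for x
    define d where "d x = cis (x * T) * 2 / (of_real T * (1 - Complex 0 x)^3)" for x
    have T0: "complex_of_real T ~= 0" using T by simp
    have dc: "(c has_vector_derivative k x * cis (x * T) + d x) (at x within {-N..N})" for x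
    proof -
     have n: "1 - \<i> * of_real x ~= 0" using nn[of x] by (simp add: Complex_eq)
     have "((%z. exp (\<i> * (z * of_real T)) / (\<i> * of_real T * (1 - \<i> * z)\<^sup>2)) has_field_derivative
       exp (\<i> * (of_real x * of_real T)) / (1 - \<i> * of_real x)\<^sup>2 + exp (\<i> * (of_real x * of_real T)) * 2 / (of_real T * (1 - \<i> * of_real x)^3)) (at (of_real x))"
      using T0 n by (auto intro!: derivative_eq_intros simp: divide_simps power2_eq_square power3_eq_cube) (simp add: algebra_simps)
     from has_vector_derivative_real_field[OF this, of "{-N..N}"] show ?thesis
      unfolding c_def k_def d_def cis_conv_exp Complex_eq by simp
    qed
    define h where "h x = cs (d x) (res (Complex 0 x) y) + cs (c x) (cs \<i> (- res (Complex 0 x) (res (Complex 0 x) y)))" for x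
    have dF: "((%x. cs (c x) (res (Complex 0 x) y)) has_vector_derivative cs (k x * cis (x * T)) (res (Complex 0 x) y) + h x) (at x within {-N..N})" for x
     using bounded_bilinear.has_vector_derivative[OF bounded_bilinear_cs dc holo_D(2)[OF res_holo order_refl, of y x "{-N..N}"]]
     by (simp add: h_def cs_add algebra_simps)
    have "((%x. cs (k x * cis (x * T)) (res (Complex 0 x) y) + h x) has_integral
      cs (c N) (res (Complex 0 N) y) - cs (c (-N)) (res (Complex 0 (-N)) y)) {-N..N}"
     by (rule fundamental_theorem_of_calculus[OF _ dF]) (use N in simp)
    from has_integral_diff[OF this integrable_integral[OF iE]]
    have hI: "(h has_integral cs (c N) (res (Complex 0 N) y) - cs (c (-N)) (res (Complex 0 (-N)) y) - E) {-N..N}"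
     unfolding E_def by simp
    have nc: "norm (c x) = 1 / T * (1 / (1 + x\<^sup>2))" for x using T by (simp add: c_def norm_divide norm_mult norm_power nk)
    have ncT: "norm (c x) <= 1 / T" for x unfolding nc using T by (intro mult_left_le) (auto simp: divide_le_eq add_pos_nonneg)
    have nd: "norm (d x) <= 2 / T * (1 / (1 + x\<^sup>2))" for x
    proof -
     have "1 <= norm (1 - Complex 0 x)" using abs_Re_le_cmod[of "1 - Complex 0 x"] by simp
     then have "1 + x\<^sup>2 <= norm (1 - Complex 0 x)^3" using power_increasing[of 2 3 "norm (1 - Complex 0 x)"] by (simp add: nk)
     then have "2 / T * (1 / norm (1 - Complex 0 x)^3) <= 2 / T * (1 / (1 + x\<^sup>2))" using T nn[of x]
      by (intro mult_left_mono divide_left_mono mult_pos_pos) (auto intro: add_pos_nonneg)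
     then show ?thesis using T by (simp add: d_def norm_divide norm_mult norm_power)
    qed
    have "norm (cs (c N) (res (Complex 0 N) y) - cs (c (-N)) (res (Complex 0 (-N)) y) - E) <= integral {-N..N} (%x. (8 * K + 4 * K\<^sup>2) * norm y / T * (1 / (1 + x\<^sup>2)))"
     unfolding integral_unique[OF hI, symmetric]
    proof (rule integral_norm_bound_integral)
     show "h integrable_on {-N..N}" using hI by blast
     show "(%x. (8 * K + 4 * K\<^sup>2) * norm y / T * (1 / (1 + x\<^sup>2))) integrable_on {-N..N}"
      using has_integral_mult_right[OF integral_arctan] N by (meson has_integral_integrable le_less_trans less_imp_le not_less zero_less_one)
     fix x
     have "norm (h x) <= 4 * norm (d x) * norm (res (Complex 0 x) y) + 4 * norm (c x * \<i>) * norm (res (Complex 0 x) (res (Complex 0 x) y))"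
      unfolding h_def cs_cs using norm_cs[of "d x" "res (Complex 0 x) y"] norm_cs[of "c x * \<i>" "- res (Complex 0 x) (res (Complex 0 x) y)"]
      by (intro order_trans[OF norm_triangle_ineq] add_mono) auto
     also have "... <= 4 * (2 / T * (1 / (1 + x\<^sup>2))) * (K * norm y) + 4 * (1 / T * (1 / (1 + x\<^sup>2))) * (K * (K * norm y))"
     proof (intro add_mono mult_mono)
      show "norm (res (Complex 0 x) (res (Complex 0 x) y)) <= K * (K * norm y)"
       using b[of "Complex 0 x" "res (Complex 0 x) y"] b[of "Complex 0 x" y] K(1) by (auto intro: order_trans mult_left_mono)
      show "norm (c x * \<i>) <= 1 / T * (1 / (1 + x\<^sup>2))" by (simp add: norm_mult nc)
      show "0 <= 4 * (2 / T * (1 / (1 + x\<^sup>2)))" "0 <= 4 * (1 / T * (1 / (1 + x\<^sup>2)))" using T by (auto simp: add_nonneg_nonneg)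
     qed (use nd b in auto)
     also have "... = (8 * K + 4 * K\<^sup>2) * norm y / T * (1 / (1 + x\<^sup>2))"
     proof -
      define X where "X = 1 / (1 + x\<^sup>2)"
      show ?thesis unfolding X_def[symmetric] by (simp add: power2_eq_square add_divide_distrib algebra_simps)
     qed
     finally show "norm (h x) <= (8 * K + 4 * K\<^sup>2) * norm y / T * (1 / (1 + x\<^sup>2))" .
    qed
    also have "... = (8 * K + 4 * K\<^sup>2) * norm y / T * (2 * arctan N)"
     by (rule integral_unique[OF has_integral_mult_right[OF integral_arctan]]) (use N in simp)
    also have "... <= (8 * K + 4 * K\<^sup>2) * norm y / T * 4"
     using arctan_ubound[of N] pi_less_4 K(1) T by (intro mult_left_mono) auto
    finally have 1: "norm (cs (c N) (res (Complex 0 N) y) - cs (c (-N)) (res (Complex 0 (-N)) y) - E) <= (32 * K + 16 * K\<^sup>2) * norm y / T"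
     by (simp add: algebra_simps)
    have 2: "norm (cs (c x) (res (Complex 0 x) y)) <= 4 * K * norm y / T" for x
    proof -
     have "4 * norm (c x) * norm (res (Complex 0 x) y) <= 4 * (1 / T) * (K * norm y)"
      using ncT b T by (intro mult_mono) auto
     then show ?thesis using norm_cs[of "c x" "res (Complex 0 x) y"] by simp
    qed
    let ?a = "cs (c N) (res (Complex 0 N) y)" and ?b = "cs (c (-N)) (res (Complex 0 (-N)) y)"
    have "E = (?a - ?b) - (?a - ?b - E)" by simp
    then have "norm E <= norm (?a - ?b) + norm (?a - ?b - E)" using norm_triangle_ineq4 by metis
    also have "... <= (4 * K * norm y / T + 4 * K * norm y / T) + (32 * K + 16 * K\<^sup>2) * norm y / T"
     using norm_triangle_ineq4[of ?a ?b] 1 2[of N] 2[of "-N"] by linarith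
    also have "... = C / T * norm y" by (simp add: C_def add_divide_distrib algebra_simps)
    finally show ?thesis .
   qed
   show ?thesis unfolding split using norm_triangle_ineq4[of E P] E P by simp
  qed
  obtain D where D: "!!N. 1 <= N ==> pi * norm (res 1 (res 1 (v T, 0))) <= norm (integral {-N..N} (%x. cs (k x) (res (Complex 0 x) (v T, 0)))) + D / N"
   using residue_part[of "(v T, 0)"] unfolding k_def by blast
  have "pi * norm (res 1 (res 1 (v T, 0))) <= C / T * norm y"
  proof (rule field_le_epsilon)
   fix e :: real assume e: "0 < e"
   define N where "N = max 1 ((40 * V * T + D) / e)"
   have N: "1 <= N" "(40 * V * T + D) / e <= N" by (auto simp: N_def)
   have "(40 * V * T + D) / N <= e" using N e by (simp add: divide_le_eq mult.commute)
   then show "pi * norm (res 1 (res 1 (v T, 0))) <= C / T * norm y + e"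
    using D[OF N(1)] main[OF N(1)] by (simp add: add_divide_distrib)
  qed
  moreover have "1 * norm (res 1 (res 1 (v T, 0))) <= pi * norm (res 1 (res 1 (v T, 0)))"
   using pi_gt3 by (intro mult_right_mono) auto
  ultimately show ?thesis by (simp add: ny)
 qed
 moreover have "0 < C" using K(1) by (simp add: C_def add_pos_pos)
 ultimately show ?thesis by blast
qed

text \<open>The inverse of 1 + B on real elements, with values in X_1.\<close>

definition R1 :: "'a => 'b" where "R1 x = fst (Rop 1 (x, 0))"

lemma Rop_real: "Rop 1 (x, 0) = (R1 x, 0)"
 and R1: "J (R1 x) + B (R1 x) = x" "R1 (J z + B z) = z"
 and R1_bl: "bounded_linear R1"
 and res_real: "res 1 (x, 0) = (J (R1 x), 0)"
proof -
 have 1: "0 <= Re 1" by simp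
 have L: "Lop 1 (a, b) = (J a + B a, J b + B b)" for a b by (simp add: Lop_def)
 have inj0: "b = 0" if "J b + B b = 0" for b
  using Rop_Lop[OF 1, of "(0, b)"] Rop_Lop[OF 1, of "(0, 0)"] that by (simp add: L linear_0[OF linear_J] linear_0[OF lin_B])
 obtain a b where ab: "Rop 1 (x, 0) = (a, b)" by (cases "Rop 1 (x, 0)")
 have eq: "J a + B a = x" "J b + B b = 0" using Lop_Rop[OF 1, of "(x, 0)"] by (auto simp: ab L)
 then show 2: "Rop 1 (x, 0) = (R1 x, 0)" using inj0[OF eq(2)] ab by (simp add: R1_def)
 show "J (R1 x) + B (R1 x) = x" using eq ab by (simp add: R1_def)
 show "R1 (J z + B z) = z" using Rop_Lop[OF 1, of "(z, 0)"] by (simp add: L R1_def linear_0[OF linear_J] linear_0[OF lin_B])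
 show "res 1 (x, 0) = (J (R1 x), 0)" by (simp add: res_def 2 linear_0[OF linear_J])
 obtain K where K: "!!f. norm (Rop 1 f) <= K * norm f" using Rop_bound[OF 1] by blast
 show "bounded_linear R1"
 proof (rule bounded_linear_intro)
  have "Rop 1 (x + y, 0) = Rop 1 (x, 0) + Rop 1 (y, 0)" for x y
   using linear_add[OF linear_Rop[OF 1], of "(x, 0)" "(y, 0)"] by simp
  then show "R1 (x + y) = R1 x + R1 y" for x y by (simp add: R1_def)
  have "Rop 1 (c *\<^sub>R x, 0) = c *\<^sub>R Rop 1 (x, 0)" for c x
   using linear_scale[OF linear_Rop[OF 1], of c "(x, 0)"] by simp
  then show "R1 (c *\<^sub>R x) = c *\<^sub>R R1 x" for c x by (simp add: R1_def)
  show "norm (R1 x) <= norm x * K" for x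
   using K[of "(x, 0)"] norm_fst_le[of "fst (Rop 1 (x, 0))" "snd (Rop 1 (x, 0))"] by (simp add: R1_def mult.commute)
 qed
qed

text \<open>The resolvent commutes with the evolution. It also raises the regularity: the X_1-valued
  representative \<open>R1 (v t)\<close> is continuous in time.\<close>

lemma sol_R1:
 assumes s: "sol B a v w (%_. 0)"
 shows "sol B a (%t. J (R1 (v t))) (%t. R1 (v t)) (%_. 0)"
proof -
 note e = sol_evo[OF s, unfolded diff_0]
 note r = bounded_linear_compose[OF J R1_bl]
 have rB: "J (R1 (- B x)) = - B (R1 (J x))" for x
 proof -
  have "R1 (B x) = x - R1 (J x)" using R1(2)[of x] by (simp add: linear_add[OF bounded_linear.linear[OF R1_bl]] algebra_simps)
  then have "J (R1 (B x)) = J x - J (R1 (J x))" by (simp only: linear_diff[OF linear_J])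
  also have "... = B (R1 (J x))" using R1(1)[of "J x"] by (simp add: algebra_simps)
  finally show ?thesis by (simp only: linear_neg[OF bounded_linear.linear[OF r]])
 qed
 have "evo a (%t. J (R1 (v t))) (%t. R1 (v t)) (%t. J (R1 (- B (w t))))"
  unfolding evo_def
 proof (intro conjI ballI)
  show "PL0 p a (%t. J (R1 (- B (w t))))" by (rule PL_cut_linear(1)[OF r evoD(2)[OF e]])
  show "J (R1 (v t)) = J (R1 (v 0)) + integral {0..t} (%t. J (R1 (- B (w t))))" if t: "t \<in> {0..a}" for t
  proof -
   have "integral {0..t} (%t. J (R1 (- B (w t)))) = J (R1 (integral {0..t} (%t. - B (w t))))"
    using integral_linear[OF evo_integrable(1)[OF e order_refl, of t] r] t by (simp add: o_def)
   then show ?thesis using trans[OF arg_cong[OF evoD(3)[OF e t], of "%x. J (R1 x)"] linear_add[OF bounded_linear.linear[OF r]]] by (simp only:)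
  qed
  have "PL0 p a (%t. R1 (J (w t)))" by (rule PL_cut_linear(1)[OF bounded_linear_compose[OF R1_bl J] evoD(1)[OF e]])
  then show "PL0 p a (%t. R1 (v t))"
   by (rule PL_AE_cong(1)[OF p0]) (rule cut_cong_AE, use evoD(4)[OF e] in \<open>eventually_elim, auto\<close>)
 qed simp
 then have "evo a (%t. J (R1 (v t))) (%t. R1 (v t)) (%t. 0 - B (R1 (v t)))"
  by (rule evo_cong) (use evoD(4)[OF e] in \<open>auto simp: rB elim!: eventually_mono\<close>)
 then show ?thesis by (simp add: sol_def)
qed

text \<open>Parabolic smoothing: t v(t) solves the problem with zero initial value and right-hand
  side \<open>v\<close>, so maximal regularity bounds it by the L_p norm of \<open>v\<close> in X_0
  alone.\<close>

lemma time_weight: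
 assumes L: "LS B a M'" and s: "sol B a v w (%_. 0)" and P: "PL0 p a v"
 shows "LN0 p a (%t. t *\<^sub>R w t) <= M' * LN0 p a v" "norm (tr v a) <= M' * LN0 p a v / a"
proof -
 note a = LS_pos(1)[OF L]
 have d: "((%t::real. t) has_real_derivative 1) (at t)" for t by (rule DERIV_ident)
 have e: "evo a (%t. t *\<^sub>R v t) (%t. t *\<^sub>R w t) (%t. 1 *\<^sub>R v t + t *\<^sub>R (0 - B (w t)))"
  by (rule evo_mult[OF sol_evo[OF s] _ d]) (use a in auto)
 then have s2: "sol B a (%t. t *\<^sub>R v t) (%t. t *\<^sub>R w t) v"
  using P unfolding sol_def by (simp add: linear_scale[OF lin_B])
 have z: "0 *\<^sub>R v 0 = i 0" by (simp add: linear_0[OF linear_i])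
 show "LN0 p a (%t. t *\<^sub>R w t) <= M' * LN0 p a v" using LS_D(1)[OF L s2 z] by simp
 have "i (tr v a) = v a" by (rule evo_tr(1)[OF a sol_evo[OF s]]) (use a in simp)
 then have "tr (%t. t *\<^sub>R v t) a = a *\<^sub>R tr v a" by (intro tr_eqI) (simp add: linear_scale[OF linear_i])
 then have "a * norm (tr v a) <= M' * LN0 p a v" using LS_D(2)[OF L s2 z, of a] a by simp
 then show "norm (tr v a) <= M' * LN0 p a v / a" using a by (simp add: field_simps)
qed

text \<open>One resolvent is removed by writing v = J(R1 v) + B(R1 v) and bounding t R1(v(t)) in
  L_p(X_1) through \<open>time_weight\<close>; on (1,a) the weight is at least 1.\<close>

lemma lift:
 assumes a: "1 < a"
 shows "\<exists>C>0. ALL v w. sol B a v w (%_. 0) --> LN p (cut 1 a v) <= C * LN0 p a (%t. J (R1 (v t)))"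
proof -
 have a0: "0 < a" using a by simp
 obtain M' where L: "LS B a M'" using LS_long[OF LS a0] by blast
 define C where "C = a + onorm B * M'"
 have oB: "0 <= onorm B" by (rule onorm_pos_le[OF B])
 have "LN p (cut 1 a v) <= C * LN0 p a (%t. J (R1 (v t)))" if s: "sol B a v w (%_. 0)" for v w
 proof -
  let ?u = "%t. J (R1 (v t))"
  note r = sol_R1[OF s]
  have cu: "continuous_on {0..a} v" by (rule evo_continuous[OF sol_evo[OF s]])
  have Pu: "PL0 p a ?u" by (rule PL_cut_continuous[OF p0 _ evo_continuous[OF sol_evo[OF r]]]) (use a in simp)
  have tw: "PL0 p a (%t. t *\<^sub>R R1 (v t))"
   by (rule PL_cut_continuous[OF p0]) (use a in \<open>auto intro!: continuous_intros bounded_linear.continuous_on[OF R1_bl cu]\<close>)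
  have u1: "PL0 p a (%t. t *\<^sub>R ?u t) & LN0 p a (%t. t *\<^sub>R ?u t) <= a * LN0 p a ?u"
  proof (rule PL_bound[OF p0 _ Pu])
   show "SM (cut 0 a (%t. t *\<^sub>R ?u t))" by (rule PL_SM[OF PL_cut_continuous[OF p0]])
    (use a in \<open>auto intro!: continuous_intros evo_continuous[OF sol_evo[OF r]]\<close>)
  qed (use a in \<open>auto simp: cut_def intro!: mult_right_mono\<close>)
  have eq: "cut 0 a (%t. t *\<^sub>R v t) = (%t. cut 0 a (%t. t *\<^sub>R ?u t) t + cut 0 a (%t. B (t *\<^sub>R R1 (v t))) t)"
   using R1(1)[of "v _"] by (auto simp: cut_def linear_scale[OF lin_B] scaleR_add_right[symmetric])
  note bw = PL_cut_linear[OF B tw]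
  have "LN0 p a (%t. t *\<^sub>R v t) <= a * LN0 p a ?u + onorm B * LN0 p a (%t. t *\<^sub>R R1 (v t))"
   unfolding eq using PL_add(2)[OF p1 conjunct1[OF u1] bw(1)] u1 bw(2) by linarith
  also have "... <= a * LN0 p a ?u + onorm B * (M' * LN0 p a ?u)"
   by (intro add_left_mono mult_left_mono time_weight(1)[OF L r Pu] oB)
  finally have 1: "LN0 p a (%t. t *\<^sub>R v t) <= C * LN0 p a ?u" by (simp add: C_def algebra_simps)
  have tv: "PL0 p a (%t. t *\<^sub>R v t)" by (rule PL_cut_continuous[OF p0]) (use a cu in \<open>auto intro!: continuous_intros\<close>)
  have "LN p (cut 1 a v) <= LN0 p a (%t. t *\<^sub>R v t)"
  proof (rule PL_mono(2)[OF p0 _ tv])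
   show "SM (cut 1 a v)" by (rule SM_continuous[OF continuous_on_subset[OF cu]]) auto
   have "1 * norm (v t) <= t * norm (v t)" if "1 < t" for t using that by (intro mult_right_mono) auto
   then show "AE t in lebesgue. norm (cut 1 a v t) <= norm (cut 0 a (%t. t *\<^sub>R v t) t)" by (auto simp: cut_def)
  qed
  then show ?thesis using 1 by linarith
 qed
 moreover have "0 < C" using a oB LS_pos(2)[OF L] by (auto simp: C_def intro!: add_pos_nonneg)
 ultimately show ?thesis by blast
qed

text \<open>After time T the doubly smoothed solution is small on an interval of length 3. Each unit
  of it pays for one gain: two applications of \<open>lift\<close>, and one of
  \<open>time_weight\<close> that passes from L_p(X_0) to X_gamma.\<close>

lemma decay:
 "\<exists>C>0. ALL T v w y. 0 < T --> sol B (T + 3) v w (%_. 0) --> v 0 = i y --> norm (tr v (T + 3)) <= C / T * norm y"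
proof -
 obtain C1 where C1: "0 < C1" "!!T v w. 0 < T ==> sol B T v w (%_. 0) ==> norm (res 1 (res 1 (v T, 0))) <= C1 / T * norm (v 0)"
  using smoothed_decay by blast
 obtain C2 where C2: "0 < C2" "!!v w. sol B 3 v w (%_. 0) ==> LN p (cut 1 3 v) <= C2 * LN0 p 3 (%t. J (R1 (v t)))" using lift[of 3] by auto
 obtain C3 where C3: "0 < C3" "!!v w. sol B 2 v w (%_. 0) ==> LN p (cut 1 2 v) <= C3 * LN0 p 2 (%t. J (R1 (v t)))" using lift[of 2] by auto
 obtain Ci where Ci: "0 < Ci" "!!z. norm (i z) <= Ci * norm z" using i_bound by blast
 define C where "C = M * C3 * C2 * (C1 * Ci * 3 powr (1 / p))"
 have "norm (tr v (T + 3)) <= C / T * norm y" if T: "0 < T" and s: "sol B (T + 3) v w (%_. 0)" and y: "v 0 = i y" for T v w y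
 proof -
  define u where "u t = v (T + t)" for t
  have s3: "sol B 3 u (%t. w (T + t)) (%_. 0)" using sol_shift[OF s, of T] T by (simp add: u_def[abs_def])
  note r3 = sol_R1[OF s3]
  have cu: "continuous_on {0..3} u" by (rule evo_continuous[OF sol_evo[OF s3]])
  let ?r = "%x. J (R1 x)"
  have rl: "bounded_linear ?r" by (rule bounded_linear_compose[OF J R1_bl])
  have cr: "continuous_on {0..3} (%t. ?r (u t))" by (rule bounded_linear.continuous_on[OF rl cu])
  have PLr: "PL p (cut a b (%t. ?r (u t)))" if "0 <= a" "a <= b" "b <= 3" for a b
   by (rule PL_cut_continuous[OF p0 that(2) continuous_on_subset[OF cr]]) (use that in auto)
  have PLu: "PL p (cut a b u)" if "0 <= a" "a <= b" "b <= 3" for a b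
   by (rule PL_cut_continuous[OF p0 that(2) continuous_on_subset[OF cu]]) (use that in auto)
  have b: "norm (?r (?r (u t))) <= C1 * Ci / T * norm y" if t: "0 < t" "t < 3" for t
  proof -
   have "norm (res 1 (res 1 (v (T + t), 0))) <= C1 / (T + t) * norm (v 0)"
    by (rule C1(2)[OF _ sol_sub[OF s]]) (use t T in auto)
   also have "... <= C1 / T * (Ci * norm y)" unfolding y using Ci(2)[of y] T t C1(1) by (intro mult_mono divide_left_mono) auto
   finally show ?thesis by (simp add: res_real u_def)
  qed
  have smr: "SM (cut 0 3 (%t. ?r (?r (u t))))"
   by (rule SM_continuous[OF continuous_on_subset[OF bounded_linear.continuous_on[OF rl cr]]]) auto
  have b0: "0 <= C1 * Ci / T * norm y" using C1 Ci T by auto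
  have 3: "LN0 p 3 (%t. ?r (?r (u t))) <= C1 * Ci / T * norm y * 3 powr (1 / p)"
   using PL_cut_bounded(2)[OF p0 _ smr b b0] by simp
  have 2: "LN p (cut 1 3 (%t. ?r (u t))) <= C2 * (C1 * Ci / T * norm y * 3 powr (1 / p))"
   using C2(2)[OF r3] 3 C2(1) by (meson mult_left_mono less_imp_le order_trans)
  have s2: "sol B 2 (%t. u (1 + t)) (%t. w (T + (1 + t))) (%_. 0)" using sol_shift[OF s3, of 1] by simp
  have "LN p (cut 1 2 (%t. u (1 + t))) <= C3 * LN0 p 2 (%t. ?r (u (1 + t)))" by (rule C3(2)[OF s2])
  also have "LN0 p 2 (%t. ?r (u (1 + t))) = LN p (cut 1 3 (%t. ?r (u t)))"
   using PL_cut_shift(2)[OF p0, of 0 1 2 "%t. ?r (u t)"] PLr[of 1 3] by simp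
  also have "LN p (cut 1 2 (%t. u (1 + t))) = LN p (cut 2 3 u)"
   using PL_cut_shift(2)[OF p0, of 1 1 2 u] PLu[of 2 3] by simp
  finally have 1: "LN p (cut 2 3 u) <= C3 * LN p (cut 1 3 (%t. ?r (u t)))" .
  have s1: "sol B 1 (%t. u (2 + t)) (%t. w (T + (2 + t))) (%_. 0)" using sol_shift[OF s3, of 2] by simp
  have P1: "PL0 p 1 (%t. u (2 + t))" using PL_cut_shift(1)[OF p0, of 0 1 u 2] PLu[of 2 3] by simp
  have "norm (tr (%t. u (2 + t)) 1) <= M * LN0 p 1 (%t. u (2 + t))" using time_weight(2)[OF LS s1 P1] by simp
  also have "LN0 p 1 (%t. u (2 + t)) = LN p (cut 2 3 u)"
   using PL_cut_shift(2)[OF p0, of 0 2 1 u] PLu[of 2 3] by simp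
  also have "M * LN p (cut 2 3 u) <= M * (C3 * (C2 * (C1 * Ci / T * norm y * 3 powr (1 / p))))"
   using 1 2 M C3(1) by (meson mult_left_mono less_imp_le order_trans)
  also have "... = C / T * norm y" by (simp add: C_def)
  also have "tr (%t. u (2 + t)) 1 = tr v (T + 3)" by (simp add: tr_def u_def add.commute)
  finally show ?thesis .
 qed
 moreover have "0 < C" using M C1 C2 C3 Ci by (simp add: C_def)
 ultimately show ?thesis by blast
qed

end

section \<open>The flow near a normally stable equilibrium\<close>

text \<open>Strict differentiability, by the mean value inequality and continuity of the derivative:
  the remainder has a small Lipschitz constant near the point, which the contraction arguments need
  and the derivative at the point alone does not give.\<close>

lemma C1_strict_derivative:
 fixes f :: "'x::real_normed_vector => 'y::real_normed_vector"
 assumes f: "C1_on S f" and S: "open S" and x: "x \<in> S"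
 obtains f' where "(f has_derivative f') (at x)"
  "!!e. 0 < e ==> \<exists>r>0. ALL c d. norm c <= r --> norm d <= r --> x + c \<in> S & norm (f (x + c) - f (x + d) - f' (c - d)) <= e * norm (c - d)"
proof -
 obtain D :: "'x => 'x \<Rightarrow>\<^sub>L 'y" where D: "!!x. x \<in> S ==> (f has_derivative blinfun_apply (D x)) (at x)" "continuous_on S D"
  using f unfolding C1_on_def by blast
 show thesis
 proof (rule that[OF D(1)[OF x]])
  fix e :: real assume e: "0 < e"
  have "isCont D x" using D(2) S x by (simp add: continuous_on_eq_continuous_at)
  then obtain s where s: "0 < s" "!!y. dist y x < s ==> dist (D y) (D x) < e" using e unfolding continuous_at_eps_delta by blast
  obtain t where t: "0 < t" "ball x t \<subseteq> S" using S x open_contains_ball by blast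
  define r where "r = min s t / 2"
  have r: "0 < r" "r < s" "r < t" using s t by (auto simp: r_def)
  have "x + c \<in> S & norm (f (x + c) - f (x + d) - D x (c - d)) <= e * norm (c - d)" if cd: "norm c <= r" "norm d <= r" for c d
  proof
   have b: "cball x r \<subseteq> S" using t r by (auto simp: subset_iff)
   show "x + c \<in> S" using b cd by (auto simp: subset_iff dist_norm)
   have "norm (f (x + c) - f (x + d) - D x ((x + c) - (x + d))) <= norm ((x + c) - (x + d)) * e"
   proof (rule differentiable_bound_linearization[where S = "cball x r"])
    show "(f has_derivative D y) (at y within cball x r)" if "y \<in> cball x r" for y
     using D(1) b that by (meson has_derivative_at_withinI subset_iff)
    have eq: "(x + d) + t *\<^sub>R ((x + c) - (x + d)) = x + ((1 - t) *\<^sub>R d + t *\<^sub>R c)" "dist x (x + y) = norm y" for t y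
     by (simp_all add: algebra_simps dist_norm)
    have "norm ((1 - t) *\<^sub>R d + t *\<^sub>R c) <= (1 - t) * r + t * r" if "t \<in> {0..1}" for t
     using that cd by (intro norm_triangle_le add_mono) (auto intro: mult_left_mono)
    then show "(x + d) + t *\<^sub>R ((x + c) - (x + d)) \<in> cball x r" if "t \<in> {0..1}" for t
     using that unfolding mem_cball eq by (simp add: algebra_simps)
    show "onorm (blinfun_apply (D y) - blinfun_apply (D x)) <= e" if "y \<in> cball x r" for y
     using s(2)[of y] that r norm_minus_commute[of x y] by (simp add: dist_norm norm_blinfun.rep_eq minus_blinfun.rep_eq dist_commute fun_diff_def)
   qed (use r in auto)
   then show "norm (f (x + c) - f (x + d) - D x (c - d)) <= e * norm (c - d)" by (simp add: mult.commute)
  qed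
  then show "\<exists>r>0. ALL c d. norm c <= r --> norm d <= r --> x + c \<in> S & norm (f (x + c) - f (x + d) - D x (c - d)) <= e * norm (c - d)"
   using r(1) by blast
 qed
qed

text \<open>If the kernel contained a nonzero \<open>k\<close>, the range would be the image of the
  hyperplane orthogonal to \<open>k\<close>, whose dimension is too small.\<close>

lemma full_rank_imp_inj:
 fixes f :: "real ^ 'm => 'y::real_vector"
 assumes f: "linear f" and d: "dim (range f) = CARD('m)"
 shows "inj f"
 unfolding linear_injective_0[OF f]
proof (intro allI impI, rule ccontr)
 fix k assume k: "f k = 0" "k ~= 0"
 obtain B where B: "B \<subseteq> {x. k \<bullet> x = 0}" "independent B" "{x. k \<bullet> x = 0} \<subseteq> span B" "card B = dim {x. k \<bullet> x = 0}" using basis_exists by blast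
 have fB: "finite B" using independent_bound[OF B(2)] by simp
 have "f x \<in> span (f ` B)" for x
 proof -
  have "x - (x \<bullet> k / (k \<bullet> k)) *\<^sub>R k \<in> span B" using B(3) k by (auto simp: inner_diff_right inner_commute)
  then have "f (x - (x \<bullet> k / (k \<bullet> k)) *\<^sub>R k) \<in> span (f ` B)" using linear_span_image[OF f] by blast
  then show ?thesis using k by (simp add: linear_diff[OF f] linear_scale[OF f])
 qed
 then have "dim (range f) <= card (f ` B)" using fB by (intro real_vector.dim_le_card) auto
 also have "... <= card B" by (rule card_image_le[OF fB])
 also have "... < CARD('m)" unfolding B(4) dim_hyperplane[OF k(2)] by simp
 finally show False using d by simp
qed

locale normally_stable = interpolation_setting p J i for p and J :: "'b::banach => 'a::banach" and i :: "'c::banach => 'a" +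
 fixes V :: "'c set" and A :: "'c => 'b \<Rightarrow>\<^sub>L 'a" and F :: "'c => 'a" and us :: 'b and U :: "(real ^ 'm) set" and Psi :: "real ^ 'm => 'b"
 assumes V: "open V" and C1: "C1_on V (%v. (A v, F v))" and us: "us \<in> equilibria J i V A F"
  and mr: "maximal_regularity p J (A (incl J i us))"
  and mf: "C1_manifold_near (equilibria J i V A F) us U Psi"
  and tangent: "range (frechet_derivative Psi (at 0)) = null_space (linearization J i A F us)"
  and semi: "zero_semisimple_eigenvalue J (linearization J i A F us)"
  and spec: "op_spectrum J (linearization J i A F us) - {0} \<subseteq> {z. Re z > 0}"
begin

abbreviation uc where "uc \<equiv> incl J i us"
abbreviation a0 where "a0 \<equiv> linearization J i A F us"
abbreviation DA where "DA \<equiv> frechet_derivative A (at uc)"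
abbreviation DF where "DF \<equiv> frechet_derivative F (at uc)"
abbreviation Psi' where "Psi' \<equiv> frechet_derivative Psi (at 0)"

lemmas lin_ic = bounded_linear.linear[OF incl_bounded]

lemma derivatives:
 "bounded_linear DA" "bounded_linear DF"
 "!!e. 0 < e ==> \<exists>r>0. ALL c d. norm c <= r --> norm d <= r --> uc + c \<in> V &
   norm (A (uc + c) - A (uc + d) - DA (c - d)) <= e * norm (c - d) & norm (F (uc + c) - F (uc + d) - DF (c - d)) <= e * norm (c - d)"
proof -
 have u: "uc \<in> V" using us by (simp add: equilibria_def)
 obtain f' where f': "((%v. (A v, F v)) has_derivative f') (at uc)"
  "!!e. 0 < e ==> \<exists>r>0. ALL c d. norm c <= r --> norm d <= r --> uc + c \<in> V &
    norm ((A (uc + c), F (uc + c)) - (A (uc + d), F (uc + d)) - f' (c - d)) <= e * norm (c - d)"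
  using C1_strict_derivative[OF C1 V u] by blast
 have d: "(A has_derivative (%x. fst (f' x))) (at uc)" "(F has_derivative (%x. snd (f' x))) (at uc)"
  using has_derivative_fst[OF f'(1)] has_derivative_snd[OF f'(1)] by simp_all
 have eq: "DA = (%x. fst (f' x))" "DF = (%x. snd (f' x))" using frechet_derivative_at[OF d(1)] frechet_derivative_at[OF d(2)] by simp_all
 show "bounded_linear DA" "bounded_linear DF" unfolding eq using d[THEN has_derivative_bounded_linear] by blast+
 fix e :: real assume "0 < e"
 then obtain r where r: "0 < r" "!!c d. norm c <= r ==> norm d <= r ==> uc + c \<in> V &
    norm ((A (uc + c), F (uc + c)) - (A (uc + d), F (uc + d)) - f' (c - d)) <= e * norm (c - d)" using f'(2) by meson
 have n: "norm (fst z) <= norm z" "norm (snd z) <= norm z" for z :: "('b \<Rightarrow>\<^sub>L 'a) \<times> 'a"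
  using norm_fst_le[of "fst z" "snd z"] norm_snd_le[of "snd z" "fst z"] by simp_all
 show "\<exists>r>0. ALL c d. norm c <= r --> norm d <= r --> uc + c \<in> V &
   norm (A (uc + c) - A (uc + d) - DA (c - d)) <= e * norm (c - d) & norm (F (uc + c) - F (uc + d) - DF (c - d)) <= e * norm (c - d)"
  unfolding eq
 proof (intro exI[of _ r] conjI allI impI r(1))
  fix c d :: 'c assume cd: "norm c <= r" "norm d <= r"
  show "uc + c \<in> V" using r(2)[OF cd] by simp
  show "norm (A (uc + c) - A (uc + d) - fst (f' (c - d))) <= e * norm (c - d)" "norm (F (uc + c) - F (uc + d) - snd (f' (c - d))) <= e * norm (c - d)"
   using n[of "(A (uc + c), F (uc + c)) - (A (uc + d), F (uc + d)) - f' (c - d)"] r(2)[OF cd] by auto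
 qed
qed

lemma a0_eq: "a0 x = A uc x + (DA (incl J i x) us - DF (incl J i x))"
 by (simp add: linearization_def)

lemma C_bl: "bounded_linear (%c. DA c us - DF c)"
 by (intro bounded_linear_sub bounded_linear_compose[OF blinfun.bounded_linear_left] derivatives)

text \<open>The linearization differs from \<open>A uc\<close> by terms that factor through X_gamma,
  so \<open>LS_perturb\<close> carries maximal regularity over.\<close>

lemma a0_LS: "0 < T ==> EX M. LS a0 T M"
proof -
 obtain M where "LS (blinfun_apply (A uc)) 1 M" using maximal_regularity_LS[OF mr] by blast
 then show "0 < T ==> EX M. LS a0 T M" using LS_perturb[OF _ C_bl] unfolding a0_eq[abs_def] by blast
qed

lemma a0_bl: "bounded_linear a0"
 using a0_LS[of 1] LS_pos(3) by auto

lemmas lin_a0 = bounded_linear.linear[OF a0_bl]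

lemma Psi:
 "open U" "0 \<in> U" "C1_on U Psi" "Psi ` U \<subseteq> equilibria J i V A F" "Psi 0 = us" "dim (range Psi') = CARD('m)"
 using mf by (auto simp: C1_manifold_near_def)

lemma Psi_bl: "bounded_linear Psi'" and Psi_inj: "inj Psi'" and a0_Psi: "a0 (Psi' z) = 0"
proof -
 obtain f' where f': "(Psi has_derivative f') (at 0)" by (rule C1_strict_derivative[OF Psi(3,1,2)])
 show b: "bounded_linear Psi'" using has_derivative_bounded_linear[OF f'] unfolding frechet_derivative_at[OF f'] .
 show "inj Psi'" by (rule full_rank_imp_inj[OF bounded_linear.linear[OF b] Psi(6)])
 show "a0 (Psi' z) = 0" using tangent by (auto simp: null_space_def)
qed

lemmas lin_Psi = bounded_linear.linear[OF Psi_bl]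

text \<open>\<open>Q\<close> is the projection onto the kernel, read in coordinates of the tangent
  space. Its boundedness comes from the open mapping theorem for the map \<open>T\<close>: the
  component \<open>z\<close> of a preimage is unique although \<open>v\<close> is not, and no closed
  range is presupposed.\<close>

lemma spectral_projection:
 obtains Q where "bounded_linear Q" "!!z. Q (J (Psi' z)) = z" "!!v. Q (a0 v) = 0" "!!x. EX v. x = J (Psi' (Q x)) + a0 v"
proof -
 define T where "T = (%(z, v). J (Psi' z) + a0 v)"
 have T: "bounded_linear T" unfolding T_def case_prod_unfold
  by (intro bounded_linear_add bounded_linear_compose[OF J] bounded_linear_compose[OF Psi_bl] bounded_linear_compose[OF a0_bl] bounded_linear_fst bounded_linear_snd)
 have z: "J ` null_space a0 \<inter> range a0 = {0}" "{x + y | x y. x \<in> J ` null_space a0 & y \<in> range a0} = UNIV"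
  using semi by (auto simp: zero_semisimple_eigenvalue_def)
 have "EX w. T w = y" for y
 proof -
  obtain x v where "y = J x + a0 v" "x \<in> null_space a0" using z(2) by blast
  moreover obtain z where "x = Psi' z" using tangent \<open>x \<in> null_space a0\<close> by blast
  ultimately show ?thesis by (intro exI[of _ "(z, v)"]) (simp add: T_def)
 qed
 then have "surj T" by (metis surjI)
 then obtain K where "ALL y. EX w. T w = y & norm w <= K * norm y" using open_mapping_bound[OF T] by blast
 then obtain g where g: "!!y. T (g y) = y" "!!y. norm (g y) <= K * norm y" by metis
 define Q where "Q y = fst (g y)" for y
 have uniq: "z = z'" if "J (Psi' z) + a0 v = J (Psi' z') + a0 v'" for z z' v v'
 proof -
  have "J (Psi' (z - z')) = a0 (v' - v)" using that by (simp add: linear_diff[OF linear_J] linear_diff[OF lin_Psi] linear_diff[OF lin_a0] algebra_simps)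
  moreover have "Psi' (z - z') \<in> null_space a0" by (simp add: null_space_def a0_Psi)
  ultimately have "J (Psi' (z - z')) \<in> J ` null_space a0 \<inter> range a0" by (metis IntI imageI rangeI)
  then have "J (Psi' (z - z')) = J (Psi' 0)" unfolding z(1) by (simp add: linear_0[OF linear_J] linear_0[OF lin_Psi])
  then have "z - z' = 0" using inj_J Psi_inj by (simp add: inj_eq)
  then show ?thesis by simp
 qed
 have dec: "y = J (Psi' (Q y)) + a0 (snd (g y))" for y using g(1)[of y] by (simp add: T_def Q_def case_prod_unfold)
 have eqI: "Q y = z" if "y = J (Psi' z) + a0 v" for y z v
  by (rule uniq[of _ "snd (g y)" _ v]) (metis dec that)
 have "bounded_linear Q"
 proof (rule bounded_linear_intro)
  show "Q (x + y) = Q x + Q y" for x y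
   by (rule eqI[of _ _ "snd (g x) + snd (g y)"], subst dec[of x], subst dec[of y])
    (simp add: linear_add[OF linear_J] linear_add[OF lin_Psi] linear_add[OF lin_a0])
  show "Q (c *\<^sub>R x) = c *\<^sub>R Q x" for c x
   by (rule eqI[of _ _ "c *\<^sub>R snd (g x)"], subst dec[of x])
    (simp add: linear_scale[OF linear_J] linear_scale[OF lin_Psi] linear_scale[OF lin_a0] scaleR_add_right)
  show "norm (Q x) <= norm x * K" for x
   using g(2)[of x] norm_fst_le[of "fst (g x)" "snd (g x)"] by (simp add: Q_def mult.commute)
 qed
 moreover have "Q (J (Psi' z)) = z" for z by (rule eqI[of _ _ 0]) (simp add: linear_0[OF lin_a0])
 moreover have "Q (a0 v) = 0" for v by (rule eqI[of _ _ v]) (simp add: linear_0[OF lin_Psi] linear_0[OF linear_J])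
 ultimately show ?thesis using that dec by blast
qed

text \<open>On the kernel the operator is shifted by 1, which makes the whole closed right half plane resolvent set of the negative operator.\<close>

lemma shifted_bij:
 fixes Q
 assumes Q: "bounded_linear Q" "!!z. Q (J (Psi' z)) = z" "!!v. Q (a0 v) = 0" "!!x. EX v. x = J (Psi' (Q x)) + a0 v"
  and l: "0 <= Re l"
 defines "B \<equiv> %x. a0 x + J (Psi' (Q (J x)))"
 shows "bij (%z. cs l (map_prod J J z) + map_prod B B z)"
proof -
 note lQ = bounded_linear.linear[OF Q(1)]
 define P where "P = (%z. J (Psi' z))"
 have lP: "linear P" unfolding P_def using linear_compose[OF lin_Psi linear_J] by (simp add: o_def)
 define L0 where "L0 z = cs l (map_prod J J z) + map_prod a0 a0 z" for z
 define X where "X z = map_prod Q Q (map_prod J J z)" for z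
 have L: "cs l (map_prod J J z) + map_prod B B z = L0 z + map_prod P P (X z)" for z
  by (simp add: L0_def X_def B_def P_def map_prod_def case_prod_unfold)
 have madd: "linear f ==> map_prod f f (a + b) = map_prod f f a + map_prod f f b"
  and mdiff: "linear f ==> map_prod f f (a - b) = map_prod f f a - map_prod f f b" for f :: "'x::real_vector => 'y::real_vector" and a b
  by (simp_all add: map_prod_def case_prod_unfold linear_add linear_diff)
 have QP: "map_prod Q Q (map_prod P P z) = z" and Qa: "map_prod Q Q (map_prod a0 a0 x) = 0" for z x
  by (simp_all add: P_def map_prod_def case_prod_unfold Q zero_prod_def)
 \<comment> \<open>Applying \<open>Q\<close> reduces the full equation to (l + 1) X = Q f, so the
   kernel component is determined first; the spectral assumption handles the remaining equation for
   \<open>L0\<close> when l is not 0.\<close>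
 have QL0: "map_prod Q Q (L0 z) = cs l (X z)" for z
  by (simp add: L0_def madd[OF lQ] Qa map_prod_cs[OF lQ] X_def)
 have l1: "l + 1 ~= 0" using l by (auto simp: complex_eq_iff)
 have inj0: "z = 0" if "L0 z = 0" "X z = 0" for z
 proof (cases "l = 0")
  case True
  have "a0 (fst z) = 0" "a0 (snd z) = 0" "Q (J (fst z)) = 0" "Q (J (snd z)) = 0"
   using that True by (auto simp: L0_def X_def map_prod_def case_prod_unfold prod_eq_iff)
  moreover have "x = 0" if x: "a0 x = 0" "Q (J x) = 0" for x
  proof -
   obtain y where "x = Psi' y" using tangent x(1) by (auto simp: null_space_def)
   then show ?thesis using x(2) Q(2)[of y] by (simp add: linear_0[OF lin_Psi])
  qed
  ultimately show ?thesis by (simp add: prod_eq_iff)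
 next
  case False
  then have "- l \<notin> op_spectrum J a0" using spec l by auto
  then have "bij (complexified_shift J a0 (- l))" by (simp add: op_spectrum_def)
  moreover have "complexified_shift J a0 (- l) x = - L0 x" for x
   by (simp add: complexified_shift_def L0_def cs_def map_prod_def case_prod_unfold prod_eq_iff)
  moreover have "L0 0 = 0" by (simp add: L0_def map_prod_def linear_0[OF linear_J] linear_0[OF lin_a0] zero_prod_def) (simp add: cs_def zero_prod_def)?
  ultimately show ?thesis using that(1) by (metis bij_pointE neg_equal_0_iff_equal)
 qed
 have lin: "linear (%z. L0 z + map_prod P P (X z))"
  unfolding L[symmetric] B_def
  by (intro bounded_linear.linear[where f = "%z. cs l (map_prod J J z) + map_prod _ _ z"] bounded_linear_add bounded_linear_compose[OF cs_bl] bounded_linear_map_prod J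
    a0_bl bounded_linear_compose[OF J bounded_linear_compose[OF Psi_bl bounded_linear_compose[OF Q(1) J]]])
 have "inj (%z. L0 z + map_prod P P (X z))"
  unfolding linear_injective_0[OF lin]
 proof (intro allI impI)
  fix z assume z: "L0 z + map_prod P P (X z) = 0"
  have "map_prod Q Q (L0 z + map_prod P P (X z)) = cs (l + 1) (X z)" by (simp add: madd[OF lQ] QL0 QP cs_add)
  then have "cs (l + 1) (X z) = 0" using z by (simp add: map_prod_def linear_0[OF lQ] zero_prod_def)
  then have "cs (1 / (l + 1)) (cs (l + 1) (X z)) = 0" by simp
  then have "X z = 0" using l1 by (simp add: cs_cs)
  moreover from this have "L0 z = 0" using z by (simp add: map_prod_def linear_0[OF lP] zero_prod_def)
  ultimately show "z = 0" using inj0 by blast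
 qed
 moreover have "EX z. L0 z + map_prod P P (X z) = f" for f
 proof (cases "l = 0")
  case True
  \<comment> \<open>For l = 0 the part of \<open>f\<close> in the range is hit by \<open>a0\<close>,
    and adding kernel elements adjusts the component \<open>X\<close> without changing the image
    under \<open>L0\<close>.\<close>
  obtain v1 v2 where v: "fst f = P (Q (fst f)) + a0 v1" "snd f = P (Q (snd f)) + a0 v2" using Q(4) unfolding P_def by blast
  have "L0 (v1 + Psi' (Q (fst f) - Q (J v1)), v2 + Psi' (Q (snd f) - Q (J v2))) = (a0 v1, a0 v2)"
   using True by (simp add: L0_def linear_add[OF lin_a0] a0_Psi)
  moreover have "X (v1 + Psi' (Q (fst f) - Q (J v1)), v2 + Psi' (Q (snd f) - Q (J v2))) = (Q (fst f), Q (snd f))"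
   by (simp add: X_def linear_add[OF linear_J] linear_add[OF lQ] Q(2))
  ultimately show ?thesis using v by (intro exI[of _ "(v1 + Psi' (Q (fst f) - Q (J v1)), v2 + Psi' (Q (snd f) - Q (J v2)))"]) (simp add: prod_eq_iff add.commute)
 next
  case False
  then have "- l \<notin> op_spectrum J a0" using spec l by auto
  then have "bij (complexified_shift J a0 (- l))" by (simp add: op_spectrum_def)
  moreover have "complexified_shift J a0 (- l) x = - L0 x" for x
   by (simp add: complexified_shift_def L0_def cs_def map_prod_def case_prod_unfold prod_eq_iff)
  ultimately have surj: "EX z. L0 z = y" for y by (metis bij_pointE minus_equation_iff)
  define s where "s = cs (1 / (l + 1)) (map_prod Q Q f)"
  obtain z where z: "L0 z = f - map_prod P P s" using surj by blast
  have f: "map_prod Q Q f = cs (l + 1) s" unfolding s_def using l1 by (simp add: cs_cs)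
  have "cs l (X z) = cs l s" unfolding QL0[symmetric] z mdiff[OF lQ] QP f by (simp add: cs_add)
  then have "cs (1 / l) (cs l (X z)) = cs (1 / l) (cs l s)" by simp
  then have "X z = s" using False by (simp add: cs_cs)
  then show ?thesis using z by (intro exI[of _ z]) simp
 qed
 then have "surj (%z. L0 z + map_prod P P (X z))" unfolding surj_def by metis
 ultimately show ?thesis unfolding L by (simp add: bij_def)
qed

text \<open>Since \<open>Q\<close> annihilates the range of \<open>a0\<close>, the kernel component
  of a solution stays 0. There \<open>a0\<close> and the shifted operator act alike, and
  \<open>decay\<close> applies to the latter.\<close>

lemma linear_decay:
 assumes Q: "bounded_linear Q" "!!z. Q (J (Psi' z)) = z" "!!v. Q (a0 v) = 0" "!!x. EX v. x = J (Psi' (Q x)) + a0 v" and e: "0 < e"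
 shows "\<exists>T>0. ALL v w y. sol a0 T v w (%_. 0) --> v 0 = i y --> Q (i y) = 0 --> norm (tr v T) <= e * norm y"
proof -
 define B where "B = (%x. a0 x + J (Psi' (Q (J x))))"
 have C: "bounded_linear (%c. J (Psi' (Q (i c))))"
  by (intro bounded_linear_compose[OF J] bounded_linear_compose[OF Psi_bl] bounded_linear_compose[OF Q(1)] bounded_linear_i)
 obtain M0 where "LS a0 1 M0" using a0_LS[of 1] by auto
 then obtain M where M: "LS B 1 M" using LS_perturb[OF _ C, of a0 1 M0 1] unfolding incl_J B_def by auto
 interpret r: resolvent_setting p J i B M
  by (intro resolvent_setting.intro resolvent_setting_axioms.intro interpolation_setting_axioms M)
   (unfold B_def, rule shifted_bij[OF Q])
 obtain K where K: "0 < K" "!!T v w y. 0 < T ==> sol B (T + 3) v w (%_. 0) ==> v 0 = i y ==> norm (tr v (T + 3)) <= K / T * norm y"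
  using r.decay by blast
 define T where "T = K / e"
 have T: "0 < T" "K / T = e" using K(1) e by (auto simp: T_def)
 have "norm (tr v (T + 3)) <= e * norm y" if s: "sol a0 (T + 3) v w (%_. 0)" and y: "v 0 = i y" "Q (i y) = 0" for v w y
 proof -
  note ev = sol_evo[OF s, unfolded diff_0]
  have z: "Q (v t) = 0" if t: "t \<in> {0..T + 3}" for t
  proof -
   have I: "(%t. - a0 (w t)) integrable_on {0..t}" by (rule evo_integrable(1)[OF ev order_refl]) (use t in auto)
   have "Q (v t) = Q (v 0) + Q (integral {0..t} (%t. - a0 (w t)))"
    unfolding evoD(3)[OF ev t] linear_add[OF bounded_linear.linear[OF Q(1)]] by (rule refl)
   also have "Q (integral {0..t} (%t. - a0 (w t))) = integral {0..t} (%t. Q (- a0 (w t)))"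
    using integral_linear[OF I Q(1)] by (simp add: o_def)
   finally show ?thesis using y by (simp add: linear_neg[OF bounded_linear.linear[OF Q(1)]] Q(3))
  qed
  have "evo (T + 3) v w (%t. 0 - B (w t))"
  proof (rule evo_cong[OF ev])
   show "AE t in lebesgue. 0 < t & t < T + 3 --> 0 - B (w t) = - a0 (w t)"
    using evoD(4)[OF ev]
   proof eventually_elim
    case (elim t)
    then show ?case using z[of t] by (auto simp: B_def linear_0[OF linear_J] linear_0[OF lin_Psi])
   qed
  qed auto
  then have "sol B (T + 3) v w (%_. 0)" by (simp add: sol_def)
  from K(2)[OF T(1) this y(1)] show ?thesis unfolding T(2) .
 qed
 then show ?thesis using T(1) by (intro exI[of _ "T + 3"]) auto
qed

end

section \<open>The nonlinear problem near the equilibrium\<close>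

context normally_stable
begin

text \<open>The remainder after linearization, with the same perturbation seen in X_gamma as
  \<open>c\<close> and in X_1 as \<open>w\<close>. It is affine in \<open>w\<close>, with a
  coefficient of \<open>w\<close> that is small with \<open>c\<close>; all other terms depend on
  \<open>c\<close> only.\<close>

definition G :: "'c => 'b => 'a" where
 "G c w = F (uc + c) - F uc - DF c - (A (uc + c) - A uc - DA c) us - (A (uc + c) - A uc) w"

lemma us_eq: "uc \<in> V" "A uc us = F uc"
 using us by (auto simp: equilibria_def)

lemma G_eq: "G (incl J i w) w - a0 w = F (uc + incl J i w) - A (uc + incl J i w) (us + w)"
 by (simp add: G_def a0_eq us_eq blinfun.diff_left blinfun.add_right)

lemma continuous_AF: "continuous_on V A" "continuous_on V F"
proof -
 obtain D :: "'c => 'c \<Rightarrow>\<^sub>L (('b \<Rightarrow>\<^sub>L 'a) \<times> 'a)" where "!!x. x \<in> V ==> ((%v. (A v, F v)) has_derivative blinfun_apply (D x)) (at x)"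
  using C1 unfolding C1_on_def by blast
 then have "continuous_on V (%v. (A v, F v))" by (rule has_derivative_continuous_on[OF has_derivative_at_withinI])
 from continuous_on_fst[OF this] continuous_on_snd[OF this] show "continuous_on V A" "continuous_on V F" by simp_all
qed

text \<open>The Lipschitz constant \<open>L\<close> of \<open>A\<close> is fixed before
  \<open>e\<close>, so that \<open>L * rho\<close> can be made small later. The other terms are
  remainders of strict differentiability of \<open>A\<close> and \<open>F\<close>, or carry the
  factor \<open>A (uc + c) - A uc\<close>.\<close>

lemma G_nonlinearity:
 "\<exists>L>0. \<forall>e>0. \<exists>r>0. (ALL c. norm c <= r --> uc + c \<in> V) & (ALL s. 0 < s --> s <= r --> nonlinearity G s e L e)"
proof -
 obtain K where K: "0 < K" "!!c. norm (DA c) <= norm c * K" using bounded_linear.pos_bounded[OF derivatives(1)] by blast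
 define L where "L = K + 1"
 have L: "0 < L" using K by (simp add: L_def)
 have "\<exists>r>0. (ALL c. norm c <= r --> uc + c \<in> V) & (ALL s. 0 < s --> s <= r --> nonlinearity G s e L e)" if e: "0 < e" for e
 proof -
  \<comment> \<open>The remainder of \<open>F\<close> counts once and that of \<open>A\<close> with
    the factor \<open>norm us\<close>; together they stay below \<open>e\<close>. The bound 1 enters
    the constant \<open>L = K + 1\<close>.\<close>
  define e1 where "e1 = min 1 (e / (norm us + 1))"
  have e1: "0 < e1" "e1 <= 1" using e by (auto simp: e1_def add_nonneg_pos)
  have "e1 <= e / (norm us + 1)" by (simp add: e1_def)
  then have e2: "e1 * norm us + e1 <= e" using pos_le_divide_eq[of "norm us + 1" e1 e] by (simp add: add_nonneg_pos distrib_left)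
  obtain r0 where r0: "0 < r0" "!!c d. norm c <= r0 ==> norm d <= r0 ==> uc + c \<in> V &
    norm (A (uc + c) - A (uc + d) - DA (c - d)) <= e1 * norm (c - d) & norm (F (uc + c) - F (uc + d) - DF (c - d)) <= e1 * norm (c - d)"
   using derivatives(3)[OF e1(1)] by meson
  define r where "r = min r0 (e / L)"
  have r: "0 < r" "r <= r0" "L * r <= e" using r0(1) e L by (auto simp: r_def min_def field_simps)
  have DA: "norm (A (uc + c) - A (uc + d)) <= L * norm (c - d)" if "norm c <= r" "norm d <= r" for c d
  proof -
   have "norm (A (uc + c) - A (uc + d)) <= norm (A (uc + c) - A (uc + d) - DA (c - d)) + norm (DA (c - d))"
    using norm_triangle_ineq[of "A (uc + c) - A (uc + d) - DA (c - d)" "DA (c - d)"] by simp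
   also have "... <= 1 * norm (c - d) + norm (c - d) * K"
    using r0(2)[of c d] that r(2) K(2)[of "c - d"] mult_right_mono[OF e1(2) norm_ge_zero[of "c - d"]] by force
   finally show ?thesis by (simp add: L_def algebra_simps)
  qed
  have lip: "norm (G c w1 - G d w2) <= e * norm (w1 - w2) + norm (c - d) * (L * norm w2 + e)" if cd: "norm c <= r" "norm d <= r" for c d w1 w2
  proof -
   note s = r0(2)[of c d] and DAl = linear_diff[OF bounded_linear.linear[OF derivatives(1)]] and DFl = linear_diff[OF bounded_linear.linear[OF derivatives(2)]]
   have n4: "norm (a - b - c - d) <= norm a + norm b + norm c + norm d" for a b c d :: 'a
    using norm_triangle_ineq4[of "a - b - c" d] norm_triangle_ineq4[of "a - b" c] norm_triangle_ineq4[of a b] by linarith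
   have "G c w1 - G d w2 = (F (uc + c) - F (uc + d) - DF (c - d)) - (A (uc + c) - A (uc + d) - DA (c - d)) us
     - (A (uc + c) - A (uc + d)) w2 - (A (uc + c) - A uc) (w1 - w2)"
    by (simp add: G_def DAl DFl blinfun.diff_left blinfun.diff_right)
   then have "norm (G c w1 - G d w2) <= norm (F (uc + c) - F (uc + d) - DF (c - d)) + norm ((A (uc + c) - A (uc + d) - DA (c - d)) us)
     + norm ((A (uc + c) - A (uc + d)) w2) + norm ((A (uc + c) - A uc) (w1 - w2))"
    by (simp only: n4)
   also have "... <= e1 * norm (c - d) + e1 * norm (c - d) * norm us + L * norm (c - d) * norm w2 + e * norm (w1 - w2)"
   proof (intro add_mono order_trans[OF norm_blinfun] mult_right_mono)
    have "norm (A (uc + c) - A (uc + 0)) <= L * norm (c - 0)" by (rule DA) (use cd r in auto)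
    also have "... <= L * r" using cd L by (intro mult_left_mono) auto
    finally show "norm (A (uc + c) - A uc) <= e" using r(3) by simp
   qed (use s cd r(2) DA in auto)
   also have "... = (e1 * norm us + e1) * norm (c - d) + L * norm (c - d) * norm w2 + e * norm (w1 - w2)" by (simp add: algebra_simps)
   also have "... <= e * norm (c - d) + L * norm (c - d) * norm w2 + e * norm (w1 - w2)" using e2 by (intro add_right_mono mult_right_mono) auto
   finally show ?thesis by (simp add: algebra_simps)
  qed
  have inV: "uc + c \<in> V" if "norm c <= r" for c using r0(2)[of c c] that r(2) by auto
  have "nonlinearity G s e L e" if s: "0 < s" "s <= r" for s
   unfolding nonlinearity_def
  proof (intro conjI allI impI)
   fix a and c :: "real => 'c" and w :: "real => 'b" assume c: "continuous_on {0..a} c" "\<forall>t\<in>{0..a}. norm (c t) <= s" and w: "SM (cut 0 a w)"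
   have V': "(%t. uc + c t) ` {0<..<a} \<subseteq> V"
   proof (rule image_subsetI)
    fix t assume "t \<in> {0<..<a}"
    then have "norm (c t) <= s" using c(2) by simp
    then show "uc + c t \<in> V" using inV s by simp
   qed
   have c': "continuous_on {0<..<a} (%t. uc + c t)" "continuous_on {0<..<a} c" by (intro continuous_intros continuous_on_subset[OF c(1)]; auto)+
   have A': "continuous_on {0<..<a} (%t. A (uc + c t))" "continuous_on {0<..<a} (%t. F (uc + c t))"
    by (rule continuous_on_compose2[OF _ c'(1) V'], rule continuous_AF)+
   have 1: "SM (cut 0 a (%t. F (uc + c t) - F uc - DF (c t) - (A (uc + c t) - A uc - DA (c t)) us))"
    by (intro SM_continuous continuous_intros A' bounded_linear.continuous_on[OF derivatives(1)] bounded_linear.continuous_on[OF derivatives(2)] c'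
      blinfun.continuous_on)
   have 2: "SM (cut 0 a (%t. A (uc + c t) - A uc))" by (intro SM_continuous continuous_intros A')
   have "SM (%t. cut 0 a (%t. F (uc + c t) - F uc - DF (c t) - (A (uc + c t) - A uc - DA (c t)) us) t
     - blinfun_apply (cut 0 a (%t. A (uc + c t) - A uc) t) (cut 0 a w t))"
    by (rule SM_diff[OF 1 SM_bilinear[OF bounded_bilinear_blinfun_apply 2 w]])
   moreover have "(%t. cut 0 a (%t. F (uc + c t) - F uc - DF (c t) - (A (uc + c t) - A uc - DA (c t)) us) t
     - blinfun_apply (cut 0 a (%t. A (uc + c t) - A uc) t) (cut 0 a w t)) = cut 0 a (%t. G (c t) (w t))"
    by (auto simp: cut_def G_def)
   ultimately show "SM (cut 0 a (%t. G (c t) (w t)))" by simp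
  next
   show "G 0 0 = 0" by (simp add: G_def linear_0[OF bounded_linear.linear[OF derivatives(1)]] linear_0[OF bounded_linear.linear[OF derivatives(2)]])
  qed (use s e L in \<open>auto intro!: lip\<close>)
  then show ?thesis using r(1) inV by blast
 qed
 then show ?thesis using L by blast
qed

text \<open>With u = uc + v the problem becomes v' + A_0 v = G(v): \<open>tr v t\<close> and
  \<open>incl J i (w t)\<close> agree almost everywhere, and there \<open>G_eq\<close>
  applies.\<close>

lemma solution_iff:
 assumes T: "0 < T"
 shows "solution_on p J i V A F T u0 u \<longleftrightarrow> u 0 = u0 & u ` {0..T} \<subseteq> V &
  (EX v w. sol a0 T v w (%t. G (tr v t) (w t)) & (\<forall>t\<in>{0..T}. u t = uc + tr v t))" (is "?L \<longleftrightarrow> ?R")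
proof
 assume ?L
 then obtain w u' where u: "continuous_on {0..T} u" "u ` {0..T} \<subseteq> V" "u 0 = u0" and w: "Lp p T w" "AE t in lebesgue_on {0<..<T}. i (u t) = J (w t)"
  and u': "H1p_derivative p T (%t. i (u t)) u'" and eq: "AE t in lebesgue_on {0<..<T}. u' t + A (u t) (w t) = F (u t)"
  unfolding solution_on_def by blast
 define v where "v t = i (u t - uc)" for t
 define w1 where "w1 t = w t - us" for t
 have tr: "tr v t = u t - uc" for t by (rule tr_eqI) (simp add: v_def)
 have P: "PL0 p T w1" "PL0 p T u'"
  using PL_diff(1)[OF p1 w(1)[unfolded Lp_PL] PL_cut_const(1)[OF p0 less_imp_le[OF T], of us]] u'
  by (auto simp: w1_def[abs_def] cut_diff H1p_derivative_def Lp_PL)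
 have ci: "continuous_on {0..T} (%t. i (u t))" by (rule bounded_linear.continuous_on[OF bounded_linear_i u(1)])
 have "\<forall>t\<in>{0..T}. i (u t) = i (u 0) + integral {0..t} u'"
  by (rule weak_derivative_iff[OF p1 T P(2) ci, THEN iffD1]) (use u' in \<open>auto simp: H1p_derivative_def\<close>)
 then have ii: "i (u t) = i (u 0) + integral {0..t} u'" if "t \<in> {0..T}" for t using that by blast
 have vi: "\<forall>t\<in>{0..T}. v t = v 0 + integral {0..t} u'"
 proof
  fix t assume t: "t \<in> {0..T}"
  show "v t = v 0 + integral {0..t} u'" unfolding v_def linear_diff[OF linear_i] ii[OF t] by simp
 qed
 have ae: "AE t in lebesgue. 0 < t & t < T --> v t = J (w1 t)"
  using w(2) unfolding AE_lebesgue_on_iff by eventually_elim (auto simp: v_def w1_def linear_diff[OF linear_i] linear_diff[OF linear_J] incl_J)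
 have e: "evo T v w1 u'" unfolding evo_def by (intro conjI P vi ae)
 have "sol a0 T v w1 (%t. G (tr v t) (w1 t))"
 proof (rule sol_cong[OF sol_of_evo[OF a0_bl e] refl])
  show "AE t in lebesgue. 0 < t & t < T --> G (tr v t) (w1 t) = u' t + a0 (w1 t)"
   using eq evo_tr(3)[OF T e] unfolding AE_lebesgue_on_iff
  proof eventually_elim
   case (elim t)
   show ?case
   proof
    assume t: "0 < t & t < T"
    have tri: "tr v t = incl J i (w1 t)" using elim(2) t by blast
    have "u t = uc + tr v t" unfolding tr by simp
    note tri = tri this[unfolded tri]
    have "u' t = G (tr v t) (w1 t) - a0 (w1 t)" using elim(1) t unfolding tri G_eq by (simp add: w1_def algebra_simps)
    then show "G (tr v t) (w1 t) = u' t + a0 (w1 t)" by simp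
   qed
  qed
 qed auto
 then show ?R using u tr by (intro conjI exI[of _ v] exI[of _ w1]) auto
next
 assume ?R
 then obtain v w where u: "u 0 = u0" "u ` {0..T} \<subseteq> V" and s: "sol a0 T v w (%t. G (tr v t) (w t))" and ut: "!!t. t \<in> {0..T} ==> u t = uc + tr v t" by blast
 note e = sol_evo[OF s]
 note t = evo_tr[OF T e]
 define u' where "u' t = G (tr v t) (w t) - a0 (w t)" for t
 have iu: "i (u t) = J us + v t" if "t \<in> {0..T}" for t
  using ut[OF that] t(1)[OF that] by (simp add: linear_add[OF linear_i] incl_J)
 have cu: "continuous_on {0..T} u"
  by (rule continuous_on_cong[THEN iffD2, OF refl ut continuous_on_add[OF continuous_on_const t(2), of uc]])
 have ci: "continuous_on {0..T} (%t. i (u t))" by (rule bounded_linear.continuous_on[OF bounded_linear_i cu])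
 have iv: "\<forall>t\<in>{0..T}. i (u t) = i (u 0) + integral {0..t} u'"
 proof
  fix t assume t: "t \<in> {0..T}"
  have "v t = v 0 + integral {0..t} u'" using evoD(3)[OF e t] unfolding u'_def .
  moreover have "i (u 0) = J us + v 0" by (rule iu) (use T in simp)
  ultimately show "i (u t) = i (u 0) + integral {0..t} u'" unfolding iu[OF t] by (simp only: add.assoc)
 qed
 have "weak_derivative T (%t. i (u t)) u'"
  by (rule weak_derivative_iff[OF p1 T evoD(2)[OF e, folded u'_def] ci _, THEN iffD2, OF _ iv]) simp
 then have H: "H1p_derivative p T (%t. i (u t)) u'"
  using evoD(2)[OF e] PL_cut_continuous[OF p0 less_imp_le[OF T] ci] unfolding H1p_derivative_def Lp_PL u'_def by simp
 have "Lp p T (%t. us + w t)" unfolding Lp_PL cut_add by (intro PL_add(1)[OF p1] PL_cut_const(1)[OF p0] evoD(1)[OF e]) (use T in simp)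
 moreover have "AE t in lebesgue. 0 < t & t < T --> i (u t) = J (us + w t)"
  using evoD(4)[OF e] by eventually_elim (auto simp: iu linear_add[OF linear_J])
 moreover have "AE t in lebesgue. 0 < t & t < T --> u' t + A (u t) (us + w t) = F (u t)"
  using t(3)
 proof eventually_elim
  case (elim t)
  then show ?case using G_eq[of "w t"] ut[of t] by (auto simp: u'_def)
 qed
 ultimately show ?L unfolding solution_on_def AE_lebesgue_on_iff using cu u H by blast
qed

lemma equilibrium_iff: "us + x \<in> equilibria J i V A F \<longleftrightarrow> uc + incl J i x \<in> V & A (uc + incl J i x) (us + x) = F (uc + incl J i x)"
 by (simp add: equilibria_def linear_add[OF lin_ic])

lemma equilibrium_sol:
 assumes x: "us + x \<in> equilibria J i V A F" and T: "0 <= T"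
 shows "sol a0 T (%_. J x) (%_. x) (%_. G (incl J i x) x)"
proof -
 have "evo T (%_. J x) (%_. x) (%_. J 0)" by (rule evo_C1[OF _ _ T]) auto
 moreover have "G (incl J i x) x - a0 x = 0" using x unfolding equilibrium_iff G_eq by simp
 ultimately show ?thesis using PL_cut_const(1)[OF p0 T] unfolding sol_def by (simp add: linear_0[OF linear_J])
qed

text \<open>In the chart \<open>Psi\<close> the map \<open>h\<close> reading the kernel coordinate
  is a small Lipschitz perturbation of the identity, invertible near 0 by Banach's theorem. The
  Lipschitz bound of \<open>X\<close> involves only the kernel component of c - d, so the
  equilibrium moves no faster than that component.\<close>

lemma equilibrium_projection:
 assumes Q: "bounded_linear Q" "!!z. Q (J (Psi' z)) = z"
 obtains X :: "'c => 'b" and delta C where "0 < delta" "0 < C" "X 0 = 0" "!!c. norm c <= delta ==> us + X c \<in> equilibria J i V A F & Q (J (X c)) = Q (i c)"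
  "!!c d. norm c <= delta ==> norm d <= delta ==> norm (X c - X d) <= C * norm (Q (i (c - d)))"
proof -
 have QJ: "bounded_linear (%x. Q (J x))" and Qi: "bounded_linear (%x. Q (i x))"
  by (intro bounded_linear_compose[OF Q(1)] J bounded_linear_i)+
 note QJl = bounded_linear.linear[OF QJ] and Qil = bounded_linear.linear[OF Qi]
 obtain k where k: "0 < k" "!!x. norm (Q (J x)) <= norm x * k" using bounded_linear.pos_bounded[OF QJ] by blast
 obtain q where q: "0 < q" "!!x. norm (Q (i x)) <= norm x * q" using bounded_linear.pos_bounded[OF Qi] by blast
 obtain m where m: "0 < m" "!!x. norm (Psi' x) <= norm x * m" using bounded_linear.pos_bounded[OF Psi_bl] by blast
 \<comment> \<open>After \<open>Q J\<close>, of norm at most \<open>k\<close>, the remainder of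
   \<open>Psi\<close> has Lipschitz constant 1/2.\<close>
 define e where "e = 1 / (2 * k)"
 have e: "0 < e" using k by (simp add: e_def)
 obtain s where s: "0 < s" and sd: "!!z y. norm z <= s ==> norm y <= s ==> z \<in> U & norm (Psi z - Psi y - Psi' (z - y)) <= e * norm (z - y)"
 proof (rule C1_strict_derivative[OF Psi(3,1,2)])
  fix f' assume f': "(Psi has_derivative f') (at 0)" and *: "!!e. 0 < e ==> \<exists>r>0. ALL c d. norm c <= r --> norm d <= r --> 0 + c \<in> U & norm (Psi (0 + c) - Psi (0 + d) - f' (c - d)) <= e * norm (c - d)"
  show ?thesis using *[OF e] that unfolding frechet_derivative_at[OF f', symmetric] by auto
 qed
 define h where "h z = Q (J (Psi z - us))" for z
 have h: "norm (z - h z - (y - h y)) <= norm (z - y) / 2" if "norm z <= s" "norm y <= s" for z y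
 proof -
  have "Q (J (Psi z - Psi y - Psi' (z - y))) = h z - h y - (z - y)" by (simp add: h_def linear_diff[OF QJl] Q(2))
  then have "norm (h z - h y - (z - y)) <= norm (Psi z - Psi y - Psi' (z - y)) * k" using k(2) by metis
  also have "... <= e * norm (z - y) * k" using sd[OF that] k(1) by (intro mult_right_mono) auto
  also have "... = norm (z - y) / 2" using k(1) by (simp add: e_def)
  finally show ?thesis using norm_minus_commute[of "h z - h y" "z - y"] by (simp add: algebra_simps)
 qed
 have h2: "norm (z - y) <= 2 * norm (h z - h y)" if "norm z <= s" "norm y <= s" for z y
  using h[OF that] norm_triangle_ineq[of "z - h z - (y - h y)" "h z - h y"] by simp
 have h0: "h 0 = 0" by (simp add: h_def Psi(5) linear_0[OF QJl])
 have ex: "EX z. norm z <= s & h z = y" if y: "norm y <= s / 2" for y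
 proof -
  have "\<exists>!z\<in>cball 0 s. z - h z + y = z"
  proof (rule Banach_fix)
   have "norm (z - h z + y) <= s" if "norm z <= s" for z
    using h[OF that, of 0] y norm_triangle_ineq[of "z - h z" y] s that by (simp add: h0)
   then show "(%z. z - h z + y) ` cball 0 s \<subseteq> cball 0 s" by auto
   show "dist (z - h z + y) (x - h x + y) <= 1 / 2 * dist z x" if "z \<in> cball 0 s" "x \<in> cball 0 s" for z x
    using h[of z x] that by (simp add: dist_norm)
  qed (use s in \<open>auto simp: complete_eq_closed\<close>)
  then show ?thesis by auto
 qed
 define delta where "delta = s / (2 * q)"
 have delta: "0 < delta" using s q by (simp add: delta_def)
 have "norm (Q (i c)) <= s / 2" if "norm c <= delta" for c
  using q(2)[of c] mult_right_mono[OF that less_imp_le[OF q(1)]] q(1) by (simp add: delta_def)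
 then have "EX z. norm z <= s & h z = Q (i c)" if "norm c <= delta" for c using ex that by blast
 then obtain Z where Z: "!!c. norm c <= delta ==> norm (Z c) <= s & h (Z c) = Q (i c)" by metis
 define X where "X c = Psi (Z c) - us" for c
 show thesis
 proof (rule that[of delta "(e + m) * 2" X])
  show "X 0 = 0" using h2[of "Z 0" 0] Z[of 0] delta s by (simp add: X_def h0 linear_0[OF Qil] Psi(5))
  show "us + X c \<in> equilibria J i V A F & Q (J (X c)) = Q (i c)" if "norm c <= delta" for c
   using Z[OF that] sd[of "Z c" 0] s Psi(4) by (auto simp: X_def h_def)
  fix c d :: 'c assume cd: "norm c <= delta" "norm d <= delta"
  have z: "norm (Z c) <= s" "norm (Z d) <= s" using Z cd by auto
  have zz: "norm (Z c - Z d) <= 2 * norm (Q (i (c - d)))" using h2[OF z] Z cd by (simp add: linear_diff[OF Qil])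
  have "norm (X c - X d) <= norm (Psi (Z c) - Psi (Z d) - Psi' (Z c - Z d)) + norm (Psi' (Z c - Z d))"
   using norm_triangle_ineq[of "Psi (Z c) - Psi (Z d) - Psi' (Z c - Z d)" "Psi' (Z c - Z d)"] by (simp add: X_def)
  also have "... <= (e + m) * norm (Z c - Z d)" using sd[OF z] m(2)[of "Z c - Z d"] by (simp add: algebra_simps)
  also have "... <= (e + m) * (2 * norm (Q (i (c - d))))" using zz e m(1) by (intro mult_left_mono) auto
  finally show "norm (X c - X d) <= (e + m) * 2 * norm (Q (i (c - d)))" by (simp add: algebra_simps)
 qed (use delta e m in auto)
qed

text \<open>A continuation argument: the time up to which the solutions agree is pushed forward by a
  short interval on which the second stays below \<open>rho\<close> by continuity and the first has
  small L_p norm by absolute continuity. The size of the second solution is not restricted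
  beforehand.\<close>

lemma solution_unique:
 assumes L: "LS a0 T M" and N: "nonlinearity G rho e L e" and kappa: "M * (e + L * rho + e * T powr (1 / p)) <= 1 / 2" and rho: "0 < rho"
  and a: "0 < a" and s1: "sol a0 a v1 w1 (%t. G (tr v1 t) (w1 t))" and s2: "sol a0 a v2 w2 (%t. G (tr v2 t) (w2 t))"
  and 0: "v1 0 = v2 0" and b: "!!t. t \<in> {0..a} ==> norm (tr v1 t) <= rho / 2" and t: "t \<in> {0..a}"
 shows "tr v2 t = tr v1 t"
proof -
 note n = N[unfolded nonlinearity_def]
 note T = LS_pos(1)[OF L] and M = LS_pos(2)[OF L]
 note e1 = sol_evo[OF s1] and e2 = sol_evo[OF s2]
 note c1 = evo_tr(2)[OF a e1] and c2 = evo_tr(2)[OF a e2]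
 define S where "S = {s \<in> {0..a}. \<forall>t\<in>{0..s}. tr v2 t = tr v1 t}"
 have S0: "0 \<in> S" using a 0 by (auto simp: S_def tr_def)
 have Sa: "s <= a" if "s \<in> S" for s using that by (simp add: S_def)
 define m where "m = Sup S"
 have bdd: "bdd_above S" using Sa by (rule bdd_aboveI)
 have m: "0 <= m" "m <= a" unfolding m_def using cSup_upper[OF S0 bdd] cSup_least[of S a] S0 Sa by auto
 have lt: "tr v2 t = tr v1 t" if tm: "0 <= t" "t < m" for t
 proof -
  obtain s where "s \<in> S" "t < s" using tm(2) less_cSup_iff[OF _ bdd] S0 unfolding m_def by blast
  then show ?thesis using tm(1) by (auto simp: S_def)
 qed
 have eqm: "tr v2 t = tr v1 t" if "t \<in> {0..m}" for t
 proof (cases "m = 0")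
  case True then show ?thesis using that S0 by (auto simp: S_def)
 next
  case False
  have cc: "continuous_on {0..m} (%t. tr v2 t - tr v1 t)"
   by (intro continuous_on_diff continuous_on_subset[OF c1] continuous_on_subset[OF c2]) (use m in auto)
  have "tr v2 t - tr v1 t = 0"
   by (rule continuous_constant_on_closure[of "{0..<m}" "%t. tr v2 t - tr v1 t"]) (use False m that cc lt in auto)
  then show ?thesis by simp
 qed
 have "m = a"
 proof (rule ccontr)
  assume "m ~= a"
  then have ma: "m < a" using m by simp
  have nm: "norm (tr v2 m) < rho" using eqm[of m] b[of m] m rho by auto
  obtain d1 where d1: "0 < d1" "!!x. x \<in> {0..a} ==> dist x m < d1 ==> dist (tr v2 x) (tr v2 m) < rho - norm (tr v2 m)"
   using c2[unfolded continuous_on_iff, rule_format, of m "rho - norm (tr v2 m)"] m nm by auto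
  obtain d2 where d2: "0 < d2" "!!s t. 0 <= s ==> s <= t ==> t <= a ==> t - s < d2 ==> LN p (cut s t w1) < rho"
   using PL_uniform_small[OF p0 evoD(1)[OF e1] rho] by blast
  \<comment> \<open>\<open>d1\<close> stems from the continuity of \<open>tr v2\<close>,
    \<open>d2\<close> from the absolute continuity for \<open>w1\<close>; the other entries keep the
    step inside [0,a] and below the length \<open>T\<close> of the linear estimate.\<close>
  define h where "h = min (min (d1 / 2) (d2 / 2)) (min (a - m) T)"
  have h: "0 < h" "h < d1" "h < d2" "m + h <= a" "h <= T" using d1(1) d2(1) ma T by (auto simp: h_def min_def)
  have Lh: "LS a0 h M" by (rule LS_short[OF L h(1,5)])
  have "h powr (1 / p) <= T powr (1 / p)" using h p0 by (intro powr_mono2) auto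
  then have "M * (e + L * rho + e * h powr (1 / p)) <= M * (e + L * rho + e * T powr (1 / p))"
   using M n by (intro mult_left_mono add_left_mono) auto
  then have kappah: "M * (e + L * rho + e * h powr (1 / p)) <= 1 / 2" using kappa by linarith
  have tre: "tr (%t. v (m + t)) t = tr v (m + t)" for v t by (simp add: tr_def)
  have q2: "sol a0 h (%t. v2 (m + t)) (%t. w2 (m + t)) (%t. G (tr v2 (m + t)) (w2 (m + t)))"
   by (rule sol_sub[OF sol_shift[OF s2 m]]) (use h in simp)
  have q1: "sol a0 h (%t. v1 (m + t)) (%t. w1 (m + t)) (%t. G (tr v1 (m + t)) (w1 (m + t)))"
   by (rule sol_sub[OF sol_shift[OF s1 m]]) (use h in simp)
  have r2: "norm (tr (%t. v2 (m + t)) t) <= rho" if t: "t \<in> {0..h}" for t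
  proof -
   have "dist (tr v2 (m + t)) (tr v2 m) < rho - norm (tr v2 m)" by (rule d1(2)) (use t h m in \<open>auto simp: dist_real_def\<close>)
   then show ?thesis using norm_triangle_sub[of "tr v2 (m + t)" "tr v2 m"] unfolding tre dist_norm by linarith
  qed
  have r1: "norm (tr (%t. v1 (m + t)) t) <= rho" if "t \<in> {0..h}" for t using b[of "m + t"] that h m rho unfolding tre by auto
  have w: "LN0 p h (%t. w1 (m + t)) <= rho"
   using PL_cut_shift(2)[OF p0, of 0 m h w1] PL_cut_sub(1)[OF p0 evoD(1)[OF e1], of m "m + h"] d2(2)[of m "m + h"] h m by (simp add: add.commute)
  have "i (tr v2 m) = v2 m" "i (tr v1 m) = v1 m" using evo_tr(1)[OF a e2, of m] evo_tr(1)[OF a e1, of m] m by auto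
  then have z: "v2 (m + 0) - v1 (m + 0) = i 0" using eqm[of m] m by (simp add: linear_0[OF linear_i])
  note nd = nonlinear_diff[OF Lh N refl kappah q2 q1 r2 r1 w PL_cut_zero(1) _ z]
  have "LN0 p h (%t. G (tr v2 (m + t)) (w2 (m + t)) - G (tr v1 (m + t)) (w1 (m + t))) <= 0"
   using nd(1) by (simp add: tre)
  then have l0: "LN0 p h (%t. G (tr v2 (m + t)) (w2 (m + t)) - G (tr v1 (m + t)) (w1 (m + t))) = 0"
   using LN_nonneg by (rule order_antisym)
  have ext: "tr v2 (m + t) = tr v1 (m + t)" if t: "t \<in> {0..h}" for t
   using nd(3)[OF _ _ _ t] unfolding tre l0 by simp
  have "tr v2 t = tr v1 t" if "t \<in> {0..m + h}" for t
   using eqm[of t] ext[of "t - m"] that by (cases "t <= m") auto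
  then have "m + h \<in> S" using h m by (simp add: S_def)
  then have "m + h <= m" unfolding m_def by (rule cSup_upper[OF _ bdd])
  then show False using h by simp
 qed
 then show ?thesis using eqm t by simp
qed

end

lemma cut_empty [simp]: "cut a a f = (%_. 0)"
 by (auto simp: cut_def fun_eq_iff)

context normally_stable
begin

text \<open>Over a fixed long time span the distance \<open>c - X c\<close> to the manifold is halved: the linearized flow contracts the complement of
 the kernel, and both the nonlinearity and the change of the equilibrium \<open>X c\<close> are small corrections.\<close>

lemma contraction_step:
 obtains T M rho e L and X :: "'c => 'b" and delta C
 where "0 < T" "LS a0 T M" "0 < rho" "nonlinearity G rho e L e" "M * (e + L * rho + e * T powr (1 / p)) <= 1 / 2"
  "!!c. norm c <= rho ==> uc + c \<in> V" "0 < delta" "0 < C" "X 0 = 0" "!!c. norm c <= delta ==> us + X c \<in> equilibria J i V A F"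
  "!!c d. norm c <= delta ==> norm d <= delta ==> norm (incl J i (X c) - incl J i (X d)) <= C * norm (c - d)"
  "!!c. norm c <= delta ==> EX v w. sol a0 T v w (%t. G (tr v t) (w t)) & v 0 = i c &
   (\<forall>t\<in>{0..T}. norm (tr v t) <= rho / 2 & norm (tr v t - incl J i (X c)) <= C * norm (c - incl J i (X c))) &
   (norm (tr v T) <= delta --> norm (tr v T - incl J i (X (tr v T))) <= norm (c - incl J i (X c)) / 2)"
proof -
 obtain Q where Q: "bounded_linear Q" "!!z. Q (J (Psi' z)) = z" "!!v. Q (a0 v) = 0" "!!x. EX v. x = J (Psi' (Q x)) + a0 v"
  using spectral_projection by blast
 obtain X :: "'c => 'b" and delta1 C0 where X: "0 < delta1" "0 < C0" "X 0 = 0" "!!c. norm c <= delta1 ==> us + X c \<in> equilibria J i V A F & Q (J (X c)) = Q (i c)"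
  "!!c d. norm c <= delta1 ==> norm d <= delta1 ==> norm (X c - X d) <= C0 * norm (Q (i (c - d)))"
  by (rule equilibrium_projection[OF Q(1,2)]) (rule that)
 obtain k where k: "0 < k" "!!x. norm (incl J i x) <= norm x * k" using bounded_linear.pos_bounded[OF incl_bounded] by blast
 have Qi: "bounded_linear (%x. Q (i x))" by (intro bounded_linear_compose[OF Q(1)] bounded_linear_i)
 obtain q where q: "0 < q" "!!x. norm (Q (i x)) <= norm x * q" using bounded_linear.pos_bounded[OF Qi] by blast
 define C1 where "C1 = C0 * q"
 have C1: "0 < C1" using X(2) q(1) by (simp add: C1_def)
 have QC: "C0 * norm (Q (i x)) <= C1 * norm x" for x
  using mult_left_mono[OF q(2)[of x] less_imp_le[OF X(2)]] by (simp add: C1_def mult.commute mult.left_commute)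
 have X5: "norm (X c - X d) <= C1 * norm (c - d)" if "norm c <= delta1" "norm d <= delta1" for c d
  using X(5)[OF that] QC[of "c - d"] by linarith
 define D where "D = 1 + k * C1"
 have D: "1 < D" using k C1 by (simp add: D_def)
 \<comment> \<open>The end state will be within \<open>2 * e0 * norm d\<close> of the old
   equilibrium, and passing to the new one costs a factor \<open>D\<close>; the product is
   \<open>norm d / 2\<close>.\<close>
 define e0 where "e0 = 1 / (4 * D)"
 have e0: "0 < e0" using D by (simp add: e0_def)
 obtain T where T: "0 < T" "!!v w y. sol a0 T v w (%_. 0) ==> v 0 = i y ==> Q (i y) = 0 ==> norm (tr v T) <= e0 * norm y"
  using linear_decay[OF Q e0] by blast
 obtain M where L0: "LS a0 T M" using a0_LS[OF T(1)] by blast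
 note M = LS_pos(2)[OF L0]
 obtain L where L: "0 < L" "!!e. 0 < e ==> \<exists>r>0. (ALL c. norm c <= r --> uc + c \<in> V) & (ALL s. 0 < s --> s <= r --> nonlinearity G s e L e)"
  using G_nonlinearity by blast
 \<comment> \<open>The bound 1/2 serves the contraction; the other makes the nonlinear correction at
   time \<open>T\<close> no larger than the linear contribution. The choices of \<open>e\<close> and
   \<open>rho\<close> each use half of \<open>kappa0\<close> and come after \<open>T\<close> and
   \<open>M\<close>.\<close>
 define kappa0 where "kappa0 = min (1 / 2) (e0 / (2 * M))"
 have kappa0: "0 < kappa0" "kappa0 <= 1 / 2" "M * (2 * kappa0) <= e0" using e0 M by (auto simp: kappa0_def min_def field_simps)
 define tau where "tau = T powr (1 / p)"
 have tau: "0 < tau" using T(1) by (simp add: tau_def)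
 define e where "e = kappa0 / (2 * M * (1 + tau))"
 have e: "0 < e" using kappa0 M tau by (simp add: e_def)
 obtain r where r: "0 < r" "!!c. norm c <= r ==> uc + c \<in> V" "!!s. 0 < s ==> s <= r ==> nonlinearity G s e L e" using L(2)[OF e] by blast
 define rho where "rho = min r (kappa0 / (2 * M * L))"
 have rho: "0 < rho" "rho <= r" "rho <= kappa0 / (2 * M * L)" using r kappa0 M L by (auto simp: rho_def)
 have N: "nonlinearity G rho e L e" by (rule r(3)[OF rho(1,2)])
 define kappa where "kappa = M * (e + L * rho + e * T powr (1 / p))"
 have "M * (L * rho) <= M * (L * (kappa0 / (2 * M * L)))" using rho(3) M L(1) by (intro mult_left_mono) auto
 moreover have "M * (L * (kappa0 / (2 * M * L))) = kappa0 / 2" using M L(1) by simp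
 moreover have "M * (e * (1 + tau)) = kappa0 / 2" using M tau by (simp add: e_def)
 ultimately have kappa: "kappa <= kappa0" by (simp add: kappa_def tau_def algebra_simps)
 have "M * (2 * kappa) <= M * (2 * kappa0)" using kappa M by (intro mult_left_mono) auto
 then have kappa2: "kappa <= 1 / 2" "M * (2 * kappa) <= e0" using kappa kappa0 by linarith+
 \<comment> \<open>The largest factor over \<open>norm c\<close>: \<open>2 * M\<close> for the
   solution, \<open>C1 * k\<close> for the equilibrium in X_gamma, \<open>C1 * tau\<close> for it in
   L_p(X_1). It determines \<open>delta\<close>.\<close>
 define m where "m = max (2 * M) (C1 * max k tau)"
 have m: "2 * M <= m" "C1 * k <= m" "C1 * tau <= m" "0 < m" using C1 M by (auto simp: m_def le_max_iff_disj max_mult_distrib_left)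
 define delta where "delta = min delta1 (rho / (2 * m))"
 have delta: "0 < delta" "delta <= delta1" "m * delta <= rho / 2" using X(1) rho(1) m(4) by (auto simp: delta_def min_def field_simps)
 define C where "C = max (2 * M) (k * C1)"
 have C: "2 * M <= C" "k * C1 <= C" "0 < C" using M by (auto simp: C_def)
 have lipX: "norm (incl J i (X c) - incl J i (X d)) <= k * C1 * norm (c - d)" if "norm c <= delta" "norm d <= delta" for c d
 proof -
  have "norm (incl J i (X c - X d)) <= norm (X c - X d) * k" by (rule k(2))
  also have "... <= C1 * norm (c - d) * k" using X5[of c d] that delta(2) k(1) by (intro mult_right_mono) auto
  finally show ?thesis by (simp add: linear_diff[OF lin_ic] mult.commute mult.left_commute)
 qed
 show thesis
 proof (rule that[of T M rho e L delta C X])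
  show "norm (incl J i (X c) - incl J i (X d)) <= C * norm (c - d)" if "norm c <= delta" "norm d <= delta" for c d
   by (rule order_trans[OF lipX[OF that] mult_right_mono[OF C(2)]]) simp
  fix c :: 'c assume c: "norm c <= delta"
  define x where "x = X c"
  define d where "d = c - incl J i x"
  have c1: "norm c <= delta1" using c delta by simp
  have mc: "m * norm c <= rho / 2" using mult_left_mono[OF c less_imp_le[OF m(4)]] delta(3) by linarith
  have xn: "norm x <= C1 * norm c" using X5[of c 0] c1 X(1,3) by (simp add: x_def)
  have ax: "a * norm c <= rho / 2" if "a <= m" for a using mult_right_mono[OF that norm_ge_zero[of c]] mc by linarith
  have "M * (2 * norm c + 2 * LN0 p T (%_. 0 :: 'a)) <= rho" using ax[OF m(1)] rho(1) by simp
  then obtain v w where s: "sol a0 T v w (%t. 0 + G (tr v t) (w t))" "v 0 = i c"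
   "LN0 p T w <= M * (2 * norm c + 2 * LN0 p T (%_. 0 :: 'a))" "!!t. t \<in> {0..T} ==> norm (tr v t) <= M * (2 * norm c + 2 * LN0 p T (%_. 0 :: 'a))"
   by (rule nonlinear_solution[OF L0 N kappa2(1)[unfolded kappa_def] PL_cut_zero(1)]) (rule that)
  have vb: "norm (tr v t) <= rho / 2" if "t \<in> {0..T}" for t using s(4)[OF that] ax[OF m(1)] by simp
  have s1: "sol a0 T v w (%t. G (tr v t) (w t))" using s(1) by simp
  have eq: "us + x \<in> equilibria J i V A F" "Q (J x) = Q (i c)" using X(4)[OF c1] by (auto simp: x_def)
  note s2 = equilibrium_sol[OF eq(1) less_imp_le[OF T(1)]]
  have trx: "tr (%_. J x) t = incl J i x" for t by (rule tr_eqI) (rule incl_J)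
  have "norm (incl J i x) <= C1 * k * norm c" using k(2)[of x] mult_right_mono[OF xn less_imp_le[OF k(1)]] by (simp add: mult.commute mult.left_commute)
  then have b2: "norm (tr (%_. J x) t) <= rho" for t using ax[OF m(2)] rho(1) unfolding trx by linarith
  have "LN0 p T (%_. x) = norm x * tau" using PL_cut_const(2)[OF p0, of 0 T x] T(1) by (simp add: tau_def)
  moreover have "norm x * tau <= C1 * tau * norm c" using mult_right_mono[OF xn less_imp_le[OF tau]] by (simp add: mult.commute mult.left_commute)
  ultimately have b3: "LN0 p T (%_. x) <= rho" using ax[OF m(3)] rho(1) by linarith
  have b1: "norm (tr v t) <= rho" if "t \<in> {0..T}" for t using vb[OF that] rho(1) by linarith
  have z: "v 0 - J x = i d" by (simp add: s(2) d_def linear_diff[OF linear_i] incl_J)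
  define g where "g t = G (tr v t) (w t) - G (incl J i x) x" for t
  have ae: "AE t in lebesgue. 0 < t & t < T --> G (tr v t) (w t) - G (incl J i x) x = 0 + (G (tr v t) (w t) - G (tr (%_. J x) t) x)"
   unfolding trx by simp
  note nd = nonlinear_diff[OF L0 N kappa_def kappa2(1) s1 s2 b1 b2 b3 PL_cut_zero(1) ae z, folded g_def, unfolded trx]
  have g1: "LN0 p T g <= 2 * kappa * norm d" using nd(1) by simp
  have "2 * kappa * norm d <= 1 * norm d" using kappa2(1) by (intro mult_right_mono) auto
  then have "M * (norm d + LN0 p T g) <= M * (2 * norm d)" using g1 M by (intro mult_left_mono) auto
  also have "... <= C * norm d" using mult_right_mono[OF C(1) norm_ge_zero[of d]] by simp
  finally have gd: "M * (norm d + LN0 p T g) <= C * norm d" .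
  have dist: "norm (tr v t - incl J i x) <= C * norm d" if "t \<in> {0..T}" for t
   by (rule order_trans[OF nd(3)[OF _ that] gd])
  \<comment> \<open>The deviation from the equilibrium is compared with the linear flow started at
    \<open>d\<close>, which has no kernel component because \<open>Q (J x) = Q (i c)\<close>. The
    flow and the difference from it contribute \<open>e0 * norm d\<close> each.\<close>
  have dT: "norm (tr v T - incl J i x) <= 2 * e0 * norm d"
  proof -
   obtain vh wh where h: "sol a0 T vh wh (%_. 0)" "vh 0 = i d" using LS_ex[OF L0 PL_cut_zero(1), of d] by blast
   have "Q (i d) = 0" by (simp add: d_def linear_diff[OF linear_i] incl_J linear_diff[OF bounded_linear.linear[OF Q(1)]] eq(2))
   then have 1: "norm (tr vh T) <= e0 * norm d" by (rule T(2)[OF h])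
   have r: "sol a0 T (%t. v t - J x - vh t) (%t. w t - x - wh t) g"
    using sol_diff[OF a0_bl sol_diff[OF a0_bl s1 s2] h(1)] by (simp add: g_def[abs_def])
   have r0: "v 0 - J x - vh 0 = i 0" by (simp add: z h(2) linear_0[OF linear_i])
   have TT: "T \<in> {0..T}" using T(1) by simp
   note iv = evo_tr(1)[OF T(1) sol_evo[OF s1] TT] and ih = evo_tr(1)[OF T(1) sol_evo[OF h(1)] TT]
   have "tr (%t. v t - J x - vh t) T = tr v T - incl J i x - tr vh T"
    by (rule tr_eqI) (simp add: linear_diff[OF linear_i] incl_J iv ih)
   then have "norm (tr v T - incl J i x - tr vh T) <= M * LN0 p T g" using LS_D(2)[OF L0 r r0 TT] by simp
   also have "... <= M * (2 * kappa) * norm d" using g1 M by simp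
   also have "... <= e0 * norm d" using kappa2(2) by (intro mult_right_mono) auto
   finally show ?thesis using 1 norm_triangle_sub[of "tr v T - incl J i x" "tr vh T"] by (simp add: algebra_simps)
  qed
  have "norm (tr v T - incl J i (X (tr v T))) <= norm d / 2" if n: "norm (tr v T) <= delta"
  proof -
   \<comment> \<open>The kernel components of \<open>c\<close> and \<open>x\<close> agree, so the
     shift of the equilibrium is bounded by the small deviation from \<open>x\<close> and not by the
     distance travelled.\<close>
   have "Q (i (tr v T - c)) = Q (i (tr v T - incl J i x))"
    using eq(2) by (simp add: linear_diff[OF bounded_linear.linear[OF Qi]] incl_J)
   then have "norm (X (tr v T) - X c) <= C1 * norm (tr v T - incl J i x)"
    using X(5)[of "tr v T" c] n delta(2) c1 QC[of "tr v T - incl J i x"] by simp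
   then have "norm (X (tr v T) - X c) * k <= C1 * norm (tr v T - incl J i x) * k" using k(1) by (intro mult_right_mono) auto
   then have "norm (incl J i (X (tr v T)) - incl J i x) <= k * C1 * norm (tr v T - incl J i x)"
    using k(2)[of "X (tr v T) - X c"] by (simp add: x_def linear_diff[OF lin_ic] mult.commute mult.left_commute)
   then have "norm (tr v T - incl J i (X (tr v T))) <= D * norm (tr v T - incl J i x)"
    using norm_triangle_ineq4[of "tr v T - incl J i x" "incl J i (X (tr v T)) - incl J i x"] by (simp add: D_def algebra_simps)
   also have "... <= D * (2 * e0 * norm d)" using dT D by (intro mult_left_mono) auto
   also have "... = norm d / 2" using D by (simp add: e0_def)
   finally show ?thesis .
  qed
  then show "EX v w. sol a0 T v w (%t. G (tr v t) (w t)) & v 0 = i c &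
   (\<forall>t\<in>{0..T}. norm (tr v t) <= rho / 2 & norm (tr v t - incl J i (X c)) <= C * norm (c - incl J i (X c))) &
   (norm (tr v T) <= delta --> norm (tr v T - incl J i (X (tr v T))) <= norm (c - incl J i (X c)) / 2)"
   using s1 s(2) vb dist unfolding x_def d_def by (intro exI[of _ v] exI[of _ w]) auto
 qed (use T(1) L0 rho N kappa2(1) r(2) delta C(3) X in \<open>auto simp: kappa_def\<close>)
qed

text \<open>Let y n be the state at time n T. Its distance to its own equilibrium is at most q 2^-n,
  and each step moves it by at most \<open>D\<close> times that distance. So the total displacement
  is a multiple of \<open>norm z\<close>, the states stay where the step applies, and they
  converge.\<close>

lemma trajectory:
 "\<exists>delta>0. EX K. ALL z. norm z <= delta --> (EX u. unique_global_solution p J i V A F (uc + z) u & (\<forall>t\<ge>0. norm (u t - uc) <= K * norm z) &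
   (\<exists>x\<in>equilibria J i V A F. converges_exponentially u (incl J i x)))"
proof -
 obtain T M rho e L and X :: "'c => 'b" and delta C
  where T: "0 < T" and L: "LS a0 T M" and rho: "0 < rho" and N: "nonlinearity G rho e L e" and kappa: "M * (e + L * rho + e * T powr (1 / p)) <= 1 / 2"
   and inV: "!!c. norm c <= rho ==> uc + c \<in> V" and delta: "0 < delta" and C: "0 < C" and X0: "X 0 = 0" and eqX: "!!c. norm c <= delta ==> us + X c \<in> equilibria J i V A F"
   and lip: "!!c d. norm c <= delta ==> norm d <= delta ==> norm (incl J i (X c) - incl J i (X d)) <= C * norm (c - d)"
   and step: "!!c. norm c <= delta ==> EX v w. sol a0 T v w (%t. G (tr v t) (w t)) & v 0 = i c &
   (\<forall>t\<in>{0..T}. norm (tr v t) <= rho / 2 & norm (tr v t - incl J i (X c)) <= C * norm (c - incl J i (X c))) &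
   (norm (tr v T) <= delta --> norm (tr v T - incl J i (X (tr v T))) <= norm (c - incl J i (X c)) / 2)"
  by (rule contraction_step) (rule that)
 define d where "d c = norm (c - incl J i (X c))" for c
 define St where "St c v w \<longleftrightarrow> sol a0 T v w (%t. G (tr v t) (w t)) & v 0 = i c &
   (\<forall>t\<in>{0..T}. norm (tr v t) <= rho / 2 & norm (tr v t - incl J i (X c)) <= C * d c) &
   (norm (tr v T) <= delta --> d (tr v T) <= d c / 2)" for c v w
 have "EX v w. St c v w" if "norm c <= delta" for c using step[OF that] unfolding St_def d_def .
 then obtain v w where "!!c. norm c <= delta ==> St c (v c) (w c)" by metis
 note S = this[unfolded St_def]
 have d0: "0 <= d c" for c by (simp add: d_def)
 define D where "D = C + 1"
 have D: "1 < D" using C by (simp add: D_def)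
 have Xn: "norm (incl J i (X c)) <= C * norm c" if "norm c <= delta" for c
  using lip[OF that, of 0] delta by (simp add: X0 linear_0[OF lin_ic])
 have dn: "d c <= D * norm c" if "norm c <= delta" for c
  using norm_triangle_ineq4[of c "incl J i (X c)"] Xn[OF that] by (simp add: d_def D_def algebra_simps)
 \<comment> \<open>1 for the initial value, 2 D D for the sum of the displacements D q 2^-n with q =
   D |z|.\<close>
 define K where "K = 1 + 2 * D * D"
 define delta0 where "delta0 = delta / K"
 have K: "1 < K" using D by (simp add: K_def)
 have delta0: "0 < delta0" "delta0 <= delta" "K * delta0 = delta" using delta K by (auto simp: delta0_def divide_le_eq)
 have main: "EX u. unique_global_solution p J i V A F (uc + z) u & (\<forall>t\<ge>0. norm (u t - uc) <= (C * D + C * K) * norm z) &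
   (\<exists>x\<in>equilibria J i V A F. converges_exponentially u (incl J i x))" if z: "norm z <= delta0" for z
 proof -
  define y where "y = rec_nat z (%_ c. tr (v c) T)"
  have y: "y 0 = z" "y (Suc n) = tr (v (y n)) T" for n by (simp_all add: y_def)
  define q where "q = D * norm z"
  have q0: "0 <= q" using D by (simp add: q_def)
  have zK: "K * norm z <= delta" using z K delta0(3) mult_left_mono[of "norm z" delta0 K] by simp
  have zdelta: "norm z <= delta" using z delta0 by simp
  have inv: "norm (y n - z) <= 2 * D * q * (1 - (1/2)^n) & norm (y n) <= delta & d (y n) <= q * (1/2)^n" for n
  proof (induction n)
   case 0 show ?case using zdelta dn[OF zdelta] by (simp add: y q_def)
  next
   case (Suc n)
   then have n: "norm (y n) <= delta" "d (y n) <= q * (1/2)^n" by auto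
   have TT: "T \<in> {0..T}" using T by simp
   have "norm (y (Suc n) - y n) <= norm (tr (v (y n)) T - incl J i (X (y n))) + d (y n)"
    using norm_triangle_ineq4[of "tr (v (y n)) T - incl J i (X (y n))" "y n - incl J i (X (y n))"] by (simp add: y d_def)
   also have "... <= D * d (y n)" using S[OF n(1)] TT by (auto simp: D_def algebra_simps)
   also have "... <= D * (q * (1/2)^n)" using n(2) D by (intro mult_left_mono) auto
   finally have "norm (y (Suc n) - z) <= D * (q * (1/2)^n) + 2 * D * q * (1 - (1/2)^n)"
    using Suc norm_triangle_ineq[of "y (Suc n) - y n" "y n - z"] by simp
   also have "... = 2 * D * q * (1 - (1/2)^Suc n)" by (simp add: algebra_simps)
   finally have 1: "norm (y (Suc n) - z) <= 2 * D * q * (1 - (1/2)^Suc n)" .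
   also have "... <= 2 * D * q * 1" using D q0 by (intro mult_left_mono) auto
   also have "... + norm z = K * norm z" by (simp add: q_def K_def algebra_simps)
   finally have 2: "norm (y (Suc n)) <= delta" using zK norm_triangle_sub[of "y (Suc n)" z] by linarith
   have "d (y (Suc n)) <= d (y n) / 2" using S[OF n(1)] 2 by (simp add: y)
   then show ?case using 1 2 n(2) by simp
  qed
  have yd: "norm (y n) <= delta" "d (y n) <= q * (1/2)^n" for n using inv by blast+
  have inc: "norm (y (Suc n) - y n) <= D * q * (1/2)^n" for n
  proof -
   have "norm (y (Suc n) - y n) <= norm (tr (v (y n)) T - incl J i (X (y n))) + d (y n)"
    using norm_triangle_ineq4[of "tr (v (y n)) T - incl J i (X (y n))" "y n - incl J i (X (y n))"] by (simp add: y d_def)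
   also have "... <= D * d (y n)" using S[OF yd(1)] T by (auto simp: D_def algebra_simps)
   also have "... <= D * (q * (1/2)^n)" using yd(2) D by (intro mult_left_mono) auto
   finally show ?thesis by simp
  qed
  have far: "norm (y (n + m) - y n) <= 2 * D * q * (1/2)^n" for n m
  proof -
   have "norm (y (n + m) - y n) <= 2 * D * q * (1/2)^n * (1 - (1/2)^m)"
   proof (induction m)
    case (Suc m)
    have "norm (y (n + Suc m) - y n) <= D * q * (1/2)^(n + m) + 2 * D * q * (1/2)^n * (1 - (1/2)^m)"
     using Suc inc[of "n + m"] norm_triangle_ineq[of "y (Suc (n + m)) - y (n + m)" "y (n + m) - y n"] by simp
    then show ?case by (simp add: power_add algebra_simps)
   qed simp
   also have "... <= 2 * D * q * (1/2)^n * 1" using D q0 by (intro mult_left_mono) auto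
   finally show ?thesis by simp
  qed
  have g0: "(%n. 2 * D * q * (1/2)^n) \<longlonglongrightarrow> 0" by (intro tendsto_mult_right_zero LIMSEQ_power_zero) simp
  have "Cauchy y"
  proof (rule CauchyI')
   fix r :: real assume "0 < r"
   then obtain n where n: "2 * D * q * (1/2)^n < r / 2" using order_tendstoD(2)[OF g0, of "r / 2"] by (auto simp: eventually_sequentially)
   have "dist (y k) (y m) < r" if "n <= k" "k < m" for k m
   proof -
    have "norm (y k - y n) < r / 2" "norm (y m - y n) < r / 2" using far[of n "k - n"] far[of n "m - n"] that n by auto
    then show ?thesis using norm_triangle_ineq4[of "y k - y n" "y m - y n"] by (simp add: dist_norm)
   qed
   then show "EX n. \<forall>k\<ge>n. \<forall>m>k. dist (y k) (y m) < r" by blast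
  qed
  then obtain yl where yl: "y \<longlonglongrightarrow> yl" using Cauchy_convergent_iff convergent_def by blast
  have yl1: "norm yl <= delta" by (rule LIMSEQ_le_const2[OF tendsto_norm[OF yl]]) (use yd(1) in blast)
  have yl2: "norm (yl - y n) <= 2 * D * q * (1/2)^n" for n
   by (rule LIMSEQ_le_const2[OF tendsto_norm[OF tendsto_diff[OF LIMSEQ_ignore_initial_segment[OF yl, of n] tendsto_const]]])
    (use far[of n] in \<open>auto simp: add.commute\<close>)
  \<comment> \<open>Solutions on [0, n T] glued from \<open>n\<close> steps. They are chosen
    separately for each \<open>n\<close>; uniqueness makes them agree afterwards.\<close>
  define Tr where "Tr n v w \<longleftrightarrow> sol a0 (real n * T) v w (%t. G (tr v t) (w t)) & v 0 = i z & v (real n * T) = i (y n) &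
   (\<forall>k<n. \<forall>t\<in>{real k * T..real (Suc k) * T}. norm (tr v t) <= rho / 2 & norm (tr v t - incl J i (X (y k))) <= C * d (y k))" for n v w
  have "EX v w. Tr n v w" for n
  proof (induction n)
   case 0
   have "sol a0 0 (%_. i z) (%_. 0) (%t. G (tr (%_. i z) t) 0)"
    unfolding sol_def evo_def by (intro conjI ballI AE_I2) auto
   then show ?case unfolding Tr_def by (intro exI[of _ "%_. i z"] exI[of _ "%_. 0"]) (simp add: y)
  next
   case (Suc n)
   then obtain v1 w1 where 1: "sol a0 (real n * T) v1 w1 (%t. G (tr v1 t) (w1 t))" "v1 0 = i z" "v1 (real n * T) = i (y n)"
    "!!k t. k < n ==> t \<in> {real k * T..real (Suc k) * T} ==> norm (tr v1 t) <= rho / 2 & norm (tr v1 t - incl J i (X (y k))) <= C * d (y k)" unfolding Tr_def by blast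
   note s = S[OF yd(1)[of n]]
   define v2 where "v2 = join (real n * T) v1 (v (y n))"
   define w2 where "w2 = join (real n * T) w1 (w (y n))"
   have nT: "0 <= real n * T" using T by simp
   have "sol a0 (real n * T + T) v2 w2 (join (real n * T) (%t. G (tr v1 t) (w1 t)) (%t. G (tr (v (y n)) t) (w (y n) t)))"
    unfolding v2_def w2_def by (rule sol_join[OF 1(1)]) (use s nT T 1(3) in auto)
   moreover have "join (real n * T) (%t. G (tr v1 t) (w1 t)) (%t. G (tr (v (y n)) t) (w (y n) t)) = (%t. G (tr v2 t) (w2 t))"
    by (auto simp: join_def v2_def w2_def tr_def)
   moreover have nS: "real (Suc n) * T = real n * T + T" by (simp add: algebra_simps)
   ultimately have 2: "sol a0 (real (Suc n) * T) v2 w2 (%t. G (tr v2 t) (w2 t))" by simp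
   have z2: "v2 0 = i z" using nT 1(2) by (simp add: v2_def join_def)
   have "i (tr (v (y n)) T) = v (y n) T" by (rule evo_tr(1)[OF T sol_evo]) (use s T in auto)
   moreover have "v2 (real n * T + T) = v (y n) T" using T by (simp add: v2_def join_def)
   ultimately have e2: "v2 (real (Suc n) * T) = i (y (Suc n))" unfolding nS y by simp
   have "norm (tr v2 t) <= rho / 2 & norm (tr v2 t - incl J i (X (y k))) <= C * d (y k)" if k: "k < Suc n" and t: "t \<in> {real k * T..real (Suc k) * T}" for k t
   proof (cases "k < n")
    case True
    then have "real (Suc k) * T <= real n * T" using T by (intro mult_right_mono) auto
    then have "tr v2 t = tr v1 t" using t by (simp add: v2_def join_def tr_def)
    then show ?thesis using 1(4)[OF True t] by simp
   next
    case False
    then have kn: "k = n" using k by simp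
    have "tr v2 t = tr (v (y n)) (t - real n * T)"
    proof (cases "t = real n * T")
     case True then show ?thesis using 1(3) s by (simp add: v2_def join_def tr_def)
    next
     case False then show ?thesis using t kn by (simp add: v2_def join_def tr_def)
    qed
    moreover have "t - real n * T \<in> {0..T}" using t kn nS by auto
    ultimately show ?thesis using s kn by simp
   qed
   then show ?case using 2 z2 e2 unfolding Tr_def by blast
  qed
  then obtain vv ww where Tr: "!!n. Tr n (vv n) (ww n)" by metis
  have P: "sol a0 (real n * T) (vv n) (ww n) (%t. G (tr (vv n) t) (ww n t))" "vv n 0 = i z"
   "k < n ==> t \<in> {real k * T..real (Suc k) * T} ==> norm (tr (vv n) t) <= rho / 2 & norm (tr (vv n) t - incl J i (X (y k))) <= C * d (y k)" for n k t
   using Tr[of n] unfolding Tr_def by blast+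
  define fl where "fl t = nat \<lfloor>t / T\<rfloor>" for t
  have fl: "real (fl t) * T <= t" "t < real (Suc (fl t)) * T" if "0 <= t" for t
  proof -
   have "real (fl t) <= t / T" "t / T < real (fl t) + 1" using that T by (auto simp: fl_def of_nat_nat floor_le_iff)
   then show "real (fl t) * T <= t" "t < real (Suc (fl t)) * T" using T by (auto simp: field_simps)
  qed
  have bnd: "norm (tr (vv n) t) <= rho / 2" if "0 < n" "t \<in> {0..real n * T}" for n t
  proof (cases "fl t < n")
   case True then show ?thesis using P(3)[of "fl t" n t] fl[of t] that by auto
  next
   case False
   then have "real n * T <= real (fl t) * T" using T by (intro mult_right_mono) auto
   then have "real n * T <= t" using fl(1)[of t] that by simp
   then have "t = real n * T" using that by simp
   moreover have "real (n - 1) * T <= real n * T" using T by (intro mult_right_mono) auto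
   ultimately show ?thesis using P(3)[of "n - 1" n t] that(1) by simp
  qed
  \<comment> \<open>The number of steps exceeds that of the completed ones by one, so that
    \<open>t\<close> lies in the interval of the chosen solution.\<close>
  define u where "u t = uc + tr (vv (Suc (fl t))) t" for t
  have uniq: "tr v2 t = tr (vv n) t" if n: "0 < a" "a <= real n * T" and s2: "sol a0 a v2 w2 (%t. G (tr v2 t) (w2 t))" "v2 0 = i z" and t: "t \<in> {0..a}" for n a v2 w2 t
  proof (rule solution_unique[OF L N kappa rho n(1) sol_sub[OF P(1) n(2)] s2(1)])
   have "0 < n" using n T by (cases n) auto
   then show "norm (tr (vv n) t) <= rho / 2" if "t \<in> {0..a}" for t using bnd that n by simp
  qed (use P(2) s2 t in auto)
  have uv: "u t = uc + tr (vv n) t" if "0 < n" "t \<in> {0..real n * T}" for n t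
  proof (cases "fl t < n")
   case True
   have a: "0 < real (Suc (fl t)) * T" "real (Suc (fl t)) * T <= real n * T" using True T by (auto intro!: mult_pos_pos mult_right_mono)
   have "t \<in> {0..real (Suc (fl t)) * T}" using fl[of t] that by simp
   then show ?thesis unfolding u_def using uniq[OF a P(1,2)] by simp
  next
   case False
   have a: "0 < real n * T" "real n * T <= real (Suc (fl t)) * T" using False that(1) T by (auto intro!: mult_pos_pos mult_right_mono)
   show ?thesis unfolding u_def using uniq[OF a P(1,2) that(2)] by simp
  qed
  have ex: "\<exists>n>0. a <= real n * T" for a
  proof -
   obtain n where "a / T <= real n" using real_arch_simple by blast
   then have "a <= real (Suc n) * T" using T by (simp add: field_simps)
   then show ?thesis by blast
  qed
  have u0: "u 0 = uc + z"
  proof -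
   have "tr (vv 1) 0 = z" by (rule tr_eqI) (simp add: P(2))
   then show ?thesis using uv[of 1 0] T by simp
  qed
  have "unique_global_solution p J i V A F (uc + z) u"
   unfolding unique_global_solution_def
  proof (intro conjI allI impI ballI)
   fix a :: real assume a: "0 < a"
   obtain n where n: "0 < n" "a <= real n * T" using ex by blast
   have un: "u t = uc + tr (vv n) t" "norm (tr (vv n) t) <= rho / 2" if "t \<in> {0..a}" for t using uv[OF n(1)] bnd[OF n(1)] that n(2) by auto
   have "u t \<in> V" if "t \<in> {0..a}" for t using inV[of "tr (vv n) t"] un[OF that] rho by simp
   then show "solution_on p J i V A F a (uc + z) u"
    unfolding solution_iff[OF a] using u0 sol_sub[OF P(1) n(2)] un(1) by blast
   fix v' t assume "solution_on p J i V A F a (uc + z) v'" and t: "t \<in> {0..a}"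
   then obtain v2 w2 where s2: "v' 0 = uc + z" "sol a0 a v2 w2 (%t. G (tr v2 t) (w2 t))" "!!t. t \<in> {0..a} ==> v' t = uc + tr v2 t"
    unfolding solution_iff[OF a] by blast
   have "tr v2 0 = z" "i (tr v2 0) = v2 0" using s2(1) s2(3)[of 0] evo_tr(1)[OF a sol_evo[OF s2(2)], of 0] a by auto
   then have "tr v2 t = tr (vv n) t" by (intro uniq[OF a n(2) s2(2) _ t]) simp
   then show "v' t = u t" using s2(3)[OF t] un(1)[OF t] by simp
  qed
  moreover have near: "norm (u t - uc - incl J i (X (y (fl t)))) <= C * (q * (1/2)^fl t)" if t: "0 <= t" for t
  proof -
   have "t \<in> {real (fl t) * T..real (Suc (fl t)) * T}" using fl[OF t] by simp
   then have "norm (u t - uc - incl J i (X (y (fl t)))) <= C * d (y (fl t))" using P(3)[of "fl t" "Suc (fl t)" t] by (simp add: u_def)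
   then show ?thesis using mult_left_mono[OF yd(2)[of "fl t"] less_imp_le[OF C]] by linarith
  qed
  moreover have "norm (u t - uc) <= (C * D + C * K) * norm z" if t: "0 <= t" for t
  proof -
   have "C * (q * (1/2)^fl t) <= C * (q * 1)" using C q0 by (intro mult_left_mono) (auto intro: power_le_one)
   moreover have "norm (incl J i (X (y (fl t)))) <= C * (K * norm z)"
   proof -
    have "norm (y (fl t) - z) <= 2 * D * q * 1" using far[of 0 "fl t"] by (simp add: y)
    then have "norm (y (fl t)) <= K * norm z" using norm_triangle_sub[of "y (fl t)" z] by (simp add: q_def K_def algebra_simps)
    then show ?thesis using Xn[OF yd(1)[of "fl t"]] mult_left_mono[of "norm (y (fl t))" "K * norm z" C] C by linarith
   qed
   ultimately show ?thesis using near[OF t] norm_triangle_sub[of "u t - uc" "incl J i (X (y (fl t)))"] by (simp add: q_def algebra_simps)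
  qed
  moreover have "converges_exponentially u (incl J i (us + X yl))"
  proof -
   \<comment> \<open>Distance to the current equilibrium plus the distance of the latter from the
     limit, both of order 2^-n at n = \<open>fl t\<close>. The summand 1 in \<open>2 * B + 1\<close>
     only makes the constant positive.\<close>
   define B where "B = C * q + C * (2 * D * q)"
   have B: "0 <= B" using C D q0 by (simp add: B_def)
   have "norm (u t - incl J i (us + X yl)) <= (2 * B + 1) * exp (- (ln 2 / T) * t)" if t: "0 <= t" for t
   proof -
    have "norm (incl J i (X (y (fl t))) - incl J i (X yl)) <= C * norm (y (fl t) - yl)" by (rule lip[OF yd(1) yl1])
    also have "... <= C * (2 * D * q * (1/2)^fl t)" using yl2[of "fl t"] C by (intro mult_left_mono) (auto simp: norm_minus_commute)
    finally have "norm ((u t - uc - incl J i (X (y (fl t)))) + (incl J i (X (y (fl t))) - incl J i (X yl))) <= B * (1/2)^fl t"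
     using near[OF t] by (intro norm_triangle_le) (simp add: B_def algebra_simps)
    then have 1: "norm (u t - incl J i (us + X yl)) <= B * (1/2)^fl t" by (simp add: linear_add[OF lin_ic] algebra_simps)
    have "exp (- ln 2) = 1 / (2::real)" by (simp add: exp_minus inverse_eq_divide)
    then have "(1/2::real)^fl t = exp (real (fl t) * (- ln 2))" by (simp only: exp_of_nat_mult)
    \<comment> \<open>At least t/T - 1 steps are completed at time \<open>t\<close>; the missing one
      costs the factor 2.\<close>
    also have "... <= exp (ln 2 + - (ln 2 / T) * t)"
    proof -
     have "t / T <= real (fl t) + 1" using fl(2)[OF t] T by (simp add: field_simps)
     then have "ln 2 * (t / T) <= ln 2 * (real (fl t) + 1)" by (intro mult_left_mono) auto
     then show ?thesis by (simp add: algebra_simps)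
    qed
    also have "... = 2 * exp (- (ln 2 / T) * t)" by (subst exp_add) simp
    finally have "B * (1/2)^fl t <= B * (2 * exp (- (ln 2 / T) * t))" using B by (intro mult_left_mono) auto
    then show ?thesis using 1 by (simp add: algebra_simps add_increasing)
   qed
   moreover have "0 < 2 * B + 1" "0 < ln 2 / T" using B T by auto
   ultimately show ?thesis unfolding converges_exponentially_def by blast
  qed
  ultimately show ?thesis using eqX[OF yl1] by blast
 qed
 then show ?thesis using delta0(1) by blast
qed

end

theorem theorem2p1:
  fixes J :: "'b::banach \<Rightarrow> 'a::banach"
    and i :: "'c::banach \<Rightarrow> 'a"
    and V :: "'c set"
    and A :: "'c \<Rightarrow> 'b \<Rightarrow>\<^sub>L 'a"
    and F :: "'c \<Rightarrow> 'a"
    and p :: real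
    and ustar :: 'b
    and U :: "(real ^ 'm) set"
    and \<Psi> :: "real ^ 'm \<Rightarrow> 'b"
  assumes "1 < p"
    and "dense_embedding J"
    and "is_real_interpolation_space J (1 - 1 / p) p i"
    and "open V"
    and "C1_on V (\<lambda>v. (A v, F v))"
    and "ustar \<in> equilibria J i V A F"
    and "maximal_regularity p J (A (incl J i ustar))"
    and "C1_manifold_near (equilibria J i V A F) ustar U \<Psi>"
    and "range (frechet_derivative \<Psi> (at 0)) = null_space (linearization J i A F ustar)"
    and "zero_semisimple_eigenvalue J (linearization J i A F ustar)"
    and "op_spectrum J (linearization J i A F ustar) - {0} \<subseteq> {z. Re z > 0}"
  shows "stable_equilibrium p J i V A F (incl J i ustar) \<and>
    (\<exists>\<delta>>0. \<forall>u0. norm (u0 - incl J i ustar) < \<delta> \<longrightarrow>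
       (\<exists>u. unique_global_solution p J i V A F u0 u \<and>
          (\<exists>uinf\<in>equilibria J i V A F. converges_exponentially u (incl J i uinf))))"
proof -
 interpret normally_stable p J i V A F ustar U \<Psi>
  by (intro normally_stable.intro interpolation_setting.intro normally_stable_axioms.intro)
   (use assms in \<open>simp_all add: dense_embedding_def\<close>)
 obtain delta K where delta: "0 < delta" and u: "!!z. norm z <= delta ==> EX u. unique_global_solution p J i V A F (uc + z) u &
   (\<forall>t\<ge>0. norm (u t - uc) <= K * norm z) & (\<exists>x\<in>equilibria J i V A F. converges_exponentially u (incl J i x))"
  using trajectory by blast
 have sol: "EX u. unique_global_solution p J i V A F u0 u & (\<forall>t\<ge>0. norm (u t - uc) <= K * norm (u0 - uc)) &
   (\<exists>x\<in>equilibria J i V A F. converges_exponentially u (incl J i x))" if "norm (u0 - uc) <= delta" for u0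
  using u[OF that] by simp
 have "stable_equilibrium p J i V A F uc"
  unfolding stable_equilibrium_def
 proof (intro allI impI)
  fix r :: real assume r: "0 < r"
  \<comment> \<open>The sign of \<open>K\<close> is unknown, and \<open>\<bar>K\<bar> + 1\<close> is
    a positive majorant.\<close>
  define d where "d = min delta (r / (\<bar>K\<bar> + 1))"
  have d: "0 < d" "d <= delta" "d <= r / (\<bar>K\<bar> + 1)" using delta r by (auto simp: d_def)
  then have d3: "(\<bar>K\<bar> + 1) * d <= r" by (simp add: pos_le_divide_eq mult.commute)
  have "EX u. unique_global_solution p J i V A F u0 u & (\<forall>t\<ge>0. norm (u t - uc) < r)" if u0: "norm (u0 - uc) < d" for u0
  proof -
   obtain u where u: "unique_global_solution p J i V A F u0 u" "!!t. 0 <= t ==> norm (u t - uc) <= K * norm (u0 - uc)"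
    using sol[of u0] u0 d(2) by auto
   have "K * norm (u0 - uc) <= (\<bar>K\<bar> + 1) * norm (u0 - uc)" by (intro mult_right_mono) auto
   also have "... < (\<bar>K\<bar> + 1) * d" using u0 by (intro mult_strict_left_mono) auto
   finally show ?thesis using u d3 by (meson le_less_trans less_le_trans)
  qed
  then show "\<exists>delta>0. ALL u0. norm (u0 - uc) < delta --> (EX u. unique_global_solution p J i V A F u0 u & (\<forall>t\<ge>0. norm (u t - uc) < r))"
   using d(1) by blast
 qed
 moreover have "EX u. unique_global_solution p J i V A F u0 u & (\<exists>uinf\<in>equilibria J i V A F. converges_exponentially u (incl J i uinf))"
  if "norm (u0 - uc) < delta" for u0
  using sol[of u0] that by auto
 ultimately show ?thesis using delta by blast
qed
end
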